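(* Let $G$ be a countably infinite amenable group and let $G\curvearrowright X$ be an expansive algebraic action (so $X$ is a compact metrizable abelian group and $G$ acts on $X$ by continuous automorphisms) such that either: (1) $\mathbb{Z}G$ is left Noetherian, or (2) $G$ satisfies the strong Atiyah conjecture, there is an upper bound on the orders of finite subgroups of $G$, and $G\curvearrowright X$ is finitely presented. Then $\overline{\Delta(X,G)}=\mathrm{IE}(X,G)$.
   Context: Fix a compatible metric $d$ on $X$. Expansive: there is $c>0$ such that for all $x\ne y$ in $X$ there is $g\in G$ with $d(gx,gy)>c$. $\Delta(X,G)$, the homoclinic group, is the set of $x\in X$ with $sx\to e_X$ as $G\ni s\to\infty$, where $e_X$ is the identity of $X$. Independence: for a tuple $\mathbf A=(A_1,\dots,A_k)$ of subsets of $X$, a set $J\subset G$ is an independence set for $\mathbf A$ if for every nonempty finite $I\subset J$ and every $\phi:I\to\{1,\dots,k\}$ we have $\bigcap_{s\in I}s^{-1}A_{\phi(s)}\neq\varnothing$. The independence density of $\mathbf A$ is the largest $q\ge0$ such that every finite $F\subset G$ has a subset of cardinality at least $q|F|$ which is an independence set for $\mathbf A$. $\mathrm{IE}_k(X,G)$ is the set of $(x_1,\dots,x_k)\in X^k$ such that for every product neighborhood $U_1\times\dots\times U_k$ of $(x_1,\dots,x_k)$ the tuple $(U_1,\dots,U_k)$ has positive independence density. $\mathrm{IE}(X,G)=\{x\in X:(x,e_X)\in\mathrm{IE}_2(X,G)\}$. The Pontryagin dual $\widehat X$ is a left $\mathbb{Z}G$-module via $(s\chi)(x)=\chi(s^{-1}x)$;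 the algebraic action is finitely presented if $\widehat X$ is a finitely presented left $\mathbb{Z}G$-module. Strong Atiyah conjecture for $G$: for all positive integers $m,n$ and all $a\in M_{m\times n}(\mathbb{C}G)$, $\dim_{\rm vN}\ker a$ lies in the subgroup of $\mathbb{Q}$ generated by $1/|H|$ for $H$ ranging over the finite subgroups of $G$. Here $\ker a$ is the kernel of the bounded operator $M_{n\times1}(\ell^2(G))\to M_{m\times1}(\ell^2(G))$, $z\mapsto az$ (convolution), and $\dim_{\rm vN}\ker a=\sum_{j=1}^n\langle P_{jj}\delta_{e_G},\delta_{e_G}\rangle$, where $P=(P_{jk})\in M_{n\times n}(\mathcal{B}(\ell^2(G)))$ is the orthogonal projection onto $\ker a$ and $\delta_{e_G}$ is the canonical unit vector at $e_G$. *)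

theory Defs
  imports
    "HOL-Analysis.Analysis"
    "HOL-Library.Poly_Mapping"
    "HOL-Computational_Algebra.Group_Closure"
begin

abbreviation (input) supp :: "('a \<Rightarrow>\<^sub>0 'b::zero) \<Rightarrow> 'a set" where "supp \<equiv> Poly_Mapping.keys"
abbreviation (input) "lookup \<equiv> Poly_Mapping.lookup"

text \<open>
  The acting group \<open>G\<close> is a type of class \<^class>\<open>group_add\<close>. This class is not assumed
  commutative; it is merely written additively, so \<open>0\<close> is \<open>e\<^sub>G\<close>, \<open>g + h\<close> is the product \<open>gh\<close>, and
  \<open>- g\<close> is the inverse. With this convention the finitely supported functions
  \<open>'g \<Rightarrow>\<^sub>0 int\<close> and \<open>'g \<Rightarrow>\<^sub>0 complex\<close> of \<^theory>\<open>HOL-Library.Poly_Mapping\<close>, whose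
  multiplication is convolution, are the group rings \<open>\<int>G\<close> and \<open>\<complex>G\<close>.
\<close>

section \<open>Groups\<close>

text \<open>The Foelner condition for left translation.\<close>

definition amenable :: "'g::group_add itself \<Rightarrow> bool" where
  "amenable _ \<longleftrightarrow>
     (\<forall>K :: 'g set. \<forall>\<epsilon>>0. finite K \<longrightarrow>
        (\<exists>F. finite F \<and> F \<noteq> {} \<and>
           (\<forall>s\<in>K. real (card (sym_diff ((+) s ` F) F)) \<le> \<epsilon> * real (card F))))"

definition finite_subgroup :: "'g::group_add set \<Rightarrow> bool" where
  "finite_subgroup H \<longleftrightarrow>
     finite H \<and> 0 \<in> H \<and> (\<forall>g\<in>H. \<forall>h\<in>H. g + h \<in> H) \<and> (\<forall>g\<in>H. - g \<in> H)"

definition bounded_finite_subgroups :: "'g::group_add itself \<Rightarrow> bool" where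
  "bounded_finite_subgroups _ \<longleftrightarrow> (\<exists>N. \<forall>H :: 'g set. finite_subgroup H \<longrightarrow> card H \<le> N)"


section \<open>Left modules over noncommutative rings\<close>

text \<open>The locale \<^locale>\<open>module\<close> of the library requires commutative scalars.\<close>

locale left_module =
  fixes smul :: "'r::ring_1 \<Rightarrow> 'm::ab_group_add \<Rightarrow> 'm"
  assumes smul_right_distrib: "smul a (x + y) = smul a x + smul a y"
    and smul_left_distrib: "smul (a + b) x = smul a x + smul b x"
    and smul_smul: "smul a (smul b x) = smul (a * b) x"
    and smul_one: "smul 1 x = x"

definition submodule :: "('r::ring_1 \<Rightarrow> 'm::ab_group_add \<Rightarrow> 'm) \<Rightarrow> 'm set \<Rightarrow> bool" where
  "submodule smul N \<longleftrightarrow>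
     0 \<in> N \<and> (\<forall>x\<in>N. \<forall>y\<in>N. x + y \<in> N) \<and> (\<forall>r. \<forall>x\<in>N. smul r x \<in> N)"

definition finitely_generated :: "('r::ring_1 \<Rightarrow> 'm::ab_group_add \<Rightarrow> 'm) \<Rightarrow> 'm set \<Rightarrow> bool" where
  "finitely_generated smul N \<longleftrightarrow> (\<exists>S. finite S \<and> N = submodule smul hull S)"

text \<open>Left ideals are the submodules of the ring acting on itself by left multiplication.\<close>

definition left_noetherian :: "'r::ring_1 itself \<Rightarrow> bool" where
  "left_noetherian _ \<longleftrightarrow>
     (\<forall>I :: 'r set. submodule (*) I \<longrightarrow> finitely_generated (*) I)"

text \<open>\<open>R\<^sup>n\<close> is the set of \<open>a :: nat \<Rightarrow>\<^sub>0 'r\<close> supported in \<open>{..<n}\<close>, with coordinatewise operations.\<close>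

definition free_module :: "nat \<Rightarrow> (nat \<Rightarrow>\<^sub>0 'r::ring_1) set" where
  "free_module n = {a. supp a \<subseteq> {..<n}}"

definition free_scale :: "'r::ring_1 \<Rightarrow> (nat \<Rightarrow>\<^sub>0 'r) \<Rightarrow> (nat \<Rightarrow>\<^sub>0 'r)" where
  "free_scale r = Poly_Mapping.map ((*) r)"

definition finitely_presented :: "('r::ring_1 \<Rightarrow> 'm::ab_group_add \<Rightarrow> 'm) \<Rightarrow> bool" where
  "finitely_presented smul \<longleftrightarrow>
     (\<exists>n. \<exists>f :: (nat \<Rightarrow>\<^sub>0 'r) \<Rightarrow> 'm.
        (\<forall>a\<in>free_module n. \<forall>b\<in>free_module n. f (a + b) = f a + f b) \<and>
        (\<forall>r. \<forall>a\<in>free_module n. f (free_scale r a) = smul r (f a)) \<and>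
        f ` free_module n = UNIV \<and>
        finitely_generated free_scale {a \<in> free_module n. f a = 0})"


section \<open>Algebraic actions\<close>

locale algebraic_action =
  fixes act :: "'g::group_add \<Rightarrow> 'x::topological_ab_group_add \<Rightarrow> 'x"
  assumes act_zero: "act 0 x = x"
    and act_act: "act g (act h x) = act (g + h) x"
    and act_add: "act g (x + y) = act g x + act g y"
    and continuous_act: "continuous_on UNIV (act g)"

definition expansive :: "('g \<Rightarrow> 'x::metric_space \<Rightarrow> 'x) \<Rightarrow> bool" where
  "expansive act \<longleftrightarrow> (\<exists>c>0. \<forall>x y. x \<noteq> y \<longrightarrow> (\<exists>g. dist (act g x) (act g y) > c))"

text \<open>Since \<open>G\<close> is discrete, \<open>s \<rightarrow> \<infinity>\<close> means convergence along the cofinite filter.\<close>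

definition homoclinic_group :: "('g \<Rightarrow> 'x::topological_ab_group_add \<Rightarrow> 'x) \<Rightarrow> 'x set" where
  "homoclinic_group act = {x. ((\<lambda>s. act s x) \<longlongrightarrow> 0) cofinite}"


subsection \<open>The Pontryagin dual as a left module over the integral group ring\<close>

typedef (overloaded) 'x pontryagin_dual =
  "{\<gamma> :: 'x::topological_ab_group_add \<Rightarrow> complex.
      continuous_on UNIV \<gamma> \<and> (\<forall>x. cmod (\<gamma> x) = 1) \<and> (\<forall>x y. \<gamma> (x + y) = \<gamma> x * \<gamma> y)}"
  morphisms char_fun Abs_char
  by (rule exI[of _ "\<lambda>_. 1"]) auto

lemma char_fun_continuous: "continuous_on UNIV (char_fun \<gamma>)"
  and cmod_char_fun [simp]: "cmod (char_fun \<gamma> x) = 1"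
  and char_fun_add: "char_fun \<gamma> (x + y) = char_fun \<gamma> x * char_fun \<gamma> y"
  using char_fun[of \<gamma>] by auto

lemma char_fun_nonzero [simp]: "char_fun \<gamma> x \<noteq> 0"
  using cmod_char_fun[of \<gamma> x] by (metis norm_zero zero_neq_one)

instantiation pontryagin_dual :: (topological_ab_group_add) ab_group_add
begin

definition zero_pontryagin_dual :: "'a pontryagin_dual" where
  "0 = Abs_char (\<lambda>_. 1)"

definition plus_pontryagin_dual :: "'a pontryagin_dual \<Rightarrow> 'a pontryagin_dual \<Rightarrow> 'a pontryagin_dual"
  where "\<gamma> + \<psi> = Abs_char (\<lambda>x. char_fun \<gamma> x * char_fun \<psi> x)"

definition uminus_pontryagin_dual :: "'a pontryagin_dual \<Rightarrow> 'a pontryagin_dual" where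
  "- \<gamma> = Abs_char (\<lambda>x. inverse (char_fun \<gamma> x))"

definition minus_pontryagin_dual :: "'a pontryagin_dual \<Rightarrow> 'a pontryagin_dual \<Rightarrow> 'a pontryagin_dual"
  where "\<gamma> - \<psi> = \<gamma> + - (\<psi> :: 'a pontryagin_dual)"

lemma char_fun_zero: "char_fun (0 :: 'a pontryagin_dual) = (\<lambda>_. 1)"
  unfolding zero_pontryagin_dual_def by (rule Abs_char_inverse) auto

lemma char_fun_plus: "char_fun (\<gamma> + \<psi> :: 'a pontryagin_dual) = (\<lambda>x. char_fun \<gamma> x * char_fun \<psi> x)"
  unfolding plus_pontryagin_dual_def
  by (rule Abs_char_inverse)
    (auto simp: char_fun_add norm_mult intro!: continuous_intros char_fun_continuous)

lemma char_fun_uminus: "char_fun (- \<gamma> :: 'a pontryagin_dual) = (\<lambda>x. inverse (char_fun \<gamma> x))"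
  unfolding uminus_pontryagin_dual_def
  by (rule Abs_char_inverse)
    (auto simp: char_fun_add norm_inverse intro!: continuous_intros char_fun_continuous)

instance
  by standard
    (auto simp: char_fun_inject[symmetric] char_fun_plus char_fun_zero char_fun_uminus
      minus_pontryagin_dual_def fun_eq_iff)

end

text \<open>
  The \<open>\<int>\<close>-linear extension of \<open>(s\<gamma>)(x) = \<gamma>(s\<^sup>-\<^sup>1x)\<close>. The group law of the dual being pointwise
  multiplication of characters, integer multiples become integer powers.
\<close>

definition dual_scale ::
  "('g::group_add \<Rightarrow> 'x::topological_ab_group_add \<Rightarrow> 'x) \<Rightarrow>
     ('g \<Rightarrow>\<^sub>0 int) \<Rightarrow> 'x pontryagin_dual \<Rightarrow> 'x pontryagin_dual" where
  "dual_scale act a \<gamma> =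
     Abs_char (\<lambda>x. \<Prod>s\<in>supp a. char_fun \<gamma> (act (- s) x) powi lookup a s)"

lemma (in algebraic_action) char_fun_dual_scale:
  "char_fun (dual_scale act a \<gamma>) x = (\<Prod>s\<in>supp a. char_fun \<gamma> (act (- s) x) powi lookup a s)"
proof -
  have "continuous_on UNIV (\<lambda>x. char_fun \<gamma> (act s x))" for s
    by (rule continuous_on_compose2[OF char_fun_continuous continuous_act]) auto
  then have "continuous_on UNIV (\<lambda>x. \<Prod>s\<in>supp a. char_fun \<gamma> (act (- s) x) powi lookup a s)"
    by (intro continuous_on_prod continuous_on_power_int) simp_all
  moreover have "cmod (\<Prod>s\<in>supp a. char_fun \<gamma> (act (- s) y) powi lookup a s) = 1" for y
    by (simp add: norm_power_int flip: prod_norm)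
  ultimately have "(\<lambda>x. \<Prod>s\<in>supp a. char_fun \<gamma> (act (- s) x) powi lookup a s) \<in>
    {\<gamma>. continuous_on UNIV \<gamma> \<and> (\<forall>x. cmod (\<gamma> x) = 1) \<and> (\<forall>x y. \<gamma> (x + y) = \<gamma> x * \<gamma> y)}"
    by (simp add: act_add char_fun_add power_int_mult_distrib prod.distrib)
  then show ?thesis
    unfolding dual_scale_def by (simp add: Abs_char_inverse)
qed

lemma (in algebraic_action) char_fun_dual_scale_superset:
  assumes "finite S" "supp a \<subseteq> S"
  shows "char_fun (dual_scale act a \<gamma>) x = (\<Prod>s\<in>S. char_fun \<gamma> (act (- s) x) powi lookup a s)"
  unfolding char_fun_dual_scale
  by (rule prod.mono_neutral_left) (use assms in \<open>auto simp: in_keys_iff\<close>)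

lemma poly_mapping_single_add_induct [case_names single add]:
  fixes a :: "'a \<Rightarrow>\<^sub>0 'b::comm_monoid_add"
  assumes single: "\<And>k v. P (Poly_Mapping.single k v)"
    and add: "\<And>f g. P f \<Longrightarrow> P g \<Longrightarrow> P (f + g)"
  shows "P a"
proof (induction a rule: update_induct)
  case const
  then show ?case using single[of undefined 0] by simp
next
  case (update f k v)
  have "Poly_Mapping.update k v f = f + Poly_Mapping.single k v"
    using update(1) by (intro poly_mapping_eqI)
      (auto simp: lookup_update lookup_add lookup_single in_keys_iff when_def)
  then show ?case using add update single by simp
qed

lemma (in algebraic_action) left_module_dual_scale: "left_module (dual_scale act)"
proof
  fix a b :: "'g \<Rightarrow>\<^sub>0 int" and \<gamma> \<psi> :: "'x pontryagin_dual"
  show add_right: "dual_scale act a (\<gamma> + \<psi>) = dual_scale act a \<gamma> + dual_scale act a \<psi>"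
    for a :: "'g \<Rightarrow>\<^sub>0 int" and \<gamma> \<psi>
    by (simp add: char_fun_inject[symmetric] char_fun_dual_scale char_fun_plus fun_eq_iff
        power_int_mult_distrib prod.distrib)
  show add_left: "dual_scale act (a + b) \<gamma> = dual_scale act a \<gamma> + dual_scale act b \<gamma>"
    for a b :: "'g \<Rightarrow>\<^sub>0 int" and \<gamma>
  proof -
    have "supp (a + b) \<subseteq> supp a \<union> supp b"
      by (rule keys_add)
    then show ?thesis
      by (simp add: char_fun_inject[symmetric] char_fun_plus fun_eq_iff lookup_add power_int_add
          char_fun_dual_scale_superset[where S = "supp a \<union> supp b"] prod.distrib)
  qed
  have dual_single: "char_fun (dual_scale act (Poly_Mapping.single s m) \<gamma>) x
      = char_fun \<gamma> (act (- s) x) powi m" for s m \<gamma> x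
    by (simp add: char_fun_dual_scale_superset[where S = "{s}"])
  show "dual_scale act a (dual_scale act b \<gamma>) = dual_scale act (a * b) \<gamma>"
  proof (induction a rule: poly_mapping_single_add_induct)
    case (single s m)
    show ?case
    proof (induction b rule: poly_mapping_single_add_induct)
      case (single t n)
      show ?case
        by (simp add: char_fun_inject[symmetric] fun_eq_iff mult_single act_act minus_add
            dual_single power_int_mult mult.commute[of m n])
    qed (simp add: distrib_left add_left add_right)
  qed (simp add: distrib_right add_left)
  show "dual_scale act 1 \<gamma> = \<gamma>"
    using dual_single[of 0 1 \<gamma>] by (simp add: char_fun_inject[symmetric] fun_eq_iff act_zero)
qed


section \<open>Combinatorial independence\<close>

text \<open>A tuple \<open>(A\<^sub>1, \<dots>, A\<^sub>k)\<close> is a list of length \<open>k\<close>, indexed from \<open>0\<close>.\<close>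

definition independence_set ::
  "('g::group_add \<Rightarrow> 'x \<Rightarrow> 'x) \<Rightarrow> 'x set list \<Rightarrow> 'g set \<Rightarrow> bool" where
  "independence_set act A J \<longleftrightarrow>
     (\<forall>I \<phi>. I \<subseteq> J \<and> finite I \<and> I \<noteq> {} \<and> (\<forall>s\<in>I. \<phi> s < length A) \<longrightarrow>
        (\<Inter>s\<in>I. act (- s) ` (A ! \<phi> s)) \<noteq> {})"

definition independence_density_bound ::
  "('g::group_add \<Rightarrow> 'x \<Rightarrow> 'x) \<Rightarrow> 'x set list \<Rightarrow> real \<Rightarrow> bool" where
  "independence_density_bound act A q \<longleftrightarrow>
     0 \<le> q \<and>
     (\<forall>F. finite F \<longrightarrow>
        (\<exists>J\<subseteq>F. real (card J) \<ge> q * real (card F) \<and> independence_set act A J))"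

definition independence_density ::
  "('g::group_add \<Rightarrow> 'x \<Rightarrow> 'x) \<Rightarrow> 'x set list \<Rightarrow> real" where
  "independence_density act A = Sup {q. independence_density_bound act A q}"

text \<open>The supremum is attained, so it is the largest such \<open>q\<close>.\<close>

lemma
  fixes act :: "'g::group_add \<Rightarrow> 'x \<Rightarrow> 'x"
  shows independence_density_bound: "independence_density_bound act A (independence_density act A)"
    and independence_density_greatest:
      "independence_density_bound act A q \<Longrightarrow> q \<le> independence_density act A"
proof -
  let ?Q = "{q. independence_density_bound act A q}"
  have empty: "independence_set act A {}"
    by (simp add: independence_set_def)
  have zero: "0 \<in> ?Q"
    unfolding independence_density_bound_def mem_Collect_eq
    using empty by (auto intro: exI[of _ "{}"])
  have "q \<le> 1" if q: "q \<in> ?Q" for q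
  proof -
    obtain J :: "'g set" where "J \<subseteq> {0}" "q * real (card {0 :: 'g}) \<le> real (card J)"
      using q unfolding independence_density_bound_def by blast
    moreover have "card J \<le> 1"
      using card_mono[OF _ \<open>J \<subseteq> {0}\<close>] by simp
    ultimately show ?thesis by simp
  qed
  then have bdd: "bdd_above ?Q"
    by (auto simp: bdd_above_def)
  show greatest: "q \<le> independence_density act A" if "independence_density_bound act A q" for q
    unfolding independence_density_def by (rule cSup_upper) (use that bdd in auto)
  show "independence_density_bound act A (independence_density act A)"
    unfolding independence_density_bound_def
  proof (intro conjI allI impI)
    show "0 \<le> independence_density act A"
      using greatest zero by simp
    fix F :: "'g set" assume "finite F"
    define C where "C = {real (card J) | J. J \<subseteq> F \<and> independence_set act A J}"
    have "C \<subseteq> (\<lambda>J. real (card J)) ` Pow F"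
      by (auto simp: C_def)
    then have "finite C"
      by (rule finite_subset) (use \<open>finite F\<close> in simp)
    have "C \<noteq> {}"
      using empty unfolding C_def by blast
    have le: "q * real (card F) \<le> Max C" if q: "q \<in> ?Q" for q
    proof -
      obtain J where "J \<subseteq> F" "q * real (card F) \<le> real (card J)" "independence_set act A J"
        using q \<open>finite F\<close> unfolding independence_density_bound_def by blast
      moreover from this have "real (card J) \<le> Max C"
        using \<open>finite C\<close> by (intro Max_ge) (auto simp: C_def)
      ultimately show ?thesis by simp
    qed
    have "independence_density act A * real (card F) \<le> Max C"
    proof (cases "card F = 0")
      case True
      then show ?thesis using le[OF zero] by simp
    next
      case False
      then have "q \<le> Max C / real (card F)" if "q \<in> ?Q" for q
        using le[OF that] by (simp add: field_simps)
      then have "independence_density act A \<le> Max C / real (card F)"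
        unfolding independence_density_def by (intro cSup_least) (use zero in auto)
      then show ?thesis
        using False by (simp add: field_simps)
    qed
    moreover obtain J where "J \<subseteq> F" "independence_set act A J" "Max C = real (card J)"
      using Max_in[OF \<open>finite C\<close> \<open>C \<noteq> {}\<close>] unfolding C_def by blast
    ultimately show
      "\<exists>J\<subseteq>F. real (card J) \<ge> independence_density act A * real (card F) \<and> independence_set act A J"
      by metis
  qed
qed

definition IE_tuples ::
  "('g::group_add \<Rightarrow> 'x::topological_space \<Rightarrow> 'x) \<Rightarrow> nat \<Rightarrow> 'x list set" where
  "IE_tuples act k =
     {xs. length xs = k \<and>
        (\<forall>U. length U = k \<and> (\<forall>i<k. open (U ! i) \<and> xs ! i \<in> U ! i) \<longrightarrow>
           independence_density act U > 0)}"

definition IE_group :: "('g::group_add \<Rightarrow> 'x::topological_ab_group_add \<Rightarrow> 'x) \<Rightarrow> 'x set" where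
  "IE_group act = {x. [x, 0] \<in> IE_tuples act 2}"


section \<open>The strong Atiyah conjecture\<close>

text \<open>
  \<open>M\<^sub>n\<^sub>\<times>\<^sub>1(\<ell>\<^sup>2(G))\<close> consists of the functions \<open>z :: nat \<Rightarrow> 'g \<Rightarrow> complex\<close> with square-summable
  components, vanishing at all indices \<open>\<ge> n\<close>; matrix indices run from \<open>0\<close>.
\<close>

definition l2_vec :: "nat \<Rightarrow> (nat \<Rightarrow> 'g \<Rightarrow> complex) set" where
  "l2_vec n =
     {z. (\<forall>j<n. (\<lambda>g. (cmod (z j g))\<^sup>2) summable_on UNIV) \<and> (\<forall>j\<ge>n. z j = (\<lambda>_. 0))}"

definition l2_inner :: "('g \<Rightarrow> complex) \<Rightarrow> ('g \<Rightarrow> complex) \<Rightarrow> complex" where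
  "l2_inner u v = (\<Sum>\<^sub>\<infinity>g. u g * cnj (v g))"

definition l2_vec_inner ::
  "nat \<Rightarrow> (nat \<Rightarrow> 'g \<Rightarrow> complex) \<Rightarrow> (nat \<Rightarrow> 'g \<Rightarrow> complex) \<Rightarrow> complex" where
  "l2_vec_inner n z w = (\<Sum>j<n. l2_inner (z j) (w j))"

definition l2_delta :: "'g::group_add \<Rightarrow> complex" where
  "l2_delta g = (if g = 0 then 1 else 0)"

text \<open>\<open>(au)(g) = \<Sum>\<^sub>s a\<^sub>s u(s\<^sup>-\<^sup>1g)\<close>\<close>

definition convolve ::
  "('g::group_add \<Rightarrow>\<^sub>0 complex) \<Rightarrow> ('g \<Rightarrow> complex) \<Rightarrow> 'g \<Rightarrow> complex" where
  "convolve a u g = (\<Sum>s\<in>supp a. lookup a s * u (- s + g))"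

text \<open>For \<open>a \<in> M\<^sub>m\<^sub>\<times>\<^sub>n(\<complex>G)\<close> only the entries \<open>a i j\<close> with \<open>i < m\<close> and \<open>j < n\<close> are relevant.\<close>

definition l2_kernel ::
  "nat \<Rightarrow> nat \<Rightarrow> (nat \<Rightarrow> nat \<Rightarrow> 'g::group_add \<Rightarrow>\<^sub>0 complex) \<Rightarrow> (nat \<Rightarrow> 'g \<Rightarrow> complex) set" where
  "l2_kernel m n a =
     {z \<in> l2_vec n. \<forall>i<m. \<forall>g. (\<Sum>j<n. convolve (a i j) (z j) g) = 0}"

text \<open>The orthogonal projection of \<open>M\<^sub>n\<^sub>\<times>\<^sub>1(\<ell>\<^sup>2(G))\<close> onto a closed subspace \<open>K\<close>.\<close>

definition l2_projection ::
  "nat \<Rightarrow> (nat \<Rightarrow> 'g \<Rightarrow> complex) set \<Rightarrow> (nat \<Rightarrow> 'g \<Rightarrow> complex) \<Rightarrow> (nat \<Rightarrow> 'g \<Rightarrow> complex)" where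
  "l2_projection n K z =
     (THE p. p \<in> K \<and> (\<forall>w\<in>K. l2_vec_inner n (\<lambda>j g. z j g - p j g) w = 0))"

text \<open>The entry \<open>P\<^sub>j\<^sub>k\<close> of an operator \<open>P\<close> on \<open>M\<^sub>n\<^sub>\<times>\<^sub>1(\<ell>\<^sup>2(G))\<close>.\<close>

definition operator_entry ::
  "((nat \<Rightarrow> 'g \<Rightarrow> complex) \<Rightarrow> (nat \<Rightarrow> 'g \<Rightarrow> complex)) \<Rightarrow>
     nat \<Rightarrow> nat \<Rightarrow> ('g \<Rightarrow> complex) \<Rightarrow> ('g \<Rightarrow> complex)" where
  "operator_entry P j k u = P (\<lambda>i. if i = k then u else (\<lambda>_. 0)) j"

definition vN_dim :: "nat \<Rightarrow> (nat \<Rightarrow> 'g::group_add \<Rightarrow> complex) set \<Rightarrow> complex" where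
  "vN_dim n K =
     (\<Sum>j<n. l2_inner (operator_entry (l2_projection n K) j j l2_delta) l2_delta)"

definition strong_atiyah :: "'g::group_add itself \<Rightarrow> bool" where
  "strong_atiyah _ \<longleftrightarrow>
     (\<forall>m>0. \<forall>n>0. \<forall>a :: nat \<Rightarrow> nat \<Rightarrow> 'g \<Rightarrow>\<^sub>0 complex.
        \<exists>q \<in> group_closure {1 / of_nat (card H) | H :: 'g set. finite_subgroup H}.
          vN_dim n (l2_kernel m n a) = of_rat q)"

end

theory Submission
  imports Defs
begin

text \<open>
  Let \<open>\<theta>\<^sub>i\<close> (\<open>i < n\<close>) be characters whose translates separate points. Kronecker's theorem identifies \<open>X\<close>
  with the real configurations \<open>u : {0..<n} \<times> G \<rightarrow> \<real>\<close> modulo integral ones on which every relation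
  \<open>a \<in> J \<subseteq> \<int>G\<^sup>n\<close> between the \<open>\<theta>\<^sub>i\<close> takes integral values. Expansiveness says that no nonzero bounded
  \<open>u\<close> is killed by \<open>J\<close>; by compactness and duality \<open>J\<close> then contains the rows of a square matrix \<open>\<alpha>\<close>
  whose distance to a large multiple \<open>N\<close> of the identity is at most \<open>N/2\<close>. Hence \<open>\<alpha>\<close> is invertible on
  \<open>\<ell>\<^sup>\<infinity>\<close> and on \<open>\<ell>\<^sup>1\<close>, and \<open>\<alpha>u\<close> determines \<open>u\<close> locally up to a small error.

  A homoclinic point \<open>x\<close> lifts to a \<open>u\<close> vanishing at infinity, for which \<open>\<alpha>u\<close> is integral and so finitely
  supported. Sums of sparse translates of \<open>u\<close> remain uniformly bounded and resemble \<open>x\<close> or \<open>0\<close> at prescribed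
  places, which gives \<open>x \<in> IE\<close>; and \<open>IE\<close> is closed.

  Conversely let \<open>x \<in> IE\<close>, let \<open>B\<close> be a finite matrix generating \<open>J\<close>, and write \<open>\<alpha> = CB\<close>. On a Foelner set \<open>F\<close>
  there are exponentially more independent patterns than possible values of \<open>Bu\<close> near the boundary of \<open>F\<close>.
  So two points \<open>u\<close>, \<open>u'\<close> following different patterns agree there, and cutting \<open>B(u - u')\<close> off outside
  \<open>F\<close> gives a finitely supported integral \<open>w\<close> satisfying finitely many prescribed relations between the rows
  of \<open>B\<close>. If these finitely many relations have the same \<open>\<ell>\<^sup>1\<close> kernel as all of them, then \<open>w = B\<xi>\<close> for the
  summable \<open>\<xi> = \<alpha>\<^sup>-\<^sup>1Cw\<close>: the error \<open>w - B\<xi>\<close> is killed by \<open>C\<close> and by all relations, and a dimension count on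
  Foelner sets shows that it is \<open>0\<close>. Thus \<open>\<xi>\<close> represents a homoclinic point, and one of its translates is near \<open>x\<close>.
  The reduction to finitely many relations is immediate if \<open>\<int>G\<close> is left Noetherian; under the strong Atiyah
  conjecture it holds because the von Neumann dimensions of the kernels are discrete.
\<close>

text \<open>The rows of \<open>\<alpha>\<close> may generate a proper submodule of \<open>J\<close>,
  so integrality of \<open>\<alpha>u\<close> does not make \<open>u\<close> a lift of a point of
  \<open>X\<close>: the inverse of \<open>\<alpha>\<close> only produces a candidate, and the
  remaining relations have to be secured separately. Sums of translates of a homoclinic point are
  lifts from the start; for the inclusion of \<open>IE\<close> in the closure this is the obstacle.
  A truncated \<open>w\<close> lies in the range of \<open>B\<close> only if it satisfies every
  relation between the rows of \<open>B\<close>, whereas a Foelner set is wide only in comparison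
  with finitely many supports. Apart from finite generation of \<open>J\<close>, bridging this gap
  is what the two alternative hypotheses are for. Proximity to \<open>N\<close> is measured by sums
  of absolute values of coefficients, since such a bound passes to bounded and to summable
  configurations alike: the former give uniform estimates on patterns, the latter give decay at
  infinity and the passage to square-summable kernels. \<open>N\<close> is large because integral
  coefficients approximate a real combination of relations only after scaling.\<close>

definition shift_avg :: "'x::ab_group_add list \<Rightarrow> ('x \<Rightarrow> 'b::real_vector) \<Rightarrow> 'x \<Rightarrow> 'b" where
  "shift_avg xs f x = (\<Sum>s\<leftarrow>xs. f (x + s)) /\<^sub>R real (length xs)"

text \<open>The mean is the Haar integral, obtained as the constant that averages of finitely many translates
  approximate uniformly. On a function without a mean, \<open>mean\<close> is an arbitrary value.\<close>

definition has_mean :: "('x::ab_group_add \<Rightarrow> 'b::real_normed_vector) \<Rightarrow> 'b \<Rightarrow> bool" where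
  "has_mean f c \<longleftrightarrow> (\<forall>\<epsilon>>0. \<exists>xs. xs \<noteq> [] \<and> (\<forall>x. norm (shift_avg xs f x - c) \<le> \<epsilon>))"

definition mean :: "('x::ab_group_add \<Rightarrow> 'b::real_normed_vector) \<Rightarrow> 'b" where
  "mean f = (SOME c. has_mean f c)"

section \<open>Averages over finite lists of translates, and uniqueness of means\<close>

lemma sum_list_product_map:
  fixes F :: "'a \<Rightarrow> 'b \<Rightarrow> 'c::comm_monoid_add"
  shows "(\<Sum>p\<leftarrow>List.product xs ys. F (fst p) (snd p)) = (\<Sum>s\<leftarrow>xs. \<Sum>t\<leftarrow>ys. F s t)"
  by (induction xs) (auto simp: comp_def)

text \<open>Sums \<open>s + t\<close> may coincide and then count with multiplicity, which is why
  translates are kept in lists rather than in sets.\<close>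

lemma shift_avg_shift_avg:
  "shift_avg xs (shift_avg ys f) = shift_avg (map (\<lambda>p. fst p + snd p) (List.product xs ys)) f"
proof
  fix x
  have "(\<Sum>s\<leftarrow>xs. \<Sum>t\<leftarrow>ys. f (x + s + t)) = (\<Sum>p\<leftarrow>List.product xs ys. f (x + (fst p + snd p)))"
    using sum_list_product_map[where F = "\<lambda>s t. f (x + s + t)" and xs = xs and ys = ys]
    by (simp add: add.assoc)
  moreover have "(\<Sum>s\<leftarrow>xs. (\<Sum>t\<leftarrow>ys. f (x + s + t)) /\<^sub>R real (length ys))
    = (\<Sum>s\<leftarrow>xs. \<Sum>t\<leftarrow>ys. f (x + s + t)) /\<^sub>R real (length ys)"
    by (induction xs) (auto simp: scaleR_add_right)
  ultimately show "shift_avg xs (shift_avg ys f) x = shift_avg (map (\<lambda>p. fst p + snd p) (List.product xs ys)) f x"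
    by (simp add: shift_avg_def comp_def)
qed

lemma shift_avg_add: "shift_avg xs (\<lambda>x. f x + g x) x = shift_avg xs f x + shift_avg xs g x"
  by (simp add: shift_avg_def sum_list_addf scaleR_add_right)

lemma shift_avg_linear:
  assumes "linear h"
  shows "shift_avg xs (\<lambda>x. h (f x)) x = h (shift_avg xs f x)"
proof -
  have "(\<Sum>s\<leftarrow>xs. h (f (x + s))) = h (\<Sum>s\<leftarrow>xs. f (x + s))"
    by (induction xs) (auto simp: linear_0[OF assms] linear_add[OF assms])
  then show ?thesis by (simp add: shift_avg_def linear_scale[OF assms])
qed

lemma shift_avg_const: "xs \<noteq> [] \<Longrightarrow> shift_avg xs (\<lambda>_. c) x = c"
proof -
  assume "xs \<noteq> []"
  moreover have "(\<Sum>s\<leftarrow>xs. c) = real (length xs) *\<^sub>R c"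
    by (induction xs) (auto simp: algebra_simps)
  ultimately show ?thesis by (simp add: shift_avg_def)
qed

text \<open>Commutativity of the group enters here; uniqueness of means and common averages for
  several functions both rest on it.\<close>

lemma shift_avg_commute:
  "shift_avg xs (shift_avg ys f) = shift_avg ys (shift_avg xs f)"
proof
  fix x
  have "(\<Sum>s\<leftarrow>xs. shift_avg ys f (x + s)) = (\<Sum>s\<leftarrow>xs. \<Sum>t\<leftarrow>ys. f (x + t + s)) /\<^sub>R real (length ys)"
    by (induction xs) (auto simp: shift_avg_def scaleR_add_right algebra_simps)
  also have "(\<Sum>s\<leftarrow>xs. \<Sum>t\<leftarrow>ys. f (x + t + s)) = (\<Sum>t\<leftarrow>ys. \<Sum>s\<leftarrow>xs. f (x + t + s))"
    by (induction xs) (auto simp: sum_list_addf)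
  also have "(\<Sum>t\<leftarrow>ys. \<Sum>s\<leftarrow>xs. f (x + t + s)) /\<^sub>R real (length ys) =
     real (length xs) *\<^sub>R shift_avg ys (shift_avg xs f) x"
  proof (cases "xs = []")
    case False
    have "(\<Sum>t\<leftarrow>ys. shift_avg xs f (x + t)) = (\<Sum>t\<leftarrow>ys. \<Sum>s\<leftarrow>xs. f (x + t + s)) /\<^sub>R real (length xs)"
      by (induction ys) (auto simp: shift_avg_def scaleR_add_right)
    with False show ?thesis by (simp add: shift_avg_def)
  qed simp
  finally show "shift_avg xs (shift_avg ys f) x = shift_avg ys (shift_avg xs f) x"
    by (cases "xs = []") (auto simp: shift_avg_def)
qed

lemma shift_avg_bound:
  assumes "xs \<noteq> []" "\<And>x. norm (f x - c) \<le> e"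
  shows "norm (shift_avg xs f x - c) \<le> e"
proof -
  have "norm ((\<Sum>s\<leftarrow>xs. f (x + s)) - real (length xs) *\<^sub>R c) \<le> real (length xs) * e"
  proof (induction xs)
    case (Cons a xs)
    have "(\<Sum>s\<leftarrow>a#xs. f (x + s)) - real (length (a#xs)) *\<^sub>R c =
      (f (x + a) - c) + ((\<Sum>s\<leftarrow>xs. f (x + s)) - real (length xs) *\<^sub>R c)"
      by (simp add: algebra_simps)
    then have "norm ((\<Sum>s\<leftarrow>a#xs. f (x + s)) - real (length (a#xs)) *\<^sub>R c) \<le> e + real (length xs) * e"
      using norm_triangle_mono[OF assms(2)[of "x + a"] Cons.IH] by (simp only:)
    then show ?case by (simp add: distrib_right)
  qed simp
  moreover have "shift_avg xs f x - c = ((\<Sum>s\<leftarrow>xs. f (x + s)) - real (length xs) *\<^sub>R c) /\<^sub>R real (length xs)"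
    using assms(1) by (simp add: shift_avg_def scaleR_diff_right)
  ultimately show ?thesis
    using assms(1) by (simp add: divide_le_eq mult.commute flip: divide_inverse_commute)
qed

lemma has_meanD:
  "has_mean f c \<Longrightarrow> \<epsilon> > 0 \<Longrightarrow> \<exists>xs. xs \<noteq> [] \<and> (\<forall>x. norm (shift_avg xs f x - c) \<le> \<epsilon>)"
  by (auto simp: has_mean_def)

text \<open>Averaging the first average over \<open>ys\<close> leaves it near \<open>c\<close>,
  averaging the second over \<open>xs\<close> leaves it near \<open>d\<close>, and both results are
  the same number.\<close>

lemma shift_avg_near_unique:
  assumes "xs \<noteq> []" "ys \<noteq> []" "\<And>x. norm (shift_avg xs f x - c) \<le> a" "\<And>x. norm (shift_avg ys f x - d) \<le> b"
  shows "norm (c - d) \<le> a + b"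
proof -
  have "norm (shift_avg ys (shift_avg xs f) 0 - c) \<le> a"
    by (rule shift_avg_bound) (use assms in auto)
  moreover have "norm (shift_avg xs (shift_avg ys f) 0 - d) \<le> b"
    by (rule shift_avg_bound) (use assms in auto)
  ultimately show ?thesis
    unfolding shift_avg_commute[of xs ys]
    by (smt (verit) norm_minus_commute norm_triangle_ineq diff_add_cancel add_diff_eq)
qed

lemma has_mean_unique:
  assumes "has_mean f c" "has_mean f d"
  shows "c = d"
proof (rule ccontr)
  assume "c \<noteq> d"
  then have e: "norm (c - d) / 3 > 0" by simp
  from has_meanD[OF assms(1) e] has_meanD[OF assms(2) e] obtain xs ys where
    "xs \<noteq> []" "ys \<noteq> []" "\<forall>x. norm (shift_avg xs f x - c) \<le> norm (c - d) / 3"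
    "\<forall>x. norm (shift_avg ys f x - d) \<le> norm (c - d) / 3" by blast
  from shift_avg_near_unique[OF this(1,2), of f c "norm (c - d) / 3" d "norm (c - d) / 3"] this
  show False using e by auto
qed

lemma mean_eq: "has_mean f c \<Longrightarrow> mean f = c"
  unfolding mean_def using has_mean_unique by (metis someI)

text \<open>An average that is nearly constant stays so under further averaging, so lists that are
  good for the individual functions can be composed.\<close>

lemma shift_avg_common:
  assumes "finite A" "\<And>i. i \<in> A \<Longrightarrow> has_mean (f i) (c i)" "\<epsilon> > 0"
  shows "\<exists>xs. xs \<noteq> [] \<and> (\<forall>i\<in>A. \<forall>x. norm (shift_avg xs (f i) x - c i) \<le> \<epsilon>)"
  using assms(1,2)
proof (induction A)
  case empty
  then show ?case by (auto intro: exI[of _ "[0]"])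
next
  case (insert a A)
  then obtain xs where xs: "xs \<noteq> []" "\<forall>i\<in>A. \<forall>x. norm (shift_avg xs (f i) x - c i) \<le> \<epsilon>"
    by auto
  obtain ys where ys: "ys \<noteq> []" "\<forall>x. norm (shift_avg ys (f a) x - c a) \<le> \<epsilon>"
    using has_meanD[OF insert.prems[of a] assms(3)] by auto
  let ?zs = "map (\<lambda>p. fst p + snd p) (List.product xs ys)"
  have "norm (shift_avg ?zs (f i) x - c i) \<le> \<epsilon>" if "i \<in> insert a A" for i x
  proof (cases "i = a")
    case True
    then show ?thesis unfolding shift_avg_shift_avg[symmetric]
      by (auto intro!: shift_avg_bound xs ys(2)[rule_format])
  next
    case False
    then show ?thesis unfolding shift_avg_shift_avg[symmetric] using that
      by (subst shift_avg_commute) (auto intro!: shift_avg_bound ys xs(2)[rule_format])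
  qed
  moreover have "?zs \<noteq> []" using xs ys by (cases xs; cases ys) auto
  ultimately show ?case by blast
qed

lemma has_mean_add:
  assumes "has_mean f c" "has_mean g d"
  shows "has_mean (\<lambda>x. f x + g x) (c + d)"
  unfolding has_mean_def
proof (intro allI impI)
  fix \<epsilon> :: real assume "\<epsilon> > 0"
  then have "\<epsilon> / 2 > 0" by simp
  have "\<exists>xs. xs \<noteq> [] \<and> (\<forall>b\<in>{True, False}. \<forall>x. norm (shift_avg xs (if b then f else g) x - (if b then c else d)) \<le> \<epsilon>/2)"
    by (rule shift_avg_common) (use assms \<open>\<epsilon> / 2 > 0\<close> in auto)
  then obtain xs where xs: "xs \<noteq> []" "\<And>x. norm (shift_avg xs f x - c) \<le> \<epsilon>/2" "\<And>x. norm (shift_avg xs g x - d) \<le> \<epsilon>/2"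
    by fastforce
  have "norm (shift_avg xs (\<lambda>x. f x + g x) x - (c + d)) \<le> \<epsilon>" for x
    unfolding shift_avg_add add_diff_add using norm_triangle_mono[OF xs(2)[of x] xs(3)[of x]]
    by simp
  with xs(1) show "\<exists>xs. xs \<noteq> [] \<and> (\<forall>x. norm (shift_avg xs (\<lambda>x. f x + g x) x - (c + d)) \<le> \<epsilon>)"
    by blast
qed

lemma has_mean_linear:
  assumes "bounded_linear h" "has_mean f c"
  shows "has_mean (\<lambda>x. h (f x)) (h c)"
  unfolding has_mean_def
proof (intro allI impI)
  fix \<epsilon> :: real assume e: "\<epsilon> > 0"
  interpret bounded_linear h by fact
  obtain K where K: "K > 0" "\<And>x. norm (h x) \<le> norm x * K" using pos_bounded by auto
  obtain xs where xs: "xs \<noteq> []" "\<And>x. norm (shift_avg xs f x - c) \<le> \<epsilon>/K"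
    using has_meanD[OF assms(2), of "\<epsilon>/K"] e K by auto
  have "norm (shift_avg xs (\<lambda>x. h (f x)) x - h c) \<le> \<epsilon>" for x
  proof -
    have "shift_avg xs (\<lambda>x. h (f x)) x - h c = h (shift_avg xs f x - c)"
      by (simp add: shift_avg_linear linear_axioms diff)
    also have "norm \<dots> \<le> norm (shift_avg xs f x - c) * K" by (rule K)
    also have "\<dots> \<le> \<epsilon>" using xs(2)[of x] K by (simp add: field_simps)
    finally show ?thesis .
  qed
  with xs(1) show "\<exists>xs. xs \<noteq> [] \<and> (\<forall>x. norm (shift_avg xs (\<lambda>x. h (f x)) x - h c) \<le> \<epsilon>)"
    by blast
qed

lemma has_mean_const: "has_mean (\<lambda>_. c) c"
  unfolding has_mean_def by (auto intro!: exI[of _ "[0]"] simp: shift_avg_const)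

lemma has_mean_shift:
  assumes "has_mean f c"
  shows "has_mean (\<lambda>x. f (x + h)) c"
  unfolding has_mean_def
proof (intro allI impI)
  fix \<epsilon> :: real assume "\<epsilon> > 0"
  then obtain xs where xs: "xs \<noteq> []" "\<And>x. norm (shift_avg xs f x - c) \<le> \<epsilon>"
    using has_meanD[OF assms] by auto
  have "shift_avg xs (\<lambda>x. f (x + h)) x = shift_avg xs f (x + h)" for x
    by (simp add: shift_avg_def algebra_simps)
  with xs show "\<exists>xs. xs \<noteq> [] \<and> (\<forall>x. norm (shift_avg xs (\<lambda>x. f (x + h)) x - c) \<le> \<epsilon>)"
    by metis
qed

lemma has_mean_shift_avg_bound:
  assumes "has_mean f c" "\<And>x. norm (f x - d) \<le> e"
  shows "norm (c - d) \<le> e"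
proof (rule field_le_epsilon)
  fix \<epsilon> :: real assume "\<epsilon> > 0"
  then obtain xs where xs: "xs \<noteq> []" "\<And>x. norm (shift_avg xs f x - c) \<le> \<epsilon>"
    using has_meanD[OF assms(1)] by auto
  from shift_avg_near_unique[OF xs(1) _ xs(2), of "[0]" d e] assms(2)
  show "norm (c - d) \<le> e + \<epsilon>" by (auto simp: shift_avg_def)
qed

lemma has_mean_nonneg:
  fixes f :: "'x::ab_group_add \<Rightarrow> real"
  assumes "has_mean f c" "\<And>x. 0 \<le> f x"
  shows "0 \<le> c"
proof (rule ccontr)
  assume "\<not> 0 \<le> c"
  then have "- c / 2 > 0" by simp
  from has_meanD[OF assms(1) this] obtain xs where
    "xs \<noteq> []" "norm (shift_avg xs f 0 - c) \<le> - c / 2" by blast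
  moreover have "shift_avg xs f 0 \<ge> 0"
    unfolding shift_avg_def using assms(2) by (auto intro!: mult_nonneg_nonneg sum_list_nonneg)
  ultimately show False using \<open>- c / 2 > 0\<close> by (auto simp: abs_if split: if_splits)
qed

section \<open>Invariant means of continuous functions\<close>

context
  assumes cpt: "compact (UNIV :: 'x::{metric_space, topological_ab_group_add} set)"
begin

text \<open>The metric need not be translation-invariant. Uniform continuity of
  \<open>(x, v) \<mapsto> F (x + v)\<close> on the compact product takes the place of
  invariance.\<close>

lemma group_uniform:
  fixes F :: "'x \<Rightarrow> 'b::metric_space"
  assumes "continuous_on UNIV F" "\<epsilon> > 0"
  shows "\<exists>\<delta>>0. \<forall>x v. dist v 0 < \<delta> \<longrightarrow> dist (F (x + v)) (F x) < \<epsilon>"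
proof -
  have "continuous_on (UNIV \<times> UNIV) (\<lambda>p::'x\<times>'x. F (fst p + snd p))"
    by (rule continuous_on_compose2[OF assms(1)]) (auto intro!: continuous_intros)
  then have "uniformly_continuous_on (UNIV \<times> UNIV) (\<lambda>p::'x\<times>'x. F (fst p + snd p))"
    by (rule compact_uniformly_continuous) (intro compact_Times cpt)
  then obtain \<delta> where "\<delta> > 0" "\<And>p q :: 'x \<times> 'x. dist q p < \<delta> \<Longrightarrow>
      dist (F (fst q + snd q)) (F (fst p + snd p)) < \<epsilon>"
    using assms(2) unfolding uniformly_continuous_on_def by (metis UNIV_I UNIV_Times_UNIV)
  from this(1) this(2)[of "(_,_)" "(_,0)"] show ?thesis
    by (intro exI[of _ \<delta>]) (auto simp: dist_Pair_Pair)
qed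

lemma group_net:
  assumes "\<delta> > 0"
  shows "\<exists>ss::'x list. ss \<noteq> [] \<and> (\<forall>z. \<exists>s\<in>set ss. dist (s - z) 0 < \<delta>)"
proof -
  have op: "open {z::'x. dist (s - z) 0 < \<delta>}" for s
    by (intro open_Collect_less continuous_intros)
  have "z \<in> {z'::'x. dist (z - z') 0 < \<delta>}" for z using assms by simp
  then have cov: "UNIV \<subseteq> (\<Union>s\<in>UNIV. {z::'x. dist (s - z) 0 < \<delta>})" by blast
  obtain S where S: "finite S" "UNIV \<subseteq> (\<Union>s\<in>S. {z::'x. dist (s - z) 0 < \<delta>})"
    by (rule compactE_image[OF cpt _ cov]) (rule op)
  obtain ss where ss: "set ss = S" using finite_list[OF S(1)] by blast
  have *: "\<exists>s\<in>set ss. dist (s - z) 0 < \<delta>" for z using S(2) ss by blast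
  moreover have "ss \<noteq> []" using *[of 0] by auto
  ultimately show ?thesis by blast
qed

text \<open>Every \<open>x\<close> has a translate \<open>x + s\<close> near \<open>y\<close>, so
  one of the \<open>length ss\<close> summands stays \<open>\<epsilon>\<close> below the upper bound
  \<open>b\<close>. The gap of \<open>3 * \<epsilon>\<close> pays for the excess of
  \<open>g y\<close> over \<open>a\<close>, for the variation of \<open>g\<close> near
  \<open>y\<close>, and for the gain.\<close>

lemma shift_avg_osc_step:
  fixes g :: "'x \<Rightarrow> real"
  assumes ss: "ss \<noteq> []" "\<And>z. \<exists>s\<in>set ss. dist (s - z) 0 < \<delta>"
    and g: "\<And>x v. dist v 0 < \<delta> \<Longrightarrow> dist (g (x + v)) (g x) \<le> \<epsilon>"
    and ab: "\<And>x. a \<le> g x" "\<And>x. g x \<le> b" "g y \<le> a + \<epsilon>" "a + 3 * \<epsilon> \<le> b" "\<epsilon> \<ge> 0"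
  shows "shift_avg ss g x \<le> b - \<epsilon> / real (length ss)"
proof -
  obtain s where s: "s \<in> set ss" "dist (s - (y - x)) 0 < \<delta>" using ss(2) by blast
  have "dist (g (y + (s - (y - x)))) (g y) \<le> \<epsilon>" by (rule g) (rule s)
  then have gs: "g (x + s) \<le> b - \<epsilon>" using ab(3,4) by (simp add: dist_real_def algebra_simps)
  obtain us vs where "ss = us @ s # vs" using s(1) by (meson split_list)
  moreover have "(\<Sum>s\<leftarrow>us. g (x + s)) \<le> real (length us) * b" for us
    using ab(2) by (induction us) (auto simp: algebra_simps intro: add_mono)
  from this[of us] this[of vs] have "(\<Sum>s\<leftarrow>us @ s # vs. g (x + s)) \<le> real (length (us @ s # vs)) * b - \<epsilon>"
    using gs by (simp add: algebra_simps)
  ultimately have "(\<Sum>s\<leftarrow>ss. g (x + s)) \<le> real (length ss) * b - \<epsilon>" by simp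
  then show ?thesis using ss(1) by (simp add: shift_avg_def field_simps)
qed

lemma shift_avg_small_osc:
  fixes f :: "'x \<Rightarrow> real"
  assumes "continuous_on UNIV f" "\<epsilon> > 0"
  shows "\<exists>xs c. xs \<noteq> [] \<and> (\<forall>x. norm (shift_avg xs f x - c) \<le> \<epsilon>)"
proof -
  define e where "e = \<epsilon> / 3"
  have e: "e > 0" using assms by (simp add: e_def)
  obtain \<delta> where d: "\<delta> > 0" "\<And>x v. dist v 0 < \<delta> \<Longrightarrow> dist (f (x + v)) (f x) < e"
    using group_uniform[OF assms(1) e] by blast
  obtain ss :: "'x list" where ss: "ss \<noteq> []" "\<And>z. \<exists>s\<in>set ss. dist (s - z) 0 < \<delta>"
    using group_net[OF d(1)] by blast
  have mod: "dist (shift_avg xs f (x + v)) (shift_avg xs f x) \<le> e" if "xs \<noteq> []" "dist v 0 < \<delta>" for xs x v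
  proof -
    have "norm (shift_avg xs (\<lambda>x. f (x + v) - f x) x - 0) \<le> e"
      by (rule shift_avg_bound[OF that(1)]) (use d(2)[OF that(2)] in \<open>auto simp: dist_real_def less_imp_le\<close>)
    also have "shift_avg xs (\<lambda>x. f (x + v) - f x) x = shift_avg xs f (x + v) - shift_avg xs f x"
      by (simp add: shift_avg_def sum_list_subtractf algebra_simps)
    finally show ?thesis by (simp add: dist_real_def)
  qed
  have "bounded (f ` UNIV)" using compact_continuous_image[OF assms(1) cpt] compact_imp_bounded by blast
  then obtain B where B: "\<And>x. \<bar>f x\<bar> \<le> B" by (auto simp: bounded_iff)
  define n where "n = real (length ss)"
  have n: "n \<ge> 1" using ss(1) by (cases ss) (auto simp: n_def)
  \<comment> \<open>Each round shrinks the enclosing interval by at least \<open>e / n\<close>: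
    either its lower end can be raised, or averaging over \<open>ss\<close> lowers its upper end.
    Averages inherit the modulus \<open>\<delta>\<close> of \<open>f\<close>, so the same net
    \<open>ss\<close> works in every round.\<close>
  have step: "\<exists>xs a b. xs \<noteq> [] \<and> (\<forall>x. a \<le> shift_avg xs f x \<and> shift_avg xs f x \<le> b) \<and>
      (b - a \<le> \<epsilon> \<or> b - a \<le> 2 * B - real k * (e / n))" for k
  proof (induction k)
    case 0
    have "\<forall>x. - B \<le> f x \<and> f x \<le> B" using B by (metis abs_le_iff minus_le_iff)
    then show ?case by (intro exI[of _ "[0]"] exI[of _ "-B"] exI[of _ B]) (auto simp: shift_avg_def)
  next
    case (Suc k)
    then obtain xs a b where xs: "xs \<noteq> []" "\<And>x. a \<le> shift_avg xs f x" "\<And>x. shift_avg xs f x \<le> b"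
      "b - a \<le> \<epsilon> \<or> b - a \<le> 2 * B - real k * (e / n)" by blast
    have en: "e / n \<le> e" "e / n > 0" using e n by (auto simp: field_simps)
    consider (small) "b - a \<le> \<epsilon>" | (high) "b - a > \<epsilon>" "\<And>x. a + e \<le> shift_avg xs f x"
      | (low) y where "b - a > \<epsilon>" "shift_avg xs f y \<le> a + e" by (meson not_le less_imp_le)
    then show ?case
    proof cases
      case small
      then show ?thesis using xs by blast
    next
      case high
      then show ?thesis using xs en
        by (intro exI[of _ xs] exI[of _ "a + e"] exI[of _ b]) (auto simp: algebra_simps)
    next
      case low
      let ?g = "shift_avg xs f"
      let ?zs = "map (\<lambda>p. fst p + snd p) (List.product ss xs)"
      have up: "shift_avg ss ?g x \<le> b - e / n" for x unfolding n_def
        by (rule shift_avg_osc_step[OF ss, where a = a and y = y])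
          (use mod[OF xs(1)] xs low e in \<open>auto simp: e_def\<close>)
      have "a \<le> shift_avg ss ?g x" for x
      proof -
        have "real (length ss) * a \<le> (\<Sum>s\<leftarrow>ss. ?g (x + s))"
          using xs(2) by (induction ss) (auto simp: algebra_simps intro: add_mono)
        then show ?thesis using ss(1) by (simp add: shift_avg_def field_simps)
      qed
      moreover have "?zs \<noteq> []" using xs(1) ss(1) by (cases xs; cases ss) auto
      moreover have "(b - e/n) - a \<le> 2 * B - real (Suc k) * (e / n)"
        using xs(4) low by (auto simp: algebra_simps)
      ultimately show ?thesis using up unfolding shift_avg_shift_avg by blast
    qed
  qed
  obtain k where "2 * B \<le> real k * (e / n)"
  proof -
    have "e / n > 0" using e n by auto
    then show ?thesis using that ex_less_of_nat_mult[of "e / n" "2 * B"] by (metis less_imp_le)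
  qed
  with step[of k] assms(2) obtain xs a b where xs: "xs \<noteq> []" "\<And>x. a \<le> shift_avg xs f x"
    "\<And>x. shift_avg xs f x \<le> b" "b - a \<le> \<epsilon>" by force
  have "norm (shift_avg xs f x - a) \<le> \<epsilon>" for x using xs(2,3)[of x] xs(4) by auto
  with xs(1) show ?thesis by blast
qed

text \<open>Averages with smaller and smaller oscillation have approximating constants that form a
  Cauchy sequence, because any two averages of one function can be compared by
  \<open>shift_avg_near_unique\<close>.\<close>

lemma has_mean_exists_real:
  fixes f :: "'x \<Rightarrow> real"
  assumes "continuous_on UNIV f"
  shows "\<exists>c. has_mean f c"
proof -
  have "\<forall>n. \<exists>xs c. xs \<noteq> [] \<and> (\<forall>x. norm (shift_avg xs f x - c) \<le> 1 / real (Suc n))"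
    by (intro allI shift_avg_small_osc[OF assms]) simp
  then obtain xs c where xs: "\<And>n. xs n \<noteq> []" "\<And>n x. norm (shift_avg (xs n) f x - c n) \<le> 1 / real (Suc n)"
    by metis
  have cc: "norm (c n - c m) \<le> 1 / real (Suc n) + 1 / real (Suc m)" for n m
    by (rule shift_avg_near_unique[OF xs(1) xs(1) xs(2) xs(2)])
  have "Cauchy c"
  proof (rule CauchyI)
    fix e :: real assume "e > 0"
    then obtain N where N: "1 / real (Suc N) < e / 2" using nat_approx_posE[of "e/2"] by auto
    have "norm (c m - c n) < e" if "m \<ge> N" "n \<ge> N" for m n
    proof -
      have "1 / real (Suc m) \<le> 1 / real (Suc N)" "1 / real (Suc n) \<le> 1 / real (Suc N)"
        using that by (auto simp: field_simps)
      with cc[of m n] N show ?thesis by linarith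
    qed
    then show "\<exists>M. \<forall>m\<ge>M. \<forall>n\<ge>M. norm (c m - c n) < e" by blast
  qed
  then obtain l where l: "c \<longlonglongrightarrow> l" using Cauchy_convergent convergent_def by blast
  have "has_mean f l" unfolding has_mean_def
  proof (intro allI impI)
    fix e :: real assume e: "e > 0"
    have "\<forall>\<^sub>F n in sequentially. norm (c n - l) < e / 2"
      using tendstoD[OF l, of "e/2"] e by (simp add: dist_norm)
    moreover have "\<forall>\<^sub>F n in sequentially. 1 / real (Suc n) < e / 2"
      using order_tendstoD(2)[OF LIMSEQ_inverse_real_of_nat, of "e/2"] e by (simp add: field_simps)
    ultimately obtain n where n: "norm (c n - l) < e / 2" "1 / real (Suc n) < e / 2"
      using eventually_happens'[OF sequentially_bot eventually_conj] by blast
    have "norm (shift_avg (xs n) f x - l) \<le> e" for x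
      using norm_triangle_ineq[of "shift_avg (xs n) f x - c n" "c n - l"] xs(2)[of n x] n by simp
    with xs(1) show "\<exists>xs. xs \<noteq> [] \<and> (\<forall>x. norm (shift_avg xs f x - l) \<le> e)" by blast
  qed
  then show ?thesis ..
qed

lemma has_mean_exists:
  fixes f :: "'x \<Rightarrow> complex"
  assumes "continuous_on UNIV f"
  shows "\<exists>c. has_mean f c"
proof -
  obtain a b where "has_mean (\<lambda>x. Re (f x)) a" "has_mean (\<lambda>x. Im (f x)) b"
    using has_mean_exists_real[OF continuous_on_Re[OF assms]] has_mean_exists_real[OF continuous_on_Im[OF assms]]
    by blast
  from has_mean_add[OF has_mean_linear[OF bounded_linear_of_real this(1)]
      has_mean_linear[OF bounded_linear_mult_right[of \<i>] has_mean_linear[OF bounded_linear_of_real this(2)]]]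
  have "has_mean (\<lambda>x. of_real (Re (f x)) + \<i> * of_real (Im (f x)) :: complex) (of_real a + \<i> * of_real b)"
    by simp
  moreover have "of_real (Re (f x)) + \<i> * of_real (Im (f x)) = f x" for x
    by (rule complex_eq[symmetric])
  ultimately show ?thesis by auto
qed

lemma has_mean_mean_real: "continuous_on UNIV f \<Longrightarrow> has_mean (f :: 'x \<Rightarrow> real) (mean f)"
  using has_mean_exists_real mean_eq by metis

lemma has_mean_mean: "continuous_on UNIV f \<Longrightarrow> has_mean (f :: 'x \<Rightarrow> complex) (mean f)"
  using has_mean_exists mean_eq by metis

end

section \<open>Inner products and equicontinuous families\<close>

definition mean_sq :: "('x::ab_group_add \<Rightarrow> complex) \<Rightarrow> real" where
  "mean_sq f = mean (\<lambda>x. (cmod (f x))\<^sup>2)"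

definition mean_inner :: "('x::ab_group_add \<Rightarrow> complex) \<Rightarrow> ('x \<Rightarrow> complex) \<Rightarrow> complex" where
  "mean_inner f g = mean (\<lambda>x. f x * cnj (g x))"

definition mean_conv :: "('x::ab_group_add \<Rightarrow> real) \<Rightarrow> ('x \<Rightarrow> complex) \<Rightarrow> 'x \<Rightarrow> complex" where
  "mean_conv \<psi> f x = mean (\<lambda>y. of_real (\<psi> (x - y)) * f y)"

lemma has_mean_of_real: "has_mean f c \<Longrightarrow> has_mean (\<lambda>x. of_real (f x) :: complex) (of_real c)"
  by (rule has_mean_linear[OF bounded_linear_of_real])

context
  assumes cpt: "compact (UNIV :: 'x::{metric_space, topological_ab_group_add} set)"
begin

lemmas mean_real = has_mean_mean_real[OF cpt]
lemmas mean_cpx = has_mean_mean[OF cpt]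

lemma mean_mono:
  fixes f g :: "'x \<Rightarrow> real"
  assumes "continuous_on UNIV f" "continuous_on UNIV g" "\<And>x. f x \<le> g x"
  shows "mean f \<le> mean g"
proof -
  have "has_mean (\<lambda>x. g x + - f x) (mean g + - mean f)"
    by (intro has_mean_add mean_real assms has_mean_linear[OF bounded_linear_minus[OF bounded_linear_ident]])
  from has_mean_nonneg[OF this] assms(3) show ?thesis by simp
qed

lemma cmod_mean_le:
  fixes f :: "'x \<Rightarrow> complex"
  assumes "continuous_on UNIV f"
  shows "cmod (mean f) \<le> mean (\<lambda>x. cmod (f x))"
proof -
  \<comment> \<open>Multiplication by the conjugate phase of the mean turns its modulus into the
    mean of a real part, to which monotonicity applies.\<close>
  define w where "w = (if mean f = 0 then 1 else cnj (sgn (mean f)))"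
  have w: "cmod w = 1" "w * mean f = of_real (cmod (mean f))"
  proof -
    have "cnj (sgn z) * z = of_real (cmod z)" if "z \<noteq> 0" for z
    proof -
      have "cnj (sgn z) * z = (z * cnj z) / of_real (cmod z)" by (simp add: sgn_eq)
      also have "z * cnj z = of_real (cmod z) * of_real (cmod z)"
        by (metis complex_norm_square power2_eq_square of_real_mult of_real_power)
      finally show ?thesis using that by simp
    qed
    then show "w * mean f = of_real (cmod (mean f))" by (simp add: w_def)
    show "cmod w = 1" by (simp add: w_def norm_sgn)
  qed
  have "has_mean (\<lambda>x. Re (w * f x)) (Re (w * mean f))"
    by (intro has_mean_linear[OF bounded_linear_Re] has_mean_linear[OF bounded_linear_mult_right] mean_cpx assms)
  then have "cmod (mean f) = mean (\<lambda>x. Re (w * f x))" using w(2) by (simp add: mean_eq)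
  also have "\<dots> \<le> mean (\<lambda>x. cmod (f x))"
  proof (rule mean_mono)
    show "Re (w * f x) \<le> cmod (f x)" for x
      using complex_Re_le_cmod[of "w * f x"] w(1) by (simp add: norm_mult)
  qed (intro continuous_intros assms)+
  finally show ?thesis .
qed

lemma continuous_bounded:
  fixes f :: "'x \<Rightarrow> 'b::real_normed_vector"
  assumes "continuous_on UNIV f"
  shows "\<exists>B>0. \<forall>x. norm (f x) \<le> B"
proof -
  have "bounded (f ` UNIV)" using compact_continuous_image[OF assms cpt] compact_imp_bounded by blast
  then show ?thesis by (auto simp: bounded_pos)
qed

lemma mean_sq_nonneg: "continuous_on UNIV f \<Longrightarrow> 0 \<le> mean_sq (f :: 'x \<Rightarrow> complex)"
  unfolding mean_sq_def by (rule has_mean_nonneg[OF mean_real]) (auto intro!: continuous_intros)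

text \<open>Cauchy-Schwarz as nonnegativity of a variance: the deviation of
  \<open>cmod (f x)\<close> from its mean \<open>?c\<close> has a nonnegative mean square.\<close>

lemma mean_cmod_le:
  assumes "continuous_on UNIV f" 
  shows "mean (\<lambda>x::'x. cmod (f x)) \<le> sqrt (mean_sq f)"
proof -
  let ?c = "mean (\<lambda>x. cmod (f x))"
  have "has_mean (\<lambda>x. (cmod (f x))\<^sup>2 + (- 2 * ?c) * cmod (f x) + ?c\<^sup>2) (mean_sq f + (- 2 * ?c) * ?c + ?c\<^sup>2)"
    unfolding mean_sq_def
    by (intro has_mean_add has_mean_linear[OF bounded_linear_mult_right] mean_real has_mean_const
        continuous_intros assms)
  moreover have "(cmod (f x))\<^sup>2 + (- 2 * ?c) * cmod (f x) + ?c\<^sup>2 = (cmod (f x) - ?c)\<^sup>2" for x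
    by (simp add: power2_eq_square algebra_simps)
  ultimately have "has_mean (\<lambda>x. (cmod (f x) - ?c)\<^sup>2) (mean_sq f + (- 2 * ?c) * ?c + ?c\<^sup>2)"
    by (simp only:)
  then have "0 \<le> mean_sq f + (- 2 * ?c) * ?c + ?c\<^sup>2"
    by (rule has_mean_nonneg) simp
  then show ?thesis by (intro real_le_rsqrt) (simp add: power2_eq_square)
qed

text \<open>Faithfulness of the mean. Averaging the square over a fine net catches, at every
  \<open>x\<close>, one value close to the one at \<open>y\<close>; this average is therefore
  bounded below by a positive \<open>b0\<close>, and it commutes with the averages that compute the
  mean.\<close>

lemma mean_sq_pos:
  fixes f :: "'x \<Rightarrow> complex"
  assumes "continuous_on UNIV f" "f y \<noteq> 0"
  shows "mean_sq f > 0"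
proof -
  let ?h = "\<lambda>x. (cmod (f x))\<^sup>2"
  define e where "e = ?h y / 2"
  have e: "e > 0" using assms(2) by (simp add: e_def)
  have ch: "continuous_on UNIV ?h" by (intro continuous_intros assms)
  obtain \<delta> where d: "\<delta> > 0" "\<And>x v. dist v 0 < \<delta> \<Longrightarrow> dist (?h (x + v)) (?h x) < e"
    using group_uniform[OF cpt ch e] by blast
  obtain ss :: "'x list" where ss: "ss \<noteq> []" "\<And>z. \<exists>s\<in>set ss. dist (s - z) 0 < \<delta>"
    using group_net[OF cpt d(1)] by blast
  define b0 where "b0 = e / real (length ss)"
  have low: "b0 \<le> shift_avg ss ?h x" for x
  proof -
    obtain s where s: "s \<in> set ss" "dist (s - (y - x)) 0 < \<delta>" using ss(2) by blast
    have "dist (?h (y + (s - (y - x)))) (?h y) < e" by (rule d(2)) (rule s)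
    moreover have "y + (s - (y - x)) = x + s" by simp
    moreover have "?h y = 2 * e" by (simp add: e_def)
    ultimately have "e \<le> ?h (x + s)" by (simp only: dist_real_def)
    also have "?h (x + s) \<le> (\<Sum>s\<leftarrow>ss. ?h (x + s))"
      using s(1) by (intro member_le_sum_list) auto
    finally show ?thesis using ss(1) by (simp add: b0_def shift_avg_def field_simps)
  qed
  have "b0 \<le> mean_sq f"
  proof (rule ccontr)
    assume neg: "\<not> ?thesis"
    define \<eta> where "\<eta> = (b0 - mean_sq f) / 2"
    have "\<eta> > 0" using neg by (simp add: \<eta>_def)
    from has_meanD[OF mean_real[OF ch] this] obtain xs where
      xs: "xs \<noteq> []" "\<And>x. norm (shift_avg xs ?h x - mean_sq f) \<le> \<eta>" unfolding mean_sq_def by blast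
    have "norm (shift_avg ss (shift_avg xs ?h) 0 - mean_sq f) \<le> \<eta>"
      by (rule shift_avg_bound[OF ss(1) xs(2)])
    moreover have "b0 \<le> shift_avg xs (shift_avg ss ?h) 0"
    proof -
      have "real (length xs) * b \<le> (\<Sum>s\<leftarrow>xs. shift_avg ss ?h (0 + s))" if "\<And>x. b \<le> shift_avg ss ?h x" for b
        using that by (induction xs) (auto simp: distrib_right intro: add_mono)
      from this[OF low]
      show ?thesis using xs(1) by (simp add: shift_avg_def[of xs] field_simps)
    qed
    ultimately have "b0 - mean_sq f \<le> \<eta>"
      unfolding shift_avg_commute[of ss xs] by simp
    then show False using neg by (simp add: \<eta>_def field_simps)
  qed
  moreover have "b0 > 0" using e ss(1) by (simp add: b0_def)
  ultimately show ?thesis by linarith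
qed

lemma mean_sq_diff:
  fixes f g :: "'x \<Rightarrow> complex"
  assumes "continuous_on UNIV f" "continuous_on UNIV g"
  shows "mean_sq (\<lambda>x. f x - of_real r * g x) = mean_sq f - 2 * r * Re (mean_inner f g) + r\<^sup>2 * mean_sq g"
proof -
  have "has_mean (\<lambda>x. (cmod (f x))\<^sup>2 + (-2 * r) * Re (f x * cnj (g x)) + r\<^sup>2 * (cmod (g x))\<^sup>2)
    (mean_sq f + (- 2 * r) * Re (mean_inner f g) + r\<^sup>2 * mean_sq g)"
    unfolding mean_sq_def mean_inner_def
    by (intro has_mean_add has_mean_linear[OF bounded_linear_mult_right] has_mean_linear[OF bounded_linear_Re]
        mean_real mean_cpx continuous_intros assms)
  moreover have "(cmod (f x))\<^sup>2 + (-2 * r) * Re (f x * cnj (g x)) + r\<^sup>2 * (cmod (g x))\<^sup>2 = (cmod (f x - of_real r * g x))\<^sup>2" for x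
    unfolding cmod_power2 by (simp add: power2_eq_square algebra_simps)
  ultimately have "has_mean (\<lambda>x. (cmod (f x - of_real r * g x))\<^sup>2)
      (mean_sq f + (- 2 * r) * Re (mean_inner f g) + r\<^sup>2 * mean_sq g)" by (simp only:)
  then show ?thesis by (simp add: mean_sq_def[of "\<lambda>x. f x - of_real r * g x"] mean_eq)
qed

lemma mean_sq_scale:
  fixes f :: "'x \<Rightarrow> complex"
  assumes "continuous_on UNIV f"
  shows "mean_sq (\<lambda>x. c * f x) = (cmod c)\<^sup>2 * mean_sq f"
  unfolding mean_sq_def norm_mult power_mult_distrib
  by (rule mean_eq) (intro has_mean_linear[OF bounded_linear_mult_right] mean_real continuous_intros assms)

lemma mean_sq_shift:
  fixes f :: "'x \<Rightarrow> complex"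
  assumes "continuous_on UNIV f"
  shows "mean_sq (\<lambda>x. f (x + h)) = mean_sq f"
  unfolding mean_sq_def
  by (rule mean_eq) (rule has_mean_shift, intro mean_real continuous_intros assms)

lemma mean_inner_self:
  fixes f :: "'x \<Rightarrow> complex"
  assumes "continuous_on UNIV f"
  shows "mean_inner f f = of_real (mean_sq f)"
  unfolding mean_inner_def mean_sq_def complex_norm_square[symmetric]
  by (rule mean_eq) (rule has_mean_of_real, intro mean_real continuous_intros assms)

lemma mean_tendsto:
  fixes s :: "nat \<Rightarrow> 'x \<Rightarrow> real"
  assumes "uniform_limit UNIV s g sequentially" "\<And>n. continuous_on UNIV (s n)" "continuous_on UNIV g"
  shows "(\<lambda>n. mean (s n)) \<longlonglongrightarrow> mean g"
proof (rule tendstoI)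
  fix e :: real assume e: "e > 0"
  have "\<forall>\<^sub>F n in sequentially. \<forall>x\<in>UNIV. dist (s n x) (g x) < e / 2"
    using uniform_limitD[OF assms(1), of "e/2"] e by simp
  then show "\<forall>\<^sub>F n in sequentially. dist (mean (s n)) (mean g) < e"
  proof eventually_elim
    case (elim n)
    have "has_mean (\<lambda>x. s n x + - g x) (mean (s n) + - mean g)"
      by (intro has_mean_add mean_real assms has_mean_linear[OF bounded_linear_minus[OF bounded_linear_ident]])
    then have "norm (mean (s n) + - mean g - 0) \<le> e / 2"
      by (rule has_mean_shift_avg_bound) (use elim in \<open>auto simp: dist_real_def less_imp_le\<close>)
    then show ?case using e by (simp add: dist_real_def)
  qed
qed

lemma mean_sq_tendsto:
  fixes s :: "nat \<Rightarrow> 'x \<Rightarrow> complex"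
  assumes "uniform_limit UNIV s g sequentially" "\<And>n. continuous_on UNIV (s n)" "continuous_on UNIV g"
  shows "(\<lambda>n. mean_sq (s n)) \<longlonglongrightarrow> mean_sq g"
  unfolding mean_sq_def
proof (rule mean_tendsto)
  obtain B where B: "B > 0" "\<And>x. cmod (g x) \<le> B" using continuous_bounded[OF assms(3)] by blast
  show "uniform_limit UNIV (\<lambda>n x. (cmod (s n x))\<^sup>2) (\<lambda>x. (cmod (g x))\<^sup>2) sequentially"
  proof (rule uniform_limitI)
    fix e :: real assume e: "e > 0"
    define d where "d = min 1 (e / (2 * B + 1))"
    have d: "d > 0" "d \<le> 1" using e B by (auto simp: d_def intro: divide_pos_pos)
    have "d * (2 * B + 1) \<le> e / (2 * B + 1) * (2 * B + 1)"
      using B(1) by (intro mult_right_mono) (auto simp: d_def)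
    then have d3: "d * (2 * B + 1) \<le> e" using B(1) by simp
    show "\<forall>\<^sub>F n in sequentially. \<forall>x\<in>UNIV. dist ((cmod (s n x))\<^sup>2) ((cmod (g x))\<^sup>2) < e"
      using uniform_limitD[OF assms(1) d(1)]
    proof eventually_elim
      case (elim n)
      show ?case
      proof
        fix x
        have 1: "\<bar>cmod (s n x) - cmod (g x)\<bar> < d"
        proof -
          have "dist (s n x) (g x) < d" using elim by blast
          then show ?thesis using norm_triangle_ineq3[of "s n x" "g x"] by (simp add: dist_norm)
        qed
        then have 2: "cmod (s n x) + cmod (g x) < 2 * B + 1" using B(2)[of x] d(2) by auto
        have "\<bar>(cmod (s n x))\<^sup>2 - (cmod (g x))\<^sup>2\<bar> = \<bar>cmod (s n x) - cmod (g x)\<bar> * (cmod (s n x) + cmod (g x))"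
          by (simp add: power2_eq_square square_diff_square_factored abs_mult mult.commute)
        also have "\<dots> \<le> \<bar>cmod (s n x) - cmod (g x)\<bar> * (2 * B + 1)"
          using 2 by (intro mult_left_mono) auto
        also have "\<dots> < d * (2 * B + 1)" using 1 B(1) by (intro mult_strict_right_mono) auto
        finally show "dist ((cmod (s n x))\<^sup>2) ((cmod (g x))\<^sup>2) < e" using d3 by (simp add: dist_real_def)
      qed
    qed
  qed
qed (intro continuous_intros assms)+

section \<open>Compactness of equicontinuous families\<close>

lemma group_dense_sequence:
  "\<exists>d :: nat \<Rightarrow> 'x. \<forall>\<delta>>0. \<exists>K. \<forall>z. \<exists>j<K. dist (d j - z) 0 < \<delta>"
proof -
  have "\<forall>k. \<exists>ss::'x list. \<forall>z. \<exists>s\<in>set ss. dist (s - z) 0 < 1 / real (Suc k)"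
  proof
    fix k show "\<exists>ss::'x list. \<forall>z. \<exists>s\<in>set ss. dist (s - z) 0 < 1 / real (Suc k)"
      using group_net[OF cpt, of "1 / real (Suc k)"] by auto
  qed
  then obtain ss where ss: "\<And>k z. \<exists>s\<in>set (ss k :: 'x list). dist (s - z) 0 < 1 / real (Suc k)" by metis
  define D where "D = (\<Union>k. set (ss k))"
  have "D \<noteq> {}" using ss[where k = 0 and z = 0] unfolding D_def by blast
  moreover have "countable D" unfolding D_def by (intro countable_UN) (auto intro: countable_finite)
  ultimately obtain d :: "nat \<Rightarrow> 'x" where d: "range d = D" using range_from_nat_into by metis
  have "\<exists>K. \<forall>z. \<exists>j<K. dist (d j - z) 0 < \<delta>" if "\<delta> > 0" for \<delta>
  proof -
    obtain k where k: "1 / real (Suc k) < \<delta>" using nat_approx_posE[OF \<open>\<delta> > 0\<close>] by auto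
    have "set (ss k) \<subseteq> d ` UNIV" using d by (auto simp: D_def)
    then obtain I where I: "finite I" "set (ss k) = d ` I" using finite_subset_image[of "set (ss k)" d UNIV] by auto
    have "\<exists>j<Suc (Max I). dist (d j - z) 0 < \<delta>" for z
    proof -
      obtain s where "s \<in> set (ss k)" "dist (s - z) 0 < 1 / real (Suc k)" using ss by blast
      with I k obtain j where "j \<in> I" "dist (d j - z) 0 < \<delta>" by auto
      then show ?thesis using Max_ge[OF I(1), of j] by (auto simp: less_Suc_eq_le)
    qed
    then show ?thesis by blast
  qed
  then show ?thesis by blast
qed

text \<open>Arzela-Ascoli: compactness of a countable product of discs yields convergence along the
  dense sequence \<open>d\<close>, and equicontinuity together with finitely many of the
  \<open>d j\<close> makes the convergence uniform.\<close>

lemma equicontinuous_subsequence: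
  fixes s :: "nat \<Rightarrow> 'x \<Rightarrow> complex"
  assumes bdd: "\<And>n x. cmod (s n x) \<le> B"
    and eqc: "\<And>\<epsilon>. \<epsilon> > 0 \<Longrightarrow> \<exists>\<delta>>0. \<forall>n x v. dist v 0 < \<delta> \<longrightarrow> cmod (s n (x + v) - s n x) < \<epsilon>"
  shows "\<exists>r g. strict_mono (r :: nat \<Rightarrow> nat) \<and> uniform_limit UNIV (\<lambda>n. s (r n)) g sequentially"
proof -
  obtain d :: "nat \<Rightarrow> 'x" where d: "\<And>\<delta>. \<delta> > 0 \<Longrightarrow> \<exists>K. \<forall>z. \<exists>j<K. dist (d j - z) 0 < \<delta>"
    using group_dense_sequence by blast
  define \<sigma> where "\<sigma> n = (\<lambda>j. s n (d j))" for n
  have "compactin (product_topology (\<lambda>_::nat. euclidean) UNIV) (PiE UNIV (\<lambda>_. cball (0::complex) B))"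
    unfolding compactin_PiE by simp
  then have "compact (PiE UNIV (\<lambda>_::nat. cball (0::complex) B))"
    by (simp add: euclidean_product_topology compactin_euclidean_iff)
  then have "seq_compact (PiE UNIV (\<lambda>_::nat. cball (0::complex) B))"
    by (rule compact_imp_seq_compact)
  then obtain l r where r: "strict_mono (r :: nat \<Rightarrow> nat)" "(\<sigma> \<circ> r) \<longlonglongrightarrow> l"
    by (rule seq_compactE[of _ \<sigma>]) (auto simp: \<sigma>_def bdd)
  have pt: "Cauchy (\<lambda>n. s (r n) (d j))" for j
  proof -
    have "isCont (\<lambda>f :: nat \<Rightarrow> complex. f j) l"
      by (rule continuous_on_interior[OF continuous_on_product_coordinates]) simp
    from isCont_tendsto_compose[OF this r(2)] have "(\<lambda>n. s (r n) (d j)) \<longlonglongrightarrow> l j"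
      by (simp add: \<sigma>_def comp_def)
    then show ?thesis by (rule LIMSEQ_imp_Cauchy)
  qed
  have "uniformly_Cauchy_on UNIV (\<lambda>n. s (r n))"
    unfolding uniformly_Cauchy_on_def
  proof (intro allI impI)
    fix e :: real assume "e > 0"
    then have e3: "e / 3 > 0" by simp
    obtain \<delta> where \<delta>: "\<delta> > 0" "\<And>n x v. dist v 0 < \<delta> \<Longrightarrow> cmod (s n (x + v) - s n x) < e / 3"
      using eqc[OF e3] by blast
    obtain K where K: "\<And>z. \<exists>j<K. dist (d j - z) 0 < \<delta>" using d[OF \<delta>(1)] by blast
    have "\<forall>j. \<exists>M. \<forall>m\<ge>M. \<forall>n\<ge>M. cmod (s (r m) (d j) - s (r n) (d j)) < e / 3"
      using pt CauchyD e3 by blast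
    then obtain M where M: "\<And>j m n. m \<ge> M j \<Longrightarrow> n \<ge> M j \<Longrightarrow> cmod (s (r m) (d j) - s (r n) (d j)) < e / 3"
      by metis
    define L where "L = Max (insert 0 (M ` {..<K}))"
    have L: "M j \<le> L" if "j < K" for j unfolding L_def using that by (intro Max_ge) auto
    have "dist (s (r m) x) (s (r n) x) < e" if "m \<ge> L" "n \<ge> L" for m n x
    proof -
      obtain j where j: "j < K" "dist (d j - x) 0 < \<delta>" using K by blast
      have 1: "cmod (s (r m) (d j) - s (r n) (d j)) < e / 3"
        using M L[OF j(1)] that by (meson le_trans)
      have 2: "cmod (s n (d j) - s n x) < e / 3" for n using \<delta>(2)[OF j(2), of n x] by simp
      have "s (r m) x - s (r n) x = - (s (r m) (d j) - s (r m) x) + (s (r m) (d j) - s (r n) (d j)) + (s (r n) (d j) - s (r n) x)"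
        by simp
      also have "cmod \<dots> \<le> cmod (s (r m) (d j) - s (r m) x) + cmod (s (r m) (d j) - s (r n) (d j)) + cmod (s (r n) (d j) - s (r n) x)"
        by (metis (no_types, lifting) norm_minus_cancel norm_triangle_le norm_triangle_ineq add_le_cancel_right)
      finally show ?thesis using 1 2[of "r m"] 2[of "r n"] by (simp add: dist_norm)
    qed
    then show "\<exists>M. \<forall>x\<in>UNIV. \<forall>m\<ge>M. \<forall>n\<ge>M. dist (s (r m) x) (s (r n) x) < e" by blast
  qed
  then obtain g where "uniform_limit UNIV (\<lambda>n. s (r n)) g sequentially"
    using Cauchy_uniformly_convergent uniformly_convergent_on_def by blast
  with r(1) show ?thesis by blast
qed

section \<open>Iterated means of functions of two variables\<close>

lemma group_uniform_continuous:
  fixes M :: "'x \<Rightarrow> complex"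
  assumes "\<And>e. e > 0 \<Longrightarrow> \<exists>\<delta>>0. \<forall>x v. dist v 0 < \<delta> \<longrightarrow> cmod (M (x + v) - M x) < e"
  shows "continuous_on UNIV M"
  unfolding continuous_on_def
proof (intro ballI tendstoI)
  fix x :: 'x and e :: real assume "e > 0"
  then obtain \<delta> where \<delta>: "\<delta> > 0" "\<And>x v. dist v 0 < \<delta> \<Longrightarrow> cmod (M (x + v) - M x) < e"
    using assms by blast
  have "((\<lambda>y. y - x) \<longlongrightarrow> x - x) (at x)" by (intro tendsto_intros)
  then have "\<forall>\<^sub>F y in at x. dist (y - x) 0 < \<delta>" using tendstoD[of _ 0 _ \<delta>] \<delta>(1) by simp
  then show "\<forall>\<^sub>F y in at x. dist (M y) (M x) < e"
  proof eventually_elim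
    case (elim y)
    then show ?case using \<delta>(2)[of "y - x" x] by (simp add: dist_norm)
  qed
qed

lemma has_mean_sum_list:
  fixes f :: "'i \<Rightarrow> 'x \<Rightarrow> complex"
  assumes "\<And>i. i \<in> set I \<Longrightarrow> has_mean (f i) (c i)"
  shows "has_mean (\<lambda>x. \<Sum>i\<leftarrow>I. f i x) (\<Sum>i\<leftarrow>I. c i)"
  using assms by (induction I) (auto intro: has_mean_add has_mean_const)

lemma mean_diff_bound:
  fixes f g :: "'x \<Rightarrow> complex"
  assumes "continuous_on UNIV f" "continuous_on UNIV g" "\<And>x. cmod (f x - g x) \<le> e"
  shows "cmod (mean f - mean g) \<le> e"
proof -
  have "has_mean (\<lambda>x. f x + - g x) (mean f + - mean g)"
    by (intro has_mean_add mean_cpx assms has_mean_linear[OF bounded_linear_minus[OF bounded_linear_ident]])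
  from has_mean_shift_avg_bound[OF this, of 0 e] assms(3) show ?thesis by simp
qed

lemma uniform_first:
  fixes F :: "'x \<Rightarrow> 'x \<Rightarrow> complex"
  assumes "continuous_on UNIV (\<lambda>p. F (fst p) (snd p))" "e > 0"
  shows "\<exists>\<delta>>0. \<forall>x v. dist v 0 < \<delta> \<longrightarrow> (\<forall>y. cmod (F (x + v) y - F x y) < e)"
proof -
  have "continuous_on (UNIV \<times> UNIV) (\<lambda>p::('x\<times>'x)\<times>'x. F (fst (fst p) + snd p) (snd (fst p)))"
    by (rule continuous_on_compose2[OF assms(1), of _ "\<lambda>p. (fst (fst p) + snd p, snd (fst p))", simplified])
      (intro continuous_intros)
  then have "uniformly_continuous_on (UNIV \<times> UNIV) (\<lambda>p::('x\<times>'x)\<times>'x. F (fst (fst p) + snd p) (snd (fst p)))"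
    by (rule compact_uniformly_continuous)
      (rule compact_Times[OF compact_Times[OF cpt cpt, unfolded UNIV_Times_UNIV] cpt])
  then obtain \<delta> where "\<delta> > 0" "\<And>p q :: ('x\<times>'x)\<times>'x. dist q p < \<delta> \<Longrightarrow>
      dist (F (fst (fst q) + snd q) (snd (fst q))) (F (fst (fst p) + snd p) (snd (fst p))) < e"
    using assms(2) unfolding uniformly_continuous_on_def by (metis UNIV_I UNIV_Times_UNIV)
  from this(1) this(2)[of "((_,_),_)" "((_,_),0)"] show ?thesis
    by (intro exI[of _ \<delta>]) (auto simp: dist_Pair_Pair dist_norm)
qed

lemma continuous_section:
  assumes "continuous_on UNIV (\<lambda>p::'x\<times>'x. F (fst p) (snd p))"
  shows "continuous_on UNIV (F x)" "continuous_on UNIV (\<lambda>x. F x y)"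
  by (rule continuous_on_compose2[OF assms, of _ "\<lambda>y. (x, y)", simplified];
      intro continuous_intros)
    (rule continuous_on_compose2[OF assms, of _ "\<lambda>x. (x, y)", simplified];
      intro continuous_intros)

lemma continuous_mean:
  fixes F :: "'x \<Rightarrow> 'x \<Rightarrow> complex"
  assumes "continuous_on UNIV (\<lambda>p. F (fst p) (snd p))"
  shows "continuous_on UNIV (\<lambda>x. mean (F x))"
proof (rule group_uniform_continuous)
  fix e :: real assume "e > 0"
  then obtain \<delta> where \<delta>: "\<delta> > 0" "\<And>x v y. dist v 0 < \<delta> \<Longrightarrow> cmod (F (x + v) y - F x y) < e / 2"
    using uniform_first[OF assms, of "e / 2"] by auto
  have "cmod (mean (F (x + v)) - mean (F x)) \<le> e / 2" if "dist v 0 < \<delta>" for x v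
    by (rule mean_diff_bound) (use \<delta>(2)[OF that] in \<open>auto intro: less_imp_le continuous_section[OF assms]\<close>)
  then have "\<forall>x v. dist v 0 < \<delta> \<longrightarrow> cmod (mean (F (x + v)) - mean (F x)) < e"
    using \<open>e > 0\<close> by (smt (verit) field_sum_of_halves)
  then show "\<exists>\<delta>>0. \<forall>x v. dist v 0 < \<delta> \<longrightarrow> cmod (mean (F (x + v)) - mean (F x)) < e"
    using \<delta>(1) by blast
qed

lemma continuous_swap:
  assumes "continuous_on UNIV (\<lambda>p::'x\<times>'x. F (fst p) (snd p))"
  shows "continuous_on UNIV (\<lambda>p::'x\<times>'x. F (snd p) (fst p))"
  by (rule continuous_on_compose2[OF assms, of _ "\<lambda>p. (snd p, fst p)", simplified]) (intro continuous_intros)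

text \<open>A single finite average in \<open>y\<close> approximates the mean of \<open>N\<close>
  and the means of the sections \<open>F s\<close> at the points of a net, hence by uniform
  continuity those of all sections. Finite averages can be exchanged with the mean in
  \<open>x\<close>.\<close>

lemma mean_fubini:
  fixes F :: "'x \<Rightarrow> 'x \<Rightarrow> complex"
  assumes F: "continuous_on UNIV (\<lambda>p. F (fst p) (snd p))"
  shows "mean (\<lambda>x. mean (F x)) = mean (\<lambda>y. mean (\<lambda>x. F x y))"
proof -
  define M where "M x = mean (F x)" for x
  define N where "N y = mean (\<lambda>x. F x y)" for y
  have M: "has_mean (F x) (M x)" for x unfolding M_def by (intro mean_cpx continuous_section[OF F])
  have N: "has_mean (\<lambda>x. F x y) (N y)" for y unfolding N_def by (intro mean_cpx continuous_section[OF F])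
  have cM: "continuous_on UNIV M" unfolding M_def by (rule continuous_mean[OF F])
  have cN: "continuous_on UNIV N" unfolding N_def by (rule continuous_mean[OF continuous_swap[OF F]])
  have "cmod (mean N - mean M) \<le> e" if "e > 0" for e
  proof -
    define d where "d = e / 4"
    have d: "d > 0" using that by (simp add: d_def)
    obtain \<delta> where \<delta>: "\<delta> > 0" "\<And>x v y. dist v 0 < \<delta> \<Longrightarrow> cmod (F (x + v) y - F x y) < d"
      using uniform_first[OF F d] by auto
    obtain ss :: "'x list" where ss: "ss \<noteq> []" "\<And>z. \<exists>s\<in>set ss. dist (s - z) 0 < \<delta>"
      using group_net[OF cpt \<delta>(1)] by blast
    \<comment> \<open>\<open>None\<close> stands for the function \<open>N\<close>, so that one list
      \<open>ys\<close> serves for \<open>N\<close> and for the finitely many sections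
      together.\<close>
    have "\<exists>ys. ys \<noteq> [] \<and> (\<forall>i\<in>insert None (Some ` set ss). \<forall>x. norm (shift_avg ys (case i of None \<Rightarrow> N | Some s \<Rightarrow> F s) x
         - (case i of None \<Rightarrow> mean N | Some s \<Rightarrow> M s)) \<le> d)"
      by (rule shift_avg_common) (use d M mean_cpx[OF cN] in auto)
    then obtain ys where ys: "ys \<noteq> []" "\<And>x. cmod (shift_avg ys N x - mean N) \<le> d"
      "\<And>s x. s \<in> set ss \<Longrightarrow> cmod (shift_avg ys (F s) x - M s) \<le> d" by fastforce
    have 3: "cmod (shift_avg ys (F x) 0 - M x) \<le> 3 * d" for x
    proof -
      obtain s where s: "s \<in> set ss" "dist (s - x) 0 < \<delta>" using ss(2) by blast
      have Fs: "cmod (F s y - F x y) \<le> d" for y using \<delta>(2)[OF s(2), of x y] by simp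
      have "cmod (M s - M x) \<le> d" unfolding M_def
        by (rule mean_diff_bound) (use Fs in \<open>auto intro: continuous_section[OF F]\<close>)
      moreover have "cmod (shift_avg ys (\<lambda>y. F s y - F x y) 0 - 0) \<le> d"
        by (rule shift_avg_bound[OF ys(1)]) (use Fs in auto)
      moreover have "shift_avg ys (\<lambda>y. F s y - F x y) 0 = shift_avg ys (F s) 0 - shift_avg ys (F x) 0"
        by (simp add: shift_avg_def sum_list_subtractf scaleR_diff_right)
      moreover have "cmod (shift_avg ys (F s) 0 - M s) \<le> d" by (rule ys(3)[OF s(1)])
      moreover have "shift_avg ys (F x) 0 - M x = - (shift_avg ys (F s) 0 - shift_avg ys (F x) 0)
         + (shift_avg ys (F s) 0 - M s) + (M s - M x)" by simp
      ultimately show ?thesis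
        by (smt (verit) diff_zero norm_minus_cancel norm_triangle_ineq)
    qed
    have "has_mean (\<lambda>x. (\<Sum>t\<leftarrow>ys. F x t) /\<^sub>R real (length ys)) ((\<Sum>t\<leftarrow>ys. N t) /\<^sub>R real (length ys))"
      by (rule has_mean_linear[OF bounded_linear_scaleR_right]) (rule has_mean_sum_list, rule N)
    then have hm: "has_mean (\<lambda>x. shift_avg ys (F x) 0) (shift_avg ys N 0)"
      by (simp add: shift_avg_def)
    have "has_mean (\<lambda>x. shift_avg ys (F x) 0 + - M x) (shift_avg ys N 0 + - mean M)"
      by (intro has_mean_add hm has_mean_linear[OF bounded_linear_minus[OF bounded_linear_ident]] mean_cpx cM)
    from has_mean_shift_avg_bound[OF this, of 0 "3 * d"] 3
    have "cmod (shift_avg ys N 0 - mean M) \<le> 3 * d" by simp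
    with ys(2)[of 0] have "cmod (mean N - mean M) \<le> 4 * d"
      by (smt (verit) norm_triangle_ineq norm_minus_commute diff_add_cancel add_diff_eq)
    then show ?thesis by (simp add: d_def)
  qed
  then have "mean N = mean M"
    by (metis dense_ge norm_le_zero_iff eq_iff_diff_eq_0)
  then show ?thesis unfolding M_def N_def by simp
qed

end

section \<open>Characters separate points\<close>

text \<open>A stand-in for a nonzero finite-dimensional translation-invariant space. Finite
  dimension is expressed by the last clause, compactness of the unit ball of the mean-square norm in
  the uniform topology; this form passes to closed subspaces at once.\<close>

definition invariant_space :: "('x::{metric_space, topological_ab_group_add} \<Rightarrow> complex) set \<Rightarrow> bool" where
  "invariant_space E \<longleftrightarrow>
     (\<forall>f\<in>E. continuous_on UNIV f) \<and>
     (\<forall>f\<in>E. \<forall>g\<in>E. \<forall>a b. (\<lambda>x. a * f x + b * g x) \<in> E) \<and>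
     (\<forall>f\<in>E. \<forall>h. (\<lambda>x. f (x + h)) \<in> E) \<and>
     (\<exists>f\<in>E. mean_sq f = 1) \<and>
     (\<forall>s g. (\<forall>n. s n \<in> E) \<longrightarrow> uniform_limit UNIV s g sequentially \<longrightarrow> g \<in> E) \<and>
     (\<forall>s :: nat \<Rightarrow> 'x \<Rightarrow> complex. (\<forall>n. s n \<in> E \<and> mean_sq (s n) \<le> 1) \<longrightarrow>
        (\<exists>r g. strict_mono (r :: nat \<Rightarrow> nat) \<and> uniform_limit UNIV (\<lambda>n. s (r n)) g sequentially))"

lemma invariant_spaceD:
  assumes "invariant_space E"
  shows "\<And>f. f \<in> E \<Longrightarrow> continuous_on UNIV f"
    and "\<And>f g a b. f \<in> E \<Longrightarrow> g \<in> E \<Longrightarrow> (\<lambda>x. a * f x + b * g x) \<in> E"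
    and "\<And>f h. f \<in> E \<Longrightarrow> (\<lambda>x. f (x + h)) \<in> E"
    and "\<exists>f\<in>E. mean_sq f = 1"
    and "\<And>s g. (\<And>n. s n \<in> E) \<Longrightarrow> uniform_limit UNIV s g sequentially \<Longrightarrow> g \<in> E"
    and "\<And>s :: nat \<Rightarrow> _. (\<And>n. s n \<in> E) \<Longrightarrow> (\<And>n. mean_sq (s n) \<le> 1) \<Longrightarrow>
        \<exists>r g. strict_mono (r :: nat \<Rightarrow> nat) \<and> uniform_limit UNIV (\<lambda>n. s (r n)) g sequentially"
  using assms unfolding invariant_space_def by blast+

lemma tendsto_eq_of_uniform_limit:
  assumes "uniform_limit UNIV s g sequentially"
  shows "(\<lambda>n. s n x) \<longlonglongrightarrow> g x"
  using tendsto_uniform_limitI[OF assms] by simp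

context
  assumes cpt: "compact (UNIV :: 'x::{metric_space, topological_ab_group_add} set)"
begin

text \<open>With \<open>T\<close> the translation by \<open>h\<close> and
  \<open>N = 1 + c T\<close>, the operator \<open>c T + cnj c T\<^sup>-\<^sup>1\<close> is the
  adjoint of \<open>N\<close> times \<open>N\<close>, minus \<open>2\<close>. Compactness of the
  unit ball yields a maximiser \<open>g\<close> of \<open>mean_sq (N g)\<close>, which is an
  eigenvector for the maximum \<open>S\<close>; hence the eigenvalue \<open>S - 2\<close>.\<close>

lemma invariant_space_eigenspace:
  fixes E :: "('x \<Rightarrow> complex) set"
  assumes E: "invariant_space E" and c: "cmod c = 1"
  shows "\<exists>\<mu>. invariant_space {f \<in> E. \<forall>x. c * f (x + h) + cnj c * f (x - h) = \<mu> * f x}"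
proof -
  note Ed = invariant_spaceD[OF E]
  define N where "N f = (\<lambda>x. f x + c * f (x + h))" for f :: "'x \<Rightarrow> complex"
  have NE: "N f \<in> E" if "f \<in> E" for f
    using Ed(2)[OF that Ed(3)[OF that, of h], of 1 c] by (simp add: N_def)
  have ms4: "mean_sq (N f) \<le> 4 * mean_sq f" if f: "f \<in> E" for f
  proof -
    have "has_mean (\<lambda>x. 2 * (cmod (f x))\<^sup>2 + 2 * (cmod (f (x + h)))\<^sup>2) (2 * mean_sq f + 2 * mean_sq f)"
      unfolding mean_sq_def
      by (intro has_mean_add has_mean_linear[OF bounded_linear_mult_right] has_mean_shift
          mean_real[OF cpt] continuous_intros Ed(1)[OF f])
    moreover have "mean (\<lambda>x. (cmod (N f x))\<^sup>2) \<le> mean (\<lambda>x. 2 * (cmod (f x))\<^sup>2 + 2 * (cmod (f (x + h)))\<^sup>2)"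
    proof (rule mean_mono[OF cpt])
      show "(cmod (N f x))\<^sup>2 \<le> 2 * (cmod (f x))\<^sup>2 + 2 * (cmod (f (x + h)))\<^sup>2" for x
      proof -
        have "cmod (N f x) \<le> cmod (f x) + cmod (f (x + h))"
          using norm_triangle_ineq[of "f x" "c * f (x + h)"] c by (simp add: N_def norm_mult)
        then have "(cmod (N f x))\<^sup>2 \<le> (cmod (f x) + cmod (f (x + h)))\<^sup>2" by (intro power_mono) auto
        also have "\<dots> \<le> 2 * (cmod (f x))\<^sup>2 + 2 * (cmod (f (x + h)))\<^sup>2"
          using sum_squares_bound[of "cmod (f x)" "cmod (f (x + h))"] by (simp add: power2_eq_square algebra_simps)
        finally show ?thesis .
      qed
    qed (intro continuous_intros Ed(1) NE f Ed(3))+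
    ultimately show ?thesis by (simp add: mean_sq_def mean_eq)
  qed
  define S where "S = Sup {mean_sq (N f) | f. f \<in> E \<and> mean_sq f = 1}"
  have bdd: "bdd_above {mean_sq (N f) | f. f \<in> E \<and> mean_sq f = 1}"
    using ms4 by (intro bdd_aboveI[of _ 4]) fastforce
  have Sup_ge: "mean_sq (N f) \<le> S" if "f \<in> E" "mean_sq f = 1" for f
    unfolding S_def using that bdd by (intro cSup_upper) auto
  have S_bound: "mean_sq (N f) \<le> S * mean_sq f" if f: "f \<in> E" for f
  proof (cases "\<exists>y. f y \<noteq> 0")
    case False
    then have "mean_sq (N f) = 0" "mean_sq f = 0"
      by (auto simp: N_def mean_sq_def intro!: mean_eq has_mean_const)
    then show ?thesis by simp
  next
    case True
    then have p: "mean_sq f > 0" using mean_sq_pos[OF cpt Ed(1)[OF f]] by blast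
    define a where "a = complex_of_real (1 / sqrt (mean_sq f))"
    have a: "(cmod a)\<^sup>2 = 1 / mean_sq f" using p by (simp add: a_def norm_divide power_divide)
    have "(\<lambda>x. a * f x) \<in> E" using Ed(2)[OF f f, of a 0] by simp
    moreover have "mean_sq (\<lambda>x. a * f x) = 1" using mean_sq_scale[OF cpt Ed(1)[OF f], of a] a p by simp
    ultimately have "mean_sq (N (\<lambda>x. a * f x)) \<le> S" by (rule Sup_ge)
    moreover have "N (\<lambda>x. a * f x) = (\<lambda>x. a * N f x)" by (simp add: N_def fun_eq_iff algebra_simps)
    ultimately have "mean_sq (N f) / mean_sq f \<le> S"
      using mean_sq_scale[OF cpt Ed(1)[OF NE[OF f]], of a] a by simp
    then show ?thesis using p by (simp add: field_simps)
  qed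
  have "\<exists>g\<in>E. mean_sq g = 1 \<and> S \<le> mean_sq (N g)"
  proof -
    have "\<forall>n. \<exists>f. f \<in> E \<and> mean_sq f = 1 \<and> S - 1 / real (Suc n) < mean_sq (N f)"
    proof
      fix n
      have "S - 1 / real (Suc n) < S" by simp
      then obtain y where "y \<in> {mean_sq (N f) | f. f \<in> E \<and> mean_sq f = 1}" "S - 1 / real (Suc n) < y"
        unfolding S_def using less_cSup_iff[OF _ bdd] Ed(4) by blast
      then show "\<exists>f. f \<in> E \<and> mean_sq f = 1 \<and> S - 1 / real (Suc n) < mean_sq (N f)" by blast
    qed
    then obtain s where s: "\<And>n. s n \<in> E" "\<And>n. mean_sq (s n) = 1" "\<And>n. S - 1 / real (Suc n) < mean_sq (N (s n))"
      by metis
    have "\<exists>r g. strict_mono (r :: nat \<Rightarrow> nat) \<and> uniform_limit UNIV (\<lambda>n. s (r n)) g sequentially"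
      by (rule Ed(6)) (use s in auto)
    then obtain r g where r: "strict_mono (r :: nat \<Rightarrow> nat)" and lim: "uniform_limit UNIV (\<lambda>n. s (r n)) g sequentially"
      by blast
    have g: "g \<in> E" by (rule Ed(5)[OF _ lim]) (rule s)
    have "(\<lambda>n. mean_sq (s (r n))) \<longlonglongrightarrow> mean_sq g"
      by (rule mean_sq_tendsto[OF cpt lim]) (use Ed(1) s g in auto)
    then have g1: "mean_sq g = 1" using s(2) LIMSEQ_unique[OF _ tendsto_const] by simp
    have "uniform_limit UNIV (\<lambda>n. N (s (r n))) (N g) sequentially"
      unfolding N_def
      by (intro uniform_limit_add lim bounded_linear.uniform_limit[OF bounded_linear_mult_right]
          uniform_limit_compose'[OF lim]) auto
    from mean_sq_tendsto[OF cpt this] have t: "(\<lambda>n. mean_sq (N (s (r n)))) \<longlonglongrightarrow> mean_sq (N g)"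
      using Ed(1) NE s g by blast
    have "(\<lambda>n. S - 1 / real (Suc n)) \<longlonglongrightarrow> S - 0"
      using LIMSEQ_inverse_real_of_nat by (intro tendsto_intros) (simp add: inverse_eq_divide)
    then have "S - 0 \<le> mean_sq (N g)"
    proof (rule LIMSEQ_le[OF _ t], intro exI allI impI)
      fix n :: nat
      have "1 / real (Suc (r n)) \<le> 1 / real (Suc n)"
        using seq_suble[OF r, of n] by (intro divide_left_mono) auto
      then show "S - 1 / real (Suc n) \<le> mean_sq (N (s (r n)))" using s(3)[of "r n"] by linarith
    qed
    with g g1 show ?thesis by auto
  qed
  then obtain g where g: "g \<in> E" "mean_sq g = 1" "S \<le> mean_sq (N g)" by blast
  then have SN: "mean_sq (N g) = S" using Sup_ge by force
  \<comment> \<open>This is the adjoint of \<open>N\<close> applied to \<open>N g\<close>.\<close>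
  define M where "M = (\<lambda>x. (2 * g x + c * g (x + h)) + cnj c * g (x - h))"
  have cc: "c * cnj c = 1" using c by (metis complex_norm_square mult.commute of_real_1 power_one)
  have cg: "continuous_on UNIV g" by (rule Ed(1)[OF g(1)])
  have cgh: "continuous_on UNIV (\<lambda>x. g (x + k))" for k by (rule Ed(1)[OF Ed(3)[OF g(1)]])
  have ME: "M \<in> E"
    using Ed(2)[OF Ed(2)[OF g(1) Ed(3)[OF g(1), of h], of 2 c] Ed(3)[OF g(1), of "- h"], of 1 "cnj c"]
    by (simp add: M_def)
  \<comment> \<open>The adjoint of \<open>N\<close> is \<open>N\<close> followed by a translation
    and a factor of modulus \<open>1\<close>, so both have the same mean square.\<close>
  have "mean_sq M = mean_sq (N (N g))"
  proof -
    have "M (x + h) = cnj c * N (N g) x" for x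
    proof -
      have "cnj c * N (N g) x = cnj c * g x + 2 * ((c * cnj c) * g (x + h)) + (c * cnj c) * (c * g (x + h + h))"
        by (simp add: N_def algebra_simps)
      then show ?thesis by (simp add: M_def cc algebra_simps)
    qed
    then have "mean_sq M = mean_sq (\<lambda>x. cnj c * N (N g) x)"
      using mean_sq_shift[OF cpt Ed(1)[OF ME], of h] by simp
    also have "\<dots> = mean_sq (N (N g))"
      using mean_sq_scale[OF cpt Ed(1)[OF NE[OF NE[OF g(1)]]], of "cnj c"] c by simp
    finally show ?thesis .
  qed
  then have MM: "mean_sq M \<le> S * S" using S_bound[OF NE[OF g(1)]] SN by simp
  define a where "a = mean (\<lambda>x. Re (c * g (x + h) * cnj (g x)))"
  have a: "has_mean (\<lambda>x. Re (c * g (x + h) * cnj (g x))) a" unfolding a_def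
    by (intro mean_real[OF cpt] continuous_intros cg cgh)
  have a': "has_mean (\<lambda>x. Re (cnj c * g (x - h) * cnj (g x))) a"
  proof -
    have "has_mean (\<lambda>x. Re (c * g (x + (- h) + h) * cnj (g (x + (- h))))) a"
      by (rule has_mean_shift[OF a])
    moreover have "Re (c * g (x + (- h) + h) * cnj (g (x + (- h)))) = Re (cnj c * g (x - h) * cnj (g x))" for x
      by (simp add: algebra_simps)
    ultimately show ?thesis by simp
  qed
  have "has_mean (\<lambda>x. ((cmod (g x))\<^sup>2 + (cmod (g (x + h)))\<^sup>2) + 2 * Re (c * g (x + h) * cnj (g x)))
      ((mean_sq g + mean_sq g) + 2 * a)"
    unfolding mean_sq_def
    by (intro has_mean_add has_mean_linear[OF bounded_linear_mult_right] a mean_real[OF cpt] continuous_intros cg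
        has_mean_shift)
  moreover have "((cmod (g x))\<^sup>2 + (cmod (g (x + h)))\<^sup>2) + 2 * Re (c * g (x + h) * cnj (g x)) = (cmod (N g x))\<^sup>2" for x
  proof -
    have "(cmod (N g x))\<^sup>2 = (cmod (g x))\<^sup>2 + 2 * Re (c * g (x + h) * cnj (g x)) + (cmod (c * g (x + h)))\<^sup>2"
      unfolding N_def cmod_power2 by (simp add: power2_eq_square algebra_simps)
    then show ?thesis using c by (simp add: norm_mult)
  qed
  ultimately have "has_mean (\<lambda>x. (cmod (N g x))\<^sup>2) ((mean_sq g + mean_sq g) + 2 * a)" by (simp only:)
  then have Sa: "S = 2 * mean_sq g + 2 * a" using SN by (simp add: mean_sq_def[of "N g"] mean_eq)
  have "has_mean (\<lambda>x. (2 * (cmod (g x))\<^sup>2 + Re (c * g (x + h) * cnj (g x))) + Re (cnj c * g (x - h) * cnj (g x)))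
      ((2 * mean_sq g + a) + a)"
    unfolding mean_sq_def
    by (intro has_mean_add has_mean_linear[OF bounded_linear_mult_right] a a' mean_real[OF cpt] continuous_intros cg)
  moreover have "(2 * (cmod (g x))\<^sup>2 + Re (c * g (x + h) * cnj (g x))) + Re (cnj c * g (x - h) * cnj (g x)) = Re (M x * cnj (g x))" for x
    unfolding M_def cmod_power2 by (simp add: power2_eq_square algebra_simps)
  ultimately have "has_mean (\<lambda>x. Re (M x * cnj (g x))) ((2 * mean_sq g + a) + a)" by (simp only:)
  moreover have "has_mean (\<lambda>x. Re (M x * cnj (g x))) (Re (mean_inner M g))" unfolding mean_inner_def
    by (intro has_mean_linear[OF bounded_linear_Re] mean_cpx[OF cpt] continuous_intros cg Ed(1)[OF ME])
  ultimately have "Re (mean_inner M g) = S" using Sa has_mean_unique by fastforce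
  \<comment> \<open>The expanded square is at most \<open>S * S - 2 * S * S + S * S\<close>, so the
    maximiser is an exact eigenvector.\<close>
  then have "mean_sq (\<lambda>x. M x - of_real S * g x) \<le> 0"
    using mean_sq_diff[OF cpt Ed(1)[OF ME] cg, of S] MM g(2) by (simp add: power2_eq_square)
  then have "M x - of_real S * g x = 0" for x
    using mean_sq_pos[OF cpt, of "\<lambda>x. M x - of_real S * g x" x]
    by (force intro!: continuous_intros cg Ed(1)[OF ME])
  then have Mx: "M x = of_real S * g x" for x by simp
  have eig: "c * g (x + h) + cnj c * g (x - h) = of_real (S - 2) * g x" for x
  proof -
    have "c * g (x + h) + cnj c * g (x - h) = M x - 2 * g x" by (simp add: M_def)
    also have "\<dots> = of_real (S - 2) * g x" by (simp add: Mx left_diff_distrib)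
    finally show ?thesis .
  qed
  let ?E = "{f \<in> E. \<forall>x. c * f (x + h) + cnj c * f (x - h) = of_real (S - 2) * f x}"
  have "invariant_space ?E"
    unfolding invariant_space_def
  proof (intro conjI ballI allI impI)
    show "continuous_on UNIV f" if "f \<in> ?E" for f using that Ed(1) by simp
    show "(\<lambda>x. a * f x + b * g x) \<in> ?E" if "f \<in> ?E" "g \<in> ?E" for f g a b
    proof -
      have "c * (a * f (x + h) + b * g (x + h)) + cnj c * (a * f (x - h) + b * g (x - h))
        = a * (c * f (x + h) + cnj c * f (x - h)) + b * (c * g (x + h) + cnj c * g (x - h))" for x
        by (simp add: algebra_simps)
      moreover have "c * f (x + h) + cnj c * f (x - h) = of_real (S - 2) * f x"
        "c * g (x + h) + cnj c * g (x - h) = of_real (S - 2) * g x" for x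
        using that by auto
      ultimately have "c * (a * f (x + h) + b * g (x + h)) + cnj c * (a * f (x - h) + b * g (x - h))
        = of_real (S - 2) * (a * f x + b * g x)" for x
        by (simp only: distrib_left mult.left_commute)
      then show ?thesis using that Ed(2)[of f g a b] by blast
    qed
    show "(\<lambda>x. f (x + k)) \<in> ?E" if "f \<in> ?E" for f k
    proof -
      have "c * f (x + k + h) + cnj c * f (x + k - h) = of_real (S - 2) * f (x + k)" for x using that by simp
      moreover have "x + k + h = x + h + k" "x + k - h = x - h + k" for x by (simp_all add: algebra_simps)
      ultimately show ?thesis using that Ed(3)[of f k] by auto
    qed
    show "\<exists>f\<in>?E. mean_sq f = 1" using g eig by blast
    show "u \<in> ?E" if s: "\<forall>n. s n \<in> ?E" and lim: "uniform_limit UNIV s u sequentially" for s u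
    proof -
      have "u \<in> E" using Ed(5)[OF _ lim] s by blast
      moreover have "c * u (x + h) + cnj c * u (x - h) = of_real (S - 2) * u x" for x
      proof -
        note l = tendsto_eq_of_uniform_limit[OF lim]
        have "(\<lambda>n. c * s n (x + h) + cnj c * s n (x - h)) \<longlonglongrightarrow> c * u (x + h) + cnj c * u (x - h)"
          by (intro tendsto_intros l)
        moreover have "(\<lambda>n. of_real (S - 2) * s n x) \<longlonglongrightarrow> of_real (S - 2) * u x"
          by (intro tendsto_intros l)
        moreover have "(\<lambda>n. c * s n (x + h) + cnj c * s n (x - h)) = (\<lambda>n. of_real (S - 2) * s n x)"
          using s by auto
        ultimately show ?thesis using LIMSEQ_unique by metis
      qed
      ultimately show ?thesis by simp
    qed
    show "\<exists>r g. strict_mono (r :: nat \<Rightarrow> nat) \<and> uniform_limit UNIV (\<lambda>n. s (r n)) g sequentially"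
      if "\<forall>n. s n \<in> ?E \<and> mean_sq (s n) \<le> 1" for s
      by (rule Ed(6)) (use that in auto)
  qed
  then show ?thesis by blast
qed

section \<open>Convolution with an even kernel as a compact self-adjoint operator\<close>

lemma divide_add_one_less:
  fixes e t :: real
  assumes "0 < e" "0 \<le> t"
  shows "0 < e / (t + 1)" "e / (t + 1) * t < e" "e * t / (t + 1) < e"
  using assms by (auto simp: pos_divide_less_eq algebra_simps)

lemma kernel_bound:
  fixes f :: "'x \<Rightarrow> complex"
  assumes "continuous_on UNIV k" "continuous_on UNIV f" "\<And>y. \<bar>k y\<bar> \<le> B"
  shows "cmod (mean (\<lambda>y. of_real (k y) * f y)) \<le> B * mean (\<lambda>y. cmod (f y))"
proof -
  have "cmod (mean (\<lambda>y. of_real (k y) * f y)) \<le> mean (\<lambda>y. cmod (of_real (k y) * f y))"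
    by (rule cmod_mean_le[OF cpt]) (intro continuous_intros assms)
  also have "\<dots> \<le> mean (\<lambda>y. B * cmod (f y))"
    by (rule mean_mono[OF cpt])
      (auto intro!: continuous_intros assms mult_right_mono simp: norm_mult)
  also have "\<dots> = B * mean (\<lambda>y. cmod (f y))"
    by (rule mean_eq) (intro has_mean_linear[OF bounded_linear_mult_right] mean_real[OF cpt] continuous_intros assms)
  finally show ?thesis .
qed

context
  fixes \<psi> :: "'x \<Rightarrow> real" and B :: real
  assumes psi: "continuous_on UNIV \<psi>" and even: "\<And>x. \<psi> (- x) = \<psi> x" and B: "\<And>x. \<bar>\<psi> x\<bar> \<le> B"
begin

private lemma B_nonneg: "0 \<le> B"
  using B[of 0] by linarith

private lemma psi_comp: "continuous_on UNIV h \<Longrightarrow> continuous_on UNIV (\<lambda>x. \<psi> (h x))"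
  by (rule continuous_on_compose2[OF psi]) auto

lemma has_mean_conv:
  "continuous_on UNIV f \<Longrightarrow> has_mean (\<lambda>y. of_real (\<psi> (x - y)) * f y) (mean_conv \<psi> f x)"
  unfolding mean_conv_def by (intro mean_cpx[OF cpt] continuous_intros psi_comp)

lemma mean_conv_linear:
  assumes "continuous_on UNIV f" "continuous_on UNIV g"
  shows "mean_conv \<psi> (\<lambda>x. a * f x + b * g x) x = a * mean_conv \<psi> f x + b * mean_conv \<psi> g x"
proof -
  have "has_mean (\<lambda>y. a * (of_real (\<psi> (x - y)) * f y) + b * (of_real (\<psi> (x - y)) * g y))
     (a * mean_conv \<psi> f x + b * mean_conv \<psi> g x)"
    by (intro has_mean_add has_mean_linear[OF bounded_linear_mult_right] has_mean_conv assms)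
  then show ?thesis unfolding mean_conv_def[of \<psi> "\<lambda>x. a * f x + b * g x"]
    by (intro mean_eq) (simp add: algebra_simps)
qed

lemma mean_conv_shift:
  assumes "continuous_on UNIV f"
  shows "mean_conv \<psi> (\<lambda>x. f (x + h)) x = mean_conv \<psi> f (x + h)"
proof -
  have "has_mean (\<lambda>y. of_real (\<psi> (x + h - (y + h))) * f (y + h)) (mean_conv \<psi> f (x + h))"
    by (rule has_mean_shift[OF has_mean_conv[OF assms]])
  then show ?thesis unfolding mean_conv_def[of \<psi> "\<lambda>x. f (x + h)"] by (intro mean_eq) simp
qed

lemma mean_conv_le:
  assumes "continuous_on UNIV f"
  shows "cmod (mean_conv \<psi> f x) \<le> B * sqrt (mean_sq f)"
proof -
  have "cmod (mean_conv \<psi> f x) \<le> B * mean (\<lambda>y. cmod (f y))"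
    unfolding mean_conv_def by (rule kernel_bound) (intro psi_comp continuous_intros assms B)+
  also have "\<dots> \<le> B * sqrt (mean_sq f)"
    using mean_cmod_le[OF cpt assms] B_nonneg by (intro mult_left_mono)
  finally show ?thesis .
qed

text \<open>The modulus of continuity comes from \<open>\<psi>\<close> and depends on
  \<open>f\<close> only through its mean-square norm. This is what makes convolution a compact
  operator.\<close>

lemma mean_conv_equicontinuous:
  assumes "e > 0"
  shows "\<exists>\<delta>>0. \<forall>f x v. continuous_on UNIV f \<and> dist v 0 < \<delta> \<longrightarrow>
     cmod (mean_conv \<psi> f (x + v) - mean_conv \<psi> f x) \<le> e * sqrt (mean_sq f)"
proof -
  obtain \<delta> where d: "\<delta> > 0" "\<And>x v. dist v 0 < \<delta> \<Longrightarrow> dist (\<psi> (x + v)) (\<psi> x) < e"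
    using group_uniform[OF cpt psi assms] by blast
  have "cmod (mean_conv \<psi> f (x + v) - mean_conv \<psi> f x) \<le> e * sqrt (mean_sq f)"
    if f: "continuous_on UNIV f" and v: "dist v 0 < \<delta>" for f x v
  proof -
    have "has_mean (\<lambda>y. of_real (\<psi> (x + v - y)) * f y + - (of_real (\<psi> (x - y)) * f y)) (mean_conv \<psi> f (x + v) + - mean_conv \<psi> f x)"
      by (intro has_mean_add has_mean_conv has_mean_linear[OF bounded_linear_minus[OF bounded_linear_ident]] f)
    moreover have "of_real (\<psi> (x + v - y)) * f y + - (of_real (\<psi> (x - y)) * f y) = of_real (\<psi> (x + v - y) - \<psi> (x - y)) * f y" for y
      by (simp add: algebra_simps)
    ultimately have "mean_conv \<psi> f (x + v) - mean_conv \<psi> f x = mean (\<lambda>y. of_real (\<psi> (x + v - y) - \<psi> (x - y)) * f y)"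
      by (simp add: mean_eq)
    also have "cmod \<dots> \<le> e * mean (\<lambda>y. cmod (f y))"
    proof (rule kernel_bound)
      show "\<bar>\<psi> (x + v - y) - \<psi> (x - y)\<bar> \<le> e" for y
        using d(2)[OF v, of "x - y"] by (simp add: dist_real_def algebra_simps)
    qed (intro continuous_intros psi_comp f)+
    also have "\<dots> \<le> e * sqrt (mean_sq f)"
      using mean_cmod_le[OF cpt f] assms by (intro mult_left_mono) auto
    finally show ?thesis .
  qed
  then show ?thesis using d(1) by blast
qed

lemma mean_conv_continuous:
  assumes "continuous_on UNIV f"
  shows "continuous_on UNIV (mean_conv \<psi> f)"
proof (rule group_uniform_continuous[OF cpt])
  fix e :: real assume e: "e > 0"
  define e' where "e' = e / (sqrt (mean_sq f) + 1)"
  have "0 \<le> sqrt (mean_sq f)" using mean_sq_nonneg[OF cpt assms] by simp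
  then have e': "e' > 0" "e' * sqrt (mean_sq f) < e" using e by (auto simp: e'_def divide_add_one_less)
  from mean_conv_equicontinuous[OF e'(1)] obtain \<delta> where "\<delta> > 0"
    "\<And>x v. dist v 0 < \<delta> \<Longrightarrow> cmod (mean_conv \<psi> f (x + v) - mean_conv \<psi> f x) \<le> e' * sqrt (mean_sq f)"
    using assms by blast
  then show "\<exists>\<delta>>0. \<forall>x v. dist v 0 < \<delta> \<longrightarrow> cmod (mean_conv \<psi> f (x + v) - mean_conv \<psi> f x) < e"
    using e'(2) by (meson le_less_trans)
qed

text \<open>The kernel \<open>\<psi> (x - y)\<close> is real and, \<open>\<psi>\<close> being even,
  symmetric in \<open>x\<close> and \<open>y\<close>, so that exchanging the two means
  suffices.\<close>

lemma mean_conv_selfadjoint: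
  assumes f: "continuous_on UNIV f" and g: "continuous_on UNIV g"
  shows "mean_inner (mean_conv \<psi> f) g = mean_inner f (mean_conv \<psi> g)"
proof -
  define F where "F x y = of_real (\<psi> (x - y)) * f y * cnj (g x)" for x y
  have F: "continuous_on UNIV (\<lambda>p. F (fst p) (snd p))"
    unfolding F_def
    by (intro continuous_intros continuous_on_compose2[OF psi, of UNIV "\<lambda>p. fst p - snd p"]
       continuous_on_compose2[OF f, of UNIV snd] continuous_on_compose2[OF g, of UNIV fst]) auto
  have "mean (F x) = mean_conv \<psi> f x * cnj (g x)" for x unfolding F_def
    by (rule mean_eq) (rule has_mean_linear[OF bounded_linear_mult_left has_mean_conv[OF f]])
  moreover have "mean (\<lambda>x. F x y) = f y * cnj (mean_conv \<psi> g y)" for y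
  proof (rule mean_eq)
    have "has_mean (\<lambda>x. f y * cnj (of_real (\<psi> (y - x)) * g x)) (f y * cnj (mean_conv \<psi> g y))"
      by (intro has_mean_linear[OF bounded_linear_mult_right] has_mean_linear[OF bounded_linear_cnj] has_mean_conv g)
    moreover have "f y * cnj (of_real (\<psi> (y - x)) * g x) = F x y" for x
      using even[of "y - x"] by (simp add: F_def)
    ultimately show "has_mean (\<lambda>x. F x y) (f y * cnj (mean_conv \<psi> g y))" by simp
  qed
  ultimately show ?thesis unfolding mean_inner_def using mean_fubini[OF cpt F] by simp
qed

lemma mean_conv_uniform_limit:
  assumes "uniform_limit UNIV s g sequentially" "\<And>n. continuous_on UNIV (s n)" "continuous_on UNIV g"
  shows "uniform_limit UNIV (\<lambda>n. mean_conv \<psi> (s n)) (mean_conv \<psi> g) sequentially"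
proof (rule uniform_limitI)
  fix e :: real assume e: "e > 0"
  define e' where "e' = e / (B + 1)"
  have e': "e' > 0" "B * e' < e" using e B_nonneg by (auto simp: e'_def field_simps)
  show "\<forall>\<^sub>F n in sequentially. \<forall>x\<in>UNIV. dist (mean_conv \<psi> (s n) x) (mean_conv \<psi> g x) < e"
    using uniform_limitD[OF assms(1) e'(1)]
  proof eventually_elim
    case (elim n)
    show ?case
    proof
      fix x
      have c: "continuous_on UNIV (\<lambda>x. 1 * s n x + (-1) * g x)" by (intro continuous_intros assms)
      have "mean_conv \<psi> (s n) x - mean_conv \<psi> g x = mean_conv \<psi> (\<lambda>x. 1 * s n x + (-1) * g x) x"
        by (subst mean_conv_linear) (auto intro: assms)
      also have "cmod \<dots> \<le> B * mean (\<lambda>y. cmod (1 * s n y + (-1) * g y))"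
        unfolding mean_conv_def by (rule kernel_bound) (intro psi_comp continuous_intros c B)+
      also have "\<dots> \<le> B * mean (\<lambda>y::'x. e')"
        using elim B_nonneg c
        by (intro mult_left_mono mean_mono[OF cpt]) (auto intro!: continuous_intros simp: dist_norm less_imp_le)
      also have "mean (\<lambda>y::'x. e') = e'" by (rule mean_eq) (rule has_mean_const)
      finally show "dist (mean_conv \<psi> (s n) x) (mean_conv \<psi> g x) < e" using e'(2) by (simp add: dist_norm)
    qed
  qed
qed

lemma mean_conv_subsequence:
  assumes s: "\<And>n. continuous_on UNIV (s n)" "\<And>n :: nat. mean_sq (s n) \<le> C"
  shows "\<exists>r g. strict_mono (r :: nat \<Rightarrow> nat) \<and> uniform_limit UNIV (\<lambda>n. mean_conv \<psi> (s (r n))) g sequentially"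
proof (rule equicontinuous_subsequence[OF cpt])
  have C: "sqrt (mean_sq (s n)) \<le> sqrt C" for n using s(2) by simp
  have C0: "0 \<le> sqrt C" using mean_sq_nonneg[OF cpt s(1)[of 0]] s(2)[of 0] by simp
  show "cmod (mean_conv \<psi> (s n) x) \<le> B * sqrt C" for n x
    using mean_conv_le[OF s(1)] mult_left_mono[OF C B_nonneg] by (rule order_trans)
  fix e :: real assume e: "e > 0"
  define e' where "e' = e / (sqrt C + 1)"
  have e': "e' > 0" "e' * sqrt C < e" using e C0 by (auto simp: e'_def divide_add_one_less)
  from mean_conv_equicontinuous[OF e'(1)] obtain \<delta> where \<delta>: "\<delta> > 0"
    "\<And>n x v. dist v 0 < \<delta> \<Longrightarrow> cmod (mean_conv \<psi> (s n) (x + v) - mean_conv \<psi> (s n) x) \<le> e' * sqrt (mean_sq (s n))"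
    using s(1) by blast
  have "cmod (mean_conv \<psi> (s n) (x + v) - mean_conv \<psi> (s n) x) < e" if "dist v 0 < \<delta>" for n x v
    using \<delta>(2)[OF that, of n x] mult_left_mono[OF C[of n], of e'] e' by linarith
  then show "\<exists>\<delta>>0. \<forall>n x v. dist v 0 < \<delta> \<longrightarrow> cmod (mean_conv \<psi> (s n) (x + v) - mean_conv \<psi> (s n) x) < e"
    using \<delta>(1) by blast
qed

text \<open>The spectral theorem for the top of a compact self-adjoint operator. The square of the
  convolution is used because its largest eigenvalue \<open>S\<close> has a known sign. A maximising
  sequence need not converge uniformly, but its images under the convolution subconverge, and their
  limit is the eigenvector.\<close>

lemma mean_conv_eigenspace:
  assumes "\<psi> 0 \<noteq> 0"
  shows "\<exists>S>0. invariant_space {f. continuous_on UNIV f \<and> (\<forall>x. mean_conv \<psi> (mean_conv \<psi> f) x = of_real S * f x)}"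
proof -
  let ?T = "mean_conv \<psi>"
  have cT: "continuous_on UNIV (?T f)" if "continuous_on UNIV f" for f using mean_conv_continuous[OF that] .
  have msT: "mean_sq (?T f) \<le> B\<^sup>2 * mean_sq f" if f: "continuous_on UNIV f" for f
  proof -
    have "mean_sq (?T f) \<le> mean (\<lambda>x::'x. (B * sqrt (mean_sq f))\<^sup>2)"
      unfolding mean_sq_def[of "?T f"]
      by (rule mean_mono[OF cpt]) (auto intro!: continuous_intros cT f power_mono mean_conv_le[OF f])
    also have "\<dots> = (B * sqrt (mean_sq f))\<^sup>2" by (rule mean_eq) (rule has_mean_const)
    also have "\<dots> = B\<^sup>2 * mean_sq f" using mean_sq_nonneg[OF cpt f] by (simp add: power_mult_distrib)
    finally show ?thesis .
  qed
  have scale: "?T (\<lambda>x. a * f x) = (\<lambda>x. a * ?T f x)" if "continuous_on UNIV f" for a and f :: "'x \<Rightarrow> complex"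
    using mean_conv_linear[OF that that, of a 0] by (simp add: fun_eq_iff)
  let ?A = "{mean_sq (?T f) | f. continuous_on UNIV f \<and> mean_sq f = 1}"
  define S where "S = Sup ?A"
  have bdd: "bdd_above ?A" using msT by (intro bdd_aboveI[of _ "B\<^sup>2"]) fastforce
  have Sup_ge: "mean_sq (?T f) \<le> S" if "continuous_on UNIV f" "mean_sq f = 1" for f
    unfolding S_def using that bdd by (intro cSup_upper) auto
  have norm1: "\<exists>a. a \<noteq> 0 \<and> mean_sq (\<lambda>x. a * f x) = 1 \<and> (cmod a)\<^sup>2 = 1 / mean_sq f"
    if f: "continuous_on UNIV f" and p: "mean_sq f > 0" for f :: "'x \<Rightarrow> complex"
  proof -
    define a where "a = complex_of_real (1 / sqrt (mean_sq f))"
    have a: "(cmod a)\<^sup>2 = 1 / mean_sq f"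
      using p by (simp add: a_def norm_divide power_divide)
    then have "mean_sq (\<lambda>x. a * f x) = 1" using p mean_sq_scale[OF cpt f, of a] by simp
    moreover have "a \<noteq> 0" using p by (simp add: a_def)
    ultimately show ?thesis using a by blast
  qed
  have S_bound: "mean_sq (?T f) \<le> S * mean_sq f" if f: "continuous_on UNIV f" and p: "mean_sq f > 0" for f :: "'x \<Rightarrow> complex"
  proof -
    obtain a where a: "mean_sq (\<lambda>x. a * f x) = 1" "(cmod a)\<^sup>2 = 1 / mean_sq f" using norm1[OF f p] by blast
    have "mean_sq (?T (\<lambda>x. a * f x)) \<le> S" by (rule Sup_ge) (intro continuous_intros f a)+
    then have "mean_sq (?T f) / mean_sq f \<le> S"
      using a mean_sq_scale[OF cpt cT[OF f], of a] by (simp add: scale[OF f])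
    then show ?thesis using p by (simp add: field_simps)
  qed
  define \<phi> where "\<phi> x = complex_of_real (\<psi> x)" for x
  have cphi: "continuous_on UNIV \<phi>" unfolding \<phi>_def by (intro continuous_intros psi)
  have p: "mean_sq \<phi> > 0" by (rule mean_sq_pos[OF cpt cphi, of 0]) (use assms in \<open>simp add: \<phi>_def\<close>)
  \<comment> \<open>The operator is nonzero because the kernel itself is not killed; hence
    \<open>S > 0\<close>.\<close>
  have "?T \<phi> 0 = of_real (mean_sq \<phi>)"
    unfolding mean_conv_def mean_sq_def
  proof (rule mean_eq)
    have "has_mean (\<lambda>x. complex_of_real ((cmod (\<phi> x))\<^sup>2)) (of_real (mean (\<lambda>x. (cmod (\<phi> x))\<^sup>2)))"
      by (rule has_mean_of_real) (intro mean_real[OF cpt] continuous_intros cphi)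
    moreover have "complex_of_real ((cmod (\<phi> y))\<^sup>2) = of_real (\<psi> (0 - y)) * \<phi> y" for y
      by (simp add: \<phi>_def even power2_eq_square)
    ultimately show "has_mean (\<lambda>y. of_real (\<psi> (0 - y)) * \<phi> y) (of_real (mean (\<lambda>x. (cmod (\<phi> x))\<^sup>2)))" by simp
  qed
  then have "mean_sq (?T \<phi>) > 0" using p by (intro mean_sq_pos[OF cpt cT[OF cphi], of 0]) simp
  with S_bound[OF cphi p] p have S: "S > 0" 
    by (meson less_le_trans zero_less_mult_pos2)
  obtain a where "mean_sq (\<lambda>x. a * \<phi> x) = 1" using norm1[OF cphi p] by blast
  moreover have "continuous_on UNIV (\<lambda>x. a * \<phi> x)" by (intro continuous_intros cphi)
  ultimately have nonempty: "?A \<noteq> {}" by blast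
  have "\<forall>n. \<exists>f. continuous_on UNIV f \<and> mean_sq f = 1 \<and> S - 1 / real (Suc n) < mean_sq (?T f)"
  proof
    fix n
    have "S - 1 / real (Suc n) < S" by simp
    then obtain y where "y \<in> ?A" "S - 1 / real (Suc n) < y"
      unfolding S_def using less_cSup_iff[OF nonempty bdd] by blast
    then show "\<exists>f. continuous_on UNIV f \<and> mean_sq f = 1 \<and> S - 1 / real (Suc n) < mean_sq (?T f)" by blast
  qed
  then obtain s where s: "\<And>n. continuous_on UNIV (s n)" "\<And>n. mean_sq (s n) = 1"
    "\<And>n. S - 1 / real (Suc n) < mean_sq (?T (s n))" by metis
  have "\<exists>r g. strict_mono (r :: nat \<Rightarrow> nat) \<and> uniform_limit UNIV (\<lambda>n. ?T (s (r n))) g sequentially"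
    by (rule mean_conv_subsequence[where C = 1]) (use s in auto)
  then obtain r g where r: "strict_mono (r :: nat \<Rightarrow> nat)" and lim: "uniform_limit UNIV (\<lambda>n. ?T (s (r n))) g sequentially"
    by blast
  have cg: "continuous_on UNIV g"
    by (rule uniform_limit_theorem[OF _ lim]) (auto intro: always_eventually cT s)
  have r0: "(\<lambda>n. 1 / real (Suc (r n))) \<longlonglongrightarrow> 0"
  proof (rule tendsto_sandwich[OF _ _ tendsto_const])
    show "(\<lambda>n. 1 / real (Suc n)) \<longlonglongrightarrow> 0" using LIMSEQ_inverse_real_of_nat by (simp add: inverse_eq_divide)
    show "\<forall>\<^sub>F n in sequentially. 1 / real (Suc (r n)) \<le> 1 / real (Suc n)"
      using seq_suble[OF r] by (intro always_eventually allI divide_left_mono) auto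
  qed simp
  have "(\<lambda>n. mean_sq (?T (s (r n)))) \<longlonglongrightarrow> S"
  proof (rule tendsto_sandwich[OF _ _ _ tendsto_const])
    show "(\<lambda>n. S - 1 / real (Suc (r n))) \<longlonglongrightarrow> S" using tendsto_diff[OF tendsto_const r0] by simp
  qed (use s Sup_ge in \<open>auto intro!: always_eventually less_imp_le\<close>)
  moreover have "(\<lambda>n. mean_sq (?T (s (r n)))) \<longlonglongrightarrow> mean_sq g"
    by (rule mean_sq_tendsto[OF cpt lim _ cg]) (intro cT s)
  ultimately have gS: "mean_sq g = S" using LIMSEQ_unique by blast
  have TTg: "?T (?T g) x = of_real S * g x" for x
  proof -
    \<comment> \<open>The defect of the eigenvalue equation along the maximising sequence. Its mean
      square tends to \<open>0\<close>, so its image under the convolution tends to \<open>0\<close>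
      pointwise; that image also tends to the defect of \<open>g\<close>.\<close>
    let ?D = "\<lambda>n x. ?T (?T (s n)) x - of_real S * s n x"
    have cD: "continuous_on UNIV (?D n)" for n by (intro continuous_intros cT s)
    have msD: "mean_sq (?D n) \<le> S * (1 / real (Suc n))" for n
    proof -
      have pos: "mean_sq (?T (s n)) > 0 \<or> mean_sq (?T (s n)) = 0"
        using mean_sq_nonneg[OF cpt cT[OF s(1)[of n]]] by linarith
      have "mean_sq (?T (?T (s n))) \<le> S * mean_sq (?T (s n))"
        using pos S_bound[OF cT[OF s(1)[of n]]] msT[OF cT[OF s(1)[of n]]] by auto
      moreover have "mean_inner (?T (?T (s n))) (s n) = of_real (mean_sq (?T (s n)))"
        using mean_conv_selfadjoint[OF cT[OF s(1)[of n]] s(1)[of n]] mean_inner_self[OF cpt cT[OF s(1)[of n]]] by simp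
      ultimately have "mean_sq (?D n) \<le> S * mean_sq (?T (s n)) - 2 * S * mean_sq (?T (s n)) + S\<^sup>2"
        using mean_sq_diff[OF cpt cT[OF cT[OF s(1)[of n]]] s(1)[of n], of S] s(2)[of n] by simp
      also have "\<dots> = S * (S - mean_sq (?T (s n)))" by (simp add: power2_eq_square algebra_simps)
      also have "\<dots> \<le> S * (1 / real (Suc n))" using s(3)[of n] S by (intro mult_left_mono) auto
      finally show ?thesis .
    qed
    have TD: "?T (?D n) x = ?T (?T (?T (s n))) x - of_real S * ?T (s n) x" for n
      using mean_conv_linear[OF cT[OF cT[OF s(1)[of n]]] s(1)[of n], of 1 "- of_real S" x] by simp
    have "(\<lambda>n. ?T (?D (r n)) x) \<longlonglongrightarrow> 0"
    proof (rule Lim_null_comparison)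
      have "cmod (?T (?D n) x) \<le> B * sqrt (S * (1 / real (Suc n)))" for n
        using mean_conv_le[OF cD] mult_left_mono[OF real_sqrt_le_mono[OF msD] B_nonneg] by (rule order_trans)
      then show "\<forall>\<^sub>F n in sequentially. cmod (?T (?D (r n)) x) \<le> B * sqrt (S * (1 / real (Suc (r n))))" by simp
      have "(\<lambda>n. B * sqrt (S * (1 / real (Suc (r n))))) \<longlonglongrightarrow> B * sqrt (S * 0)"
        by (intro tendsto_intros r0)
      then show "(\<lambda>n. B * sqrt (S * (1 / real (Suc (r n))))) \<longlonglongrightarrow> 0" by simp
    qed
    moreover have "(\<lambda>n. ?T (?D (r n)) x) \<longlonglongrightarrow> ?T (?T g) x - of_real S * g x"
      unfolding TD
      by (intro tendsto_intros tendsto_eq_of_uniform_limit mean_conv_uniform_limit lim cT s cg)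
    ultimately show ?thesis using LIMSEQ_unique by fastforce
  qed
  let ?E = "{f. continuous_on UNIV f \<and> (\<forall>x. ?T (?T f) x = of_real S * f x)}"
  have "invariant_space ?E"
    unfolding invariant_space_def
  proof (intro conjI ballI allI impI)
    show "continuous_on UNIV f" if "f \<in> ?E" for f using that by simp
    show "(\<lambda>x. a * f x + b * h x) \<in> ?E" if f: "f \<in> ?E" and h: "h \<in> ?E" for f h a b
    proof -
      have "?T (\<lambda>x. a * f x + b * h x) = (\<lambda>x. a * ?T f x + b * ?T h x)"
        using f h by (simp add: mean_conv_linear fun_eq_iff)
      then show ?thesis using f h cT
        by (auto simp: mean_conv_linear algebra_simps intro!: continuous_intros)
    qed
    show "(\<lambda>x. f (x + k)) \<in> ?E" if f: "f \<in> ?E" for f k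
    proof -
      have "?T (\<lambda>x. f (x + k)) = (\<lambda>x. ?T f (x + k))" using f by (simp add: mean_conv_shift fun_eq_iff)
      moreover have "continuous_on UNIV (\<lambda>x. f (x + k))"
        by (rule continuous_on_compose2[of UNIV f]) (use f in \<open>auto intro!: continuous_intros\<close>)
      ultimately show ?thesis using f cT by (simp add: mean_conv_shift)
    qed
    show "\<exists>f\<in>?E. mean_sq f = 1"
    proof -
      obtain a where "mean_sq (\<lambda>x. a * g x) = 1" using norm1[OF cg] gS S by auto
      moreover have "(\<lambda>x. a * g x) \<in> ?E" using cg cT TTg
        by (auto simp: scale intro!: continuous_intros)
      ultimately show ?thesis by blast
    qed
    show "u \<in> ?E" if s: "\<forall>n. s n \<in> ?E" and lim: "uniform_limit UNIV s u sequentially" for s u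
    proof -
      have cu: "continuous_on UNIV u"
        by (rule uniform_limit_theorem[OF _ lim]) (use s in \<open>auto intro: always_eventually\<close>)
      have cs: "continuous_on UNIV (s n)" for n using s by auto
      have "?T (?T u) x = of_real S * u x" for x
      proof -
        have "(\<lambda>n. ?T (?T (s n)) x) \<longlonglongrightarrow> ?T (?T u) x"
          by (intro tendsto_eq_of_uniform_limit mean_conv_uniform_limit lim cT cs cu)
        moreover have "(\<lambda>n. ?T (?T (s n)) x) = (\<lambda>n. of_real S * s n x)" using s by auto
        moreover have "(\<lambda>n. of_real S * s n x) \<longlonglongrightarrow> of_real S * u x"
          by (intro tendsto_intros tendsto_eq_of_uniform_limit lim)
        ultimately show ?thesis using LIMSEQ_unique by metis
      qed
      then show ?thesis using cu by simp
    qed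
    \<comment> \<open>On the eigenspace a function is recovered as \<open>1 / S\<close> times its
      double convolution, so the unit ball inherits compactness from the operator.\<close>
    show "\<exists>r g. strict_mono (r :: nat \<Rightarrow> nat) \<and> uniform_limit UNIV (\<lambda>n. s (r n)) g sequentially"
      if s: "\<forall>n. s n \<in> ?E \<and> mean_sq (s n) \<le> 1" for s
    proof -
      have "continuous_on UNIV (?T (s n))" "mean_sq (?T (s n)) \<le> B\<^sup>2" for n
        using s cT msT[of "s n"] mult_left_mono[of "mean_sq (s n)" 1 "B\<^sup>2"] by (auto intro: order_trans)
      from mean_conv_subsequence[where s = "\<lambda>n. ?T (s n)", OF this] obtain r g where r: "strict_mono (r :: nat \<Rightarrow> nat)"
        and lim: "uniform_limit UNIV (\<lambda>n. ?T (?T (s (r n)))) g sequentially" by blast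
      have "uniform_limit UNIV (\<lambda>n x. of_real (1 / S) * ?T (?T (s (r n))) x) (\<lambda>x. of_real (1 / S) * g x) sequentially"
        by (rule bounded_linear.uniform_limit[OF bounded_linear_mult_right lim])
      moreover have "of_real (1 / S) * ?T (?T (s (r n))) x = s (r n) x" for n x
        using s S by simp
      ultimately have "uniform_limit UNIV (\<lambda>n. s (r n)) (\<lambda>x. of_real (1 / S) * g x) sequentially" by simp
      with r show ?thesis by blast
    qed
  qed
  with S show ?thesis by blast
qed

end

text \<open>Successive eigenspaces for countably many self-adjoint operators form a decreasing
  sequence of invariant spaces; a limit of unit vectors lies in all of them. The conclusion is
  cross-multiplied so that zeros of \<open>g\<close> do no harm and it passes to limits in
  \<open>h\<close>.\<close>

lemma common_eigenvector:
  fixes E :: "('x \<Rightarrow> complex) set"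
  assumes E: "invariant_space E"
  shows "\<exists>g\<in>E. (\<exists>y. g y \<noteq> 0) \<and> (\<forall>h x y. g (x + h) * g y = g (y + h) * g x)"
proof -
  obtain d :: "nat \<Rightarrow> 'x" where d: "\<And>\<delta>. \<delta> > 0 \<Longrightarrow> \<exists>K. \<forall>z. \<exists>j<K. dist (d j - z) 0 < \<delta>"
    using group_dense_sequence[OF cpt] by blast
  \<comment> \<open>Every \<open>d j\<close> occurs twice, with \<open>c = 1\<close> at an even and
    \<open>c = \<i>\<close> at an odd index. The two self-adjoint combinations determine the
    translation by \<open>d j\<close>, which need not be self-adjoint itself.\<close>
  define h where "h k = d (k div 2)" for k
  define c where "c k = (if even k then 1 else \<i>)" for k :: nat
  have cm: "cmod (c k) = 1" for k by (simp add: c_def)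
  have "\<exists>F. \<forall>k. (invariant_space (F k) \<and> F k \<subseteq> E) \<and>
    (F (Suc k) \<subseteq> F k \<and> (\<exists>\<mu>. \<forall>f\<in>F (Suc k). \<forall>x. c k * f (x + h k) + cnj (c k) * f (x - h k) = \<mu> * f x))"
  proof (rule dependent_nat_choice)
    show "\<exists>F. invariant_space F \<and> F \<subseteq> E" using E by blast
    fix F k assume F: "invariant_space F \<and> F \<subseteq> E"
    then obtain \<mu> where "invariant_space {f \<in> F. \<forall>x. c k * f (x + h k) + cnj (c k) * f (x - h k) = \<mu> * f x}"
      using invariant_space_eigenspace[of F "c k" "h k"] cm by blast
    then show "\<exists>F'. (invariant_space F' \<and> F' \<subseteq> E) \<and>
       (F' \<subseteq> F \<and> (\<exists>\<mu>. \<forall>f\<in>F'. \<forall>x. c k * f (x + h k) + cnj (c k) * f (x - h k) = \<mu> * f x))"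
      using F by (intro exI[of _ "{f \<in> F. \<forall>x. c k * f (x + h k) + cnj (c k) * f (x - h k) = \<mu> * f x}"]) blast
  qed
  then obtain F where F: "\<And>k. invariant_space (F k)" "\<And>k. F k \<subseteq> E" "\<And>k. F (Suc k) \<subseteq> F k"
    "\<And>k. \<exists>\<mu>. \<forall>f\<in>F (Suc k). \<forall>x. c k * f (x + h k) + cnj (c k) * f (x - h k) = \<mu> * f x" by blast
  have anti: "F n \<subseteq> F m" if "m \<le> n" for m n using that
    by (induction rule: dec_induct) (use F(3) in blast)+
  have "\<forall>k. \<exists>f\<in>F k. mean_sq f = 1" using invariant_spaceD(4)[OF F(1)] by blast
  then obtain f where f: "\<And>k. f k \<in> F k" "\<And>k. mean_sq (f k) = 1" by metis
  have "\<exists>r g. strict_mono (r :: nat \<Rightarrow> nat) \<and> uniform_limit UNIV (\<lambda>n. f (r n)) g sequentially"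
    by (rule invariant_spaceD(6)[OF E]) (use f F(2) in auto)
  then obtain r g where r: "strict_mono (r :: nat \<Rightarrow> nat)" and lim: "uniform_limit UNIV (\<lambda>n. f (r n)) g sequentially"
    by blast
  \<comment> \<open>The spaces decrease, so a tail of the subsequence lies in \<open>F m\<close>,
    which is closed under uniform limits.\<close>
  have gF: "g \<in> F m" for m
  proof (rule invariant_spaceD(5)[OF F(1)])
    show "f (r (n + m)) \<in> F m" for n
      using f(1)[of "r (n + m)"] anti[of m "r (n + m)"] seq_suble[OF r, of "n + m"] by force
    show "uniform_limit UNIV (\<lambda>n. f (r (n + m))) g sequentially"
      using lim unfolding uniform_limit_iff eventually_sequentially by (meson trans_le_add1)
  qed
  have gE: "g \<in> E" using gF F(2) by blast
  have cg: "continuous_on UNIV g" by (rule invariant_spaceD(1)[OF E gE])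
  have "(\<lambda>n. mean_sq (f (r n))) \<longlonglongrightarrow> mean_sq g"
    by (rule mean_sq_tendsto[OF cpt lim _ cg]) (use f F(2) invariant_spaceD(1)[OF E] in blast)
  then have g1: "mean_sq g = 1" using f(2) LIMSEQ_unique[OF _ tendsto_const] by simp
  have "\<exists>y. g y \<noteq> 0"
  proof (rule ccontr)
    assume "\<not> ?thesis"
    then have "mean_sq g = 0" by (auto simp: mean_sq_def intro!: mean_eq has_mean_const)
    then show False using g1 by simp
  qed
  moreover have dj: "g (x + d j) * g y = g (y + d j) * g x" for j x y
  proof -
    obtain \<mu> where \<mu>: "\<And>x. g (x + d j) + g (x - d j) = \<mu> * g x"
      using F(4)[of "2 * j"] gF[of "Suc (2 * j)"] by (auto simp: c_def h_def)
    obtain \<nu> where \<nu>: "\<And>x. \<i> * g (x + d j) - \<i> * g (x - d j) = \<nu> * g x"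
      using F(4)[of "2 * j + 1"] gF[of "Suc (2 * j + 1)"] by (auto simp: c_def h_def)
    have "2 * g (x + d j) = (g (x + d j) + g (x - d j)) - \<i> * (\<i> * g (x + d j) - \<i> * g (x - d j))" for x
      by (simp add: algebra_simps flip: mult.assoc)
    then have k: "2 * g (x + d j) = (\<mu> - \<i> * \<nu>) * g x" for x unfolding \<mu> \<nu> by (simp add: algebra_simps)
    have "2 * (g (x + d j) * g y) = (2 * g (x + d j)) * g y" by simp
    also have "\<dots> = (2 * g (y + d j)) * g x" unfolding k by (simp add: mult_ac)
    finally show ?thesis by simp
  qed
  moreover have "g (x + k) * g y = g (y + k) * g x" for k x y
  proof -
    have "\<forall>n. \<exists>j. dist (d j - k) 0 < 1 / real (Suc n)"
    proof
      fix n show "\<exists>j. dist (d j - k) 0 < 1 / real (Suc n)" using d[of "1 / real (Suc n)"] by auto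
    qed
    then obtain j where j: "\<And>n. dist (d (j n) - k) 0 < 1 / real (Suc n)" by metis
    have "(\<lambda>n. dist (d (j n) - k) 0) \<longlonglongrightarrow> 0"
    proof (rule tendsto_sandwich[OF _ _ tendsto_const])
      show "(\<lambda>n. 1 / real (Suc n)) \<longlonglongrightarrow> 0" using LIMSEQ_inverse_real_of_nat by (simp add: inverse_eq_divide)
    qed (use j in \<open>auto intro!: always_eventually less_imp_le\<close>)
    then have u: "(\<lambda>n. d (j n) - k) \<longlonglongrightarrow> 0" by (subst tendsto_dist_iff)
    have "(\<lambda>n. (x + k) + (d (j n) - k)) \<longlonglongrightarrow> (x + k) + 0" for x by (intro tendsto_intros u)
    then have v: "(\<lambda>n. x + d (j n)) \<longlonglongrightarrow> x + k" for x by simp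
    have w: "(\<lambda>n. g (x + d (j n))) \<longlonglongrightarrow> g (x + k)" for x
      by (rule continuous_on_tendsto_compose[OF cg v]) auto
    have "(\<lambda>n. g (x + d (j n)) * g y) \<longlonglongrightarrow> g (x + k) * g y" by (intro tendsto_intros w)
    moreover have "(\<lambda>n. g (y + d (j n)) * g x) \<longlonglongrightarrow> g (y + k) * g x" by (intro tendsto_intros w)
    ultimately show ?thesis unfolding dj[of x _ y] using LIMSEQ_unique by blast
  qed
  ultimately show ?thesis using gE by blast
qed

lemma invariant_space_character:
  fixes E :: "('x \<Rightarrow> complex) set"
  assumes E: "invariant_space E"
  shows "\<exists>g\<in>E. \<exists>\<gamma> :: 'x pontryagin_dual. (\<exists>y. g y \<noteq> 0) \<and> (\<forall>h x. g (x + h) = char_fun \<gamma> h * g x)"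
proof -
  obtain g y where g: "g \<in> E" "g y \<noteq> 0" "\<And>h x y. g (x + h) * g y = g (y + h) * g x"
    using common_eigenvector[OF E] by blast
  define \<kappa> where "\<kappa> h = g (y + h) / g y" for h
  have eig: "g (x + h) = \<kappa> h * g x" for x h using g(2) g(3)[of x h y] by (simp add: \<kappa>_def field_simps)
  have cg: "continuous_on UNIV g" by (rule invariant_spaceD(1)[OF E g(1)])
  have c: "continuous_on UNIV \<kappa>" unfolding \<kappa>_def
    by (intro continuous_intros continuous_on_compose2[OF cg]) (auto simp: g(2))
  have mult: "\<kappa> (h + k) = \<kappa> h * \<kappa> k" for h k
    using eig[of "y + h" k] eig[of y h] g(2) by (simp add: \<kappa>_def field_simps add.assoc)
  have zero: "\<kappa> 0 = 1" using g(2) by (simp add: \<kappa>_def)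
  obtain C where C: "\<And>x. cmod (\<kappa> x) \<le> C" using continuous_bounded[OF cpt c] by blast
  \<comment> \<open>The powers of \<open>\<kappa> h\<close> are again values of the bounded function
    \<open>\<kappa>\<close>. The same bound at \<open>- h\<close> then forces modulus
    \<open>1\<close>.\<close>
  have le1: "cmod (\<kappa> h) \<le> 1" for h
  proof (rule ccontr)
    assume "\<not> ?thesis"
    then obtain n where n: "C < cmod (\<kappa> h) ^ n" using real_arch_pow by (metis not_le)
    have "\<exists>x. \<kappa> x = \<kappa> h ^ n" by (induction n) (use zero mult in \<open>auto, metis\<close>)
    then show False using n C by (metis norm_power not_le)
  qed
  have "cmod (\<kappa> h) = 1" for h
  proof -
    have "cmod (\<kappa> h) * cmod (\<kappa> (- h)) = 1" using mult[of h "- h"] zero by (simp flip: norm_mult)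
    then have "1 \<le> cmod (\<kappa> h) * 1" using le1[of "- h"] by (metis mult_left_mono norm_ge_zero)
    then show ?thesis using le1[of h] by simp
  qed
  then have "char_fun (Abs_char \<kappa> :: 'x pontryagin_dual) = \<kappa>"
    using c mult by (intro Abs_char_inverse) simp
  then have "\<forall>h x. g (x + h) = char_fun (Abs_char \<kappa> :: 'x pontryagin_dual) h * g x" using eig by simp
  with g(1,2) show ?thesis by blast
qed

text \<open>Convolution with the second difference \<open>\<psi>\<close> of an even function is nonzero, so it has a nontrivial
  eigenspace, which contains a multiple of a character \<open>\<gamma>\<close>. If \<open>\<gamma> t = 1\<close>, then taking the difference by
  \<open>t\<close> kills \<open>\<gamma>\<close>, so that the eigenvalue would be \<open>0\<close>.\<close>

theorem characters_separate_points:
  fixes t :: 'x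
  assumes "t \<noteq> 0"
  shows "\<exists>\<gamma> :: 'x pontryagin_dual. char_fun \<gamma> t \<noteq> 1"
proof -
  \<comment> \<open>The distance to \<open>0\<close>, symmetrised because the metric need not be
    invariant. The second difference in direction \<open>t\<close> has the value
    \<open>2 * \<phi> t\<close> at \<open>0\<close>, which is positive.\<close>
  define \<phi> where "\<phi> x = dist x 0 + dist (- x) 0" for x :: 'x
  define \<psi> where "\<psi> x = \<phi> (x - t) + \<phi> (x + t) - 2 * \<phi> x" for x
  have cphi: "continuous_on UNIV (\<lambda>x. \<phi> (u x))" if "continuous_on UNIV u" for u
    unfolding \<phi>_def by (intro continuous_intros that)
  have cpsi: "continuous_on UNIV \<psi>" unfolding \<psi>_def by (intro continuous_intros cphi)
  have ev: "\<phi> (- x) = \<phi> x" for x by (simp add: \<phi>_def)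
  have even: "\<psi> (- x) = \<psi> x" for x
    using ev[of "x - t"] ev[of "x + t"] by (simp add: \<psi>_def ev)
  obtain B where B: "\<And>x. \<bar>\<psi> x\<bar> \<le> B" using continuous_bounded[OF cpt cpsi] by auto
  have "\<psi> 0 = 2 * \<phi> t" using ev[of t] by (simp add: \<psi>_def) (simp add: \<phi>_def)
  moreover have "\<phi> t > 0" unfolding \<phi>_def using assms by (intro add_pos_nonneg) auto
  ultimately obtain S where S: "S > 0"
    "invariant_space {f. continuous_on UNIV f \<and> (\<forall>x. mean_conv \<psi> (mean_conv \<psi> f) x = of_real S * f x)}"
    using mean_conv_eigenspace[OF cpsi even B] by auto
  obtain g \<gamma> y where cg: "continuous_on UNIV g" and T: "\<And>x. mean_conv \<psi> (mean_conv \<psi> g) x = of_real S * g x"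
    and gy: "g y \<noteq> 0" and eig: "\<And>h x. g (x + h) = char_fun (\<gamma> :: 'x pontryagin_dual) h * g x"
    using invariant_space_character[OF S(2)] by blast
  have "char_fun \<gamma> t \<noteq> 1"
  proof
    assume "char_fun \<gamma> t = 1"
    then have inv: "g (x + t) = g x" for x using eig by simp
    have "mean_conv \<psi> g x = 0" for x
    proof -
      define m where "m = mean (\<lambda>y. of_real (\<phi> (x - y)) * g y)"
      have m: "has_mean (\<lambda>y. of_real (\<phi> (x - y)) * g y) m" unfolding m_def
        by (intro mean_cpx[OF cpt] continuous_intros cphi cg)
      have "has_mean (\<lambda>y. of_real (\<phi> (x - (y + t))) * g (y + t)) m" by (rule has_mean_shift[OF m])
      then have m1: "has_mean (\<lambda>y. of_real (\<phi> (x - y - t)) * g y) m" by (simp add: inv algebra_simps)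
      have "has_mean (\<lambda>y. of_real (\<phi> (x - (y + - t))) * g (y + - t)) m" by (rule has_mean_shift[OF m])
      moreover have "g (y + - t) = g y" for y using inv[of "y + - t"] by simp
      ultimately have m2: "has_mean (\<lambda>y. of_real (\<phi> (x - y + t)) * g y) m" by (simp add: algebra_simps)
      have "has_mean (\<lambda>y. of_real (\<phi> (x - y - t)) * g y + of_real (\<phi> (x - y + t)) * g y + (- 2) * (of_real (\<phi> (x - y)) * g y))
        (m + m + (- 2) * m)"
        by (intro has_mean_add m1 m2 has_mean_linear[OF bounded_linear_mult_right m])
      moreover have "of_real (\<phi> (x - y - t)) * g y + of_real (\<phi> (x - y + t)) * g y + (- 2) * (of_real (\<phi> (x - y)) * g y)
        = of_real (\<psi> (x - y)) * g y" for y
        by (simp add: \<psi>_def algebra_simps)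
      ultimately show ?thesis unfolding mean_conv_def by (intro mean_eq) simp
    qed
    then have "mean_conv \<psi> (mean_conv \<psi> g) y = 0"
      unfolding mean_conv_def[of \<psi> "mean_conv \<psi> g"]
      by (intro mean_eq) (simp add: has_mean_const)
    then show False using T[of y] S(1) gy by simp
  qed
  then show ?thesis by blast
qed

end

section \<open>Modules\<close>

lemma left_module_mult: "left_module ((*) :: 'r::ring_1 \<Rightarrow> 'r \<Rightarrow> 'r)"
  by standard (auto simp: algebra_simps)

lemma lookup_free_scale: "lookup (free_scale r a) i = r * lookup a i"
  unfolding free_scale_def by (transfer fixing: r) (simp add: when_def)

lemma left_module_free_scale: "left_module (free_scale :: 'r::ring_1 \<Rightarrow> _)"
  by standard (auto intro!: poly_mapping_eqI simp: lookup_free_scale lookup_add algebra_simps)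

context left_module
begin

lemma smul_zero_left: "smul 0 x = 0"
  using smul_left_distrib[of 0 0 x] by simp

lemma smul_zero_right: "smul a 0 = 0"
  using smul_right_distrib[of a 0 0] by simp

lemma smul_minus_one: "smul (- 1) x = - x"
  using smul_left_distrib[of 1 "- 1" x] by (simp add: smul_one smul_zero_left eq_neg_iff_add_eq_0 add.commute)

lemma smul_sum: "smul a (\<Sum>i\<in>I. f i) = (\<Sum>i\<in>I. smul a (f i))"
  by (induction I rule: infinite_finite_induct) (auto simp: smul_zero_right smul_right_distrib)

lemma submodule_sum:
  assumes "submodule smul N" "\<And>i. i \<in> I \<Longrightarrow> f i \<in> N"
  shows "(\<Sum>i\<in>I. f i) \<in> N"
  using assms(2) by (induction I rule: infinite_finite_induct) (use assms(1) in \<open>auto simp: submodule_def\<close>)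

lemma submodule_diff:
  assumes "submodule smul N" "x \<in> N" "y \<in> N"
  shows "x - y \<in> N"
proof -
  have "x + smul (- 1) y \<in> N" using assms by (auto simp: submodule_def)
  then show ?thesis by (simp add: smul_minus_one)
qed

lemma submodule_combinations:
  "submodule smul {\<Sum>b\<in>S. smul (c b) b | c. True}"
  unfolding submodule_def
proof (intro conjI ballI allI)
  show "0 \<in> {\<Sum>b\<in>S. smul (c b) b | c. True}"
    by (auto intro!: exI[of _ "\<lambda>_. 0"] simp: smul_zero_left)
next
  fix x y assume "x \<in> {\<Sum>b\<in>S. smul (c b) b | c. True}" "y \<in> {\<Sum>b\<in>S. smul (c b) b | c. True}"
  then obtain c d where "x = (\<Sum>b\<in>S. smul (c b) b)" "y = (\<Sum>b\<in>S. smul (d b) b)" by blast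
  then show "x + y \<in> {\<Sum>b\<in>S. smul (c b) b | c. True}"
    by (auto intro!: exI[of _ "\<lambda>b. c b + d b"] simp: smul_left_distrib sum.distrib)
next
  fix r x assume "x \<in> {\<Sum>b\<in>S. smul (c b) b | c. True}"
  then obtain c where "x = (\<Sum>b\<in>S. smul (c b) b)" by blast
  then show "smul r x \<in> {\<Sum>b\<in>S. smul (c b) b | c. True}"
    by (auto intro!: exI[of _ "\<lambda>b. r * c b"] simp: smul_sum smul_smul)
qed

lemma submodule_hull: "submodule smul (submodule smul hull S)"
  by (rule hull_in) (auto simp: submodule_def)

lemma hull_finite_combination:
  assumes "finite S" "x \<in> submodule smul hull S"
  shows "\<exists>c. x = (\<Sum>b\<in>S. smul (c b) b)"
proof -
  have "b \<in> {\<Sum>b\<in>S. smul (c b) b | c. True}" if "b \<in> S" for b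
  proof -
    have "(\<Sum>b'\<in>S. smul (if b' = b then 1 else 0) b') = (\<Sum>b'\<in>S. if b' = b then b else 0)"
      by (rule sum.cong) (auto simp: smul_one smul_zero_left)
    then show ?thesis using that assms(1) by (auto intro!: exI[of _ "\<lambda>b'. if b' = b then 1 else 0"])
  qed
  then have "S \<subseteq> {\<Sum>b\<in>S. smul (c b) b | c. True}" by blast
  then have "submodule smul hull S \<subseteq> {\<Sum>b\<in>S. smul (c b) b | c. True}"
    by (rule hull_minimal) (rule submodule_combinations)
  with assms(2) show ?thesis by blast
qed

end

interpretation free: left_module free_scale
  by (rule left_module_free_scale)

lemma submodule_free_module: "submodule free_scale (free_module n)"
  unfolding submodule_def free_module_def
  by (auto simp: lookup_free_scale in_keys_iff lookup_add) (metis in_keys_iff add.right_neutral lookup_add mult_zero_right lessThan_iff subset_iff)+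

text \<open>Induction on the rank: the last coordinates of \<open>N\<close> form a left ideal, and
  preimages of its generators together with generators of the elements with vanishing last
  coordinate generate \<open>N\<close>.\<close>

theorem noetherian_submodule_finitely_generated:
  fixes N :: "(nat \<Rightarrow>\<^sub>0 'r::ring_1) set"
  assumes noeth: "left_noetherian TYPE('r)" and "submodule free_scale N" "N \<subseteq> free_module n"
  shows "finitely_generated free_scale N"
  using assms(2,3)
proof (induction n arbitrary: N)
  case 0
  then have "N = {0}" by (auto simp: free_module_def submodule_def)
  have "submodule free_scale {0 :: nat \<Rightarrow>\<^sub>0 'r}" by (auto simp: submodule_def free.smul_zero_right)
  then have "submodule free_scale hull {} \<subseteq> {0 :: nat \<Rightarrow>\<^sub>0 'r}" by (rule hull_minimal[rotated]) simp
  moreover have "0 \<in> submodule free_scale hull ({} :: (nat \<Rightarrow>\<^sub>0 'r) set)"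
    using free.submodule_hull[of "{}"] unfolding submodule_def by blast
  ultimately have "N = submodule free_scale hull {}" using \<open>N = {0}\<close> by blast
  then show ?case unfolding finitely_generated_def by blast
next
  case (Suc n)
  let ?l = "\<lambda>x. lookup x n"
  have "submodule (*) (?l ` N)"
    using Suc.prems(1) unfolding submodule_def
    by (auto simp: lookup_add[symmetric] lookup_free_scale[symmetric] intro!: imageI) (metis image_iff lookup_zero)
  then obtain T where T: "finite T" "?l ` N = submodule (*) hull T"
    using noeth unfolding left_noetherian_def finitely_generated_def by blast
  then have "T \<subseteq> ?l ` N" using hull_subset[of T "submodule (*)"] by simp
  then obtain P where P: "P \<subseteq> N" "finite P" "T = ?l ` P" using finite_subset_image[OF T(1)] by metis
  have "\<exists>p. p \<in> P \<and> ?l p = t" if "t \<in> T" for t using that P(3) by blast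
  then obtain pre where pre: "\<And>t. t \<in> T \<Longrightarrow> pre t \<in> P \<and> ?l (pre t) = t" by metis
  have sub: "submodule free_scale (N \<inter> free_module n)"
    using Suc.prems(1) submodule_free_module[of n] unfolding submodule_def by blast
  then obtain S where S: "finite S" "N \<inter> free_module n = submodule free_scale hull S"
    using Suc.IH[of "N \<inter> free_module n"] unfolding finitely_generated_def by blast
  let ?H = "submodule free_scale hull (S \<union> P)"
  have sH: "submodule free_scale ?H" by (rule free.submodule_hull)
  have "N = ?H"
  proof
    have "S \<subseteq> N" using S(2) hull_subset[of S "submodule free_scale"] by blast
    then show "?H \<subseteq> N" by (intro hull_minimal) (use P Suc.prems in auto)
    show "N \<subseteq> ?H"
    proof
      fix x assume x: "x \<in> N"
      then have "?l x \<in> submodule (*) hull T" using T(2) by blast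
      from left_module.hull_finite_combination[OF left_module_mult T(1) this]
      obtain c where c: "?l x = (\<Sum>t\<in>T. c t * t)" by blast
      define y where "y = (\<Sum>t\<in>T. free_scale (c t) (pre t))"
      have "free_scale (c t) (pre t) \<in> ?H \<inter> N" if "t \<in> T" for t
        using pre[OF that] P(1) Suc.prems(1) sH hull_subset[of "S \<union> P" "submodule free_scale"]
        unfolding submodule_def by blast
      then have fs: "\<And>t. t \<in> T \<Longrightarrow> free_scale (c t) (pre t) \<in> ?H" "\<And>t. t \<in> T \<Longrightarrow> free_scale (c t) (pre t) \<in> N"
        by auto
      have y: "y \<in> ?H" "y \<in> N"
        unfolding y_def by (rule free.submodule_sum[OF sH fs(1)] free.submodule_sum[OF Suc.prems(1) fs(2)], assumption)+
      have "?l y = ?l x" unfolding y_def c lookup_sum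
        by (rule sum.cong) (auto simp: lookup_free_scale pre)
      then have l0: "?l (x - y) = 0" by (simp add: lookup_minus)
      have xy: "x - y \<in> N" by (rule free.submodule_diff[OF Suc.prems(1) x y(2)])
      have keys: "supp (x - y) \<subseteq> {..<Suc n}"
        using xy Suc.prems(2) by (auto simp: free_module_def)
      have "k < n" if "k \<in> supp (x - y)" for k
      proof -
        have "k \<noteq> n" using that l0 by (auto simp: in_keys_iff)
        moreover have "k < Suc n" using keys that by blast
        ultimately show ?thesis by simp
      qed
      then have "x - y \<in> free_module n" by (auto simp: free_module_def)
      then have "x - y \<in> submodule free_scale hull S" using S(2) xy by blast
      then have "x - y \<in> ?H" using hull_mono[of S "S \<union> P" "submodule free_scale"] by blast
      then have "(x - y) + y \<in> ?H" using sH y(1) unfolding submodule_def by blast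
      then show "x \<in> ?H" by simp
    qed
  qed
  moreover have "finite (S \<union> P)" using S(1) P(2) by simp
  ultimately show ?case unfolding finitely_generated_def by blast
qed

section \<open>Rows over the integral group ring acting on functions\<close>

definition coef :: "(nat \<Rightarrow>\<^sub>0 'g \<Rightarrow>\<^sub>0 int) \<Rightarrow> nat \<times> 'g \<Rightarrow> int" where
  "coef r p = lookup (lookup r (fst p)) (snd p)"

definition row_supp :: "(nat \<Rightarrow>\<^sub>0 'g \<Rightarrow>\<^sub>0 int) \<Rightarrow> (nat \<times> 'g) set" where
  "row_supp r = {p. coef r p \<noteq> 0}"

text \<open>Left convolution, summed over the columns. It commutes with right translations of
  configurations, and those describe the action of \<open>G\<close> on lifts.\<close>

definition row_act :: "(nat \<Rightarrow>\<^sub>0 'g::group_add \<Rightarrow>\<^sub>0 int) \<Rightarrow> (nat \<Rightarrow> 'g \<Rightarrow> real) \<Rightarrow> 'g \<Rightarrow> real" where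
  "row_act r u g = (\<Sum>p\<in>row_supp r. of_int (coef r p) * u (fst p) (- snd p + g))"

definition ring_act :: "('g::group_add \<Rightarrow>\<^sub>0 int) \<Rightarrow> ('g \<Rightarrow> real) \<Rightarrow> 'g \<Rightarrow> real" where
  "ring_act a v g = (\<Sum>s\<in>supp a. of_int (lookup a s) * v (- s + g))"

lemma row_supp_subset: "row_supp r \<subseteq> (SIGMA i:supp r. supp (lookup r i))"
  by (auto simp: row_supp_def coef_def in_keys_iff)

lemma finite_row_supp [simp]: "finite (row_supp r)"
  by (rule finite_subset[OF row_supp_subset]) auto

lemma fst_row_supp: "r \<in> free_module n \<Longrightarrow> p \<in> row_supp r \<Longrightarrow> fst p < n"
  using subsetD[OF row_supp_subset[of r], of p] by (cases p) (auto simp: free_module_def)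

lemma coef_add: "coef (r + r') p = coef r p + coef r' p"
  by (simp add: coef_def lookup_add)

lemma coef_zero [simp]: "coef 0 p = 0"
  by (simp add: coef_def)

lemma coef_sum: "coef (\<Sum>i\<in>I. f i) p = (\<Sum>i\<in>I. coef (f i) p)"
  by (induction I rule: infinite_finite_induct) (auto simp: coef_add)

lemma coef_single: "coef (Poly_Mapping.single i (Poly_Mapping.single s m)) p = (if p = (i, s) then m else 0)"
  by (cases p) (auto simp: coef_def lookup_single when_def)

lemma coef_eqI: "(\<And>p. coef r p = coef r' p) \<Longrightarrow> r = r'"
  by (rule poly_mapping_eqI, rule poly_mapping_eqI) (auto simp: coef_def dest: spec[of _ "(_, _)"] split: prod.splits)

lemma row_act_superset:
  assumes "finite S" "row_supp r \<subseteq> S"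
  shows "row_act r u g = (\<Sum>p\<in>S. of_int (coef r p) * u (fst p) (- snd p + g))"
  unfolding row_act_def by (rule sum.mono_neutral_left) (use assms in \<open>auto simp: row_supp_def\<close>)

lemma row_supp_add: "row_supp (r + r') \<subseteq> row_supp r \<union> row_supp r'"
  by (auto simp: row_supp_def coef_add)

lemma row_act_add: "row_act (r + r') u g = row_act r u g + row_act r' u g"
  by (simp add: row_act_superset[of "row_supp r \<union> row_supp r'"] row_supp_add coef_add distrib_right sum.distrib)

lemma row_act_zero [simp]: "row_act 0 u g = 0"
  by (simp add: row_act_def)

lemma row_act_sum: "row_act (\<Sum>i\<in>I. f i) u g = (\<Sum>i\<in>I. row_act (f i) u g)"
  by (induction I rule: infinite_finite_induct) (auto simp: row_act_add)

lemma row_act_linear: "row_act r (\<lambda>i g. a * u i g + b * v i g) g = a * row_act r u g + b * row_act r v g"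
  by (simp add: row_act_def sum.distrib sum_distrib_left algebra_simps)

lemma row_act_diff: "row_act r (\<lambda>i g. u i g - v i g) g = row_act r u g - row_act r v g"
  using row_act_linear[of r 1 u "-1" v g] by simp

lemma row_act_scale: "row_act r (\<lambda>i g. a * u i g) g = a * row_act r u g"
  using row_act_linear[of r a u 0 u g] by simp

lemma row_act_sum_right: "row_act r (\<lambda>i g. \<Sum>k\<in>K. u k i g) g = (\<Sum>k\<in>K. row_act r (u k) g)"
  unfolding row_act_def sum_distrib_left by (rule sum.swap)

lemma row_act_shift: "row_act r (\<lambda>i g. u i (g + h)) g = row_act r u (g + h)"
  by (simp add: row_act_def add.assoc)

lemma row_act_cong:
  assumes "\<And>p. p \<in> row_supp r \<Longrightarrow> u (fst p) (- snd p + g) = v (fst p) (- snd p + g)"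
  shows "row_act r u g = row_act r v g"
  unfolding row_act_def by (rule sum.cong) (use assms in auto)

lemma ring_act_superset:
  assumes "finite S" "supp a \<subseteq> S"
  shows "ring_act a v g = (\<Sum>s\<in>S. of_int (lookup a s) * v (- s + g))"
  unfolding ring_act_def by (rule sum.mono_neutral_left) (use assms in \<open>auto simp: in_keys_iff\<close>)

lemma ring_act_add: "ring_act (a + b) v g = ring_act a v g + ring_act b v g"
  using keys_add[of a b]
  by (simp add: ring_act_superset[of "supp a \<union> supp b"] lookup_add distrib_right sum.distrib)

lemma ring_act_single: "ring_act (Poly_Mapping.single s m) v g = of_int m * v (- s + g)"
  by (simp add: ring_act_superset[of "{s}"])

lemma row_act_free_scale: "row_act (free_scale a r) u g = ring_act a (row_act r u) g"
proof (induction a arbitrary: g rule: poly_mapping_single_add_induct)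
  case (add a b)
  then show ?case by (simp add: free.smul_left_distrib row_act_add ring_act_add)
next
  case (single s m)
  have c: "coef (free_scale (Poly_Mapping.single s m) r) p = m * coef r (fst p, - s + snd p)" for p
  proof -
    have "lookup (Poly_Mapping.single s m * f) k = m * lookup f (- s + k)" for f :: "'a \<Rightarrow>\<^sub>0 int" and k
    proof (induction f rule: poly_mapping_single_add_induct)
      case (single k' v)
      show ?case by (auto simp: mult_single lookup_single when_def)
    qed (simp add: distrib_left lookup_add)
    then show ?thesis by (simp add: coef_def lookup_free_scale)
  qed
  let ?f = "\<lambda>p. (fst p, s + snd p)"
  have sub: "row_supp (free_scale (Poly_Mapping.single s m) r) \<subseteq> ?f ` row_supp r"
  proof
    fix p assume "p \<in> row_supp (free_scale (Poly_Mapping.single s m) r)"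
    then have "(fst p, - s + snd p) \<in> row_supp r" by (auto simp: row_supp_def c)
    moreover have "p = ?f (fst p, - s + snd p)" by (simp add: add.assoc[symmetric])
    ultimately show "p \<in> ?f ` row_supp r" by blast
  qed
  have "inj_on ?f (row_supp r)" by (auto simp: inj_on_def)
  then have "row_act (free_scale (Poly_Mapping.single s m) r) u g =
    (\<Sum>p\<in>row_supp r. of_int (m * coef r p) * u (fst p) (- (s + snd p) + g))"
    using sub by (simp add: row_act_superset[OF _ sub] sum.reindex c add.assoc[symmetric] minus_add)
  also have "\<dots> = of_int m * row_act r u (- s + g)"
    by (simp add: row_act_def sum_distrib_left mult.assoc minus_add add.assoc del: add_uminus_conv_diff)
  finally show ?case by (simp add: ring_act_single)
qed

section \<open>A Kronecker theorem for compact groups\<close>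

context
  fixes E :: "'e set" and z :: "'e \<Rightarrow> 'x::{metric_space, topological_ab_group_add} \<Rightarrow> complex"
begin

definition monomial :: "('e \<Rightarrow> int) \<Rightarrow> 'x \<Rightarrow> complex" where
  "monomial a x = (\<Prod>e\<in>E. z e x powi a e)"

text \<open>Trigonometric polynomials with nonnegative coefficients. Different exponents may give
  the same function, even a constant one; as all coefficients are nonnegative, such coincidences can
  only increase the mean.\<close>

inductive_set positive_poly :: "('x \<Rightarrow> complex) set" where
  zero: "(\<lambda>x. 0) \<in> positive_poly"
| add: "f \<in> positive_poly \<Longrightarrow> 0 \<le> c \<Longrightarrow> (\<lambda>x. of_real c * monomial a x + f x) \<in> positive_poly"

lemma positive_poly_add:
  assumes "f \<in> positive_poly" "g \<in> positive_poly"
  shows "(\<lambda>x. f x + g x) \<in> positive_poly"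
  using assms(1)
proof induction
  case (add f c a)
  from positive_poly.add[OF add.IH add.hyps(2), of a] show ?case by (simp add: add.assoc)
qed (use assms(2) in simp)

lemma positive_poly_monomial: "0 \<le> c \<Longrightarrow> (\<lambda>x. of_real c * monomial a x) \<in> positive_poly"
  using positive_poly.add[OF positive_poly.zero, of c a] by simp

lemma positive_poly_scale:
  assumes "f \<in> positive_poly" "0 \<le> c"
  shows "(\<lambda>x. of_real c * f x) \<in> positive_poly"
  using assms(1)
proof induction
  case (add f d a)
  from positive_poly.add[OF add.IH, of "c * d" a] add.hyps(2) assms(2) show ?case
    by (simp add: distrib_left mult.assoc)
qed (simp add: positive_poly.zero)

lemma positive_poly_sum:
  assumes "finite I" "\<And>i. i \<in> I \<Longrightarrow> f i \<in> positive_poly"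
  shows "(\<lambda>x. \<Sum>i\<in>I. f i x) \<in> positive_poly"
  using assms by (induction I) (auto intro: positive_poly.zero positive_poly_add)

context
  assumes fin: "finite E" and z: "\<And>e x. cmod (z e x) = 1"
begin

lemma z_nonzero: "z e x \<noteq> 0"
  using z[of e x] by auto

lemma monomial_mult: "monomial a x * monomial b x = monomial (\<lambda>e. a e + b e) x"
  using z_nonzero by (simp add: monomial_def power_int_add prod.distrib)

lemma positive_poly_mult:
  assumes "f \<in> positive_poly" "g \<in> positive_poly"
  shows "(\<lambda>x. f x * g x) \<in> positive_poly"
  using assms(1)
proof induction
  case (add f c a)
  have "(\<lambda>x. of_real c * monomial a x * g x) \<in> positive_poly"
    using assms(2)
  proof induction
    case (add g d b)
    have "of_real c * monomial a x * (of_real d * monomial b x + g x) =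
       of_real (c * d) * monomial (\<lambda>e. a e + b e) x + of_real c * monomial a x * g x" for x
      by (simp only: monomial_mult[of a x b, symmetric]) (simp add: algebra_simps)
    with positive_poly.add[OF add.IH, of "c * d"] add.hyps(2) \<open>0 \<le> c\<close> show ?case by simp
  qed (simp add: positive_poly.zero)
  from positive_poly_add[OF this add.IH] show ?case by (simp add: distrib_right)
qed (simp add: positive_poly.zero)

text \<open>The \<open>2 * N\<close>-th power is the square of the modulus of
  \<open>\<Sum>i\<le>N. w i * z ^ i\<close> with binomial weights of total mass \<open>1\<close>.
  Its diagonal terms contribute the constant \<open>\<Sum>i\<le>N. (w i)\<^sup>2\<close>, which
  Cauchy-Schwarz bounds below by \<open>1 / (N + 1)\<close>.\<close>

lemma positive_poly_power:
  assumes e: "e \<in> E"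
  shows "\<exists>\<kappa>\<ge>1 / (real N + 1). (\<lambda>x. of_real ((cmod (1 + z e x) / 2) ^ (2 * N)) - of_real \<kappa>) \<in> positive_poly"
proof -
  define w where "w i = real (N choose i) / 2 ^ N" for i
  have w1: "(\<Sum>i\<le>N. w i) = 1"
    using choose_row_sum[of N] by (simp add: w_def flip: sum_divide_distrib of_nat_sum)
  define \<kappa> where "\<kappa> = (\<Sum>i\<le>N. (w i)\<^sup>2)"
  have "(\<Sum>i\<le>N. w i)\<^sup>2 \<le> (real (Suc N)) * \<kappa>"
    using sum_squared_le_sum_of_squares[of w "{..N}"] by (simp add: \<kappa>_def mult.commute)
  then have k: "\<kappa> \<ge> 1 / (real N + 1)" by (simp add: w1 field_simps)
  define m where "m n = (\<lambda>e'. if e' = e then n else 0 :: int)" for n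
  have mono: "monomial (m n) x = z e x powi n" for n x
  proof -
    have "monomial (m n) x = (\<Prod>e'\<in>E. if e' = e then z e x powi n else 1)"
      unfolding monomial_def m_def by (rule prod.cong) auto
    then show ?thesis using e fin by simp
  qed
  have expand: "((1 + z e x) / 2) ^ N = (\<Sum>i\<le>N. of_real (w i) * z e x ^ i)" for x
  proof -
    have "((1 + z e x) / 2) ^ N = (\<Sum>i\<le>N. of_nat (N choose i) * z e x ^ i) / 2 ^ N"
      using binomial_ring[of "z e x" 1 N] by (simp add: power_divide add.commute)
    then show ?thesis by (simp add: w_def sum_divide_distrib)
  qed
  have key: "of_real ((cmod (1 + z e x) / 2) ^ (2 * N)) =
     (\<Sum>p\<in>{..N}\<times>{..N}. of_real (w (fst p) * w (snd p)) * monomial (m (int (fst p) - int (snd p))) x)" for x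
  proof -
    have c: "cnj (z e x) = inverse (z e x)"
      using z[of e x] by (metis complex_norm_square inverse_unique of_real_1 power_one)
    have "of_real ((cmod (1 + z e x) / 2) ^ (2 * N)) = ((1 + z e x) / 2) ^ N * cnj (((1 + z e x) / 2) ^ N)"
    proof -
      have "of_real ((cmod (1 + z e x) / 2) ^ (2 * N)) = complex_of_real ((cmod (((1 + z e x) / 2) ^ N))\<^sup>2)"
        by (simp add: norm_power norm_divide power_mult[symmetric] mult.commute)
      then show ?thesis by (simp only: complex_norm_square)
    qed
    also have "\<dots> = (\<Sum>i\<le>N. \<Sum>j\<le>N. (of_real (w i) * z e x ^ i) * (of_real (w j) * inverse (z e x) ^ j))"
      unfolding expand by (simp add: c sum_product)
    also have "\<dots> = (\<Sum>p\<in>{..N}\<times>{..N}. (of_real (w (fst p)) * z e x ^ fst p) * (of_real (w (snd p)) * inverse (z e x) ^ snd p))"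
      by (simp add: sum.cartesian_product case_prod_beta)
    also have "\<dots> = (\<Sum>p\<in>{..N}\<times>{..N}. of_real (w (fst p) * w (snd p)) * monomial (m (int (fst p) - int (snd p))) x)"
      by (rule sum.cong) (auto simp: mono power_int_diff z_nonzero power_inverse divide_inverse)
    finally show ?thesis .
  qed
  define D where "D = {p\<in>{..N}\<times>{..N}. fst p = snd p}"
  have "(\<Sum>p\<in>D. of_real (w (fst p) * w (snd p)) * monomial (m (int (fst p) - int (snd p))) x) = (of_real \<kappa> :: complex)" for x
  proof -
    have D: "D = (\<lambda>i. (i, i)) ` {..N}" by (auto simp: D_def)
    show ?thesis unfolding D
      by (subst sum.reindex) (auto simp: inj_on_def mono \<kappa>_def power2_eq_square)
  qed
  moreover have "(\<Sum>p\<in>{..N}\<times>{..N}. of_real (w (fst p) * w (snd p)) * monomial (m (int (fst p) - int (snd p))) x) =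
    (\<Sum>p\<in>D. of_real (w (fst p) * w (snd p)) * monomial (m (int (fst p) - int (snd p))) x) +
    (\<Sum>p\<in>{..N}\<times>{..N} - D. of_real (w (fst p) * w (snd p)) * monomial (m (int (fst p) - int (snd p))) x)" for x
    by (subst sum.subset_diff[of D]) (auto simp: D_def)
  ultimately have "(\<lambda>x. of_real ((cmod (1 + z e x) / 2) ^ (2 * N)) - of_real \<kappa>) =
     (\<lambda>x. \<Sum>p\<in>{..N}\<times>{..N} - D. of_real (w (fst p) * w (snd p)) * monomial (m (int (fst p) - int (snd p))) x)"
    unfolding key by simp
  also have "\<dots> \<in> positive_poly"
    by (intro positive_poly_sum positive_poly_monomial) (auto simp: w_def)
  finally show ?thesis using k by blast
qed

text \<open>Constants multiply, since \<open>f * g - \<kappa> * \<nu>\<close> equals \<open>(f -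
  \<kappa>) * (g - \<nu>) + \<kappa> * (g - \<nu>) + \<nu> * (f - \<kappa>)\<close>.\<close>

lemma positive_poly_prod:
  assumes "F \<subseteq> E"
  shows "\<exists>\<kappa>\<ge>(1 / (real N + 1)) ^ card F.
    (\<lambda>x. (\<Prod>e\<in>F. of_real ((cmod (1 + z e x) / 2) ^ (2 * N))) - of_real \<kappa>) \<in> positive_poly"
proof -
  have "finite F" using assms fin finite_subset by blast
  then show ?thesis using assms
  proof induction
    case empty
    then show ?case using positive_poly.zero by (intro exI[of _ 1]) simp
  next
    case (insert e F)
    obtain \<kappa> where k: "\<kappa> \<ge> 1 / (real N + 1)" "(\<lambda>x. of_real ((cmod (1 + z e x) / 2) ^ (2 * N)) - of_real \<kappa>) \<in> positive_poly"
      using positive_poly_power insert.prems by blast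
    obtain \<nu> where l: "\<nu> \<ge> (1 / (real N + 1)) ^ card F"
       "(\<lambda>x. (\<Prod>e\<in>F. of_real ((cmod (1 + z e x) / 2) ^ (2 * N))) - of_real \<nu>) \<in> positive_poly"
      using insert.IH insert.prems by blast
    let ?f = "\<lambda>x. of_real ((cmod (1 + z e x) / 2) ^ (2 * N)) - complex_of_real \<kappa>"
    let ?g = "\<lambda>x. (\<Prod>e\<in>F. of_real ((cmod (1 + z e x) / 2) ^ (2 * N))) - complex_of_real \<nu>"
    have pos: "0 \<le> \<kappa>" "0 \<le> \<nu>" using k(1) l(1) by (auto intro: order_trans[rotated])
    have "(\<lambda>x. (?f x * ?g x + of_real \<kappa> * ?g x) + of_real \<nu> * ?f x) \<in> positive_poly"
      by (intro positive_poly_add positive_poly_mult positive_poly_scale k l pos)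
    moreover have "(?f x * ?g x + of_real \<kappa> * ?g x) + of_real \<nu> * ?f x =
       (\<Prod>e\<in>insert e F. of_real ((cmod (1 + z e x) / 2) ^ (2 * N))) - of_real (\<kappa> * \<nu>)" for x
      using insert.hyps by (simp add: algebra_simps)
    moreover have "\<kappa> * \<nu> \<ge> (1 / (real N + 1)) ^ card (insert e F)"
      using insert.hyps mult_mono[OF k(1) l(1)] pos by simp
    ultimately show ?case by (intro exI[of _ "\<kappa> * \<nu>"]) simp
  qed
qed

lemma positive_poly_mean:
  assumes mono: "\<And>a. has_mean (monomial a) 0 \<or> has_mean (monomial a) 1"
    and "f \<in> positive_poly"
  shows "\<exists>m\<ge>0. has_mean f (of_real m)"
  using assms(2)
proof induction
  case zero
  show ?case using has_mean_const[of 0] by (intro exI[of _ 0]) simp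
next
  case (add f c a)
  then obtain m where m: "m \<ge> 0" "has_mean f (of_real m)" by blast
  obtain j :: real where j: "j \<ge> 0" "has_mean (monomial a) (of_real j)"
    using mono[of a] by (metis of_real_0 of_real_1 order_refl zero_le_one)
  have "has_mean (\<lambda>x. of_real c * monomial a x + f x) (of_real c * of_real j + of_real m)"
    by (intro has_mean_add has_mean_linear[OF bounded_linear_mult_right] j m)
  then show ?case using m(1) j(1) add.hyps(2) by (intro exI[of _ "c * j + m"]) simp
qed

end
end

lemma exists_power_beats_polynomial:
  assumes "0 \<le> \<rho>" "\<rho> < (1::real)"
  shows "\<exists>N. \<rho> ^ N < (1 / (real N + 1)) ^ k"
proof -
  \<comment> \<open>The geometric factor is split into \<open>Suc k\<close> equal factors, each of
    which beats one factor \<open>N + 1\<close>. The maximum with \<open>1/2\<close> keeps the root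
    positive.\<close>
  define \<sigma> where "\<sigma> = root (Suc k) (max \<rho> (1/2))"
  have s: "0 < \<sigma>" "\<sigma> < 1"
    unfolding \<sigma>_def using assms by (auto simp: real_root_gt_0_iff)
  have s3: "\<sigma> ^ Suc k = max \<rho> (1/2)"
    unfolding \<sigma>_def using assms by (intro real_root_pow_pos2) auto
  have "(\<lambda>n. real n * \<sigma> ^ n) \<longlonglongrightarrow> 0"
    using powser_times_n_limit_0[of \<sigma>] s by simp
  from LIMSEQ_Suc[OF this] have "(\<lambda>n. (real n + 1) * \<sigma> ^ Suc n) \<longlonglongrightarrow> 0" by (simp add: add.commute)
  from order_tendstoD(2)[OF this s(1)] obtain N where "(real N + 1) * \<sigma> ^ Suc N < \<sigma>"
    by (auto simp: eventually_sequentially)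
  then have N: "(real N + 1) * \<sigma> ^ N < 1" using s(1) by simp
  have "((real N + 1) * \<sigma> ^ N) ^ Suc k < 1"
    using N s(1) power_Suc_less_one[of "(real N + 1) * \<sigma> ^ N" k] by (simp add: power_less_one_iff)
  moreover have "(real N + 1) ^ k * \<rho> ^ N \<le> ((real N + 1) * \<sigma> ^ N) ^ Suc k"
  proof -
    have "\<rho> ^ N \<le> (\<sigma> ^ Suc k) ^ N" unfolding s3 using assms by (intro power_mono) auto
    also have "\<dots> = (\<sigma> ^ N) ^ Suc k" by (simp only: power_mult[symmetric] mult.commute)
    finally have "(real N + 1) ^ k * \<rho> ^ N \<le> (real N + 1) ^ Suc k * (\<sigma> ^ N) ^ Suc k"
      using assms by (intro mult_mono) auto
    then show ?thesis by (simp only: power_mult_distrib)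
  qed
  ultimately have "(real N + 1) ^ k * \<rho> ^ N < 1" by linarith
  then show ?thesis by (intro exI[of _ N]) (simp add: power_divide field_simps)
qed

lemma prod_cis: "(\<Prod>e\<in>E. cis (f e)) = cis (\<Sum>e\<in>E. f e)"
  by (induction E rule: infinite_finite_induct) (auto simp: cis_mult)

lemma cmod_one_plus_unit:
  assumes "cmod z = 1"
  shows "(cmod (1 + z) / 2)\<^sup>2 = 1 - (cmod (z - 1))\<^sup>2 / 4"
proof -
  have "(cmod (1 + z))\<^sup>2 + (cmod (z - 1))\<^sup>2 = 2 + 2 * (cmod z)\<^sup>2"
    unfolding cmod_power2 by (simp add: power2_eq_square algebra_simps)
  then show ?thesis using assms by (simp add: power_divide field_simps)
qed

context
  assumes cpt: "compact (UNIV :: 'x::{metric_space, topological_ab_group_add} set)"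
begin

text \<open>If the point \<open>t\<close> is not approximated, the product of the \<open>\<bar>1 + z\<^sub>e\<bar>\<^sup>2\<^sup>N/4\<^sup>N\<close> is exponentially small in
  \<open>N\<close>. It is however a nonnegative combination of monomials, whose means are \<open>0\<close> or \<open>1\<close>, and its constant
  coefficient decays only polynomially.\<close>

lemma kronecker_finite:
  fixes \<psi> :: "'e \<Rightarrow> 'x pontryagin_dual" and t :: "'e \<Rightarrow> real"
  assumes fin: "finite E"
    and rel: "\<And>a :: 'e \<Rightarrow> int. (\<And>x. (\<Prod>e\<in>E. char_fun (\<psi> e) x powi a e) = 1) \<Longrightarrow> (\<Sum>e\<in>E. of_int (a e) * t e) \<in> \<int>"
    and "\<epsilon> > 0"
  shows "\<exists>x. \<forall>e\<in>E. cmod (char_fun (\<psi> e) x - cis (2 * pi * t e)) < \<epsilon>"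
proof (rule ccontr)
  assume contra: "\<not> ?thesis"
  define z where "z e x = cis (- (2 * pi * t e)) * char_fun (\<psi> e) x" for e x
  have z1: "cmod (z e x) = 1" for e x by (simp add: z_def norm_mult)
  have cz: "continuous_on UNIV (z e)" for e unfolding z_def by (intro continuous_intros char_fun_continuous)
  note zn = z_nonzero[of E z, OF fin z1]
  \<comment> \<open>A nontrivial character has mean \<open>0\<close> by translation invariance. If
    the character is trivial, \<open>rel\<close> makes the total phase an integer and the monomial
    is the constant \<open>1\<close>.\<close>
  have mono: "has_mean (monomial E z a) 0 \<or> has_mean (monomial E z a) 1" for a
  proof -
    define p where "p x = (\<Prod>e\<in>E. char_fun (\<psi> e) x powi a e)" for x
    define c where "c = (\<Prod>e\<in>E. cis (- (2 * pi * t e)) powi a e)"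
    have m: "monomial E z a x = c * p x" for x
      by (simp add: monomial_def z_def power_int_mult_distrib prod.distrib c_def p_def)
    have padd: "p (x + h) = p x * p h" for x h
      by (simp add: p_def char_fun_add power_int_mult_distrib prod.distrib)
    have cm: "continuous_on UNIV (monomial E z a)" unfolding monomial_def
      by (intro continuous_on_prod continuous_on_power_int cz) (use zn in auto)
    show ?thesis
    proof (cases "\<forall>x. p x = 1")
      case True
      then have "(\<Sum>e\<in>E. of_int (a e) * t e) \<in> \<int>" using rel unfolding p_def by blast
      then obtain k where k: "(\<Sum>e\<in>E. of_int (a e) * t e) = of_int k" by (auto elim: Ints_cases)
      have "cis (- (2 * pi * t e)) powi a e = cis (- (2 * pi) * (of_int (a e) * t e))" for e
        by (simp add: cis_power_int mult_ac)
      then have "c = cis (\<Sum>e\<in>E. - (2 * pi) * (of_int (a e) * t e))"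
        by (simp add: c_def prod_cis)
      also have "(\<Sum>e\<in>E. - (2 * pi) * (of_int (a e) * t e)) = 2 * pi * of_int (- k)"
        by (simp only: sum_distrib_left[symmetric] k)
      also have "cis (2 * pi * of_int (- k)) = 1" by (rule cis_multiple_2pi) simp
      finally have "monomial E z a = (\<lambda>_. 1)" using m True by auto
      then show ?thesis by (simp add: has_mean_const)
    next
      case False
      then obtain h where h: "p h \<noteq> 1" by blast
      have hm: "has_mean (monomial E z a) (mean (monomial E z a))" by (rule has_mean_mean[OF cpt cm])
      have "has_mean (\<lambda>x. p h * monomial E z a x) (p h * mean (monomial E z a))"
        by (rule has_mean_linear[OF bounded_linear_mult_right hm])
      moreover have "p h * monomial E z a x = monomial E z a (x + h)" for x by (simp add: m padd mult_ac)
      ultimately have "has_mean (\<lambda>x. monomial E z a (x + h)) (p h * mean (monomial E z a))" by simp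
      then have "p h * mean (monomial E z a) = mean (monomial E z a)"
        using has_mean_unique has_mean_shift[OF hm] by blast
      then have "mean (monomial E z a) = 0" using h by simp
      then show ?thesis using hm by simp
    qed
  qed
  define \<rho> where "\<rho> = max 0 (1 - \<epsilon>\<^sup>2 / 4)"
  have \<rho>: "0 \<le> \<rho>" "\<rho> < 1" using assms(3) by (auto simp: \<rho>_def)
  obtain N where N: "\<rho> ^ N < (1 / (real N + 1)) ^ card E" using exists_power_beats_polynomial[OF \<rho>] by blast
  define f where "f x = (\<Prod>e\<in>E. complex_of_real ((cmod (1 + z e x) / 2) ^ (2 * N)))" for x
  obtain \<kappa> where k: "\<kappa> \<ge> (1 / (real N + 1)) ^ card E" "(\<lambda>x. f x - of_real \<kappa>) \<in> positive_poly E z"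
    unfolding f_def using positive_poly_prod[of E z E N, OF fin z1 order_refl] by blast
  obtain m where m: "m \<ge> 0" "has_mean (\<lambda>x. f x - of_real \<kappa>) (of_real m)"
    using positive_poly_mean[where E = E and z = z, OF fin z1 mono k(2)] by blast
  from has_mean_add[OF m(2) has_mean_const[of "of_real \<kappa>"]]
  have hf: "has_mean f (of_real (m + \<kappa>))" by simp
  have sq: "(cmod (1 + z e x) / 2)\<^sup>2 = 1 - (cmod (z e x - 1))\<^sup>2 / 4" for e x
    by (rule cmod_one_plus_unit[OF z1])
  have fact: "(cmod (1 + z e x) / 2) ^ (2 * N) = ((cmod (1 + z e x) / 2)\<^sup>2) ^ N" for e x
    by (simp only: power_mult)
  have "cmod (f x - 0) \<le> \<rho> ^ N" for x
  proof -
    obtain e where e: "e \<in> E" "\<epsilon> \<le> cmod (char_fun (\<psi> e) x - cis (2 * pi * t e))" using contra by (meson not_le)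
    have "z e x - 1 = cis (- (2 * pi * t e)) * (char_fun (\<psi> e) x - cis (2 * pi * t e))"
      by (simp add: z_def right_diff_distrib cis_mult)
    then have "\<epsilon> \<le> cmod (z e x - 1)" using e(2) by (simp add: norm_mult)
    then have "\<epsilon>\<^sup>2 \<le> (cmod (z e x - 1))\<^sup>2" using assms(3) by (intro power_mono) auto
    then have "(cmod (1 + z e x) / 2)\<^sup>2 \<le> \<rho>" unfolding sq \<rho>_def by simp
    then have 1: "(cmod (1 + z e x) / 2) ^ (2 * N) \<le> \<rho> ^ N" unfolding fact by (intro power_mono) auto
    have 2: "(\<Prod>e\<in>E - {e}. (cmod (1 + z e x) / 2) ^ (2 * N)) \<le> 1"
    proof (rule prod_le_1)
      fix e'
      have "(cmod (1 + z e' x) / 2)\<^sup>2 \<le> 1" unfolding sq by simp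
      then show "0 \<le> (cmod (1 + z e' x) / 2) ^ (2 * N) \<and> (cmod (1 + z e' x) / 2) ^ (2 * N) \<le> 1"
        unfolding fact by (auto intro: power_le_one)
    qed
    have "cmod (f x - 0) = (\<Prod>e\<in>E. (cmod (1 + z e x) / 2) ^ (2 * N))"
      by (simp add: f_def norm_power norm_divide flip: prod_norm)
    also have "\<dots> = (cmod (1 + z e x) / 2) ^ (2 * N) * (\<Prod>e\<in>E - {e}. (cmod (1 + z e x) / 2) ^ (2 * N))"
      by (rule prod.remove[OF fin e(1)])
    also have "\<dots> \<le> \<rho> ^ N * 1"
      using 1 2 \<rho>(1) by (intro mult_mono) (auto intro: prod_nonneg)
    finally show ?thesis by simp
  qed
  from has_mean_shift_avg_bound[OF hf this] have "\<bar>m + \<kappa>\<bar> \<le> \<rho> ^ N" by (simp flip: of_real_add)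
  then show False using N k(1) m(1) by linarith
qed

text \<open>Finitely many characters at finite precision are covered by the previous lemma;
  compactness of \<open>X\<close> gives a common exact solution.\<close>

theorem kronecker:
  fixes \<psi> :: "'e \<Rightarrow> 'x pontryagin_dual" and t :: "'e \<Rightarrow> real"
  assumes rel: "\<And>E (a :: 'e \<Rightarrow> int). finite E \<Longrightarrow> (\<And>x. (\<Prod>e\<in>E. char_fun (\<psi> e) x powi a e) = 1) \<Longrightarrow>
      (\<Sum>e\<in>E. of_int (a e) * t e) \<in> \<int>"
  shows "\<exists>x. \<forall>e. char_fun (\<psi> e) x = cis (2 * pi * t e)"
proof -
  define C where "C = (\<lambda>(e, n :: nat). {x. cmod (char_fun (\<psi> e) x - cis (2 * pi * t e)) \<le> 1 / real (Suc n)})"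
  have "UNIV \<inter> \<Inter>(C ` UNIV) \<noteq> {}"
  proof (rule compact_imp_fip[OF cpt])
    show "closed T" if "T \<in> C ` UNIV" for T
      using that unfolding C_def
      by (auto intro!: closed_Collect_le continuous_intros char_fun_continuous)
    fix F' assume F': "finite F'" "F' \<subseteq> C ` UNIV"
    then obtain I where I: "finite I" "F' = C ` I" using finite_subset_image[OF F'] by blast
    define n where "n = Max (insert 0 (snd ` I))"
    obtain x where x: "\<And>e. e \<in> fst ` I \<Longrightarrow> cmod (char_fun (\<psi> e) x - cis (2 * pi * t e)) < 1 / real (Suc n)"
      using kronecker_finite[of "fst ` I" \<psi> t "1 / real (Suc n)"] I(1) rel by auto
    have "x \<in> C (e, k)" if ek: "(e, k) \<in> I" for e k
    proof -
      have "k \<le> n" unfolding n_def using I(1) ek by (intro Max_ge) force+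
      then have "1 / real (Suc n) \<le> 1 / real (Suc k)" by (intro divide_left_mono) auto
      moreover have "e \<in> fst ` I" using ek by force
      ultimately show ?thesis using x[of e] by (auto simp: C_def)
    qed
    then show "UNIV \<inter> \<Inter> F' \<noteq> {}" unfolding I(2) by fastforce
  qed
  then obtain x where x: "\<And>e n. cmod (char_fun (\<psi> e) x - cis (2 * pi * t e)) \<le> 1 / real (Suc n)"
    by (auto simp: C_def)
  have "cmod (char_fun (\<psi> e) x - cis (2 * pi * t e)) \<le> 0" for e
  proof (rule field_le_epsilon)
    fix d :: real assume "d > 0"
    then obtain n where "1 / real (Suc n) < d" using nat_approx_posE by blast
    then show "cmod (char_fun (\<psi> e) x - cis (2 * pi * t e)) \<le> 0 + d" using x[of e n] by linarith
  qed
  then show ?thesis by auto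
qed

end

section \<open>Square matrices close to a multiple of the identity\<close>

text \<open>The operator \<open>1 - \<alpha> / N\<close>. The value \<open>0\<close> in the
  components \<open>j \<ge> n\<close> keeps bounds that are uniform in all components valid under
  iteration.\<close>

definition defect :: "nat \<Rightarrow> (nat \<Rightarrow> nat \<Rightarrow>\<^sub>0 'g::group_add \<Rightarrow>\<^sub>0 int) \<Rightarrow> real \<Rightarrow> (nat \<Rightarrow> 'g \<Rightarrow> real) \<Rightarrow> nat \<Rightarrow> 'g \<Rightarrow> real" where
  "defect n \<alpha> N u j g = (if j < n then u j g - row_act (\<alpha> j) u g / N else 0)"

text \<open>Testing all configurations bounded by \<open>1\<close> at the single place
  \<open>0\<close> amounts to a bound on the sum of the absolute values of the coefficients in each
  row of \<open>N - \<alpha>\<close>.\<close>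

definition near_identity :: "nat \<Rightarrow> (nat \<Rightarrow> nat \<Rightarrow>\<^sub>0 'g::group_add \<Rightarrow>\<^sub>0 int) \<Rightarrow> real \<Rightarrow> bool" where
  "near_identity n \<alpha> N \<longleftrightarrow> N > 0 \<and> (\<forall>j<n. \<alpha> j \<in> free_module n) \<and>
     (\<forall>j<n. \<forall>u. (\<forall>i g. \<bar>u i g\<bar> \<le> 1) \<longrightarrow> \<bar>N * u j 0 - row_act (\<alpha> j) u 0\<bar> \<le> N / 2)"

context
  fixes n :: nat and \<alpha> :: "nat \<Rightarrow> nat \<Rightarrow>\<^sub>0 'g::group_add \<Rightarrow>\<^sub>0 int" and N :: real
  assumes near: "near_identity n \<alpha> N"
begin

private abbreviation "Q \<equiv> defect n \<alpha> N"

definition defect_supp :: "nat \<Rightarrow> (nat \<times> 'g) set" where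
  "defect_supp j = insert (j, 0) (row_supp (\<alpha> j))"

definition defect_coef :: "nat \<Rightarrow> nat \<times> 'g \<Rightarrow> real" where
  "defect_coef j p = (if p = (j, 0) then 1 else 0) - of_int (coef (\<alpha> j) p) / N"

private lemma N_pos: "N > 0"
  using near by (simp add: near_identity_def)

lemma finite_defect_supp: "finite (defect_supp j)"
  by (simp add: defect_supp_def)

lemma defect_sum:
  "j < n \<Longrightarrow> Q u j g = (\<Sum>p\<in>defect_supp j. defect_coef j p * u (fst p) (- snd p + g))"
proof -
  assume j: "j < n"
  have "row_act (\<alpha> j) u g = (\<Sum>p\<in>defect_supp j. of_int (coef (\<alpha> j) p) * u (fst p) (- snd p + g))"
    by (rule row_act_superset[OF finite_defect_supp]) (auto simp: defect_supp_def)
  moreover have "(\<Sum>p\<in>defect_supp j. (if p = (j, 0) then 1 else 0) * u (fst p) (- snd p + g)) = u j g"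
  proof -
    have "(\<Sum>p\<in>defect_supp j. (if p = (j, 0) then 1 else 0) * u (fst p) (- snd p + g)) =
      (\<Sum>p\<in>defect_supp j. if p = (j, 0) then u j g else 0)" by (rule sum.cong) auto
    then show ?thesis by (simp add: finite_defect_supp) (simp add: defect_supp_def)
  qed
  ultimately show ?thesis using j
    by (simp add: defect_def defect_coef_def left_diff_distrib sum_subtractf sum_divide_distrib)
qed

text \<open>The extremal test configuration consists of the signs of the coefficients.\<close>

lemma defect_coef_sum:
  assumes j: "j < n"
  shows "(\<Sum>p\<in>defect_supp j. \<bar>defect_coef j p\<bar>) \<le> 1 / 2"
proof -
  define u where "u i h = sgn (defect_coef j (i, - h))" for i h
  have "\<bar>u i h\<bar> \<le> 1" for i h by (simp add: u_def abs_sgn_eq)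
  then have "\<bar>N * u j 0 - row_act (\<alpha> j) u 0\<bar> \<le> N / 2" using near j by (simp add: near_identity_def)
  moreover have "N * u j 0 - row_act (\<alpha> j) u 0 = N * Q u j 0" using j N_pos by (simp add: defect_def right_diff_distrib)
  moreover have "Q u j 0 = (\<Sum>p\<in>defect_supp j. \<bar>defect_coef j p\<bar>)"
    unfolding defect_sum[OF j] by (rule sum.cong) (auto simp: u_def abs_sgn mult.commute)
  ultimately have "N * (\<Sum>p\<in>defect_supp j. \<bar>defect_coef j p\<bar>) \<le> N * (1 / 2)" by simp
  then show ?thesis using N_pos by (simp only: mult_le_cancel_left_pos)
qed

lemma defect_bound_at:
  assumes "0 \<le> M" "\<And>p. p \<in> defect_supp j \<Longrightarrow> \<bar>u (fst p) (- snd p + g)\<bar> \<le> M"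
  shows "\<bar>Q u j g\<bar> \<le> M / 2"
proof (cases "j < n")
  case True
  have "\<bar>Q u j g\<bar> \<le> (\<Sum>p\<in>defect_supp j. \<bar>defect_coef j p\<bar> * M)"
    unfolding defect_sum[OF True]
    by (rule order_trans[OF sum_abs sum_mono]) (auto simp: abs_mult intro!: mult_left_mono assms)
  also have "\<dots> \<le> 1 / 2 * M" unfolding sum_distrib_right[symmetric]
    by (intro mult_right_mono defect_coef_sum True assms)
  finally show ?thesis by simp
qed (use assms(1) in \<open>simp add: defect_def\<close>)

lemma defect_power_bound:
  assumes "0 \<le> M" "\<And>i g. \<bar>u i g\<bar> \<le> M"
  shows "\<bar>(Q ^^ k) u j g\<bar> \<le> M / 2 ^ k"
proof (induction k arbitrary: j g)
  case (Suc k)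
  have "\<bar>Q ((Q ^^ k) u) j g\<bar> \<le> M / 2 ^ k / 2"
    by (rule defect_bound_at) (use assms(1) Suc.IH in auto)
  then show ?case by (simp add: mult.commute)
qed (use assms in simp)

text \<open>Translation does not change sums over the group. As the components are bounded
  separately by the same \<open>M\<close>, the row sums of \<open>defect_coef\<close> suffice here
  too, with the same factor \<open>1/2\<close> as for the supremum.\<close>

lemma defect_l1:
  assumes "0 \<le> M" "\<And>i E. finite E \<Longrightarrow> (\<Sum>g\<in>E. \<bar>u i g\<bar>) \<le> M" and E: "finite E"
  shows "(\<Sum>g\<in>E. \<bar>Q u j g\<bar>) \<le> M / 2"
proof (cases "j < n")
  case True
  have "(\<Sum>g\<in>E. \<bar>Q u j g\<bar>) \<le> (\<Sum>g\<in>E. \<Sum>p\<in>defect_supp j. \<bar>defect_coef j p\<bar> * \<bar>u (fst p) (- snd p + g)\<bar>)"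
    unfolding defect_sum[OF True] by (rule sum_mono) (rule order_trans[OF sum_abs], simp add: abs_mult)
  also have "\<dots> = (\<Sum>p\<in>defect_supp j. \<bar>defect_coef j p\<bar> * (\<Sum>g\<in>E. \<bar>u (fst p) (- snd p + g)\<bar>))"
    by (subst sum.swap) (simp add: sum_distrib_left)
  also have "\<dots> \<le> (\<Sum>p\<in>defect_supp j. \<bar>defect_coef j p\<bar> * M)"
  proof (intro sum_mono mult_left_mono)
    fix p
    have "(\<Sum>g\<in>E. \<bar>u (fst p) (- snd p + g)\<bar>) = (\<Sum>g\<in>(+) (- snd p) ` E. \<bar>u (fst p) g\<bar>)"
      by (subst sum.reindex) auto
    also have "\<dots> \<le> M" by (rule assms(2)) (use E in simp)
    finally show "(\<Sum>g\<in>E. \<bar>u (fst p) (- snd p + g)\<bar>) \<le> M" .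
  qed auto
  also have "\<dots> \<le> 1 / 2 * M" unfolding sum_distrib_right[symmetric]
    by (intro mult_right_mono defect_coef_sum True assms)
  finally show ?thesis by simp
qed (use assms(1) in \<open>simp add: defect_def\<close>)

lemma defect_power_l1:
  assumes "0 \<le> M" "\<And>i E. finite E \<Longrightarrow> (\<Sum>g\<in>E. \<bar>u i g\<bar>) \<le> M" "finite E"
  shows "(\<Sum>g\<in>E. \<bar>(Q ^^ k) u j g\<bar>) \<le> M / 2 ^ k"
  using assms(3)
proof (induction k arbitrary: j E)
  case (Suc k)
  have "(\<Sum>g\<in>E. \<bar>Q ((Q ^^ k) u) j g\<bar>) \<le> M / 2 ^ k / 2"
    by (rule defect_l1) (use assms(1) Suc in auto)
  then show ?case by (simp add: mult.commute)
qed (use assms in simp)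

lemma row_act_defect: "j < n \<Longrightarrow> row_act (\<alpha> j) u g = N * (u j g - Q u j g)"
  using N_pos by (simp add: defect_def)

lemma fst_defect_supp: "j < n \<Longrightarrow> p \<in> defect_supp j \<Longrightarrow> fst p < n"
  using near fst_row_supp[of "\<alpha> j" n p] by (auto simp: defect_supp_def near_identity_def)

text \<open>Where \<open>\<alpha>u\<close> vanishes, \<open>u\<close> equals its image under the
  defect operator, which is half as large as \<open>u\<close> on a slightly larger window. After
  \<open>k\<close> rounds the bound is \<open>M / 2 ^ k\<close>, and \<open>T\<close> collects the
  places seen in these rounds.\<close>

lemma near_identity_local:
  assumes "\<epsilon> > 0" "0 \<le> M"
  shows "\<exists>T. finite T \<and> (\<forall>u g. (\<forall>i g. \<bar>u i g\<bar> \<le> M) \<longrightarrow> (\<forall>t\<in>T. \<forall>j<n. row_act (\<alpha> j) u (t + g) = 0) \<longrightarrow>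
     (\<forall>j<n. \<bar>u j g\<bar> < \<epsilon>))"
proof -
  define P where "P T b \<longleftrightarrow> (\<forall>u g. (\<forall>i g. \<bar>u i g\<bar> \<le> M) \<longrightarrow> (\<forall>t\<in>T. \<forall>j<n. row_act (\<alpha> j) u (t + g) = 0) \<longrightarrow>
     (\<forall>j<n. \<bar>u j g\<bar> \<le> b))" for T b
  have step: "\<exists>T. finite T \<and> P T (M / 2 ^ k)" for k
  proof (induction k)
    case 0
    show ?case by (intro exI[of _ "{}"]) (simp add: P_def)
  next
    case (Suc k)
    then obtain T where T: "finite T" "P T (M / 2 ^ k)" by blast
    define R where "R = (\<Union>j<n. snd ` defect_supp j)"
    define T' where "T' = insert 0 ((\<lambda>(t, s). t + - s) ` (T \<times> R))"
    have "finite R" by (auto simp: R_def finite_defect_supp)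
    then have fT': "finite T'" using T(1) by (simp add: T'_def)
    have "\<bar>u j g\<bar> \<le> M / 2 ^ Suc k" if u: "\<forall>i g. \<bar>u i g\<bar> \<le> M"
      and z: "\<forall>t\<in>T'. \<forall>j<n. row_act (\<alpha> j) u (t + g) = 0" and j: "j < n" for u g j
    proof -
      have "0 \<in> T'" by (simp add: T'_def)
      then have "row_act (\<alpha> j) u (0 + g) = 0" using z j by blast
      then have "u j g = Q u j g" by (simp add: defect_def j)
      moreover have "\<bar>Q u j g\<bar> \<le> M / 2 ^ k / 2"
      proof (rule defect_bound_at)
        fix p assume p: "p \<in> defect_supp j"
        have "snd p \<in> R" using p j by (auto simp: R_def)
        then have "t + - snd p \<in> T'" if "t \<in> T" for t
          using that unfolding T'_def by (intro insertI2 image_eqI[of _ _ "(t, snd p)"]) auto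
        then have "\<forall>t\<in>T. \<forall>j<n. row_act (\<alpha> j) u ((t + - snd p) + g) = 0" using z by blast
        then have "\<forall>t\<in>T. \<forall>j<n. row_act (\<alpha> j) u (t + (- snd p + g)) = 0" by (simp only: add.assoc)
        then show "\<bar>u (fst p) (- snd p + g)\<bar> \<le> M / 2 ^ k"
          using T(2) u fst_defect_supp[OF j p] unfolding P_def by blast
      qed (use assms(2) in simp)
      ultimately show ?thesis by (simp add: mult.commute)
    qed
    then show ?case using fT' unfolding P_def by blast
  qed
  obtain k where "M / \<epsilon> < 2 ^ k" using real_arch_pow[of 2 "M / \<epsilon>"] by auto
  then have k: "M / 2 ^ k < \<epsilon>" using assms(1) by (simp add: field_simps)
  from step[of k] obtain T where "finite T" "P T (M / 2 ^ k)" by blast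
  with k show ?thesis unfolding P_def by (meson le_less_trans)
qed

text \<open>The Neumann series: \<open>u\<close> is \<open>1 / N\<close> times the sum of the
  iterates of the defect operator on \<open>z\<close>, and the factor \<open>2\<close> is the sum of
  the geometric series.\<close>

lemma near_identity_solve:
  assumes M: "0 \<le> M" "\<And>i g. \<bar>z i g\<bar> \<le> M"
    and L: "0 \<le> L" "\<And>i E. finite E \<Longrightarrow> (\<Sum>g\<in>E. \<bar>z i g\<bar>) \<le> L"
  shows "\<exists>u. (\<forall>j<n. \<forall>g. row_act (\<alpha> j) u g = z j g) \<and> (\<forall>i g. \<bar>u i g\<bar> \<le> 2 * M / N) \<and>
    (\<forall>i E. finite E \<longrightarrow> (\<Sum>g\<in>E. \<bar>u i g\<bar>) \<le> 2 * L / N)"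
proof -
  define v where "v k = (Q ^^ k) z" for k
  have v: "\<bar>v k i g\<bar> \<le> M / 2 ^ k" for k i g unfolding v_def by (rule defect_power_bound[OF M])
  have geo: "(\<lambda>k. c / 2 ^ k) sums (2 * c)" for c :: real
    using sums_mult[OF geometric_sums[of "1/2::real"], of c] by (simp add: power_one_over field_simps)
  have abs_sm: "summable (\<lambda>k. \<bar>v k i g\<bar>)" for i g
    by (rule summable_comparison_test'[OF sums_summable[OF geo[of M]], of 0]) (use v in simp)
  have sm: "summable (\<lambda>k. v k i g)" for i g by (rule summable_rabs_cancel[OF abs_sm])
  define u where "u i g = suminf (\<lambda>k. v k i g) / N" for i g
  have "row_act (\<alpha> j) u g = z j g" if j: "j < n" for j g
  proof -
    have "N * Q u j g = (\<Sum>p\<in>defect_supp j. defect_coef j p * (suminf (\<lambda>k. v k (fst p) (- snd p + g))))"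
      using N_pos by (simp add: defect_sum[OF j] u_def sum_distrib_left)
    also have "\<dots> = (\<Sum>p\<in>defect_supp j. suminf (\<lambda>k. defect_coef j p * v k (fst p) (- snd p + g)))"
      by (simp add: suminf_mult[OF sm])
    also have "\<dots> = (suminf (\<lambda>k. \<Sum>p\<in>defect_supp j. defect_coef j p * v k (fst p) (- snd p + g)))"
      by (rule suminf_sum[symmetric]) (intro summable_mult sm)
    also have "\<dots> = (suminf (\<lambda>k. v (Suc k) j g))" by (simp add: v_def defect_sum[OF j])
    also have "\<dots> = (suminf (\<lambda>k. v k j g)) - v 0 j g" by (rule suminf_split_head[OF sm])
    finally have "N * Q u j g = N * u j g - z j g" using N_pos by (simp add: u_def v_def)
    then show ?thesis by (simp add: row_act_defect[OF j] right_diff_distrib)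
  qed
  moreover have "\<bar>u i g\<bar> \<le> 2 * M / N" for i g
  proof -
    have "\<bar>suminf (\<lambda>k. v k i g)\<bar> \<le> (suminf (\<lambda>k. \<bar>v k i g\<bar>))" by (rule summable_rabs[OF abs_sm])
    also have "\<dots> \<le> (suminf (\<lambda>k. M / 2 ^ k))" by (rule suminf_le[OF v abs_sm sums_summable[OF geo]])
    also have "\<dots> = 2 * M" by (rule sums_unique[OF geo, symmetric])
    finally show ?thesis using N_pos by (simp add: u_def divide_right_mono)
  qed
  moreover have "(\<Sum>g\<in>E. \<bar>u i g\<bar>) \<le> 2 * L / N" if E: "finite E" for i E
  proof -
    have "(\<Sum>g\<in>E. \<bar>suminf (\<lambda>k. v k i g)\<bar>) \<le> (\<Sum>g\<in>E. suminf (\<lambda>k. \<bar>v k i g\<bar>))"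
      by (intro sum_mono summable_rabs[OF abs_sm])
    also have "\<dots> = (suminf (\<lambda>k. \<Sum>g\<in>E. \<bar>v k i g\<bar>))" by (rule suminf_sum[symmetric]) (rule abs_sm)
    also have "\<dots> \<le> (suminf (\<lambda>k. L / 2 ^ k))"
    proof (rule suminf_le)
      show "(\<Sum>g\<in>E. \<bar>v k i g\<bar>) \<le> L / 2 ^ k" for k unfolding v_def by (rule defect_power_l1[OF L E])
      show "summable (\<lambda>k. \<Sum>g\<in>E. \<bar>v k i g\<bar>)" by (intro summable_sum abs_sm)
    qed (rule sums_summable[OF geo])
    also have "\<dots> = 2 * L" by (rule sums_unique[OF geo, symmetric])
    finally show ?thesis using N_pos by (simp add: u_def divide_right_mono flip: sum_divide_distrib)
  qed
  ultimately show ?thesis by blast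
qed

end

section \<open>Existence of a nearly scalar matrix of relations\<close>

definition linear_functional :: "((nat \<Rightarrow> 'g \<Rightarrow> real) \<Rightarrow> real) \<Rightarrow> bool" where
  "linear_functional F \<longleftrightarrow> (\<forall>a b u v. F (\<lambda>i g. a * u i g + b * v i g) = a * F u + b * F v)"

definition balanced_convex :: "(nat \<Rightarrow> 'g \<Rightarrow> real) set \<Rightarrow> bool" where
  "balanced_convex C \<longleftrightarrow> (\<forall>u\<in>C. \<forall>v\<in>C. \<forall>a b. \<bar>a\<bar> + \<bar>b\<bar> \<le> 1 \<longrightarrow> (\<lambda>i g. a * u i g + b * v i g) \<in> C)"

text \<open>The multiplier \<open>d\<close> has to lie above all quotients
  \<open>(F u - r) / G u\<close> with \<open>G u > 0\<close> and below all those with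
  \<open>G u < 0\<close>. Such a number exists because a convex combination of two points of
  opposite sign on which \<open>G\<close> vanishes compares the two quotients.\<close>

lemma lagrange_one:
  assumes C: "balanced_convex C" and F: "linear_functional F" and G: "linear_functional G"
    and r: "\<And>u. u \<in> C \<Longrightarrow> G u = 0 \<Longrightarrow> F u \<le> r"
  shows "\<exists>d. \<forall>u\<in>C. F u - d * G u \<le> r"
proof (cases "\<exists>u\<in>C. G u \<noteq> 0")
  case False
  then show ?thesis using r by (intro exI[of _ 0]) auto
next
  case True
  then obtain w where w: "w \<in> C" "G w \<noteq> 0" by blast
  have neg: "(\<lambda>i g. - u i g) \<in> C \<and> G (\<lambda>i g. - u i g) = - G u \<and> F (\<lambda>i g. - u i g) = - F u" if "u \<in> C" for u
  proof -
    have "(\<lambda>i g. (-1) * u i g + 0 * u i g) \<in> C"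
      using C[unfolded balanced_convex_def, rule_format, OF that that, of "-1" 0] by simp
    moreover have "G (\<lambda>i g. (-1) * u i g + 0 * u i g) = - G u" "F (\<lambda>i g. (-1) * u i g + 0 * u i g) = - F u"
      using F G unfolding linear_functional_def by (metis add.right_neutral mult_minus1 mult_zero_left)+
    ultimately show ?thesis by simp
  qed
  define P where "P = (\<lambda>u. (F u - r) / G u) ` {u\<in>C. G u > 0}"
  have cross: "(F u - r) / G u \<le> (F v - r) / G v" if u: "u \<in> C" "G u > 0" and v: "v \<in> C" "G v < 0" for u v
  proof -
    \<comment> \<open>Weights of the convex combination of \<open>u\<close> and \<open>v\<close> at
      which \<open>G\<close> vanishes.\<close>
    define a where "a = - G v / (G u - G v)"
    define b where "b = G u / (G u - G v)"
    have D: "G u - G v > 0" using u v by simp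
    have aD: "a * (G u - G v) = - G v" and bD: "b * (G u - G v) = G u" using D by (auto simp: a_def b_def)
    have "a \<ge> 0" "b \<ge> 0" using u v D unfolding a_def b_def by (auto intro!: divide_nonneg_pos simp del: minus_divide_left[symmetric])
    moreover have "(a + b) * (G u - G v) = 1 * (G u - G v)" unfolding distrib_right aD bD by simp
    then have "a + b = 1" using D by (subst (asm) mult_right_cancel) auto
    ultimately have ab: "a \<ge> 0" "b \<ge> 0" "a + b = 1" by auto
    have "(\<lambda>i g. a * u i g + b * v i g) \<in> C" using C u v ab unfolding balanced_convex_def by auto
    moreover have "G (\<lambda>i g. a * u i g + b * v i g) = 0"
    proof -
      have "a * G u + b * G v = 0" by (simp add: a_def b_def)
      then show ?thesis using G by (simp add: linear_functional_def)
    qed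
    ultimately have "F (\<lambda>i g. a * u i g + b * v i g) \<le> r" by (rule r)
    then have "a * F u + b * F v \<le> (a + b) * r" using F ab by (simp add: linear_functional_def)
    then have "(a * F u + b * F v) * (G u - G v) \<le> ((a + b) * r) * (G u - G v)"
      using D by (intro mult_right_mono) auto
    then have "(a * (G u - G v)) * F u + (b * (G u - G v)) * F v \<le> (a * (G u - G v) + b * (G u - G v)) * r"
      by (simp add: algebra_simps)
    then have "(F v - r) * G u \<le> (F u - r) * G v" unfolding aD bD by (simp add: algebra_simps)
    then have "F v - r \<le> (F u - r) / G u * G v" by (simp add: pos_le_divide_eq[OF u(2)])
    then show ?thesis by (simp only: neg_le_divide_eq[OF v(2)])
  qed
  obtain u0 where u0: "u0 \<in> C" "G u0 > 0"
    using w neg[OF w(1)] by (metis linorder_neqE_linordered_idom neg_0_less_iff_less)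
  let ?v0 = "\<lambda>i g. - u0 i g"
  have v0: "?v0 \<in> C" "G ?v0 < 0" using neg[OF u0(1)] u0(2) by auto
  have bdd: "bdd_above P" unfolding P_def using cross[OF _ _ v0] by (intro bdd_aboveI[of _ "(F ?v0 - r) / G ?v0"]) auto
  have ne: "P \<noteq> {}" unfolding P_def using u0 by auto
  have "F u - Sup P * G u \<le> r" if u: "u \<in> C" for u
  proof -
    consider "G u = 0" | "G u > 0" | "G u < 0" by linarith
    then show ?thesis
    proof cases
      case 1
      then show ?thesis using r[OF u] by simp
    next
      case 2
      then have "(F u - r) / G u \<le> Sup P" using u by (intro cSup_upper bdd) (auto simp: P_def)
      then show ?thesis using 2 by (simp add: pos_divide_le_eq)
    next
      case 3
      have "Sup P \<le> (F u - r) / G u"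
        by (rule cSup_least[OF ne]) (use cross[OF _ _ u 3] in \<open>auto simp: P_def\<close>)
      then show ?thesis using 3 by (simp add: neg_le_divide_eq)
    qed
  qed
  then show ?thesis by blast
qed

text \<open>The constraints after the first are treated on the subset where the first functional
  vanishes, which is again balanced and convex; the last multiplier comes from
  \<open>lagrange_one\<close>.\<close>

lemma lagrange_list:
  assumes "balanced_convex C" "linear_functional F" "\<forall>G\<in>set Gs. linear_functional G"
    "\<And>u. u \<in> C \<Longrightarrow> \<forall>G\<in>set Gs. G u = 0 \<Longrightarrow> F u \<le> r"
  shows "\<exists>c. \<forall>u\<in>C. F u - (\<Sum>k<length Gs. c k * (Gs ! k) u) \<le> r"
  using assms
proof (induction Gs arbitrary: C)
  case (Cons G Gs)
  let ?C = "{u \<in> C. G u = 0}"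
  have "balanced_convex ?C" using Cons.prems(1,3)
    unfolding balanced_convex_def linear_functional_def by simp
  moreover have "F u \<le> r" if "u \<in> ?C" "\<forall>G\<in>set Gs. G u = 0" for u
    using Cons.prems(4) that by simp
  ultimately obtain c where c: "\<forall>u\<in>?C. F u - (\<Sum>k<length Gs. c k * (Gs ! k) u) \<le> r"
    using Cons.IH[of ?C] Cons.prems(2,3) by auto
  let ?F = "\<lambda>u. F u - (\<Sum>k<length Gs. c k * (Gs ! k) u)"
  have "linear_functional ?F"
    unfolding linear_functional_def
  proof (intro allI)
    fix a b u v
    have "(\<Sum>k<length Gs. c k * (Gs ! k) (\<lambda>i g. a * u i g + b * v i g)) =
      a * (\<Sum>k<length Gs. c k * (Gs ! k) u) + b * (\<Sum>k<length Gs. c k * (Gs ! k) v)"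
      unfolding sum_distrib_left sum.distrib[symmetric]
    proof (rule sum.cong)
      fix k assume "k \<in> {..<length Gs}"
      then have "linear_functional (Gs ! k)" using Cons.prems(3) by auto
      then show "c k * (Gs ! k) (\<lambda>i g. a * u i g + b * v i g) = a * (c k * (Gs ! k) u) + b * (c k * (Gs ! k) v)"
        by (simp add: linear_functional_def algebra_simps)
    qed simp
    then show "?F (\<lambda>i g. a * u i g + b * v i g) = a * ?F u + b * ?F v"
      using Cons.prems(2) by (simp add: linear_functional_def algebra_simps)
  qed
  then obtain d where d: "\<forall>u\<in>C. ?F u - d * G u \<le> r"
    using lagrange_one[OF Cons.prems(1), of ?F G r] Cons.prems(3) c by auto
  have eq: "F u - (\<Sum>k<length (G # Gs). (case k of 0 \<Rightarrow> d | Suc k \<Rightarrow> c k) * ((G # Gs) ! k) u) = ?F u - d * G u" for u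
    unfolding length_Cons sum.lessThan_Suc_shift by simp
  show ?case
    by (rule exI[of _ "\<lambda>k. case k of 0 \<Rightarrow> d | Suc k \<Rightarrow> c k"]) (unfold eq, rule d)
qed simp

definition row_norm :: "(nat \<Rightarrow>\<^sub>0 'g \<Rightarrow>\<^sub>0 int) \<Rightarrow> real" where
  "row_norm a = (\<Sum>p\<in>row_supp a. \<bar>of_int (coef a p)\<bar>)"

lemma row_norm_nonneg: "0 \<le> row_norm a"
  by (simp add: row_norm_def sum_nonneg)

lemma row_act_bound:
  assumes "\<And>i g. \<bar>u i g\<bar> \<le> M"
  shows "\<bar>row_act a u g\<bar> \<le> row_norm a * M"
  unfolding row_act_def row_norm_def sum_distrib_right
  by (rule order_trans[OF sum_abs sum_mono]) (auto simp: abs_mult intro!: mult_left_mono assms)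

text \<open>By compactness of \<open>[-1,1]\<^sup>n\<^sup>\<times>\<^sup>G\<close> finitely many relations suffice up to an error \<open>r\<close>.\<close>

lemma separating_relations:
  fixes J :: "(nat \<Rightarrow>\<^sub>0 'g::group_add \<Rightarrow>\<^sub>0 int) set"
  assumes J: "submodule free_scale J"
    and inj: "\<And>u. (\<And>i g. \<bar>u i g\<bar> \<le> 1) \<Longrightarrow> (\<And>a g. a \<in> J \<Longrightarrow> row_act a u g = 0) \<Longrightarrow> u j 0 = 0"
    and r: "r > 0"
  shows "\<exists>as. set as \<subseteq> J \<and> (\<forall>u. (\<forall>i g. \<bar>u i g\<bar> \<le> 1) \<longrightarrow> (\<forall>a\<in>set as. row_act a u 0 = 0) \<longrightarrow> u j 0 \<le> r)"
proof -
  define K where "K = PiE UNIV (\<lambda>_ :: nat \<times> 'g. {-1..1::real})"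
  have "compactin (product_topology (\<lambda>_::nat \<times> 'g. euclidean) UNIV) (PiE UNIV (\<lambda>_. {-1..1::real}))"
    unfolding compactin_PiE by simp
  then have K: "compact K"
    unfolding K_def by (simp add: euclidean_product_topology)
  define T0 where "T0 = {x :: nat \<times> 'g \<Rightarrow> real. r \<le> x (j, 0)}"
  define T where "T = (\<lambda>(a, g). {x :: nat \<times> 'g \<Rightarrow> real. row_act a (\<lambda>i g. x (i, g)) g = 0})"
  have closed: "closed S" if "S \<in> insert T0 (T ` (J \<times> UNIV))" for S
  proof -
    have "closed T0" unfolding T0_def by (intro closed_Collect_le continuous_intros) simp
    moreover have "closed (T (a, g))" for a g
      unfolding T_def prod.case row_act_def
      by (intro closed_Collect_eq continuous_intros) simp_all
    ultimately show ?thesis using that by auto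
  qed
  have empty: "K \<inter> \<Inter>(insert T0 (T ` (J \<times> UNIV))) = {}"
  proof (rule ccontr)
    assume "\<not> ?thesis"
    then obtain x where x0: "x \<in> K" "x \<in> \<Inter>(insert T0 (T ` (J \<times> UNIV)))" by auto
    have x: "x \<in> K" "x \<in> T0" "x \<in> T (a, g)" if "a \<in> J" for a g
      using x0 that by auto
    have "x (j, 0) = 0"
    proof (rule inj[of "\<lambda>i g. x (i, g)"])
      fix i g show "\<bar>x (i, g)\<bar> \<le> 1" 
        using PiE_mem[OF x0(1)[unfolded K_def], of "(i, g)"] by (auto simp: abs_le_iff)
    qed (use x(3) in \<open>auto simp: T_def\<close>)
    then show False using x0(2) r by (simp add: T0_def)
  qed
  have "\<exists>F. finite F \<and> F \<subseteq> insert T0 (T ` (J \<times> UNIV)) \<and> K \<inter> \<Inter>F = {}"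
  proof (rule ccontr)
    assume no: "\<not> ?thesis"
    have "K \<inter> \<Inter>(insert T0 (T ` (J \<times> UNIV))) \<noteq> {}"
      by (rule compact_imp_fip[OF K closed]) (use no in blast)+
    with empty show False by contradiction
  qed
  then obtain F where F: "finite F" "F \<subseteq> insert T0 (T ` (J \<times> UNIV))" "K \<inter> \<Inter>F = {}" by blast
  have "F - {T0} \<subseteq> T ` (J \<times> UNIV)" using F(2) by blast
  then obtain I where I: "I \<subseteq> J \<times> UNIV" "finite I" "F - {T0} = T ` I"
    using finite_subset_image[of "F - {T0}" T "J \<times> UNIV"] F(1) by auto
  obtain is' where is': "set is' = I" using finite_list[OF I(2)] by blast
  \<comment> \<open>Vanishing of \<open>a\<close> at \<open>g\<close> is vanishing at
    \<open>0\<close> of a translate of \<open>a\<close>, which also lies in the submodule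
    \<open>J\<close>; so all conditions can be read off at \<open>0\<close>.\<close>
  define as where "as = map (\<lambda>(a, g). free_scale (Poly_Mapping.single (- g) 1) a) is'"
  have "set as \<subseteq> J" using I(1) J is' by (auto simp: as_def submodule_def)
  moreover have "u j 0 \<le> r" if u: "\<forall>i g. \<bar>u i g\<bar> \<le> 1" and z: "\<forall>a\<in>set as. row_act a u 0 = 0" for u
  proof (rule ccontr)
    assume c: "\<not> ?thesis"
    define x where "x p = u (fst p) (snd p)" for p
    have "x \<in> K" using u unfolding K_def PiE_iff x_def by (auto simp: abs_le_iff minus_le_iff)
    moreover have "x \<in> T0" using c by (simp add: T0_def x_def)
    moreover have "x \<in> T (a, g)" if "(a, g) \<in> I" for a g
    proof -
      have "free_scale (Poly_Mapping.single (- g) 1) a \<in> set as" using that is' by (force simp: as_def)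
      then have "row_act (free_scale (Poly_Mapping.single (- g) 1) a) u 0 = 0" using z by blast
      then show ?thesis by (simp add: row_act_free_scale ring_act_single T_def x_def)
    qed
    then have "x \<in> \<Inter>(F - {T0})" unfolding I(3) by auto
    ultimately have "x \<in> K \<inter> \<Inter>F" by blast
    then show False using F(3) by blast
  qed
  ultimately show ?thesis by blast
qed

text \<open>Lagrange multipliers express \<open>u \<mapsto> u j 0\<close> on the cube as a real combination of relations up to a small
  error; multiplying by a large \<open>N\<close> and rounding the coefficients makes the rows integral.\<close>

theorem exists_near_identity:
  fixes J :: "(nat \<Rightarrow>\<^sub>0 'g::group_add \<Rightarrow>\<^sub>0 int) set"
  assumes J: "submodule free_scale J" "J \<subseteq> free_module n"
    and inj: "\<And>u j. j < n \<Longrightarrow> (\<And>i g. \<bar>u i g\<bar> \<le> 1) \<Longrightarrow> (\<And>a g. a \<in> J \<Longrightarrow> row_act a u g = 0) \<Longrightarrow> u j 0 = 0"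
  shows "\<exists>\<alpha> N. near_identity n \<alpha> N \<and> (\<forall>j<n. \<alpha> j \<in> J)"
proof -
  let ?cube = "{u :: nat \<Rightarrow> 'g \<Rightarrow> real. \<forall>i g. \<bar>u i g\<bar> \<le> 1}"
  define P where "P j as c \<longleftrightarrow> set as \<subseteq> J \<and> (\<forall>u\<in>?cube. \<bar>u j 0 - (\<Sum>k<length as. c k * row_act (as ! k) u 0)\<bar> \<le> 1/8)" for j as c
  have "\<exists>as c. P j as c" if j: "j < n" for j
  proof -
    obtain as where as: "set as \<subseteq> J"
      "\<And>u. u \<in> ?cube \<Longrightarrow> \<forall>a\<in>set as. row_act a u 0 = 0 \<Longrightarrow> u j 0 \<le> 1/8"
      using separating_relations[OF J(1), of j "1/8"] inj[OF j] by auto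
    define Gs where "Gs = map (\<lambda>a u. row_act a u (0::'g)) as"
    have "\<exists>c. \<forall>u\<in>?cube. u j 0 - (\<Sum>k<length Gs. c k * (Gs ! k) u) \<le> 1/8"
    proof (rule lagrange_list)
      show "balanced_convex ?cube" unfolding balanced_convex_def
      proof (intro ballI allI impI CollectI)
        fix u v :: "nat \<Rightarrow> 'g \<Rightarrow> real" and a b :: real and i g
        assume "u \<in> ?cube" "v \<in> ?cube" and ab: "\<bar>a\<bar> + \<bar>b\<bar> \<le> 1"
        then have "\<bar>a * u i g\<bar> \<le> \<bar>a\<bar>" "\<bar>b * v i g\<bar> \<le> \<bar>b\<bar>"
          unfolding abs_mult by (auto intro!: mult_left_le)
        then show "\<bar>a * u i g + b * v i g\<bar> \<le> 1" using ab by linarith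
      qed
      show "linear_functional (\<lambda>u. u j 0)" by (simp add: linear_functional_def)
      show "\<forall>G\<in>set Gs. linear_functional G" by (auto simp: Gs_def linear_functional_def row_act_linear)
    qed (use as(2) in \<open>auto simp: Gs_def\<close>)
    then obtain c where c: "\<And>u. u \<in> ?cube \<Longrightarrow> u j 0 - (\<Sum>k<length as. c k * row_act (as ! k) u 0) \<le> 1/8"
      by (auto simp: Gs_def)
    have "\<bar>u j 0 - (\<Sum>k<length as. c k * row_act (as ! k) u 0)\<bar> \<le> 1/8" if u: "u \<in> ?cube" for u
    proof -
      have "(\<lambda>i g. (-1) * u i g) \<in> ?cube" using u by simp
      from c[OF this] have "- u j 0 - (\<Sum>k<length as. c k * ((-1) * row_act (as ! k) u 0)) \<le> 1/8"
        unfolding row_act_scale by simp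
      then have "- (u j 0 - (\<Sum>k<length as. c k * row_act (as ! k) u 0)) \<le> 1/8"
        by (simp add: sum_negf)
      with c[OF u] show ?thesis by linarith
    qed
    then show ?thesis using as(1) unfolding P_def by blast
  qed
  then obtain as c where "\<And>j. j < n \<Longrightarrow> P j (as j) (c j)" by metis
  then have as: "\<And>j. j < n \<Longrightarrow> set (as j) \<subseteq> J"
    "\<And>j u. j < n \<Longrightarrow> u \<in> ?cube \<Longrightarrow> \<bar>u j 0 - (\<Sum>k<length (as j). c j k * row_act (as j ! k) u 0)\<bar> \<le> 1/8"
    unfolding P_def by blast+
  define B where "B j = (\<Sum>k<length (as j). row_norm (as j ! k))" for j
  have B: "0 \<le> B j" for j unfolding B_def by (intro sum_nonneg row_norm_nonneg)
  \<comment> \<open>Rounding will cost at most \<open>B j \<le> N / 4\<close> and the error of the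
    multipliers becomes \<open>N / 8\<close>, together less than \<open>N / 2\<close>. The summand
    \<open>1\<close> keeps \<open>N\<close> positive.\<close>
  define N where "N = 1 + 4 * (\<Sum>j<n. B j)"
  have N: "N > 0" "4 * B j \<le> N" if "j < n" for j
  proof -
    have "0 \<le> (\<Sum>j<n. B j)" by (intro sum_nonneg B)
    then show "N > 0" by (simp add: N_def)
    have "B j \<le> (\<Sum>j<n. B j)" using B that by (intro member_le_sum) auto
    then show "4 * B j \<le> N" by (simp add: N_def)
  qed
  have N0: "N > 0" using sum_nonneg[of "{..<n}" B] B by (simp add: N_def)
  define \<alpha> where "\<alpha> j = (\<Sum>k<length (as j). free_scale (Poly_Mapping.single 0 (round (N * c j k))) (as j ! k))" for j
  have aJ: "\<alpha> j \<in> J" if "j < n" for j unfolding \<alpha>_def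
    by (rule free.submodule_sum[OF J(1)]) (use as(1)[OF that] J(1) in \<open>auto simp: submodule_def subset_iff\<close>)
  have "\<bar>N * u j 0 - row_act (\<alpha> j) u 0\<bar> \<le> N / 2" if j: "j < n" and u: "\<forall>i g. \<bar>u i g\<bar> \<le> 1" for j u
  proof -
    have "row_act (\<alpha> j) u 0 = (\<Sum>k<length (as j). of_int (round (N * c j k)) * row_act (as j ! k) u 0)"
      by (simp add: \<alpha>_def row_act_sum row_act_free_scale ring_act_single)
    then have "N * u j 0 - row_act (\<alpha> j) u 0 = N * (u j 0 - (\<Sum>k<length (as j). c j k * row_act (as j ! k) u 0))
      + (\<Sum>k<length (as j). (N * c j k - of_int (round (N * c j k))) * row_act (as j ! k) u 0)"
      by (simp add: algebra_simps sum_subtractf sum_distrib_left)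
    moreover have "\<bar>N * (u j 0 - (\<Sum>k<length (as j). c j k * row_act (as j ! k) u 0))\<bar> \<le> N * (1/8)"
      unfolding abs_mult using as(2)[OF j, of u] u N0 by (simp add: mult_left_mono)
    moreover have "\<bar>\<Sum>k<length (as j). (N * c j k - of_int (round (N * c j k))) * row_act (as j ! k) u 0\<bar> \<le> B j"
      unfolding B_def
    proof (rule order_trans[OF sum_abs sum_mono])
      fix k
      have "\<bar>N * c j k - of_int (round (N * c j k))\<bar> \<le> 1"
        using of_int_round_abs_le[of "N * c j k"] by linarith
      moreover have "\<bar>row_act (as j ! k) u 0\<bar> \<le> row_norm (as j ! k)"
        using row_act_bound[of u 1 "as j ! k" 0] u by simp
      ultimately show "\<bar>(N * c j k - of_int (round (N * c j k))) * row_act (as j ! k) u 0\<bar> \<le> row_norm (as j ! k)"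
        unfolding abs_mult using mult_mono[of "\<bar>N * c j k - of_int (round (N * c j k))\<bar>" 1 "\<bar>row_act (as j ! k) u 0\<bar>" "row_norm (as j ! k)"] by simp
    qed
    ultimately show ?thesis using N(2)[OF j] by linarith
  qed
  then have "near_identity n \<alpha> N" using N0 aJ J(2) unfolding near_identity_def by blast
  with aJ show ?thesis by blast
qed

section \<open>Counting arguments\<close>

text \<open>A functional that vanishes on the common kernel of finitely many others is a combination
  of them, here for a set \<open>S\<close> closed only under integer multiples. By induction,
  \<open>\<alpha>\<close> is first matched on the kernel of one \<open>\<beta> w\<close>; the
  difference is then a multiple of that \<open>\<beta> w\<close>.\<close>

lemma integer_duality:
  fixes \<alpha> :: "'a::ab_group_add \<Rightarrow> real" and \<beta> :: "'w \<Rightarrow> 'a \<Rightarrow> int" and sc :: "int \<Rightarrow> 'a \<Rightarrow> 'a"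
  assumes "finite W"
    and \<alpha>: "\<And>x y. \<alpha> (x + y) = \<alpha> x + \<alpha> y" "\<And>k x. \<alpha> (sc k x) = of_int k * \<alpha> x"
    and \<beta>: "\<And>w x y. \<beta> w (x + y) = \<beta> w x + \<beta> w y" "\<And>w k x. \<beta> w (sc k x) = k * \<beta> w x"
    and "\<And>x y. x \<in> S \<Longrightarrow> y \<in> S \<Longrightarrow> x + y \<in> S" "\<And>k x. x \<in> S \<Longrightarrow> sc k x \<in> S"
    and "\<And>x. x \<in> S \<Longrightarrow> \<forall>w\<in>W. \<beta> w x = 0 \<Longrightarrow> \<alpha> x = 0"
  shows "\<exists>c. \<forall>x\<in>S. \<alpha> x = (\<Sum>w\<in>W. c w * of_int (\<beta> w x))"
  using assms(1,6-)
proof (induction W arbitrary: S)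
  case empty
  then show ?case by simp
next
  case (insert w W)
  let ?S = "{x \<in> S. \<beta> w x = 0}"
  have "\<exists>c. \<forall>x\<in>?S. \<alpha> x = (\<Sum>w\<in>W. c w * of_int (\<beta> w x))"
    by (rule insert.IH) (use insert.prems \<beta> in auto)
  then obtain c where c: "\<And>x. x \<in> S \<Longrightarrow> \<beta> w x = 0 \<Longrightarrow> \<alpha> x = (\<Sum>w\<in>W. c w * of_int (\<beta> w x))" by blast
  define \<alpha>' where "\<alpha>' x = \<alpha> x - (\<Sum>w\<in>W. c w * of_int (\<beta> w x))" for x
  have add': "\<alpha>' (x + y) = \<alpha>' x + \<alpha>' y" for x y
    by (simp add: \<alpha>'_def \<alpha> \<beta> sum.distrib distrib_left)
  have sc': "\<alpha>' (sc k x) = of_int k * \<alpha>' x" for k x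
    by (simp add: \<alpha>'_def \<alpha> \<beta> sum_distrib_left right_diff_distrib mult.left_commute)
  have "\<exists>d. \<forall>x\<in>S. \<alpha>' x = d * of_int (\<beta> w x)"
  proof (cases "\<exists>x\<in>S. \<beta> w x \<noteq> 0")
    case False
    then show ?thesis using c by (auto simp: \<alpha>'_def)
  next
    case True
    then obtain x0 where x0: "x0 \<in> S" "\<beta> w x0 \<noteq> 0" by blast
    have "\<alpha>' x = \<alpha>' x0 / of_int (\<beta> w x0) * of_int (\<beta> w x)" if x: "x \<in> S" for x
    proof -
      \<comment> \<open>A cross-multiplied combination in the kernel of \<open>\<beta> w\<close>;
        dividing by \<open>\<beta> w x0\<close> could lead out of \<open>S\<close>.\<close>
      define z where "z = sc (\<beta> w x0) x + sc (- \<beta> w x) x0"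
      have "z \<in> S" unfolding z_def using insert.prems x x0 by blast
      moreover have "\<beta> w z = 0" by (simp add: z_def \<beta>)
      ultimately have "\<alpha>' z = 0" using c by (simp add: \<alpha>'_def)
      then have "of_int (\<beta> w x0) * \<alpha>' x = of_int (\<beta> w x) * \<alpha>' x0" by (simp add: z_def add' sc')
      then show ?thesis using x0(2) by (simp add: field_simps)
    qed
    then show ?thesis by blast
  qed
  then obtain d where d: "\<And>x. x \<in> S \<Longrightarrow> \<alpha>' x = d * of_int (\<beta> w x)" by blast
  have "\<alpha> x = (\<Sum>v\<in>insert w W. (if v = w then d else c v) * of_int (\<beta> v x))" if "x \<in> S" for x
  proof -
    have "(\<Sum>v\<in>W. (if v = w then d else c v) * of_int (\<beta> v x)) = (\<Sum>v\<in>W. c v * of_int (\<beta> v x))"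
      by (rule sum.cong) (use insert.hyps in auto)
    then show ?thesis using d[OF that] insert.hyps by (simp add: \<alpha>'_def)
  qed
  then show ?case by (intro exI[of _ "\<lambda>v. if v = w then d else c v"]) blast
qed

lemma underdetermined_system:
  fixes a :: "'e \<Rightarrow> 'h \<Rightarrow> real"
  assumes "finite E" "finite H" "card E < card H"
  shows "\<exists>c. (\<exists>h\<in>H. c h \<noteq> 0) \<and> (\<forall>e\<in>E. (\<Sum>h\<in>H. c h * a e h) = 0)"
  using assms
proof (induction E arbitrary: H a)
  case empty
  then show ?case by (intro exI[of _ "\<lambda>_. 1"]) (auto simp: card_gt_0_iff)
next
  case (insert e E)
  show ?case
  proof (cases "\<exists>h\<in>H. a e h \<noteq> 0")
    case False
    obtain c where "\<exists>h\<in>H. c h \<noteq> 0" "\<forall>e\<in>E. (\<Sum>h\<in>H. c h * a e h) = 0"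
      using insert.IH[of H a] insert.prems insert.hyps by auto
    moreover have "(\<Sum>h\<in>H. c h * a e h) = 0" using False by (intro sum.neutral) auto
    ultimately show ?thesis by blast
  next
    case True
    then obtain h0 where h0: "h0 \<in> H" "a e h0 \<noteq> 0" by blast
    let ?H = "H - {h0}"
    define a' where "a' e' h = a e' h - a e' h0 * a e h / a e h0" for e' h
    have "card E < card ?H" using insert.prems insert.hyps h0 by simp
    then obtain c where c: "\<exists>h\<in>?H. c h \<noteq> 0" "\<forall>e\<in>E. (\<Sum>h\<in>?H. c h * a' e h) = 0"
      using insert.IH[of ?H a'] insert.prems by auto
    define s where "s = (\<Sum>h\<in>?H. c h * a e h) / a e h0"
    define c' where "c' h = (if h = h0 then - s else c h)" for h
    have sum: "(\<Sum>h\<in>H. c' h * a e' h) = - s * a e' h0 + (\<Sum>h\<in>?H. c h * a e' h)" for e'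
    proof -
      have "(\<Sum>h\<in>?H. c' h * a e' h) = (\<Sum>h\<in>?H. c h * a e' h)" by (rule sum.cong) (auto simp: c'_def)
      then show ?thesis using sum.remove[OF insert.prems(1) h0(1), of "\<lambda>h. c' h * a e' h"] by (simp add: c'_def)
    qed
    have "(\<Sum>h\<in>H. c' h * a e h) = 0" unfolding sum using h0(2) by (simp add: s_def)
    moreover have "(\<Sum>h\<in>H. c' h * a e' h) = 0" if e': "e' \<in> E" for e'
    proof -
      have "0 = (\<Sum>h\<in>?H. c h * a' e' h)" using c(2) e' by simp
      also have "\<dots> = (\<Sum>h\<in>?H. c h * a e' h) - (\<Sum>h\<in>?H. (a e' h0 / a e h0) * (c h * a e h))"
        unfolding sum_subtractf[symmetric] by (rule sum.cong) (auto simp: a'_def field_simps)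
      also have "\<dots> = (\<Sum>h\<in>?H. c h * a e' h) - s * a e' h0"
        unfolding sum_distrib_left[symmetric] by (simp add: s_def)
      finally show ?thesis unfolding sum by simp
    qed
    moreover have "\<exists>h\<in>H. c' h \<noteq> 0" using c(1) by (auto simp: c'_def)
    ultimately show ?thesis by blast
  qed
qed

text \<open>For \<open>P\<close> of maximal size, every point of \<open>F\<close> differs from some
  point of \<open>P\<close> by an element of the symmetrised \<open>K\<close> with \<open>0\<close>;
  otherwise it could be added to \<open>P\<close>.\<close>

lemma sparse_subset:
  fixes F K :: "'g::group_add set"
  assumes "finite F" "finite K"
  shows "\<exists>P\<subseteq>F. card F \<le> card (insert 0 (K \<union> uminus ` K)) * card P \<and> (\<forall>p\<in>P. \<forall>q\<in>P. p \<noteq> q \<longrightarrow> p - q \<notin> K)"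
proof -
  define good where "good P \<longleftrightarrow> P \<subseteq> F \<and> (\<forall>p\<in>P. \<forall>q\<in>P. p \<noteq> q \<longrightarrow> p - q \<notin> K)" for P
  have "good {}" by (simp add: good_def)
  moreover have "card P \<le> card F" if "good P" for P using that assms(1) by (auto simp: good_def intro: card_mono)
  ultimately obtain P where P: "good P" "\<And>P'. good P' \<Longrightarrow> card P' \<le> card P"
    using ex_has_greatest_nat[of good "{}" card "Suc (card F)"] by (auto simp: less_Suc_eq_le)
  let ?K = "insert 0 (K \<union> uminus ` K)"
  have finP: "finite P" using P(1) assms(1) finite_subset by (auto simp: good_def)
  have "F \<subseteq> (\<lambda>(k, p). k + p) ` (?K \<times> P)"
  proof
    fix f assume f: "f \<in> F"
    have "\<exists>p\<in>P. f = p \<or> f - p \<in> K \<or> p - f \<in> K"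
    proof (rule ccontr)
      assume no: "\<not> ?thesis"
      then have "good (insert f P)" using P(1) f by (auto simp: good_def)
      then have "card (insert f P) \<le> card P" by (rule P(2))
      moreover have "f \<notin> P" using no by blast
      ultimately show False using finP by simp
    qed
    then obtain p where p: "p \<in> P" "f = p \<or> f - p \<in> K \<or> p - f \<in> K" by blast
    have "f - p \<in> ?K"
    proof -
      have "f - p = - (p - f)" by simp
      then show ?thesis using p(2) by (metis UnCI diff_self image_eqI insertCI)
    qed
    then show "f \<in> (\<lambda>(k, p). k + p) ` (?K \<times> P)" using p(1) by (intro image_eqI[of _ _ "(f - p, p)"]) auto
  qed
  then have "card F \<le> card ((\<lambda>(k, p). k + p) ` (?K \<times> P))" using assms finP by (intro card_mono) auto
  also have "\<dots> \<le> card (?K \<times> P)" using assms finP by (intro card_image_le) auto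
  also have "\<dots> = card ?K * card P" by (rule card_cartesian_product)
  finally show ?thesis using P(1) by (auto simp: good_def)
qed

text \<open>The first bound controls points of \<open>F\<close> from which some
  \<open>t \<in> T\<close> leads out of \<open>F\<close>, the second points outside \<open>F\<close>
  reached from it. Both follow by summing, over \<open>T\<close>, the number of points that a single
  translation moves out of \<open>F\<close>.\<close>

lemma folner_set:
  fixes T :: "'g::group_add set"
  assumes am: "amenable TYPE('g)" and T: "finite T" and \<eta>: "\<eta> > 0"
  shows "\<exists>F. finite F \<and> F \<noteq> {} \<and> real (card {g\<in>F. \<exists>t\<in>T. t + g \<notin> F}) \<le> \<eta> * real (card F) \<and>
    real (card ((\<Union>t\<in>T. (+) t ` F) - F)) \<le> \<eta> * real (card F)"
proof -
  define e where "e = \<eta> / (real (card T) + 1)"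
  have e: "e > 0" "real (card T) * e \<le> \<eta>" using \<eta> by (auto simp: e_def field_simps)
  obtain F where F: "finite F" "F \<noteq> {}" "\<And>s. s \<in> T \<Longrightarrow> real (card (sym_diff ((+) s ` F) F)) \<le> e * real (card F)"
    using am[unfolded amenable_def, rule_format, OF e(1) T] by blast
  have out: "real (card ((+) t ` F - F)) \<le> e * real (card F)" if "t \<in> T" for t
  proof -
    have "card ((+) t ` F - F) \<le> card (sym_diff ((+) t ` F) F)" using F(1) by (intro card_mono) auto
    then show ?thesis using F(3)[OF that] by linarith
  qed
  have inn: "card {g\<in>F. t + g \<notin> F} = card ((+) t ` F - F)" for t
  proof -
    have "(+) t ` F - F = (+) t ` {g\<in>F. t + g \<notin> F}" by blast
    then show ?thesis by (simp add: card_image)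
  qed
  have "real (card ((\<Union>t\<in>T. (+) t ` F) - F)) \<le> real (\<Sum>t\<in>T. card ((+) t ` F - F))"
  proof -
    have "(\<Union>t\<in>T. (+) t ` F) - F = (\<Union>t\<in>T. (+) t ` F - F)" by blast
    then show ?thesis unfolding of_nat_le_iff using card_UN_le[OF T, of "\<lambda>t. (+) t ` F - F"] by simp
  qed
  also have "\<dots> \<le> (\<Sum>t\<in>T. e * real (card F))" unfolding of_nat_sum by (intro sum_mono out)
  also have "\<dots> = (real (card T) * e) * real (card F)" by simp
  also have "\<dots> \<le> \<eta> * real (card F)" using e by (intro mult_right_mono) auto
  finally have 1: "real (card ((\<Union>t\<in>T. (+) t ` F) - F)) \<le> \<eta> * real (card F)" .
  have "real (card {g\<in>F. \<exists>t\<in>T. t + g \<notin> F}) \<le> real (\<Sum>t\<in>T. card {g\<in>F. t + g \<notin> F})"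
  proof -
    have "{g\<in>F. \<exists>t\<in>T. t + g \<notin> F} = (\<Union>t\<in>T. {g\<in>F. t + g \<notin> F})" by blast
    then show ?thesis unfolding of_nat_le_iff using card_UN_le[OF T, of "\<lambda>t. {g\<in>F. t + g \<notin> F}"] by simp
  qed
  also have "\<dots> \<le> (\<Sum>t\<in>T. e * real (card F))" unfolding of_nat_sum inn by (intro sum_mono out)
  also have "\<dots> = (real (card T) * e) * real (card F)" by simp
  also have "\<dots> \<le> \<eta> * real (card F)" using e by (intro mult_right_mono) auto
  finally show ?thesis using 1 F by blast
qed

section \<open>Kernels of matrices over the group ring of an amenable group\<close>

text \<open>The product of the row \<open>d\<close> with the matrix whose rows are the
  \<open>b j\<close>. Its vanishing says that \<open>d\<close> is a relation between these
  rows.\<close>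

definition compose_row :: "nat \<Rightarrow> (nat \<Rightarrow> nat \<Rightarrow>\<^sub>0 'g::group_add \<Rightarrow>\<^sub>0 int) \<Rightarrow> (nat \<Rightarrow>\<^sub>0 'g \<Rightarrow>\<^sub>0 int) \<Rightarrow> nat \<Rightarrow>\<^sub>0 'g \<Rightarrow>\<^sub>0 int" where
  "compose_row m b d = (\<Sum>j<m. free_scale (lookup d j) (b j))"

lemma row_act_ring_act:
  assumes "d \<in> free_module m"
  shows "row_act d v g = (\<Sum>j<m. ring_act (lookup d j) (v j) g)"
proof -
  have "row_supp d \<subseteq> (SIGMA j:{..<m}. supp (lookup d j))"
    using assms row_supp_subset[of d] unfolding free_module_def by blast
  then have "row_act d v g = (\<Sum>p\<in>(SIGMA j:{..<m}. supp (lookup d j)). of_int (coef d p) * v (fst p) (- snd p + g))"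
    by (intro row_act_superset) auto
  also have "\<dots> = (\<Sum>j<m. \<Sum>s\<in>supp (lookup d j). of_int (coef d (j, s)) * v j (- s + g))"
    by (subst sum.Sigma) (auto simp: case_prod_beta)
  finally show ?thesis by (simp add: ring_act_def coef_def)
qed

lemma row_act_compose_row:
  assumes "d \<in> free_module m"
  shows "row_act (compose_row m b d) y g = row_act d (\<lambda>j. row_act (b j) y) g"
  by (simp add: row_act_ring_act[OF assms] compose_row_def row_act_sum row_act_free_scale)

lemma compose_row_add: "compose_row m b (d + d') = compose_row m b d + compose_row m b d'"
  by (simp add: compose_row_def lookup_add free.smul_left_distrib sum.distrib)

lemma compose_row_scale: "compose_row m b (free_scale a d) = free_scale a (compose_row m b d)"
  by (simp add: compose_row_def lookup_free_scale free.smul_smul free.smul_sum)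

lemma row_supp_free_scale:
  "row_supp (free_scale a r) \<subseteq> {(i, s + k) | i s k. s \<in> supp a \<and> (i, k) \<in> row_supp r}"
proof
  fix p assume p: "p \<in> row_supp (free_scale a r)"
  have "snd p \<in> supp (a * lookup r (fst p))"
    using p by (simp add: row_supp_def coef_def lookup_free_scale in_keys_iff)
  then obtain s k where "snd p = s + k" "s \<in> supp a" "k \<in> supp (lookup r (fst p))"
    using keys_mult by blast
  then show "p \<in> {(i, s + k) | i s k. s \<in> supp a \<and> (i, k) \<in> row_supp r}"
    by (cases p) (auto simp: row_supp_def coef_def in_keys_iff)
qed

lemma coef_scale_zero: "coef (free_scale (Poly_Mapping.single 0 k) r) p = k * coef r p"
proof -
  have "Poly_Mapping.single 0 k * f = Poly_Mapping.map ((*) k) f" for f :: "'a \<Rightarrow>\<^sub>0 int"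
    by (rule mult_map_scale_conv_mult[symmetric])
  moreover have "lookup (Poly_Mapping.map ((*) k) f) s = k * lookup f s" for f :: "'a \<Rightarrow>\<^sub>0 int" and s
    by (transfer fixing: k) (simp add: when_def)
  ultimately show ?thesis by (simp add: coef_def lookup_free_scale)
qed

text \<open>A finite linear system over \<open>\<int>\<close> whose right-hand side satisfies all integral relations
  between its rows is solvable over \<open>\<real>\<close>.\<close>

lemma local_solution:
  fixes b :: "nat \<Rightarrow> nat \<Rightarrow>\<^sub>0 'g::group_add \<Rightarrow>\<^sub>0 int"
  assumes L: "\<And>d. d \<in> free_module m \<Longrightarrow> compose_row m b d = 0 \<Longrightarrow> row_act d u 0 = 0"
    and F: "finite F"
  shows "\<exists>y. finite {p. y (fst p) (snd p) \<noteq> 0} \<and>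
    {p. y (fst p) (snd p) \<noteq> 0} \<subseteq> {(i, - s + f) | i s f j. j < m \<and> (i, s) \<in> row_supp (b j) \<and> f \<in> F} \<and>
    (\<forall>j<m. \<forall>g\<in>F. row_act (b j) y g = u j g)"
proof -
  \<comment> \<open>Rows that, evaluated at \<open>0\<close>, read \<open>u\<close> only at places
    of \<open>F\<close>; \<open>W\<close> contains the supports of their products with
    \<open>b\<close>.\<close>
  define S where "S = {d \<in> free_module m. \<forall>p\<in>row_supp d. - snd p \<in> F}"
  define W where "W = (\<Union>j<m. (\<lambda>(f, p). (fst p, - f + snd p)) ` (F \<times> row_supp (b j)))"
  have finW: "finite W" using F by (simp add: W_def)
  have suppW: "row_supp (compose_row m b d) \<subseteq> W" if d: "d \<in> S" for d
  proof
    fix p assume "p \<in> row_supp (compose_row m b d)"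
    then have "(\<Sum>j<m. coef (free_scale (lookup d j) (b j)) p) \<noteq> 0"
      by (simp add: row_supp_def compose_row_def coef_sum)
    then obtain j where j: "j < m" "p \<in> row_supp (free_scale (lookup d j) (b j))"
      unfolding row_supp_def by (metis (mono_tags, lifting) lessThan_iff mem_Collect_eq sum.neutral)
    then obtain i s k where p: "p = (i, s + k)" "s \<in> supp (lookup d j)" "(i, k) \<in> row_supp (b j)"
      using row_supp_free_scale by blast
    have "(j, s) \<in> row_supp d" using p(2) by (simp add: row_supp_def coef_def in_keys_iff)
    then have "- s \<in> F" using d by (auto simp: S_def)
    then have "p \<in> (\<lambda>(f, p). (fst p, - f + snd p)) ` (F \<times> row_supp (b j))"
      using p by (intro image_eqI[of _ _ "(- s, (i, k))"]) auto
    then show "p \<in> W" using j(1) by (auto simp: W_def)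
  qed
  have "\<exists>c. \<forall>d\<in>S. row_act d u 0 = (\<Sum>w\<in>W. c w * of_int (coef (compose_row m b d) w))"
  proof (rule integer_duality[where sc = "\<lambda>k. free_scale (Poly_Mapping.single 0 k)"])
    show "row_act (free_scale (Poly_Mapping.single 0 k) x) u 0 = of_int k * row_act x u 0" for k x
      by (simp add: row_act_free_scale ring_act_single)
    show "coef (compose_row m b (free_scale (Poly_Mapping.single 0 k) x)) w = k * coef (compose_row m b x) w" for w k x
      by (simp add: compose_row_scale coef_scale_zero)
    show "x + y \<in> S" if "x \<in> S" "y \<in> S" for x y
      using that row_supp_add[of x y] submodule_free_module[of m] unfolding S_def submodule_def by blast
    show "free_scale (Poly_Mapping.single 0 k) x \<in> S" if "x \<in> S" for k x
      using that submodule_free_module[of m] unfolding S_def submodule_def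
      by (auto simp: row_supp_def coef_scale_zero)
    show "row_act x u 0 = 0" if x: "x \<in> S" and z: "\<forall>w\<in>W. coef (compose_row m b x) w = 0" for x
    proof (rule L)
      show "x \<in> free_module m" using x by (simp add: S_def)
      show "compose_row m b x = 0"
      proof (rule coef_eqI)
        show "coef (compose_row m b x) p = coef 0 p" for p
          using suppW[OF x] z by (auto simp: row_supp_def)
      qed
    qed
  qed (auto simp: finW row_act_add compose_row_add coef_add)
  then obtain c where c: "\<And>d. d \<in> S \<Longrightarrow> row_act d u 0 = (\<Sum>w\<in>W. c w * of_int (coef (compose_row m b d) w))" by blast
  \<comment> \<open>The value at \<open>0\<close> of a row reads position \<open>- s\<close> for its
    coefficient at \<open>s\<close>, hence the sign in the index of \<open>c\<close>.\<close>
  define y where "y i g = (if (i, - g) \<in> W then c (i, - g) else 0)" for i g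
  have yd: "row_act d u 0 = row_act d (\<lambda>j. row_act (b j) y) 0" if d: "d \<in> S" for d
  proof -
    have "row_act (compose_row m b d) y 0 = (\<Sum>w\<in>W. of_int (coef (compose_row m b d) w) * y (fst w) (- snd w + 0))"
      by (rule row_act_superset[OF finW suppW[OF d]])
    also have "\<dots> = (\<Sum>w\<in>W. c w * of_int (coef (compose_row m b d) w))"
      by (rule sum.cong) (auto simp: y_def)
    finally show ?thesis using c[OF d] row_act_compose_row[of d m b y 0] d by (simp add: S_def)
  qed
  have "row_act (b j) y g = u j g" if j: "j < m" and g: "g \<in> F" for j g
  proof -
    \<comment> \<open>The unit row that reads off component \<open>j\<close> at place
      \<open>g\<close>.\<close>
    let ?d = "Poly_Mapping.single j (Poly_Mapping.single (- g) (1::int))"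
    have supp: "row_supp ?d \<subseteq> {(j, - g)}" by (auto simp: row_supp_def coef_single split: if_splits)
    have "?d \<in> S" using j g supp by (auto simp: S_def free_module_def)
    moreover have "row_act ?d v 0 = v j g" for v
      using row_act_superset[OF _ supp, of v 0] by (simp add: coef_single)
    ultimately show ?thesis using yd[of ?d] by simp
  qed
  moreover have supp: "{p. y (fst p) (snd p) \<noteq> 0} \<subseteq> (\<lambda>p. (fst p, - snd p)) ` W"
  proof
    fix p assume "p \<in> {p. y (fst p) (snd p) \<noteq> 0}"
    then have "(fst p, - snd p) \<in> W" by (simp add: y_def split: if_splits)
    then show "p \<in> (\<lambda>p. (fst p, - snd p)) ` W" by (intro image_eqI[of _ _ "(fst p, - snd p)"]) auto
  qed
  moreover have "(\<lambda>p. (fst p, - snd p)) ` W \<subseteq> {(i, - s + f) | i s f j. j < m \<and> (i, s) \<in> row_supp (b j) \<and> f \<in> F}"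
    by (fastforce simp: W_def minus_add)
  moreover have "finite {p. y (fst p) (snd p) \<noteq> 0}" by (rule finite_subset[OF supp]) (use finW in simp)
  ultimately show ?thesis by (intro exI[of _ y]) blast
qed

text \<open>If \<open>\<alpha>u\<close> vanishes everywhere, the local estimate applies with every
  \<open>\<epsilon>\<close>.\<close>

lemma near_identity_injective:
  assumes "near_identity n \<alpha> N" "\<And>i g. \<bar>u i g\<bar> \<le> M" "\<And>j g. j < n \<Longrightarrow> row_act (\<alpha> j) u g = 0" "j < n"
  shows "u j g = 0"
proof -
  have M: "0 \<le> M" using assms(2)[of 0 g] by linarith
  have "\<bar>u j g\<bar> \<le> 0 + \<epsilon>" if eps: "\<epsilon> > 0" for \<epsilon>
  proof -
    obtain T where "\<forall>u g. (\<forall>i g. \<bar>u i g\<bar> \<le> M) \<longrightarrow> (\<forall>t\<in>T. \<forall>j<n. row_act (\<alpha> j) u (t + g) = 0) \<longrightarrow> (\<forall>j<n. \<bar>u j g\<bar> < \<epsilon>)"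
      using near_identity_local[OF assms(1) eps M] by blast
    then have "\<bar>u j g\<bar> < \<epsilon>" using assms by blast
    then show ?thesis by simp
  qed
  then have "\<bar>u j g\<bar> \<le> 0" by (rule field_le_epsilon)
  then show ?thesis by simp
qed

lemma finite_sums_tail:
  fixes v :: "'a \<Rightarrow> real"
  assumes "\<And>E. finite E \<Longrightarrow> (\<Sum>g\<in>E. \<bar>v g\<bar>) \<le> M" "e > 0"
  shows "\<exists>K. finite K \<and> (\<forall>E. finite E \<longrightarrow> E \<inter> K = {} \<longrightarrow> (\<Sum>g\<in>E. \<bar>v g\<bar>) < e)"
proof -
  let ?A = "(\<lambda>E. \<Sum>g\<in>E. \<bar>v g\<bar>) ` {E. finite E}"
  have bdd: "bdd_above ?A" using assms(1) by (auto simp: bdd_above_def)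
  have ne: "?A \<noteq> {}" by (auto intro: exI[of _ "{}"])
  have "Sup ?A - e < Sup ?A" using assms(2) by simp
  then obtain K where K: "finite K" "Sup ?A - e < (\<Sum>g\<in>K. \<bar>v g\<bar>)"
    using less_cSup_iff[OF ne bdd] by auto
  have "(\<Sum>g\<in>E. \<bar>v g\<bar>) < e" if "finite E" "E \<inter> K = {}" for E
  proof -
    have "(\<Sum>g\<in>E \<union> K. \<bar>v g\<bar>) \<le> Sup ?A" using that K by (intro cSup_upper bdd) auto
    moreover have "(\<Sum>g\<in>E \<union> K. \<bar>v g\<bar>) = (\<Sum>g\<in>E. \<bar>v g\<bar>) + (\<Sum>g\<in>K. \<bar>v g\<bar>)"
      using that K by (intro sum.union_disjoint) auto
    ultimately show ?thesis using K(2) by linarith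
  qed
  with K(1) show ?thesis by blast
qed

text \<open>If \<open>A = CB\<close> is invertible over \<open>\<ell>\<^sup>1(G)\<close>, then \<open>BA\<^sup>-\<^sup>1C\<close> is an idempotent whose kernel is that of
  \<open>C\<close>. An \<open>\<ell>\<^sup>1\<close> vector in this kernel that satisfies all finitely supported relations between the
  rows of \<open>B\<close> coincides on each finite set with some \<open>By\<close>. On a Foelner set its translates are too
  many to be independent of the range of \<open>B\<close> modulo boundary effects.\<close>

theorem kernel_vanishes:
  fixes b c \<alpha> :: "nat \<Rightarrow> nat \<Rightarrow>\<^sub>0 'g::group_add \<Rightarrow>\<^sub>0 int" and u :: "nat \<Rightarrow> 'g \<Rightarrow> real"
  assumes am: "amenable TYPE('g)" and near: "near_identity n \<alpha> N"
    and b: "\<And>j. j < m \<Longrightarrow> b j \<in> free_module n" and c: "\<And>i. i < n \<Longrightarrow> c i \<in> free_module m"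
    and comp: "\<And>i. i < n \<Longrightarrow> \<alpha> i = compose_row m b (c i)"
    and l1: "\<And>j E. finite E \<Longrightarrow> (\<Sum>g\<in>E. \<bar>u j g\<bar>) \<le> M"
    and Cu: "\<And>i g. i < n \<Longrightarrow> row_act (c i) u g = 0"
    and Lu: "\<And>d g. d \<in> free_module m \<Longrightarrow> compose_row m b d = 0 \<Longrightarrow> row_act d u g = 0"
    and j0: "j0 < m"
  shows "u j0 g0 = 0"
proof (rule ccontr)
  assume nz: "u j0 g0 \<noteq> 0"
  \<comment> \<open>For translates of \<open>u\<close> by points no two of which differ by an
    element of \<open>K\<close>, the square array of their \<open>j0\<close> components at these
    points has \<open>u j0 g0\<close> on the diagonal and off-diagonal row sums below
    \<open>e\<close>. Diagonal dominance will make the translates independent.\<close>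
  define e where "e = \<bar>u j0 g0\<bar>"
  have e: "e > 0" using nz by (simp add: e_def)
  obtain K0 where K0: "finite K0" "\<And>E. finite E \<Longrightarrow> E \<inter> K0 = {} \<Longrightarrow> (\<Sum>g\<in>E. \<bar>u j0 g\<bar>) < e"
    using finite_sums_tail[of "u j0" M, OF l1 e] by blast
  define K where "K = (\<lambda>x. x - g0) ` K0"
  have K: "finite K" using K0(1) by (simp add: K_def)
  define k where "k = card (insert 0 (K \<union> uminus ` K))"
  have k: "k > 0" using K by (simp add: k_def card_gt_0_iff)
  \<comment> \<open>\<open>T1\<close> collects the places read by the rows \<open>c i\<close>.
    \<open>T2\<close> collects the displacements by which the image under \<open>\<alpha>\<close> of
    a local solution on \<open>F\<close> can stick out of \<open>F\<close>.\<close>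
  define T1 where "T1 = (\<Union>i<n. (\<lambda>p. - snd p) ` row_supp (c i))"
  define T2 where "T2 = (\<Union>i<n. \<Union>j<m. (\<lambda>(p, q). snd p + - snd q) ` (row_supp (\<alpha> i) \<times> row_supp (b j)))"
  define T where "T = T1 \<union> T2"
  have finT: "finite T" by (simp add: T_def T1_def T2_def)
  \<comment> \<open>Chosen so that \<open>card R \<le> 2 * \<eta> * card F\<close> and
    \<open>card F \<le> k * card P\<close> give \<open>n * card R < card P\<close>: more translates
    than equations on the boundary.\<close>
  define \<eta> where "\<eta> = 1 / (4 * (real n + 1) * real k)"
  have \<eta>: "\<eta> > 0" using k by (simp add: \<eta>_def)
  obtain F where F: "finite F" "F \<noteq> {}" "real (card {g\<in>F. \<exists>t\<in>T. t + g \<notin> F}) \<le> \<eta> * real (card F)"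
    "real (card ((\<Union>t\<in>T. (+) t ` F) - F)) \<le> \<eta> * real (card F)"
    using folner_set[OF am finT \<eta>] by blast
  define R where "R = {g\<in>F. \<exists>t\<in>T. t + g \<notin> F} \<union> ((\<Union>t\<in>T. (+) t ` F) - F)"
  have finR: "finite R" using F(1) finT by (simp add: R_def)
  have "card R \<le> card {g\<in>F. \<exists>t\<in>T. t + g \<notin> F} + card ((\<Union>t\<in>T. (+) t ` F) - F)"
    unfolding R_def by (rule card_Un_le)
  then have cardR: "real (card R) \<le> 2 * \<eta> * real (card F)" using F(3,4) by linarith
  obtain P where P: "P \<subseteq> F" "card F \<le> k * card P" "\<And>p q. p \<in> P \<Longrightarrow> q \<in> P \<Longrightarrow> p \<noteq> q \<Longrightarrow> p - q \<notin> K"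
    unfolding k_def using sparse_subset[OF F(1) K] by blast
  have finP: "finite P" using P(1) F(1) finite_subset by blast
  have Fpos: "real (card F) > 0" using F by (simp add: card_gt_0_iff)
  have "real n * real (card R) < real (card P)"
  proof -
    define Y where "Y = real n * (real k * \<eta>)"
    have "4 * (real n + 1) * real k * \<eta> = 1" using k by (simp add: \<eta>_def)
    then have "4 * Y + 4 * (real k * \<eta>) = 1" by (simp add: Y_def algebra_simps)
    moreover have "real k * \<eta> > 0" using k \<eta> by simp
    ultimately have Y: "2 * Y < 1" by linarith
    have "real k * (real n * real (card R)) \<le> real k * (real n * (2 * \<eta> * real (card F)))"
      using cardR by (intro mult_left_mono) auto
    also have "\<dots> = (2 * Y) * real (card F)" by (simp add: Y_def)
    also have "\<dots> < 1 * real (card F)" using Y Fpos by (rule mult_strict_right_mono)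
    also have "\<dots> \<le> real k * real (card P)" using P(2) by (metis mult_1 of_nat_le_iff of_nat_mult)
    finally show ?thesis using k by (simp only: mult_less_cancel_left_pos of_nat_0_less_iff)
  qed
  then have "real (card ({..<n} \<times> R)) < real (card P)" by (simp add: card_cartesian_product)
  then have lt: "card ({..<n} \<times> R) < card P" by (simp only: of_nat_less_iff)
  \<comment> \<open>The translate that carries the entry at \<open>g0\<close> to the place
    \<open>p\<close>.\<close>
  define us where "us p = (\<lambda>i g. u i (g + (- p + g0)))" for p
  define sol where "sol p y \<longleftrightarrow> finite {q. y (fst q) (snd q) \<noteq> 0} \<and>
    {q. y (fst q) (snd q) \<noteq> 0} \<subseteq> {(i, - s + f) | i s f j. j < m \<and> (i, s) \<in> row_supp (b j) \<and> f \<in> F} \<and>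
    (\<forall>j<m. \<forall>g\<in>F. row_act (b j) y g = us p j g)" for p and y :: "nat \<Rightarrow> 'g \<Rightarrow> real"
  have "\<exists>y. sol p y" for p unfolding sol_def
    by (rule local_solution[OF _ F(1)]) (simp add: us_def row_act_shift Lu)
  then obtain y where "\<And>p. sol p (y p)" by metis
  then have y: "\<And>p. finite {q. y p (fst q) (snd q) \<noteq> 0}"
    "\<And>p. {q. y p (fst q) (snd q) \<noteq> 0} \<subseteq> {(i, - s + f) | i s f j. j < m \<and> (i, s) \<in> row_supp (b j) \<and> f \<in> F}"
    "\<And>p j g. j < m \<Longrightarrow> g \<in> F \<Longrightarrow> row_act (b j) (y p) g = us p j g"
    unfolding sol_def by blast+
  \<comment> \<open>A nontrivial combination of the local solutions whose image under
    \<open>\<alpha>\<close> vanishes on the boundary set \<open>R\<close>.\<close>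
  obtain w where w: "\<exists>p\<in>P. w p \<noteq> 0" "\<And>i g. i < n \<Longrightarrow> g \<in> R \<Longrightarrow> (\<Sum>p\<in>P. w p * row_act (\<alpha> i) (y p) g) = 0"
    using underdetermined_system[OF _ finP lt, of "\<lambda>e p. row_act (\<alpha> (fst e)) (y p) (snd e)"] finR by auto
  define yc where "yc i g = (\<Sum>p\<in>P. w p * y p i g)" for i g
  define uc where "uc j g = (\<Sum>p\<in>P. w p * us p j g)" for j g
  have act_yc: "row_act r yc g = (\<Sum>p\<in>P. w p * row_act r (y p) g)" for r g
    unfolding yc_def by (simp add: row_act_sum_right row_act_scale)
  have Byc: "row_act (b j) yc g = uc j g" if "j < m" "g \<in> F" for j g
    unfolding act_yc uc_def using y(3)[OF that] by simp
  have Ay: "row_act (\<alpha> i) yc g = 0" if i: "i < n" for i g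
  proof (cases "g \<in> R")
    case True
    then show ?thesis unfolding act_yc by (rule w(2)[OF i])
  next
    case nR: False
    show ?thesis
    proof (cases "g \<in> F")
      case True
      then have tF: "\<And>t. t \<in> T \<Longrightarrow> t + g \<in> F" using nR by (auto simp: R_def)
      have "row_act (\<alpha> i) yc g = row_act (c i) (\<lambda>j. row_act (b j) yc) g"
        unfolding comp[OF i] by (rule row_act_compose_row[OF c[OF i]])
      also have "\<dots> = row_act (c i) uc g"
      proof (rule row_act_cong, rule Byc)
        fix p assume p: "p \<in> row_supp (c i)"
        show "fst p < m" by (rule fst_row_supp[OF c[OF i] p])
        have "- snd p \<in> T" using p i by (auto simp: T_def T1_def)
        then show "- snd p + g \<in> F" by (rule tF)
      qed
      also have "\<dots> = (\<Sum>p\<in>P. w p * row_act (c i) (us p) g)"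
        unfolding uc_def by (simp add: row_act_sum_right row_act_scale)
      also have "\<dots> = 0" unfolding us_def row_act_shift using Cu[OF i] by simp
      finally show ?thesis .
    next
      case False
      have "yc (fst q) (- snd q + g) = 0" if q: "q \<in> row_supp (\<alpha> i)" for q
      proof -
        have "y p (fst q) (- snd q + g) = 0" for p
        proof (rule ccontr)
          assume "\<not> ?thesis"
          then have "(fst q, - snd q + g) \<in> {q. y p (fst q) (snd q) \<noteq> 0}" by simp
          then obtain s f j where s: "- snd q + g = - s + f" "j < m" "(fst q, s) \<in> row_supp (b j)" "f \<in> F"
            using y(2)[of p] by blast
          have "snd q + (- snd q + g) = snd q + (- s + f)" using s(1) by simp
          then have g: "g = (snd q + - s) + f" by (simp add: add.assoc[symmetric] del: add_uminus_conv_diff)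
          have "(snd q + - s) \<in> T2" unfolding T2_def using i s q by force
          then have "g \<in> (\<Union>t\<in>T. (+) t ` F)" using g s(4) by (auto simp: T_def)
          then show False using False nR by (simp add: R_def)
        qed
        then show ?thesis by (simp add: yc_def)
      qed
      then show ?thesis by (simp add: row_act_def)
    qed
  qed
  have "{q. yc (fst q) (snd q) \<noteq> 0} \<subseteq> (\<Union>p\<in>P. {q. y p (fst q) (snd q) \<noteq> 0})"
  proof
    fix q assume "q \<in> {q. yc (fst q) (snd q) \<noteq> 0}"
    then have "(\<Sum>p\<in>P. w p * y p (fst q) (snd q)) \<noteq> 0" by (simp add: yc_def)
    then obtain p where "p \<in> P" "w p * y p (fst q) (snd q) \<noteq> 0" by (meson sum.neutral)
    then show "q \<in> (\<Union>p\<in>P. {q. y p (fst q) (snd q) \<noteq> 0})" by auto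
  qed
  then have fin: "finite {q. yc (fst q) (snd q) \<noteq> 0}" by (rule finite_subset) (use finP y(1) in auto)
  define B where "B = Max (insert 0 ((\<lambda>q. \<bar>yc (fst q) (snd q)\<bar>) ` {q. yc (fst q) (snd q) \<noteq> 0}))"
  have bound: "\<bar>yc i g\<bar> \<le> B" for i g
  proof (cases "yc i g = 0")
    case True
    then show ?thesis using fin by (simp add: B_def)
  next
    case False
    then have "\<bar>yc i g\<bar> \<in> (\<lambda>q. \<bar>yc (fst q) (snd q)\<bar>) ` {q. yc (fst q) (snd q) \<noteq> 0}"
      by (intro image_eqI[of _ _ "(i, g)"]) auto
    then show ?thesis unfolding B_def using fin by (intro Max_ge) auto
  qed
  have yc0: "yc i g = 0" if "i < n" for i g
    by (rule near_identity_injective[OF near bound Ay that])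
  \<comment> \<open>Evaluating the vanishing combination at the place of its largest coefficient
    contradicts diagonal dominance.\<close>
  obtain p0 where p0: "p0 \<in> P" "\<And>p. p \<in> P \<Longrightarrow> \<bar>w p\<bar> \<le> \<bar>w p0\<bar>"
  proof -
    have ne: "P \<noteq> {}" using w(1) by blast
    have "Max ((\<lambda>p. \<bar>w p\<bar>) ` P) \<in> (\<lambda>p. \<bar>w p\<bar>) ` P" using finP ne by (intro Max_in) auto
    then obtain p0 where "p0 \<in> P" "Max ((\<lambda>p. \<bar>w p\<bar>) ` P) = \<bar>w p0\<bar>" by auto
    then show ?thesis using that[of p0] finP by (metis Max_ge finite_imageI imageI)
  qed
  obtain p1 where "p1 \<in> P" "w p1 \<noteq> 0" using w(1) by blast
  then have wp0: "\<bar>w p0\<bar> > 0" using p0(2)[of p1] by simp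
  have "row_act (b j0) yc p0 = 0"
    unfolding row_act_def using fst_row_supp[OF b[OF j0]] yc0 by (intro sum.neutral) auto
  then have "uc j0 p0 = 0" using Byc[OF j0, of p0] p0(1) P(1) by auto
  moreover have "uc j0 p0 = w p0 * u j0 g0 + (\<Sum>p\<in>P - {p0}. w p * u j0 (p0 + (- p + g0)))"
    unfolding uc_def us_def using sum.remove[OF finP p0(1), of "\<lambda>p. w p * u j0 (p0 + (- p + g0))"]
    by (simp add: add.assoc[symmetric])
  ultimately have "\<bar>w p0\<bar> * e = \<bar>\<Sum>p\<in>P - {p0}. w p * u j0 (p0 + (- p + g0))\<bar>"
    unfolding e_def abs_mult[symmetric] by linarith
  also have "\<dots> \<le> (\<Sum>p\<in>P - {p0}. \<bar>w p0\<bar> * \<bar>u j0 (p0 + (- p + g0))\<bar>)"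
    by (rule order_trans[OF sum_abs sum_mono]) (auto simp: abs_mult intro!: mult_right_mono p0(2))
  also have "\<dots> = \<bar>w p0\<bar> * (\<Sum>p\<in>P - {p0}. \<bar>u j0 (p0 + (- p + g0))\<bar>)" by (simp add: sum_distrib_left)
  also have "(\<Sum>p\<in>P - {p0}. \<bar>u j0 (p0 + (- p + g0))\<bar>) = (\<Sum>g\<in>(\<lambda>p. p0 + (- p + g0)) ` (P - {p0}). \<bar>u j0 g\<bar>)"
    by (subst sum.reindex) (auto simp: inj_on_def)
  also have "\<bar>w p0\<bar> * \<dots> < \<bar>w p0\<bar> * e"
  proof (intro mult_strict_left_mono wp0 K0(2))
    show "finite ((\<lambda>p. p0 + (- p + g0)) ` (P - {p0}))" using finP by simp
    have "p0 + (- p + g0) \<notin> K0" if "p \<in> P" "p \<noteq> p0" for p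
    proof
      assume "p0 + (- p + g0) \<in> K0"
      then have "(p0 + (- p + g0)) - g0 \<in> K" unfolding K_def by blast
      moreover have "(p0 + (- p + g0)) - g0 = p0 - p" by (simp add: add.assoc[symmetric])
      ultimately show False using P(3)[OF p0(1) that(1)] that(2) by auto
    qed
    then show "(\<lambda>p. p0 + (- p + g0)) ` (P - {p0}) \<inter> K0 = {}" by blast
  qed
  finally show False by simp
qed

section \<open>Square-summable functions\<close>

definition ell2 :: "('i \<Rightarrow> complex) \<Rightarrow> bool" where
  "ell2 f \<longleftrightarrow> (\<lambda>i. (cmod (f i))\<^sup>2) summable_on UNIV"

definition sqnorm :: "('i \<Rightarrow> complex) \<Rightarrow> real" where
  "sqnorm f = (\<Sum>\<^sub>\<infinity>i. (cmod (f i))\<^sup>2)"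

definition inner2 :: "('i \<Rightarrow> complex) \<Rightarrow> ('i \<Rightarrow> complex) \<Rightarrow> complex" where
  "inner2 f g = (\<Sum>\<^sub>\<infinity>i. f i * cnj (g i))"

lemma ell2_bounded_sums:
  assumes "\<And>F. finite F \<Longrightarrow> (\<Sum>i\<in>F. (cmod (f i))\<^sup>2) \<le> B"
  shows "ell2 f" "sqnorm f \<le> B"
proof -
  show e: "ell2 f" unfolding ell2_def
    by (rule nonneg_bdd_above_summable_on) (use assms in \<open>auto simp: bdd_above_def\<close>)
  show "sqnorm f \<le> B" unfolding sqnorm_def
    by (rule infsum_le_finite_sums) (use e assms in \<open>auto simp: ell2_def\<close>)
qed

lemma ell2_comparison:
  assumes "ell2 f" "ell2 g" "\<And>i. (cmod (h i))\<^sup>2 \<le> a * (cmod (f i))\<^sup>2 + b * (cmod (g i))\<^sup>2"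
  shows "ell2 h"
  unfolding ell2_def
proof (rule summable_on_comparison_test)
  show "(\<lambda>i. a * (cmod (f i))\<^sup>2 + b * (cmod (g i))\<^sup>2) summable_on UNIV"
    using assms(1,2) unfolding ell2_def by (intro summable_on_add summable_on_cmult_right)
qed (use assms(3) in auto)

lemma ell2_lin:
  assumes "ell2 f" "ell2 g"
  shows "ell2 (\<lambda>i. a * f i + b * g i)"
proof (rule ell2_comparison[OF assms])
  fix i
  have "(cmod (a * f i + b * g i))\<^sup>2 \<le> (cmod a * cmod (f i) + cmod b * cmod (g i))\<^sup>2"
    by (intro power_mono) (metis norm_mult norm_triangle_ineq, simp)
  also have "\<dots> \<le> 2 * (cmod a * cmod (f i))\<^sup>2 + 2 * (cmod b * cmod (g i))\<^sup>2"
    using sum_squares_bound[of "cmod a * cmod (f i)" "cmod b * cmod (g i)"]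
    by (simp add: power2_sum)
  finally show "(cmod (a * f i + b * g i))\<^sup>2 \<le> (2 * (cmod a)\<^sup>2) * (cmod (f i))\<^sup>2 + (2 * (cmod b)\<^sup>2) * (cmod (g i))\<^sup>2"
    by (simp add: power_mult_distrib)
qed

lemma ell2_diff: "ell2 f \<Longrightarrow> ell2 g \<Longrightarrow> ell2 (\<lambda>i. f i - g i)"
  using ell2_lin[of f g 1 "-1"] by simp

lemma sqnorm_has_sum: "ell2 f \<Longrightarrow> ((\<lambda>i. (cmod (f i))\<^sup>2) has_sum sqnorm f) UNIV"
  unfolding ell2_def sqnorm_def by (rule has_sum_infsum)

lemma sqnorm_nonneg: "0 \<le> sqnorm f"
  unfolding sqnorm_def by (rule infsum_nonneg) simp

lemma sqnorm_ge:
  assumes "ell2 f"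
  shows "(cmod (f i))\<^sup>2 \<le> sqnorm f"
  using finite_sum_le_infsum[of "\<lambda>i. (cmod (f i))\<^sup>2" UNIV "{i}"] assms by (simp add: ell2_def sqnorm_def)

lemma sqnorm_sums_le:
  assumes "ell2 f" "finite F"
  shows "(\<Sum>i\<in>F. (cmod (f i))\<^sup>2) \<le> sqnorm f"
  using finite_sum_le_infsum[of "\<lambda>i. (cmod (f i))\<^sup>2" UNIV F] assms by (simp add: ell2_def sqnorm_def)

lemma inner2_has_sum:
  assumes "ell2 f" "ell2 g"
  shows "((\<lambda>i. f i * cnj (g i)) has_sum inner2 f g) UNIV"
proof -
  have "(\<lambda>i. norm (f i * cnj (g i))) summable_on UNIV"
  proof (rule summable_on_comparison_test)
    show "(\<lambda>i. (cmod (f i))\<^sup>2 + (cmod (g i))\<^sup>2) summable_on UNIV"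
      using assms unfolding ell2_def by (intro summable_on_add)
    show "norm (f i * cnj (g i)) \<le> (cmod (f i))\<^sup>2 + (cmod (g i))\<^sup>2" for i
    proof -
      have "2 * (cmod (f i) * cmod (g i)) \<le> (cmod (f i))\<^sup>2 + (cmod (g i))\<^sup>2"
        using sum_squares_bound[of "cmod (f i)" "cmod (g i)"] by simp
      moreover have "0 \<le> cmod (f i) * cmod (g i)" by simp
      ultimately show ?thesis unfolding norm_mult complex_mod_cnj by linarith
    qed
  qed auto
  then have "(\<lambda>i. f i * cnj (g i)) summable_on UNIV" by (rule abs_summable_summable)
  then show ?thesis unfolding inner2_def by (rule has_sum_infsum)
qed

lemma inner2_lin_left:
  assumes "ell2 f" "ell2 g" "ell2 h"
  shows "inner2 (\<lambda>i. a * f i + b * g i) h = a * inner2 f h + b * inner2 g h"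
proof -
  have "((\<lambda>i. a * (f i * cnj (h i)) + b * (g i * cnj (h i))) has_sum (a * inner2 f h + b * inner2 g h)) UNIV"
    by (intro has_sum_add has_sum_cmult_right inner2_has_sum assms)
  moreover have "(\<lambda>i. a * (f i * cnj (h i)) + b * (g i * cnj (h i))) = (\<lambda>i. (a * f i + b * g i) * cnj (h i))"
    by (simp add: algebra_simps)
  ultimately have "((\<lambda>i. (a * f i + b * g i) * cnj (h i)) has_sum (a * inner2 f h + b * inner2 g h)) UNIV"
    by (simp only:)
  from infsumI[OF this] show ?thesis by (simp only: inner2_def[of "\<lambda>i. a * f i + b * g i"])
qed

lemma inner2_diff_left:
  assumes "ell2 f" "ell2 g" "ell2 h"
  shows "inner2 (\<lambda>i. f i - g i) h = inner2 f h - inner2 g h"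
  using inner2_lin_left[OF assms, of 1 "-1"] by simp

lemma inner2_cnj: "ell2 f \<Longrightarrow> ell2 g \<Longrightarrow> inner2 g f = cnj (inner2 f g)"
proof -
  assume "ell2 f" "ell2 g"
  then have "((\<lambda>i. cnj (f i * cnj (g i))) has_sum cnj (inner2 f g)) UNIV"
    using inner2_has_sum by (simp only: has_sum_cnj_iff)
  then have "((\<lambda>i. g i * cnj (f i)) has_sum cnj (inner2 f g)) UNIV" by (simp add: mult.commute)
  from infsumI[OF this] show ?thesis by (simp only: inner2_def[of g f])
qed

lemma inner2_self: "ell2 f \<Longrightarrow> inner2 f f = of_real (sqnorm f)"
  unfolding inner2_def
  unfolding complex_norm_square[symmetric]
  by (rule infsumI) (rule has_sum_of_real[OF sqnorm_has_sum])

lemma sqnorm_expand: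
  assumes "ell2 f" "ell2 g"
  shows "sqnorm (\<lambda>i. f i - t * g i) = sqnorm f - 2 * Re (cnj t * inner2 f g) + (cmod t)\<^sup>2 * sqnorm g"
proof -
  have "((\<lambda>i. (cmod (f i))\<^sup>2 + (- 2) * Re (cnj t * (f i * cnj (g i))) + (cmod t)\<^sup>2 * (cmod (g i))\<^sup>2) has_sum
     (sqnorm f + (- 2) * Re (cnj t * inner2 f g) + (cmod t)\<^sup>2 * sqnorm g)) UNIV"
    by (intro has_sum_add has_sum_cmult_right has_sum_Re sqnorm_has_sum inner2_has_sum assms)
  moreover have "(cmod (f i))\<^sup>2 + (- 2) * Re (cnj t * (f i * cnj (g i))) + (cmod t)\<^sup>2 * (cmod (g i))\<^sup>2 = (cmod (f i - t * g i))\<^sup>2" for i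
    unfolding cmod_power2 by (simp add: power2_eq_square algebra_simps)
  ultimately have "((\<lambda>i. (cmod (f i - t * g i))\<^sup>2) has_sum
     (sqnorm f + (- 2) * Re (cnj t * inner2 f g) + (cmod t)\<^sup>2 * sqnorm g)) UNIV" by (simp only:)
  then show ?thesis unfolding sqnorm_def[of "\<lambda>i. f i - t * g i"] by (simp add: infsumI)
qed

lemma sqnorm_eq_0:
  assumes "ell2 f" "sqnorm f \<le> 0"
  shows "f i = 0"
proof -
  have "(cmod (f i))\<^sup>2 \<le> 0" using sqnorm_ge[OF assms(1), of i] assms(2) by (rule order_trans)
  then show ?thesis by simp
qed

text \<open>Closure under pointwise limits with square-summable limit is stronger than closure in
  norm. Kernels of matrices over the group ring have it because each value of the image is a finite
  sum.\<close>

definition pointwise_closed_subspace :: "('i \<Rightarrow> complex) set \<Rightarrow> bool" where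
  "pointwise_closed_subspace K \<longleftrightarrow>
     (\<forall>f\<in>K. ell2 f) \<and> (\<lambda>_. 0) \<in> K \<and> (\<forall>f\<in>K. \<forall>g\<in>K. \<forall>a b. (\<lambda>i. a * f i + b * g i) \<in> K) \<and>
     (\<forall>s f. (\<forall>n :: nat. s n \<in> K) \<and> ell2 f \<and> (\<forall>i. (\<lambda>n. s n i) \<longlonglongrightarrow> f i) \<longrightarrow> f \<in> K)"

context
  fixes K :: "('i \<Rightarrow> complex) set"
  assumes K: "pointwise_closed_subspace K"
begin

private lemmas K' = K[unfolded pointwise_closed_subspace_def]

lemma pointwise_closed_subspace_ell2: "f \<in> K \<Longrightarrow> ell2 f"
  by (rule bspec[OF conjunct1[OF K']])

lemma pointwise_closed_subspace_zero: "(\<lambda>_. 0) \<in> K"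
  by (rule conjunct1[OF conjunct2[OF K']])

lemma pointwise_closed_subspace_lin: "f \<in> K \<Longrightarrow> g \<in> K \<Longrightarrow> (\<lambda>i. a * f i + b * g i) \<in> K"
  by (rule conjunct1[OF conjunct2[OF conjunct2[OF K']], THEN bspec, THEN bspec, THEN spec, THEN spec])

lemma pointwise_closed_subspace_limit:
  assumes "\<forall>n :: nat. s n \<in> K" "ell2 f" "\<forall>i. (\<lambda>n. s n i) \<longlonglongrightarrow> f i"
  shows "f \<in> K"
  by (rule conjunct2[OF conjunct2[OF conjunct2[OF K']], THEN spec[of _ s], THEN spec[of _ f], THEN mp])
    (intro conjI assms)

end

lemmas pointwise_closed_subspaceD = pointwise_closed_subspace_ell2 pointwise_closed_subspace_zero
  pointwise_closed_subspace_lin pointwise_closed_subspace_limit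

text \<open>A minimising sequence is norm Cauchy, hence pointwise convergent; by Fatou the pointwise limit
  attains the distance, so completeness of \<open>\<ell>\<^sup>2\<close> is not needed separately.\<close>

lemma orthogonal_projection_exists:
  assumes K: "pointwise_closed_subspace K" and z: "ell2 z"
  shows "\<exists>p\<in>K. \<forall>w\<in>K. inner2 (\<lambda>i. z i - p i) w = 0"
proof -
  note Kl = pointwise_closed_subspaceD[OF K]
  let ?D = "(\<lambda>w. sqnorm (\<lambda>i. z i - w i)) ` K"
  define d where "d = Inf ?D"
  have bdd: "bdd_below ?D" by (rule bdd_belowI2[of _ 0]) (rule sqnorm_nonneg)
  have ne: "?D \<noteq> {}" using Kl(2) by blast
  have dle: "d \<le> sqnorm (\<lambda>i. z i - w i)" if "w \<in> K" for w
    unfolding d_def by (rule cInf_lower[OF _ bdd]) (use that in blast)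
  have "\<forall>n. \<exists>w. w \<in> K \<and> sqnorm (\<lambda>i. z i - w i) < d + 1 / real (Suc n)"
  proof
    fix n
    have "d < d + 1 / real (Suc n)" by simp
    then show "\<exists>w. w \<in> K \<and> sqnorm (\<lambda>i. z i - w i) < d + 1 / real (Suc n)"
      unfolding d_def using cInf_less_iff[OF ne bdd] by blast
  qed
  then obtain s where s: "\<And>n. s n \<in> K" "\<And>n. sqnorm (\<lambda>i. z i - s n i) < d + 1 / real (Suc n)" by metis
  \<comment> \<open>The parallelogram law, with the midpoint \<open>h\<close> of \<open>s m\<close>
    and \<open>s n\<close> again in \<open>K\<close> and so at squared distance at least
    \<open>d\<close> from \<open>z\<close>.\<close>
  have par: "sqnorm (\<lambda>i. s m i - s n i) \<le> 2 / real (Suc m) + 2 / real (Suc n)" for m n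
  proof -
    have em: "ell2 (\<lambda>i. z i - s n i)" for n by (intro ell2_diff z Kl(1) s)
    have A: "((\<lambda>i. 2 * (cmod (z i - s m i))\<^sup>2 + 2 * (cmod (z i - s n i))\<^sup>2) has_sum
        (2 * sqnorm (\<lambda>i. z i - s m i) + 2 * sqnorm (\<lambda>i. z i - s n i))) UNIV"
      by (intro has_sum_add has_sum_cmult_right sqnorm_has_sum em)
    define h where "h = (\<lambda>i. (1/2) * s m i + (1/2) * s n i)"
    have hK: "h \<in> K" unfolding h_def by (rule Kl(3)[OF s(1) s(1)])
    have eh: "ell2 (\<lambda>i. z i - h i)" by (intro ell2_diff z Kl(1) hK)
    have es: "ell2 (\<lambda>i. s m i - s n i)" by (intro ell2_diff Kl(1) s)
    have "((\<lambda>i. (cmod (s m i - s n i))\<^sup>2 + 4 * (cmod (z i - h i))\<^sup>2) has_sum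
        (sqnorm (\<lambda>i. s m i - s n i) + 4 * sqnorm (\<lambda>i. z i - h i))) UNIV"
      by (intro has_sum_add has_sum_cmult_right sqnorm_has_sum es eh)
    moreover have "(cmod (s m i - s n i))\<^sup>2 + 4 * (cmod (z i - h i))\<^sup>2 = 2 * (cmod (z i - s m i))\<^sup>2 + 2 * (cmod (z i - s n i))\<^sup>2" for i
      unfolding cmod_power2 h_def by (simp add: power2_eq_square algebra_simps)
    ultimately have "((\<lambda>i. 2 * (cmod (z i - s m i))\<^sup>2 + 2 * (cmod (z i - s n i))\<^sup>2) has_sum
        (sqnorm (\<lambda>i. s m i - s n i) + 4 * sqnorm (\<lambda>i. z i - h i))) UNIV" by (simp only:)
    from has_sum_unique[OF this A]
    have "sqnorm (\<lambda>i. s m i - s n i) + 4 * sqnorm (\<lambda>i. z i - h i) = 2 * sqnorm (\<lambda>i. z i - s m i) + 2 * sqnorm (\<lambda>i. z i - s n i)" .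
    moreover have "2 / real (Suc m) = 2 * (1 / real (Suc m))" "2 / real (Suc n) = 2 * (1 / real (Suc n))" by simp_all
    ultimately show ?thesis using dle[OF hK] s(2)[of m] s(2)[of n] by linarith
  qed
  have "\<exists>l. (\<lambda>n. s n i) \<longlonglongrightarrow> l" for i
  proof -
    have "Cauchy (\<lambda>n. s n i)"
    proof (rule CauchyI)
      fix e :: real assume e: "e > 0"
      obtain N where N: "1 / real (Suc N) < e\<^sup>2 / 4" using nat_approx_posE[of "e\<^sup>2 / 4"] e by auto
      have "norm (s m i - s n i) < e" if "m \<ge> N" "n \<ge> N" for m n
      proof -
        have "1 / real (Suc m) \<le> 1 / real (Suc N)" "1 / real (Suc n) \<le> 1 / real (Suc N)"
          using that by (auto simp: field_simps)
        moreover have "(cmod (s m i - s n i))\<^sup>2 \<le> 2 / real (Suc m) + 2 / real (Suc n)"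
        proof -
          have "ell2 (\<lambda>i. s m i - s n i)" by (intro ell2_diff Kl(1) s)
          from sqnorm_ge[OF this, of i] par[of m n] show ?thesis by linarith
        qed
        ultimately have "(cmod (s m i - s n i))\<^sup>2 < e\<^sup>2" using N by linarith
        then show ?thesis by (rule power2_less_imp_less) (use e in simp)
      qed
      then show "\<exists>M. \<forall>m\<ge>M. \<forall>n\<ge>M. norm (s m i - s n i) < e" by blast
    qed
    then show ?thesis using Cauchy_convergent convergent_def by blast
  qed
  then obtain p where p: "\<And>i. (\<lambda>n. s n i) \<longlonglongrightarrow> p i" by metis
  have fat: "(\<Sum>i\<in>F. (cmod (z i - p i))\<^sup>2) \<le> d" if F: "finite F" for F
  proof (rule LIMSEQ_le)
    show "(\<lambda>n. \<Sum>i\<in>F. (cmod (z i - s n i))\<^sup>2) \<longlonglongrightarrow> (\<Sum>i\<in>F. (cmod (z i - p i))\<^sup>2)"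
      by (intro tendsto_intros p)
    have "(\<lambda>n. d + 1 / real (Suc n)) \<longlonglongrightarrow> d + 0"
      using LIMSEQ_inverse_real_of_nat by (intro tendsto_intros) (simp add: inverse_eq_divide)
    then show "(\<lambda>n. d + 1 / real (Suc n)) \<longlonglongrightarrow> d" by simp
    have "(\<Sum>i\<in>F. (cmod (z i - s n i))\<^sup>2) \<le> d + 1 / real (Suc n)" for n
      using sqnorm_sums_le[OF ell2_diff[OF z Kl(1)[OF s(1)]] F, of n] s(2)[of n] by linarith
    then show "\<exists>N. \<forall>n\<ge>N. (\<Sum>i\<in>F. (cmod (z i - s n i))\<^sup>2) \<le> d + 1 / real (Suc n)" by blast
  qed
  have ezp: "ell2 (\<lambda>i. z i - p i)" and min: "sqnorm (\<lambda>i. z i - p i) \<le> d"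
    using ell2_bounded_sums[OF fat] by blast+
  have "ell2 p" using ell2_diff[OF z ezp] by simp
  then have pK: "p \<in> K" using s(1) p by (intro Kl(4)[of s p]) auto
  have "inner2 (\<lambda>i. z i - p i) w = 0" if w: "w \<in> K" for w
  proof (rule ccontr)
    let ?c = "inner2 (\<lambda>i. z i - p i) w"
    assume c: "?c \<noteq> 0"
    \<comment> \<open>Moving from \<open>p\<close> by \<open>r\<close> times the inner product along
      \<open>w\<close> would reduce the squared distance; this choice keeps the quadratic term
      smaller than the linear gain.\<close>
    define r where "r = 1 / (sqnorm w + 1)"
    have r: "r > 0" "r * sqnorm w < 1" using sqnorm_nonneg[of w] by (auto simp: r_def field_simps)
    define t where "t = of_real r * ?c"
    have "(\<lambda>i. 1 * p i + t * w i) \<in> K" by (rule Kl(3)[OF pK w])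
    from dle[OF this] have "d \<le> sqnorm (\<lambda>i. (z i - p i) - t * w i)" by (simp add: algebra_simps)
    also have "\<dots> = sqnorm (\<lambda>i. z i - p i) - 2 * Re (cnj t * ?c) + (cmod t)\<^sup>2 * sqnorm w"
      by (rule sqnorm_expand[OF ezp Kl(1)[OF w]])
    also have "Re (cnj t * ?c) = r * (cmod ?c)\<^sup>2"
      unfolding t_def cmod_power2 by (simp add: power2_eq_square algebra_simps)
    also have "(cmod t)\<^sup>2 = r\<^sup>2 * (cmod ?c)\<^sup>2" by (simp add: t_def norm_mult power_mult_distrib)
    finally have "2 * r * (cmod ?c)\<^sup>2 \<le> r\<^sup>2 * (cmod ?c)\<^sup>2 * sqnorm w" using min by simp
    also have "\<dots> = (r * (cmod ?c)\<^sup>2) * (r * sqnorm w)" by (simp add: power2_eq_square)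
    also have "\<dots> < (r * (cmod ?c)\<^sup>2) * 1" using r c by (intro mult_strict_left_mono) auto
    finally show False using r c by simp
  qed
  with pK show ?thesis by blast
qed

section \<open>Von Neumann dimensions of kernels\<close>

definition flat :: "(nat \<Rightarrow> 'g \<Rightarrow> complex) \<Rightarrow> nat \<times> 'g \<Rightarrow> complex" where
  "flat z p = z (fst p) (snd p)"

lemma flat_inject: "flat z = flat w \<Longrightarrow> z = w"
  by (auto simp: flat_def fun_eq_iff)

lemma l2_vec_iff: "z \<in> l2_vec n \<longleftrightarrow> ell2 (flat z) \<and> (\<forall>j\<ge>n. z j = (\<lambda>_. 0))"
proof (intro iffI conjI)
  assume z: "z \<in> l2_vec n"
  then show "\<forall>j\<ge>n. z j = (\<lambda>_. 0)" by (simp add: l2_vec_def)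
  have sm: "(\<lambda>g. (cmod (z j g))\<^sup>2) summable_on UNIV" for j
    using z by (cases "j < n") (auto simp: l2_vec_def)
  show "ell2 (flat z)"
  proof (rule ell2_bounded_sums)
    fix F :: "(nat \<times> 'a) set" assume F: "finite F"
    have "(\<Sum>p\<in>F. (cmod (flat z p))\<^sup>2) \<le> (\<Sum>p\<in>(fst ` F \<union> {..<n}) \<times> snd ` F. (cmod (flat z p))\<^sup>2)"
      using F by (intro sum_mono2) (auto simp: image_iff Bex_def intro: exI[of _ "_ :: nat"])
    also have "\<dots> = (\<Sum>j\<in>fst ` F \<union> {..<n}. \<Sum>g\<in>snd ` F. (cmod (z j g))\<^sup>2)"
      by (simp add: sum.cartesian_product flat_def case_prod_beta)
    also have "\<dots> = (\<Sum>j<n. \<Sum>g\<in>snd ` F. (cmod (z j g))\<^sup>2)"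
      using F z by (intro sum.mono_neutral_right) (auto simp: l2_vec_def)
    also have "\<dots> \<le> (\<Sum>j<n. \<Sum>\<^sub>\<infinity>g. (cmod (z j g))\<^sup>2)"
      using F by (intro sum_mono finite_sum_le_infsum sm) auto
    finally show "(\<Sum>p\<in>F. (cmod (flat z p))\<^sup>2) \<le> (\<Sum>j<n. \<Sum>\<^sub>\<infinity>g. (cmod (z j g))\<^sup>2)" .
  qed
next
  assume z: "ell2 (flat z) \<and> (\<forall>j\<ge>n. z j = (\<lambda>_. 0))"
  have "ell2 (z j)" for j
  proof (rule ell2_bounded_sums)
    fix E :: "'a set" assume E: "finite E"
    have "(\<Sum>g\<in>E. (cmod (z j g))\<^sup>2) = (\<Sum>p\<in>Pair j ` E. (cmod (flat z p))\<^sup>2)"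
      by (subst sum.reindex) (auto simp: inj_on_def flat_def)
    also have "\<dots> \<le> sqnorm (flat z)" by (rule sqnorm_sums_le) (use z E in auto)
    finally show "(\<Sum>g\<in>E. (cmod (z j g))\<^sup>2) \<le> sqnorm (flat z)" .
  qed
  with z show "z \<in> l2_vec n" by (simp add: l2_vec_def ell2_def)
qed

lemma has_sum_finite_family:
  fixes f :: "'j \<Rightarrow> 'i \<Rightarrow> complex"
  assumes "finite J" "\<And>j. j \<in> J \<Longrightarrow> (f j has_sum c j) A"
  shows "((\<lambda>p. \<Sum>j\<in>J. f j p) has_sum (\<Sum>j\<in>J. c j)) A"
  using assms by (induction J) (auto intro!: has_sum_add)

lemma l2_vec_inner_flat:
  assumes z: "z \<in> l2_vec n" and w: "w \<in> l2_vec n"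
  shows "l2_vec_inner n z w = inner2 (flat z) (flat w)"
proof -
  let ?f = "\<lambda>p. flat z p * cnj (flat w p)"
  have slice: "((\<lambda>p. if fst p = j then ?f p else 0) has_sum l2_inner (z j) (w j)) UNIV" if "j < n" for j
  proof -
    have "ell2 (z j)" "ell2 (w j)" using z w that by (auto simp: l2_vec_def ell2_def)
    then have "((\<lambda>g. z j g * cnj (w j g)) has_sum l2_inner (z j) (w j)) UNIV"
      using inner2_has_sum[of "z j" "w j"] by (simp add: l2_inner_def inner2_def)
    then have "((?f \<circ> Pair j) has_sum l2_inner (z j) (w j)) UNIV" by (simp add: comp_def flat_def)
    then have "(?f has_sum l2_inner (z j) (w j)) (range (Pair j))"
      by (subst has_sum_reindex) (auto simp: inj_on_def)
    then show ?thesis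
      by (rule has_sum_cong_neutral[THEN iffD1, rotated -1]) auto
  qed
  have "((\<lambda>p. \<Sum>j<n. if fst p = j then ?f p else 0) has_sum (\<Sum>j<n. l2_inner (z j) (w j))) UNIV"
    by (rule has_sum_finite_family) (use slice in auto)
  then have "((\<lambda>p. \<Sum>j<n. if fst p = j then ?f p else 0) has_sum l2_vec_inner n z w) UNIV"
    by (simp add: l2_vec_inner_def)
  moreover have "(\<Sum>j<n. if fst p = j then ?f p else 0) = ?f p" for p
    using z by (auto simp: l2_vec_def flat_def)
  ultimately have "(?f has_sum l2_vec_inner n z w) UNIV" by simp
  from infsumI[OF this] show ?thesis by (simp add: inner2_def)
qed

definition basis_vec :: "nat \<Rightarrow> nat \<Rightarrow> 'g::group_add \<Rightarrow> complex" where
  "basis_vec k = (\<lambda>i. if i = k then l2_delta else (\<lambda>_. 0))"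

lemma flat_basis_vec: "flat (basis_vec k) p = (if p = (k, 0) then 1 else 0)"
  by (cases p) (auto simp: flat_def basis_vec_def l2_delta_def)

lemma basis_vec_l2: "k < n \<Longrightarrow> basis_vec k \<in> l2_vec n"
proof -
  assume k: "k < n"
  have "ell2 (flat (basis_vec k :: nat \<Rightarrow> 'a \<Rightarrow> complex))"
  proof (rule ell2_bounded_sums)
    fix F :: "(nat \<times> 'a) set" assume "finite F"
    moreover have "(\<Sum>p\<in>F. (cmod (flat (basis_vec k) p))\<^sup>2) = (\<Sum>p\<in>F. if p = (k, 0) then 1 else 0)"
      by (rule sum.cong) (auto simp: flat_basis_vec)
    ultimately show "(\<Sum>p\<in>F. (cmod (flat (basis_vec k) p))\<^sup>2) \<le> 1" by simp
  qed
  then show ?thesis using k by (auto simp: l2_vec_iff basis_vec_def)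
qed

lemma has_sum_single_point: "((\<lambda>i. if i = k then c i else (0::complex)) has_sum c k) UNIV"
proof -
  have "((\<lambda>i. c i) has_sum sum c {k}) {k}" by (rule has_sum_finite) simp
  then have "(c has_sum c k) {k}" by simp
  then show ?thesis by (rule has_sum_cong_neutral[THEN iffD1, rotated -1]) auto
qed

lemma inner2_basis_vec: "inner2 f (flat (basis_vec k)) = f (k, 0)"
proof -
  have "(\<lambda>p. f p * cnj (flat (basis_vec k) p)) = (\<lambda>p. if p = (k, 0) then f p else 0)"
    by (auto simp: flat_basis_vec)
  then show ?thesis unfolding inner2_def using infsumI[OF has_sum_single_point[of "(k, 0)" f]] by simp
qed

lemma l2_inner_delta: "l2_inner u l2_delta = u 0"
proof -
  have "(\<lambda>g. u g * cnj (l2_delta g)) = (\<lambda>g. if g = 0 then u g else 0)"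
    by (auto simp: l2_delta_def)
  then show ?thesis unfolding l2_inner_def using infsumI[OF has_sum_single_point[of 0 u]] by simp
qed

context
  fixes n :: nat and K :: "(nat \<Rightarrow> 'g::group_add \<Rightarrow> complex) set"
  assumes K: "K \<subseteq> l2_vec n" "pointwise_closed_subspace (flat ` K)"
begin

lemma l2_projection_orthogonal:
  assumes z: "z \<in> l2_vec n"
  shows "l2_projection n K z \<in> K"
    and "\<And>w. w \<in> K \<Longrightarrow> inner2 (\<lambda>p. flat z p - flat (l2_projection n K z) p) (flat w) = 0"
proof -
  note Kd = pointwise_closed_subspaceD[OF K(2)]
  have ez: "ell2 (flat z)" using z by (simp add: l2_vec_iff)
  have diff: "l2_vec_inner n (\<lambda>j g. z j g - p j g) w = inner2 (\<lambda>q. flat z q - flat p q) (flat w)" if "p \<in> K" "w \<in> K" for p w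
  proof -
    have fl: "flat (\<lambda>j g. z j g - p j g) = (\<lambda>q. flat z q - flat p q)" by (simp add: flat_def fun_eq_iff)
    have "(\<lambda>j g. z j g - p j g) \<in> l2_vec n" using z that(1) K(1) ell2_diff[of "flat z" "flat p"]
      by (auto simp: l2_vec_iff fl subset_iff)
    then show ?thesis using l2_vec_inner_flat[of "\<lambda>j g. z j g - p j g" n w] that(2) K(1) fl by auto
  qed
  obtain p where p: "p \<in> K" "\<And>w. w \<in> K \<Longrightarrow> inner2 (\<lambda>q. flat z q - flat p q) (flat w) = 0"
    using orthogonal_projection_exists[OF K(2) ez] by auto
  have "p' = p" if p': "p' \<in> K \<and> (\<forall>w\<in>K. l2_vec_inner n (\<lambda>j g. z j g - p' j g) w = 0)" for p'
  proof -
    have e: "ell2 (flat p)" "ell2 (flat p')" using p p' Kd(1) by auto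
    have "(\<lambda>q. 1 * flat p' q + (-1) * flat p q) \<in> flat ` K" by (rule Kd(3)) (use p p' in auto)
    then obtain w where w: "w \<in> K" "flat w = (\<lambda>q. flat p' q - flat p q)" by auto
    have "inner2 (\<lambda>q. (flat z q - flat p q) - (flat z q - flat p' q)) (flat w) = 0"
      using p(2)[OF w(1)] p' w(1) diff[of p' w] Kd(1)[of "flat w"] ez e
      by (subst inner2_diff_left) (auto intro: ell2_diff)
    then have "inner2 (flat w) (flat w) = 0" by (simp add: w(2))
    then have "sqnorm (flat w) \<le> 0" using inner2_self[of "flat w"] Kd(1)[of "flat w"] w(1) by auto
    then have "flat w q = 0" for q using sqnorm_eq_0[of "flat w" q] Kd(1)[of "flat w"] w(1) by auto
    then have "flat p' = flat p" by (simp add: w(2) fun_eq_iff)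
    then show ?thesis by (rule flat_inject)
  qed
  then have "l2_projection n K z = p"
    unfolding l2_projection_def using p diff by (intro the_equality) auto
  with p show "l2_projection n K z \<in> K"
    "\<And>w. w \<in> K \<Longrightarrow> inner2 (\<lambda>p. flat z p - flat (l2_projection n K z) p) (flat w) = 0" by auto
qed

text \<open>The projected basis vector represents evaluation at \<open>(j, 0)\<close> on
  \<open>K\<close>. Its value at \<open>(j, 0)\<close> is thus its own square norm, and this is the
  \<open>j\<close>-th diagonal contribution to the dimension.\<close>

definition reproducing :: "nat \<Rightarrow> nat \<times> 'g \<Rightarrow> complex" where
  "reproducing j = flat (l2_projection n K (basis_vec j))"

lemma reproducing_mem: "j < n \<Longrightarrow> reproducing j \<in> flat ` K"
  unfolding reproducing_def using l2_projection_orthogonal(1)[OF basis_vec_l2] by blast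

lemma reproducing_property:
  assumes j: "j < n" and f: "f \<in> flat ` K"
  shows "inner2 f (reproducing j) = f (j, 0)"
proof -
  note Kd = pointwise_closed_subspaceD[OF K(2)]
  have e: "ell2 f" "ell2 (reproducing j)" "ell2 (flat (basis_vec j :: nat \<Rightarrow> 'g \<Rightarrow> complex))"
    using Kd(1) f reproducing_mem[OF j] basis_vec_l2[OF j] by (auto simp: l2_vec_iff)
  have "inner2 (flat (basis_vec j)) f - inner2 (reproducing j) f = 0"
    using l2_projection_orthogonal(2)[OF basis_vec_l2[OF j]] f e
    by (subst inner2_diff_left[symmetric]) (auto simp: reproducing_def)
  then have "cnj (inner2 (reproducing j) f) = cnj (inner2 (flat (basis_vec j)) f)" by simp
  then have "inner2 f (reproducing j) = inner2 f (flat (basis_vec j))"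
    using inner2_cnj e by metis
  then show ?thesis by (simp add: inner2_basis_vec)
qed

lemma vN_dim_reproducing: "vN_dim n K = of_real (\<Sum>j<n. sqnorm (reproducing j))"
proof -
  note Kd = pointwise_closed_subspaceD[OF K(2)]
  have "l2_inner (operator_entry (l2_projection n K) j j l2_delta) l2_delta = of_real (sqnorm (reproducing j))" if j: "j < n" for j
  proof -
    have "l2_inner (operator_entry (l2_projection n K) j j l2_delta) l2_delta = reproducing j (j, 0)"
      by (simp add: l2_inner_delta operator_entry_def reproducing_def flat_def basis_vec_def)
    also have "\<dots> = inner2 (reproducing j) (reproducing j)"
      by (rule reproducing_property[OF j reproducing_mem[OF j], symmetric])
    also have "\<dots> = of_real (sqnorm (reproducing j))"
      by (rule inner2_self) (rule Kd(1)[OF reproducing_mem[OF j]])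
    finally show ?thesis .
  qed
  then show ?thesis by (simp add: vN_dim_def)
qed

end

section \<open>Comparing kernels of group ring matrices by dimension\<close>

lemma convolve_lin: "convolve a (\<lambda>g. x * u g + y * v g) g = x * convolve a u g + y * convolve a v g"
  by (simp add: convolve_def sum.distrib sum_distrib_left algebra_simps)

lemma convolve_shift: "convolve a (\<lambda>g. u (g + h)) g = convolve a u (g + h)"
  by (simp add: convolve_def add.assoc)

lemma l2_kernel_subset: "l2_kernel k n a \<subseteq> l2_vec n"
  by (auto simp: l2_kernel_def)

lemma l2_kernel_lin:
  assumes "z \<in> l2_kernel k n a" "w \<in> l2_kernel k n a"
  shows "(\<lambda>j g. x * z j g + y * w j g) \<in> l2_kernel k n a"
proof -
  have "flat (\<lambda>j g. x * z j g + y * w j g) = (\<lambda>p. x * flat z p + y * flat w p)"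
    by (simp add: flat_def fun_eq_iff)
  then have "(\<lambda>j g. x * z j g + y * w j g) \<in> l2_vec n"
    using assms by (auto simp: l2_kernel_def l2_vec_iff ell2_lin)
  moreover have "(\<Sum>j<n. convolve (a i j) (\<lambda>g. x * z j g + y * w j g) g) = 0" if "i < k" for i g
    using assms that by (simp add: l2_kernel_def convolve_lin sum.distrib flip: sum_distrib_left)
  ultimately show ?thesis by (simp add: l2_kernel_def)
qed

lemma l2_kernel_closed:
  fixes a :: "nat \<Rightarrow> nat \<Rightarrow> 'g::group_add \<Rightarrow>\<^sub>0 complex"
  shows "pointwise_closed_subspace (flat ` l2_kernel k n a)"
  unfolding pointwise_closed_subspace_def
proof (intro conjI ballI allI impI)
  show "ell2 f" if "f \<in> flat ` l2_kernel k n a" for f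
    using that l2_kernel_subset[of k n a] by (auto simp: l2_vec_iff)
  have "(\<lambda>_ (_ :: 'g). 0) \<in> l2_kernel k n a"
    by (simp add: l2_kernel_def l2_vec_def convolve_def)
  moreover have "flat (\<lambda>_ (_ :: 'g). 0) = (\<lambda>_. 0)" by (simp add: flat_def fun_eq_iff)
  ultimately show "(\<lambda>_. 0) \<in> flat ` l2_kernel k n a" using imageI[of "\<lambda>_ _. 0" "l2_kernel k n a" flat] by simp
  show "(\<lambda>i. x * f i + y * g i) \<in> flat ` l2_kernel k n a"
    if f: "f \<in> flat ` l2_kernel k n a" and g: "g \<in> flat ` l2_kernel k n a" for f g x y
  proof -
    obtain z where z: "z \<in> l2_kernel k n a" "f = flat z" using f by (rule imageE)
    obtain w where w: "w \<in> l2_kernel k n a" "g = flat w" using g by (rule imageE)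
    have "flat (\<lambda>j g. x * z j g + y * w j g) = (\<lambda>i. x * f i + y * g i)" by (simp add: flat_def z w fun_eq_iff)
    then show ?thesis using imageI[OF l2_kernel_lin[OF z(1) w(1), of x y], of flat] by simp
  qed
  fix s f assume "(\<forall>m :: nat. s m \<in> flat ` l2_kernel k n a) \<and> ell2 f \<and> (\<forall>i. (\<lambda>m. s m i) \<longlonglongrightarrow> f i)"
  then have s: "\<And>m. s m \<in> flat ` l2_kernel k n a" and f: "ell2 f" and lim: "\<And>i. (\<lambda>m. s m i) \<longlonglongrightarrow> f i"
    by auto
  have "\<forall>m. \<exists>z. z \<in> l2_kernel k n a \<and> s m = flat z" using s by blast
  then obtain zz where zz: "\<And>m. zz m \<in> l2_kernel k n a" "\<And>m. s m = flat (zz m)" by metis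
  define z where "z j g = f (j, g)" for j g
  have flz: "flat z = f" by (simp add: flat_def z_def fun_eq_iff)
  have pt: "(\<lambda>m. zz m j g) \<longlonglongrightarrow> z j g" for j g using lim[of "(j, g)"] zz(2) by (simp add: flat_def z_def)
  have "z j g = 0" if "j \<ge> n" for j g
  proof -
    have "zz m j g = 0" for m using zz(1)[of m] that by (simp add: l2_kernel_def l2_vec_def)
    then show ?thesis using pt[of j g] LIMSEQ_unique[OF _ tendsto_const] by simp
  qed
  then have "z \<in> l2_vec n" using f by (simp add: l2_vec_iff flz fun_eq_iff)
  moreover have "(\<Sum>j<n. convolve (a i j) (z j) g) = 0" if "i < k" for i g
  proof -
    have "(\<lambda>m. \<Sum>j<n. convolve (a i j) (zz m j) g) \<longlonglongrightarrow> (\<Sum>j<n. convolve (a i j) (z j) g)"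
      unfolding convolve_def by (intro tendsto_intros pt)
    moreover have "(\<Sum>j<n. convolve (a i j) (zz m j) g) = 0" for m
      using zz(1)[of m] that by (simp add: l2_kernel_def)
    ultimately show ?thesis using LIMSEQ_unique[OF _ tendsto_const] by simp
  qed
  ultimately have "z \<in> l2_kernel k n a" by (simp add: l2_kernel_def)
  then show "f \<in> flat ` l2_kernel k n a" using flz imageI[of z "l2_kernel k n a" flat] by simp
qed

lemma ell2_reindex:
  assumes "inj h" "ell2 f"
  shows "ell2 (\<lambda>i. f (h i))"
proof (rule ell2_bounded_sums)
  fix F :: "'a set" assume F: "finite F"
  have "(\<Sum>i\<in>F. (cmod (f (h i)))\<^sup>2) = (\<Sum>i\<in>h ` F. (cmod (f i))\<^sup>2)"
    using assms(1) by (subst sum.reindex) (auto intro: inj_on_subset)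
  also have "\<dots> \<le> sqnorm f" by (rule sqnorm_sums_le) (use assms F in auto)
  finally show "(\<Sum>i\<in>F. (cmod (f (h i)))\<^sup>2) \<le> sqnorm f" .
qed

lemma l2_kernel_shift:
  assumes "z \<in> l2_kernel k n a"
  shows "(\<lambda>j g. z j (g + h)) \<in> l2_kernel k n a"
proof -
  have "flat (\<lambda>j g. z j (g + h)) = (\<lambda>p. flat z (fst p, snd p + h))" by (simp add: flat_def fun_eq_iff)
  moreover have "ell2 (\<lambda>p. flat z (fst p, snd p + h))"
    by (rule ell2_reindex) (use assms in \<open>auto simp: inj_on_def l2_kernel_def l2_vec_iff prod_eq_iff\<close>)
  ultimately have "(\<lambda>j g. z j (g + h)) \<in> l2_vec n"
    using assms by (simp add: l2_kernel_def l2_vec_iff)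
  then show ?thesis using assms by (simp add: l2_kernel_def convolve_shift)
qed

lemma inner2_shift:
  fixes z w :: "nat \<Rightarrow> 'g::group_add \<Rightarrow> complex"
  shows "inner2 (flat (\<lambda>j g. z j (g + h))) (flat w) = inner2 (flat z) (flat (\<lambda>j g. w j (g + - h)))"
proof -
  let ?b = "\<lambda>p :: nat \<times> 'g. (fst p, snd p + h)"
  have "bij ?b" by (rule bijI', auto simp: prod_eq_iff) (metis diff_add_cancel)
  then have "(\<Sum>\<^sub>\<infinity>p. (\<lambda>q. flat z q * cnj (flat (\<lambda>j g. w j (g + - h)) q)) (?b p)) = inner2 (flat z) (flat (\<lambda>j g. w j (g + - h)))"
    unfolding inner2_def by (rule infsum_reindex_bij_betw)
  then show ?thesis by (simp add: inner2_def flat_def add.assoc)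
qed

text \<open>Pythagoras: the reproducing vector of the smaller kernel is the orthogonal projection of
  that of the larger one.\<close>

lemma reproducing_diff:
  fixes a :: "nat \<Rightarrow> nat \<Rightarrow> 'g::group_add \<Rightarrow>\<^sub>0 complex"
  assumes sub: "l2_kernel k n a \<subseteq> l2_kernel k' n a'" and j: "j < n"
  defines "p \<equiv> reproducing n (l2_kernel k n a) j" and "p' \<equiv> reproducing n (l2_kernel k' n a') j"
  shows "sqnorm (\<lambda>i. p' i - p i) = sqnorm p' - sqnorm p" "ell2 (\<lambda>i. p' i - p i)"
proof -
  note K = l2_kernel_subset[of k n a] l2_kernel_closed[of k n a]
  note K' = l2_kernel_subset[of k' n a'] l2_kernel_closed[of k' n a']
  note Kd = pointwise_closed_subspaceD[OF K(2)]
  note Kd' = pointwise_closed_subspaceD[OF K'(2)]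
  have mem: "p \<in> flat ` l2_kernel k n a" "p' \<in> flat ` l2_kernel k' n a'"
    unfolding p_def p'_def using reproducing_mem[OF K j] reproducing_mem[OF K' j] by auto
  have e: "ell2 p" "ell2 p'" using mem Kd(1) Kd'(1) by auto
  then show "ell2 (\<lambda>i. p' i - p i)" by (intro ell2_diff)
  have "p \<in> flat ` l2_kernel k' n a'" using mem(1) sub by blast
  then have "inner2 p p' = p (j, 0)" unfolding p'_def by (rule reproducing_property[OF K' j])
  also have "\<dots> = inner2 p p"
    using reproducing_property[OF K j mem(1)] by (simp add: p_def)
  also have "\<dots> = of_real (sqnorm p)" by (rule inner2_self[OF e(1)])
  finally have "inner2 p' p = of_real (sqnorm p)" using inner2_cnj[OF e(1) e(2)] by simp
  then show "sqnorm (\<lambda>i. p' i - p i) = sqnorm p' - sqnorm p" using sqnorm_expand[OF e(2) e(1), of 1] by simp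
qed

lemma l2_kernel_dim_mono:
  fixes a :: "nat \<Rightarrow> nat \<Rightarrow> 'g::group_add \<Rightarrow>\<^sub>0 complex"
  assumes "l2_kernel k n a \<subseteq> l2_kernel k' n a'"
  shows "Re (vN_dim n (l2_kernel k n a)) \<le> Re (vN_dim n (l2_kernel k' n a'))"
  unfolding vN_dim_reproducing[OF l2_kernel_subset l2_kernel_closed] Re_complex_of_real
proof (rule sum_mono)
  fix j assume "j \<in> {..<n}"
  then have j: "j < n" by simp
  show "sqnorm (reproducing n (l2_kernel k n a) j) \<le> sqnorm (reproducing n (l2_kernel k' n a') j)"
    using reproducing_diff(1)[OF assms j] sqnorm_nonneg[of "\<lambda>i. reproducing n (l2_kernel k' n a') j i - reproducing n (l2_kernel k n a) j i"]
    by linarith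
qed

text \<open>Faithfulness of the trace. Equal dimensions make the reproducing vectors coincide, which
  controls evaluation at the identity only; invariance of both kernels under right translation
  carries it to every group element.\<close>

lemma l2_kernel_eq_of_dim:
  fixes a :: "nat \<Rightarrow> nat \<Rightarrow> 'g::group_add \<Rightarrow>\<^sub>0 complex"
  assumes sub: "l2_kernel k n a \<subseteq> l2_kernel k' n a'"
    and dim: "vN_dim n (l2_kernel k n a) = vN_dim n (l2_kernel k' n a')"
  shows "l2_kernel k' n a' \<subseteq> l2_kernel k n a"
proof
  let ?K = "l2_kernel k n a" and ?K' = "l2_kernel k' n a'"
  note K = l2_kernel_subset[of k n a] l2_kernel_closed[of k n a]
  note K' = l2_kernel_subset[of k' n a'] l2_kernel_closed[of k' n a']
  note Kd = pointwise_closed_subspaceD[OF K(2)]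
  note Kd' = pointwise_closed_subspaceD[OF K'(2)]
  define \<pi> where "\<pi> j = reproducing n ?K j" for j
  define \<pi>' where "\<pi>' j = reproducing n ?K' j" for j
  have mem: "\<pi> j \<in> flat ` ?K" "\<pi>' j \<in> flat ` ?K'" if "j < n" for j
    unfolding \<pi>_def \<pi>'_def using reproducing_mem[OF K that] reproducing_mem[OF K' that] by auto
  have diff: "sqnorm (\<lambda>i. \<pi>' j i - \<pi> j i) = sqnorm (\<pi>' j) - sqnorm (\<pi> j)" if j: "j < n" for j
    unfolding \<pi>_def \<pi>'_def by (rule reproducing_diff[OF sub j])
  have "(\<Sum>j<n. sqnorm (\<pi> j)) = (\<Sum>j<n. sqnorm (\<pi>' j))"
    using dim vN_dim_reproducing[OF K] vN_dim_reproducing[OF K'] by (simp add: \<pi>_def \<pi>'_def flip: of_real_sum)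
  then have "(\<Sum>j<n. sqnorm (\<lambda>i. \<pi>' j i - \<pi> j i)) = 0" by (simp add: diff sum_subtractf)
  then have "\<forall>j\<in>{..<n}. sqnorm (\<lambda>i. \<pi>' j i - \<pi> j i) = 0"
    by (subst (asm) sum_nonneg_eq_0_iff) (auto simp: sqnorm_nonneg)
  then have eq: "\<pi>' j = \<pi> j" if "j < n" for j
  proof -
    have "ell2 (\<lambda>i. \<pi>' j i - \<pi> j i)" using mem[OF that] Kd(1) Kd'(1) by (intro ell2_diff) auto
    then have "\<pi>' j i - \<pi> j i = 0" for i
      using sqnorm_eq_0[of "\<lambda>i. \<pi>' j i - \<pi> j i" i] \<open>\<forall>j\<in>{..<n}. _\<close> that by simp
    then show ?thesis by (simp add: fun_eq_iff)
  qed
  fix z assume z: "z \<in> ?K'"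
  define p where "p = l2_projection n ?K z"
  have zl: "z \<in> l2_vec n" using z K'(1) by blast
  have p: "p \<in> ?K" "\<And>w. w \<in> ?K \<Longrightarrow> inner2 (\<lambda>q. flat z q - flat p q) (flat w) = 0"
    unfolding p_def using l2_projection_orthogonal[OF K zl] by auto
  define y where "y j g = z j g - p j g" for j g
  have y: "y \<in> ?K'" using l2_kernel_lin[OF z subsetD[OF sub p(1)], of 1 "-1"] by (simp add: y_def[abs_def])
  have fy: "flat y = (\<lambda>q. flat z q - flat p q)" by (simp add: flat_def y_def fun_eq_iff)
  \<comment> \<open>The value at \<open>h\<close> is the inner product of the translate of
    \<open>y\<close> with a vector of the smaller kernel, to which all translates of
    \<open>y\<close> are orthogonal.\<close>
  have "y j h = 0" for j h
  proof (cases "j < n")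
    case True
    let ?yh = "\<lambda>j g. y j (g + h)"
    have "flat ?yh \<in> flat ` ?K'" using l2_kernel_shift[OF y, of h] by blast
    then have "inner2 (flat ?yh) (\<pi> j) = flat ?yh (j, 0)"
      using reproducing_property[OF K' True] eq[OF True] by (simp add: \<pi>'_def)
    moreover obtain w where w: "w \<in> ?K" "\<pi> j = flat w" using mem(1)[OF True] by blast
    moreover have "inner2 (flat ?yh) (flat w) = 0"
      unfolding inner2_shift fy using p(2) l2_kernel_shift[OF w(1), of "- h"] by blast
    ultimately show ?thesis by (simp add: flat_def)
  next
    case False
    then show ?thesis using y by (simp add: l2_kernel_def l2_vec_def)
  qed
  then have "z = p" by (simp add: y_def fun_eq_iff)
  then show "z \<in> ?K" using p(1) by simp
qed

section \<open>Consequences of the strong Atiyah conjecture\<close>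

text \<open>The factorial of a bound for the orders of finite subgroups is a common denominator. A
  natural number results because the dimension is a sum of square norms.\<close>

lemma atiyah_quantized:
  assumes at: "strong_atiyah TYPE('g::group_add)" and bd: "bounded_finite_subgroups TYPE('g)"
  shows "\<exists>N>0. \<forall>k>0. \<forall>n>0. \<forall>a :: nat \<Rightarrow> nat \<Rightarrow> 'g \<Rightarrow>\<^sub>0 complex.
    \<exists>t :: nat. of_nat N * vN_dim n (l2_kernel k n a) = of_nat t"
proof -
  obtain B where B: "\<And>H :: 'g set. finite_subgroup H \<Longrightarrow> card H \<le> B"
    using bd unfolding bounded_finite_subgroups_def by blast
  define N where "N = (fact B :: nat)"
  have int: "of_nat N * q \<in> \<int>" if "q \<in> group_closure {1 / of_nat (card H) | H :: 'g set. finite_subgroup H}" for q :: rat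
    using that
  proof induction
    case (base s)
    then have "s = 0 \<or> (\<exists>H :: 'g set. finite_subgroup H \<and> s = 1 / of_nat (card H))" by blast
    then consider "s = 0" | H :: "'g set" where "finite_subgroup H" "s = 1 / of_nat (card H)" by blast
    then show ?case
    proof cases
      case 2
      have "card H > 0" using 2(1) by (auto simp: finite_subgroup_def card_gt_0_iff)
      then have "card H dvd N" unfolding N_def using B[OF 2(1)] by (intro dvd_fact) auto
      then obtain c where "N = card H * c" by blast
      then have "of_nat N * s = of_nat c" using 2(2) \<open>card H > 0\<close> by simp
      then show ?thesis by simp
    qed simp
  next
    case (diff s t)
    then show ?case by (simp add: right_diff_distrib)
  qed
  have "\<exists>t :: nat. of_nat N * vN_dim n (l2_kernel k n a) = of_nat t" if k: "k > 0" and n: "n > 0"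
    for k n and a :: "nat \<Rightarrow> nat \<Rightarrow> 'g \<Rightarrow>\<^sub>0 complex"
  proof -
    note atn = at[unfolded strong_atiyah_def, THEN spec[of _ k], THEN mp, OF k, THEN spec[of _ n], THEN mp, OF n, THEN spec[of _ a]]
    obtain q where qm: "q \<in> group_closure {1 / of_nat (card H) | H :: 'g set. finite_subgroup H}"
      and q2: "vN_dim n (l2_kernel k n a) = of_rat q"
      by (rule bexE[OF atn])
    note q = int[OF qm] q2
    define v where "v = (\<Sum>j<n. sqnorm (reproducing n (l2_kernel k n a) j))"
    have v: "v \<ge> 0" "vN_dim n (l2_kernel k n a) = of_real v"
      unfolding v_def by (intro sum_nonneg sqnorm_nonneg) (rule vN_dim_reproducing[OF l2_kernel_subset l2_kernel_closed])
    obtain i where i: "of_nat N * q = of_int i" using q(1) by (auto elim: Ints_cases)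
    have e: "of_nat N * vN_dim n (l2_kernel k n a) = of_int i"
      using arg_cong[OF i, of "of_rat :: rat \<Rightarrow> complex"] q(2) by (simp add: of_rat_mult)
    then have "complex_of_real (real N * v) = of_real (of_int i)" by (simp add: v(2))
    then have "real N * v = of_int i" by (simp only: of_real_eq_iff)
    then have "i \<ge> 0" using v(1) by (metis mult_nonneg_nonneg of_int_0_le_iff of_nat_0_le_iff)
    then have "of_nat N * vN_dim n (l2_kernel k n a) = of_nat (nat i)" using e by simp
    then show ?thesis ..
  qed
  moreover have "N > 0" by (simp add: N_def)
  ultimately show ?thesis by blast
qed

definition row_matrix :: "(nat \<Rightarrow>\<^sub>0 'g \<Rightarrow>\<^sub>0 int) list \<Rightarrow> nat \<Rightarrow> nat \<Rightarrow> 'g \<Rightarrow>\<^sub>0 complex" where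
  "row_matrix ds i j = Poly_Mapping.map of_int (lookup (ds ! i) j)"

lemma convolve_map_of_int:
  "convolve (Poly_Mapping.map of_int p) (\<lambda>g. of_real (v g)) g = of_real (ring_act p v g)"
proof -
  have l: "lookup (Poly_Mapping.map of_int p :: 'a \<Rightarrow>\<^sub>0 complex) s = of_int (lookup p s)" for s
    by (simp add: Poly_Mapping.map.rep_eq when_def)
  then have "supp (Poly_Mapping.map of_int p :: 'a \<Rightarrow>\<^sub>0 complex) = supp p"
    by (auto simp: in_keys_iff)
  then show ?thesis by (simp add: convolve_def ring_act_def l)
qed

text \<open>Among nonempty finite lists of relations one has a kernel of least dimension, since the
  dimensions are multiples of a fixed \<open>1 / N\<close>. Adding a further relation shrinks the
  kernel but cannot lower its dimension, hence does not change it. Summable configurations are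
  square-summable, so the equality of kernels applies to them.\<close>

theorem finite_kernel_determination:
  fixes L :: "(nat \<Rightarrow>\<^sub>0 'g::group_add \<Rightarrow>\<^sub>0 int) set"
  assumes at: "strong_atiyah TYPE('g)" and bd: "bounded_finite_subgroups TYPE('g)"
    and L: "L \<subseteq> free_module m"
  shows "\<exists>D. finite D \<and> D \<subseteq> L \<and> (\<forall>u M. (\<forall>j E. finite E \<longrightarrow> (\<Sum>g\<in>E. \<bar>u j g\<bar>) \<le> M) \<longrightarrow>
    (\<forall>d\<in>D. \<forall>g. row_act d u g = 0) \<longrightarrow> (\<forall>d\<in>L. \<forall>g. row_act d u g = 0))"
proof (cases "L = {} \<or> m = 0")
  \<comment> \<open>Dimensions are quantised for matrices of positive size only, so this degenerate
    case is settled by hand.\<close>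
  case True
  then have "d = 0" if "d \<in> L" for d using that L by (auto simp: free_module_def)
  then show ?thesis by (intro exI[of _ "{}"]) (auto, metis row_act_zero)
next
  case False
  obtain N :: nat where N0: "N > 0 \<and> (\<forall>k>0. \<forall>n>0. \<forall>a :: nat \<Rightarrow> nat \<Rightarrow> 'g \<Rightarrow>\<^sub>0 complex.
      \<exists>t :: nat. of_nat N * vN_dim n (l2_kernel k n a) = of_nat t)"
    by (rule exE[OF atiyah_quantized[OF at bd]])
  have N: "N > 0" "\<And>k n (a :: nat \<Rightarrow> nat \<Rightarrow> 'g \<Rightarrow>\<^sub>0 complex). k > 0 \<Longrightarrow> n > 0 \<Longrightarrow>
      \<exists>t :: nat. of_nat N * vN_dim n (l2_kernel k n a) = of_nat t"
    using N0 by simp_all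
  define ker where "ker ds = l2_kernel (length ds) m (row_matrix ds)" for ds :: "(nat \<Rightarrow>\<^sub>0 'g \<Rightarrow>\<^sub>0 int) list"
  define t where "t ds = (SOME t :: nat. of_nat N * vN_dim m (ker ds) = of_nat t)" for ds
  have t: "of_nat N * vN_dim m (ker ds) = of_nat (t ds)" if "ds \<noteq> []" for ds
  proof -
    have "\<exists>t :: nat. of_nat N * vN_dim m (ker ds) = of_nat t"
      unfolding ker_def using that False by (intro N(2)) auto
    then show ?thesis unfolding t_def by (rule someI_ex)
  qed
  obtain d0 where d0: "d0 \<in> L" using False by blast
  define good where "good ds \<longleftrightarrow> ds \<noteq> [] \<and> set ds \<subseteq> L" for ds
  have "good [d0]" using d0 by (simp add: good_def)
  then obtain ds where ds: "good ds" "\<And>es. good es \<Longrightarrow> t ds \<le> t es"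
    using ex_has_least_nat[of good "[d0]" t] by blast
  have sub: "ker (d # ds) \<subseteq> ker ds" for d
  proof
    fix z assume z: "z \<in> ker (d # ds)"
    have "(\<Sum>j<m. convolve (row_matrix ds i j) (z j) g) = 0" if "i < length ds" for i g
    proof -
      have "row_matrix (d # ds) (Suc i) = row_matrix ds i" by (simp add: row_matrix_def fun_eq_iff)
      moreover have "(\<Sum>j<m. convolve (row_matrix (d # ds) (Suc i) j) (z j) g) = 0"
        using z that by (simp add: ker_def l2_kernel_def)
      ultimately show ?thesis by simp
    qed
    then show "z \<in> ker ds" using z by (simp add: ker_def l2_kernel_def)
  qed
  have full: "ker ds \<subseteq> ker (d # ds)" if d: "d \<in> L" for d
  proof -
    have g: "good (d # ds)" using ds(1) d by (simp add: good_def)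
    have ne: "ds \<noteq> []" "d # ds \<noteq> []" using ds(1) by (auto simp: good_def)
    obtain v where v: "vN_dim m (ker ds) = of_real v"
      using vN_dim_reproducing[OF l2_kernel_subset l2_kernel_closed] unfolding ker_def by blast
    obtain v' where v': "vN_dim m (ker (d # ds)) = of_real v'"
      using vN_dim_reproducing[OF l2_kernel_subset l2_kernel_closed] unfolding ker_def by blast
    have dim: "vN_dim m (ker (d # ds)) = vN_dim m (ker ds)"
    proof -
      have le: "v' \<le> v" using l2_kernel_dim_mono[OF sub[of d, unfolded ker_def]] v v' unfolding ker_def by simp
      have real_eq: "real N * x = real r" if "complex_of_nat N * complex_of_real x = of_nat r" for x r
        using arg_cong[OF that, of Re] by simp
      have "real N * v = real (t ds)" "real N * v' = real (t (d # ds))"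
        by (rule real_eq, use t[OF ne(1)] in \<open>simp only: v\<close>) (rule real_eq, use t[OF ne(2)] in \<open>simp only: v'\<close>)
      then have "real N * v \<le> real N * v'" using ds(2)[OF g] by simp
      then have "v \<le> v'" using N(1) by simp
      then show ?thesis using le v v' by simp
    qed
    show ?thesis
      using l2_kernel_eq_of_dim[OF sub[of d, unfolded ker_def] dim[unfolded ker_def]] unfolding ker_def .
  qed
  \<comment> \<open>Components from \<open>m\<close> on are set to \<open>0\<close>, as membership
    in \<open>l2_vec m\<close> demands; rows in \<open>free_module m\<close> do not see
    them.\<close>
  have kerI: "(\<lambda>j g. if j < m then complex_of_real (u j g) else 0) \<in> ker es \<longleftrightarrow>
      (\<forall>d\<in>set es. \<forall>g. row_act d u g = 0)"
    if u: "\<forall>j E. finite E \<longrightarrow> (\<Sum>g\<in>E. \<bar>u j g\<bar>) \<le> M" and es: "set es \<subseteq> L" for u M es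
  proof -
    let ?z = "\<lambda>j g. if j < m then complex_of_real (u j g) else 0"
    have M: "\<bar>u j g\<bar> \<le> M" for j g using u[rule_format, of "{g}" j] by simp
    have "ell2 (\<lambda>g. complex_of_real (u j g))" for j
    proof (rule ell2_bounded_sums)
      fix E :: "'g set" assume E: "finite E"
      have "(\<Sum>g\<in>E. (cmod (complex_of_real (u j g)))\<^sup>2) \<le> (\<Sum>g\<in>E. M * \<bar>u j g\<bar>)"
      proof (rule sum_mono)
        fix g
        have "(cmod (complex_of_real (u j g)))\<^sup>2 = \<bar>u j g\<bar> * \<bar>u j g\<bar>" by (simp add: power2_eq_square)
        also have "\<dots> \<le> M * \<bar>u j g\<bar>" by (rule mult_right_mono[OF M]) simp
        finally show "(cmod (complex_of_real (u j g)))\<^sup>2 \<le> M * \<bar>u j g\<bar>" .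
      qed
      also have "\<dots> \<le> M * M" unfolding sum_distrib_left[symmetric]
        using u E M[of j 0] by (intro mult_left_mono) auto
      finally show "(\<Sum>g\<in>E. (cmod (complex_of_real (u j g)))\<^sup>2) \<le> M * M" .
    qed
    then have "?z \<in> l2_vec m" by (simp add: l2_vec_def ell2_def)
    moreover have "(\<Sum>j<m. convolve (row_matrix es i j) (?z j) g) = of_real (row_act (es ! i) u g)" if i: "i < length es" for i g
    proof -
      have "es ! i \<in> free_module m" using es L i by (meson nth_mem subsetD)
      then have "row_act (es ! i) u g = (\<Sum>j<m. ring_act (lookup (es ! i) j) (u j) g)"
        by (rule row_act_ring_act)
      then show ?thesis by (simp add: row_matrix_def convolve_map_of_int)
    qed
    ultimately have "?z \<in> ker es \<longleftrightarrow> (\<forall>i<length es. \<forall>g. row_act (es ! i) u g = 0)"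
      by (simp add: ker_def l2_kernel_def)
    then show ?thesis by (simp add: all_set_conv_all_nth)
  qed
  have "row_act d u g = 0" if u: "\<forall>j E. finite E \<longrightarrow> (\<Sum>g\<in>E. \<bar>u j g\<bar>) \<le> M" and D: "\<forall>d\<in>set ds. \<forall>g. row_act d u g = 0"
    and d: "d \<in> L" for u M d g
  proof -
    have "set (d # ds) \<subseteq> L" "set ds \<subseteq> L" using ds(1) d by (auto simp: good_def)
    then show ?thesis using kerI[OF u, of ds] kerI[OF u, of "d # ds"] D full[OF d] by auto
  qed
  then show ?thesis using ds(1) unfolding good_def by (intro exI[of _ "set ds"]) blast
qed

section \<open>Real coordinates on an algebraic action\<close>

lemma cis_eq_1_iff: "cis (2 * pi * r) = 1 \<longleftrightarrow> r \<in> \<int>"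
proof
  assume "cis (2 * pi * r) = 1"
  then have "cos (2 * pi * r) = 1" by (simp add: complex_eq_iff)
  then obtain k :: int where "2 * pi * r = of_int k * (2 * pi)" by (auto simp: cos_one_2pi_int)
  then have "r = of_int k" by simp
  then show "r \<in> \<int>" by simp
next
  assume "r \<in> \<int>"
  then show "cis (2 * pi * r) = 1" by (auto elim!: Ints_cases simp: cis_multiple_2pi)
qed

lemma dist_cis_1_le: "cmod (cis t - 1) \<le> \<bar>t\<bar>"
proof -
  have "(cmod (cis t - 1))\<^sup>2 = (cos t - 1)\<^sup>2 + (sin t)\<^sup>2" by (simp add: cmod_power2)
  also have "\<dots> = 2 - 2 * cos t"
    using sin_cos_squared_add[of t] by (simp add: power2_eq_square algebra_simps)
  also have "\<dots> = (2 * sin (t / 2))\<^sup>2"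
    using cos_double_sin[of "t / 2"] by (simp add: power_mult_distrib)
  finally have "cmod (cis t - 1) = \<bar>2 * sin (t / 2)\<bar>"
    by (metis norm_ge_zero power2_abs power2_eq_iff_nonneg abs_ge_zero)
  also have "\<dots> \<le> \<bar>t\<bar>" using abs_sin_x_le_abs_x[of "t / 2"] by (simp add: abs_mult)
  finally show ?thesis .
qed

lemma char_fun_sum: "char_fun (\<Sum>i\<in>I. f i) x = (\<Prod>i\<in>I. char_fun (f i) x)"
  by (induction I rule: infinite_finite_induct) (auto simp: char_fun_plus char_fun_zero)

lemma char_fun_at_0 [simp]: "char_fun \<gamma> 0 = 1"
  using char_fun_add[of \<gamma> 0 0] by simp

lemma char_fun_minus: "char_fun \<gamma> (- x) = inverse (char_fun \<gamma> x)"
  using char_fun_add[of \<gamma> x "- x"] by (simp add: inverse_unique)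

lemma char_fun_diff: "char_fun \<gamma> (x - y) = char_fun \<gamma> x / char_fun \<gamma> y"
  using char_fun_add[of \<gamma> x "- y"] by (simp add: char_fun_minus divide_inverse)

lemma row_act_single:
  "row_act (Poly_Mapping.single i (Poly_Mapping.single s k)) t g = of_int k * t i (- s + g)"
  by (subst row_act_superset[of "{(i, s)}"]) (auto simp: row_supp_def coef_single split: if_splits)

lemma (in algebraic_action) act_0 [simp]: "act g 0 = 0"
  using act_add[of g 0 0] by simp

lemma (in algebraic_action) act_minus: "act g (- x) = - act g x"
  using act_add[of g x "- x"] by (simp add: eq_neg_iff_add_eq_0 add.commute)

lemma (in algebraic_action) act_diff: "act g (x - y) = act g x - act g y"
  using act_add[of g x "- y"] by (simp add: act_minus)

definition relations :: "('g::group_add \<Rightarrow> 'x::topological_ab_group_add \<Rightarrow> 'x) \<Rightarrow> nat \<Rightarrow> (nat \<Rightarrow> 'x pontryagin_dual) \<Rightarrow> (nat \<Rightarrow>\<^sub>0 'g \<Rightarrow>\<^sub>0 int) set" where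
  "relations act n \<theta> = {a \<in> free_module n. (\<Sum>i<n. dual_scale act (lookup a i) (\<theta> i)) = 0}"

lemma (in algebraic_action) submodule_relations: "submodule free_scale (relations act n \<theta>)"
proof -
  interpret dual: left_module "dual_scale act" by (rule left_module_dual_scale)
  have "submodule free_scale (free_module n :: (nat \<Rightarrow>\<^sub>0 'g \<Rightarrow>\<^sub>0 int) set)" by (rule submodule_free_module)
  note fm = this[unfolded submodule_def]
  show ?thesis unfolding submodule_def
  proof (intro conjI ballI allI)
    show "0 \<in> relations act n \<theta>" using fm by (simp add: relations_def dual.smul_zero_left)
    show "x + y \<in> relations act n \<theta>" if "x \<in> relations act n \<theta>" "y \<in> relations act n \<theta>" for x y
      using that fm by (simp add: relations_def lookup_add dual.smul_left_distrib sum.distrib)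
    show "free_scale r x \<in> relations act n \<theta>" if "x \<in> relations act n \<theta>" for r x
      using that fm
      by (simp add: relations_def lookup_free_scale dual.smul_zero_right flip: dual.smul_smul dual.smul_sum)
  qed
qed

text \<open>Asking for separation of points, rather than for generators of the dual, is tailored to
  both constructions of coordinates: from expansiveness and from a finite presentation.\<close>

locale coordinate_action = algebraic_action act
  for act :: "'g::group_add \<Rightarrow> 'x::{metric_space, topological_ab_group_add} \<Rightarrow> 'x" +
  fixes n :: nat and \<theta> :: "nat \<Rightarrow> 'x pontryagin_dual"
  assumes compact_space: "compact (UNIV :: 'x set)"
    and separating: "\<And>x. (\<And>i g. i < n \<Longrightarrow> char_fun (\<theta> i) (act g x) = 1) \<Longrightarrow> x = 0"
begin

definition lifts :: "(nat \<Rightarrow> 'g \<Rightarrow> real) \<Rightarrow> 'x \<Rightarrow> bool" where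
  "lifts t x \<longleftrightarrow> (\<forall>i<n. \<forall>g. char_fun (\<theta> i) (act g x) = cis (2 * pi * t i g))"

definition phase :: "'x \<Rightarrow> nat \<Rightarrow> 'g \<Rightarrow> real" where
  "phase x i g = (if i < n then Arg (char_fun (\<theta> i) (act g x)) / (2 * pi) else 0)"

lemma lifts_phase: "lifts (phase x) x"
  unfolding lifts_def
proof (intro allI impI)
  fix i g assume "i < n"
  then show "char_fun (\<theta> i) (act g x) = cis (2 * pi * phase x i g)"
    using cis_Arg[of "char_fun (\<theta> i) (act g x)"] by (simp add: phase_def sgn_div_norm)
qed

lemma phase_bound: "\<bar>phase x i g\<bar> \<le> 1 / 2"
proof -
  have "\<bar>Arg (char_fun (\<theta> i) (act g x))\<bar> \<le> pi" using Arg_bounded[of "char_fun (\<theta> i) (act g x)"] by auto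
  then show ?thesis by (simp add: phase_def field_simps)
qed

lemma lifts_zero: "lifts (\<lambda>_ _. 0) 0"
  by (simp add: lifts_def)

lemma lifts_add: "lifts t x \<Longrightarrow> lifts s y \<Longrightarrow> lifts (\<lambda>i g. t i g + s i g) (x + y)"
  by (simp add: lifts_def act_add char_fun_add cis_mult distrib_left)

lemma lifts_diff: "lifts t x \<Longrightarrow> lifts s y \<Longrightarrow> lifts (\<lambda>i g. t i g - s i g) (x - y)"
  by (simp add: lifts_def act_diff char_fun_diff cis_divide right_diff_distrib)

lemma lifts_sum:
  "(\<And>k. k \<in> K \<Longrightarrow> lifts (t k) (x k)) \<Longrightarrow> lifts (\<lambda>i g. \<Sum>k\<in>K. t k i g) (\<Sum>k\<in>K. x k)"
  by (induction K rule: infinite_finite_induct) (auto simp: lifts_zero lifts_add)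

lemma lifts_shift: "lifts t x \<Longrightarrow> lifts (\<lambda>i g. t i (g + h)) (act h x)"
  by (simp add: lifts_def act_act)

lemma lifts_character:
  assumes "lifts t x" and a: "a \<in> free_module n"
  shows "char_fun (\<Sum>i<n. dual_scale act (lookup a i) (\<theta> i)) (act g x) = cis (2 * pi * row_act a t g)"
proof -
  have "char_fun (dual_scale act p (\<theta> i)) (act g x) = cis (2 * pi * ring_act p (t i) g)" if "i < n" for i p
  proof -
    have "char_fun (\<theta> i) (act (- s) (act g x)) powi k = cis (2 * pi * (of_int k * t i (- s + g)))" for s k
      using assms(1) that by (simp add: lifts_def act_act cis_power_int mult_ac)
    then show ?thesis
      by (simp add: char_fun_dual_scale prod_cis ring_act_def sum_distrib_left)
  qed
  then have "char_fun (\<Sum>i<n. dual_scale act (lookup a i) (\<theta> i)) (act g x)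
      = (\<Prod>i<n. cis (2 * pi * ring_act (lookup a i) (t i) g))"
    by (simp add: char_fun_sum)
  then show ?thesis by (simp add: prod_cis row_act_ring_act[OF a] sum_distrib_left)
qed

lemma lifts_integer:
  assumes "lifts t x" "a \<in> relations act n \<theta>"
  shows "row_act a t g \<in> \<int>"
  using lifts_character[OF assms(1), of a g] assms(2) by (simp add: relations_def char_fun_zero flip: cis_eq_1_iff)

text \<open>Kronecker's theorem for the family of all translates of the \<open>\<theta> i\<close>: a
  multiplicative relation among finitely many of them is a row in
  \<open>relations act n \<theta>\<close>.\<close>

lemma exists_lifts:
  assumes t: "\<And>a g. a \<in> relations act n \<theta> \<Longrightarrow> row_act a t g \<in> \<int>"
  shows "\<exists>x. lifts t x"
proof -
  \<comment> \<open>Indices from \<open>n\<close> on receive the trivial character and the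
    prescribed value \<open>0\<close>, so that the family is indexed by the whole type.\<close>
  define \<psi> where "\<psi> p = (if fst p < n then dual_scale act (Poly_Mapping.single (- snd p) 1) (\<theta> (fst p)) else 0)" for p :: "nat \<times> 'g"
  define t' where "t' p = (if fst p < n then t (fst p) (snd p) else 0)" for p
  have \<psi>: "char_fun (\<psi> p) x = (if fst p < n then char_fun (\<theta> (fst p)) (act (snd p) x) else 1)" for p x
    by (simp add: \<psi>_def char_fun_zero char_fun_dual_scale)
  have "\<exists>x. \<forall>p. char_fun (\<psi> p) x = cis (2 * pi * t' p)"
  proof (rule kronecker[OF compact_space])
    fix E :: "(nat \<times> 'g) set" and a :: "nat \<times> 'g \<Rightarrow> int"
    assume E: "finite E" and one: "\<And>x. (\<Prod>e\<in>E. char_fun (\<psi> e) x powi a e) = 1"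
    define E' where "E' = {e\<in>E. fst e < n}"
    define r where "r = (\<Sum>e\<in>E'. Poly_Mapping.single (fst e) (Poly_Mapping.single (- snd e) (a e)))"
    have r: "r \<in> free_module n" unfolding r_def
      by (rule free.submodule_sum[OF submodule_free_module]) (auto simp: free_module_def E'_def)
    have act_r: "row_act r u 0 = (\<Sum>e\<in>E'. of_int (a e) * u (fst e) (snd e))" for u
      by (simp add: r_def row_act_sum row_act_single)
    have "char_fun (\<Sum>i<n. dual_scale act (lookup r i) (\<theta> i)) x = 1" for x
    proof -
      have "char_fun (\<Sum>i<n. dual_scale act (lookup r i) (\<theta> i)) x = cis (\<Sum>e\<in>E'. 2 * pi * (of_int (a e) * phase x (fst e) (snd e)))"
        using lifts_character[OF lifts_phase[of x] r, of 0] by (simp add: act_zero act_r sum_distrib_left)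
      also have "\<dots> = (\<Prod>e\<in>E'. char_fun (\<psi> e) x powi a e)"
        unfolding prod_cis[symmetric]
      proof (rule prod.cong)
        fix e assume "e \<in> E'"
        then show "cis (2 * pi * (of_int (a e) * phase x (fst e) (snd e))) = char_fun (\<psi> e) x powi a e"
          using lifts_phase[of x] by (simp add: \<psi> E'_def lifts_def cis_power_int mult_ac)
      qed simp
      also have "\<dots> = (\<Prod>e\<in>E. char_fun (\<psi> e) x powi a e)"
        by (rule prod.mono_neutral_left) (use E in \<open>auto simp: E'_def \<psi>\<close>)
      finally show ?thesis using one by simp
    qed
    then have "r \<in> relations act n \<theta>"
      using r by (simp add: relations_def char_fun_inject[symmetric] char_fun_zero fun_eq_iff)
    then have "row_act r t 0 \<in> \<int>" by (rule t)
    moreover have "(\<Sum>e\<in>E. of_int (a e) * t' e) = (\<Sum>e\<in>E'. of_int (a e) * t (fst e) (snd e))"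
      by (rule sum.mono_neutral_cong_right) (use E in \<open>auto simp: E'_def t'_def\<close>)
    ultimately show "(\<Sum>e\<in>E. of_int (a e) * t' e) \<in> \<int>" by (simp add: act_r)
  qed
  then obtain x where x: "\<forall>p. char_fun (\<psi> p) x = cis (2 * pi * t' p)" by (rule exE)
  have "char_fun (\<theta> i) (act g x) = cis (2 * pi * t i g)" if "i < n" for i g
    using x[THEN spec[of _ "(i, g)"]] that by (simp add: \<psi> t'_def)
  then have "lifts t x" by (simp add: lifts_def)
  then show ?thesis ..
qed

text \<open>The complement of \<open>U\<close> is compact and avoids \<open>0\<close>; by separation
  finitely many coordinates, each bounded away from integers by a definite amount, detect all its
  points.\<close>

lemma lifts_neighbourhood:
  assumes "open U" "0 \<in> U"
  shows "\<exists>S \<epsilon>. finite S \<and> \<epsilon> > 0 \<and> (\<forall>t x. lifts t x \<longrightarrow> (\<forall>g\<in>S. \<forall>i<n. \<bar>t i g\<bar> < \<epsilon>) \<longrightarrow> x \<in> U)"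
proof -
  define C where "C p = {x. cmod (char_fun (\<theta> (fst p)) (act (fst (snd p)) x) - 1) > 1 / real (Suc (snd (snd p)))}" for p :: "nat \<times> 'g \<times> nat"
  define I where "I = {p :: nat \<times> 'g \<times> nat. fst p < n}"
  have comp: "compact (- U)" using compact_Int_closed[OF compact_space, of "- U"] assms(1) by (simp add: closed_Compl)
  have op: "open (C p)" for p
  proof -
    have "continuous_on UNIV (\<lambda>x. char_fun (\<theta> (fst p)) (act (fst (snd p)) x))"
      by (rule continuous_on_compose2[OF char_fun_continuous continuous_act]) auto
    then show ?thesis unfolding C_def by (intro open_Collect_less continuous_intros)
  qed
  have "- U \<subseteq> (\<Union>p\<in>I. C p)"
  proof
    fix x assume "x \<in> - U"
    then have "x \<noteq> 0" using assms(2) by auto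
    then obtain i g where ig: "i < n" "char_fun (\<theta> i) (act g x) \<noteq> 1" using separating by blast
    then obtain k where "1 / real (Suc k) < cmod (char_fun (\<theta> i) (act g x) - 1)"
      using reals_Archimedean[of "cmod (char_fun (\<theta> i) (act g x) - 1)"] by (auto simp: inverse_eq_divide)
    then show "x \<in> (\<Union>p\<in>I. C p)" using ig by (intro UN_I[of "(i, g, k)"]) (auto simp: I_def C_def)
  qed
  then obtain D where D: "D \<subseteq> I" "finite D" "- U \<subseteq> (\<Union>p\<in>D. C p)"
    using compactE_image[OF comp, of I C] op by blast
  define \<epsilon> where "\<epsilon> = Min (insert 1 ((\<lambda>p. 1 / (2 * pi * real (Suc (snd (snd p))))) ` D))"
  have "\<epsilon> > 0" unfolding \<epsilon>_def using D(2) by (subst Min_gr_iff) auto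
  moreover have "x \<in> U" if l: "lifts t x" and small: "\<forall>g\<in>(fst \<circ> snd) ` D. \<forall>i<n. \<bar>t i g\<bar> < \<epsilon>" for t x
  proof (rule ccontr)
    assume "x \<notin> U"
    then obtain p where p: "p \<in> D" "x \<in> C p" using D(3) by blast
    obtain i g k where ig: "p = (i, g, k)" by (cases p)
    have i: "i < n" using p(1) D(1) ig by (auto simp: I_def)
    have "\<epsilon> \<le> 1 / (2 * pi * real (Suc k))" unfolding \<epsilon>_def
      by (rule Min_le) (use D(2) p(1) ig in \<open>auto intro!: image_eqI[of _ _ p]\<close>)
    moreover have "\<bar>t i g\<bar> < \<epsilon>" using small p(1) i ig by force
    ultimately have "\<bar>t i g\<bar> \<le> 1 / (2 * pi * real (Suc k))" by simp
    then have "2 * pi * \<bar>t i g\<bar> \<le> 2 * pi * (1 / (2 * pi * real (Suc k)))" by (rule mult_left_mono) simp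
    then have "\<bar>2 * pi * t i g\<bar> \<le> 1 / real (Suc k)" by (simp add: abs_mult)
    moreover have "1 / real (Suc k) < cmod (cis (2 * pi * t i g) - 1)"
      using p(2) l i by (simp add: C_def ig lifts_def)
    ultimately show False using dist_cis_1_le[of "2 * pi * t i g"] by linarith
  qed
  ultimately show ?thesis using D(2) by (intro exI[of _ "(fst \<circ> snd) ` D"] exI[of _ \<epsilon>]) blast
qed

lemma lifts_homoclinic:
  assumes t: "lifts t x" and small: "\<And>\<epsilon> i. \<epsilon> > 0 \<Longrightarrow> i < n \<Longrightarrow> finite {g. \<bar>t i g\<bar> \<ge> \<epsilon>}"
  shows "x \<in> homoclinic_group act"
  unfolding homoclinic_group_def mem_Collect_eq
proof (rule topological_tendstoI)
  fix U :: "'x set" assume "open U" "0 \<in> U"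
  then obtain S \<epsilon> where S: "finite S" "\<epsilon> > 0" "\<And>t x. lifts t x \<Longrightarrow> (\<forall>g\<in>S. \<forall>i<n. \<bar>t i g\<bar> < \<epsilon>) \<Longrightarrow> x \<in> U"
    using lifts_neighbourhood[of U] by blast
  have "{h. act h x \<notin> U} \<subseteq> (\<Union>g\<in>S. \<Union>i<n. (\<lambda>k. - g + k) ` {k. \<bar>t i k\<bar> \<ge> \<epsilon>})"
  proof
    fix h assume "h \<in> {h. act h x \<notin> U}"
    then have "\<not> (\<forall>g\<in>S. \<forall>i<n. \<bar>t i (g + h)\<bar> < \<epsilon>)"
      using S(3)[OF lifts_shift[OF t, of h]] by blast
    then obtain g i where "g \<in> S" "i < n" "\<bar>t i (g + h)\<bar> \<ge> \<epsilon>" by (auto simp: not_less)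
    moreover have "h = - g + (g + h)" by (simp add: add.assoc[symmetric])
    ultimately show "h \<in> (\<Union>g\<in>S. \<Union>i<n. (\<lambda>k. - g + k) ` {k. \<bar>t i k\<bar> \<ge> \<epsilon>})" by blast
  qed
  moreover have "finite (\<Union>g\<in>S. \<Union>i<n. (\<lambda>k. - g + k) ` {k. \<bar>t i k\<bar> \<ge> \<epsilon>})"
    using S(1,2) small by auto
  ultimately show "\<forall>\<^sub>F h in cofinite. act h x \<in> U"
    unfolding eventually_cofinite by (rule finite_subset)
qed

lemma phase_homoclinic:
  assumes x: "x \<in> homoclinic_group act" and "\<epsilon> > 0"
  shows "finite {g. \<bar>phase x i g\<bar> \<ge> \<epsilon>}"
proof (cases "i < n")
  case True
  have "isCont (char_fun (\<theta> i)) 0"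
    using char_fun_continuous[of "\<theta> i"] by (simp add: continuous_on_eq_continuous_at)
  then have "((\<lambda>g. char_fun (\<theta> i) (act g x)) \<longlongrightarrow> char_fun (\<theta> i) 0) cofinite"
    by (rule isCont_tendsto_compose) (use x in \<open>simp add: homoclinic_group_def\<close>)
  then have "((\<lambda>g. Arg (char_fun (\<theta> i) (act g x))) \<longlongrightarrow> Arg 1) cofinite"
    by (intro isCont_tendsto_compose[OF continuous_at_Arg]) auto
  then have "((\<lambda>g. phase x i g) \<longlongrightarrow> 0 / (2 * pi)) cofinite"
    unfolding phase_def using True by (simp only: if_True Arg_1) (intro tendsto_intros, auto)
  then have "((\<lambda>g. phase x i g) \<longlongrightarrow> 0) cofinite" by (simp only: div_0)
  from tendstoD[OF this \<open>\<epsilon> > 0\<close>] show ?thesis by (simp add: dist_real_def eventually_cofinite not_less)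
next
  case False
  then show ?thesis using \<open>\<epsilon> > 0\<close> by (simp add: phase_def)
qed

text \<open>A small multiple of \<open>u\<close> lifts some point, because the relations give
  \<open>0\<close> on it. The whole orbit of that point stays within the expansivity constant of
  \<open>0\<close>, so the point is \<open>0\<close> and its small lift is integral.\<close>

lemma bounded_kernel_trivial:
  assumes exp: "expansive act" and u: "\<And>i g. \<bar>u i g\<bar> \<le> 1"
    and rel: "\<And>a g. a \<in> relations act n \<theta> \<Longrightarrow> row_act a u g = 0" and j: "j < n"
  shows "u j 0 = 0"
proof -
  obtain c where c: "c > 0" "\<And>x y. x \<noteq> y \<Longrightarrow> \<exists>g. dist (act g x) (act g y) > c"
    using exp unfolding expansive_def by blast
  obtain S \<epsilon> where S: "finite S" "\<epsilon> > 0" "\<And>t x. lifts t x \<Longrightarrow> (\<forall>g\<in>S. \<forall>i<n. \<bar>t i g\<bar> < \<epsilon>) \<Longrightarrow> x \<in> ball 0 c"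
    using lifts_neighbourhood[of "ball 0 c"] c(1) by auto
  \<comment> \<open>Being below \<open>\<epsilon>\<close> confines the orbit; being below
    \<open>1\<close> leaves \<open>0\<close> as the only possible integral value of
    \<open>r * u j 0\<close>.\<close>
  define r where "r = min \<epsilon> 1 / 2"
  have r: "0 < r" "r < \<epsilon>" "r < 1" using S(2) by (auto simp: r_def)
  have ru: "\<bar>r * u i g\<bar> \<le> r" for i g using u[of i g] r(1) by (simp add: abs_mult mult_left_le)
  obtain x where x: "lifts (\<lambda>i g. r * u i g) x"
    using exists_lifts[of "\<lambda>i g. r * u i g"] rel by (auto simp: row_act_scale)
  have "act h x \<in> ball 0 c" for h
    by (rule S(3)[OF lifts_shift[OF x]]) (intro ballI allI impI le_less_trans[OF ru r(2)])
  then have "\<not> (\<exists>g. dist (act g x) (act g 0) > c)" by (simp add: dist_commute less_imp_le not_less)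
  then have "x = 0" using c(2)[of x 0] by blast
  then have "cis (2 * pi * (r * u j 0)) = 1" using x j by (simp add: lifts_def)
  then have "r * u j 0 \<in> \<int>" by (simp only: cis_eq_1_iff)
  moreover have "\<bar>r * u j 0\<bar> < 1" using ru[of j 0] r(3) by linarith
  ultimately show ?thesis using r(1) Ints_nonzero_abs_less1[of "r * u j 0"] by auto
qed

lemma expansive_near_identity:
  assumes "expansive act"
  shows "\<exists>\<alpha> N. near_identity n \<alpha> N \<and> (\<forall>j<n. \<alpha> j \<in> relations act n \<theta>)"
  by (rule exists_near_identity[OF submodule_relations])
    (auto simp: relations_def intro: bounded_kernel_trivial[OF assms, unfolded relations_def])

end

section \<open>Homoclinic points have positive independence density\<close>

lemma finite_support_l1:
  fixes w :: "nat \<Rightarrow> 'g \<Rightarrow> real"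
  assumes A: "finite A" "\<And>j g. g \<notin> A \<or> j \<ge> n \<Longrightarrow> w j g = 0"
  shows "\<exists>L\<ge>0. \<forall>j E. finite E \<longrightarrow> (\<Sum>g\<in>E. \<bar>w j g\<bar>) \<le> L"
proof (intro exI conjI allI impI)
  let ?L = "\<Sum>j<n. \<Sum>g\<in>A. \<bar>w j g\<bar>"
  show "0 \<le> ?L" by (intro sum_nonneg) auto
  fix j and E :: "'g set" assume E: "finite E"
  have "(\<Sum>g\<in>E. \<bar>w j g\<bar>) = (\<Sum>g\<in>E \<inter> A. \<bar>w j g\<bar>)"
    by (rule sum.mono_neutral_right) (use E A(2) in auto)
  also have "\<dots> \<le> (\<Sum>g\<in>A. \<bar>w j g\<bar>)" by (rule sum_mono2) (use A(1) in auto)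
  also have "\<dots> \<le> ?L"
  proof (cases "j < n")
    case True
    then show ?thesis by (intro member_le_sum[of j "{..<n}" "\<lambda>j. \<Sum>g\<in>A. \<bar>w j g\<bar>"]) (auto intro: sum_nonneg)
  next
    case False
    then have "(\<Sum>g\<in>A. \<bar>w j g\<bar>) = 0" using A(2) by simp
    then show ?thesis using \<open>0 \<le> ?L\<close> by linarith
  qed
  finally show "(\<Sum>g\<in>E. \<bar>w j g\<bar>) \<le> ?L" .
qed

lemma abs_sum_at_most_one:
  fixes f :: "'a \<Rightarrow> real"
  assumes fin: "finite I" and one: "\<And>s s'. s \<in> I \<Longrightarrow> s' \<in> I \<Longrightarrow> f s \<noteq> 0 \<Longrightarrow> f s' \<noteq> 0 \<Longrightarrow> s = s'"
    and M: "0 \<le> M" "\<And>s. s \<in> I \<Longrightarrow> \<bar>f s\<bar> \<le> M"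
  shows "\<bar>\<Sum>s\<in>I. f s\<bar> \<le> M"
proof (cases "\<exists>s\<in>I. f s \<noteq> 0")
  case True
  then obtain s where s: "s \<in> I" "f s \<noteq> 0" by blast
  have "(\<Sum>s\<in>I. f s) = (\<Sum>s\<in>{s}. f s)"
    by (rule sum.mono_neutral_right) (use fin s one in auto)
  then show ?thesis using M(2)[OF s(1)] by simp
next
  case False
  then show ?thesis using M(1) by simp
qed

text \<open>An integral-valued function that is small outside a finite set vanishes there.\<close>

lemma integer_row_act_finite:
  fixes a :: "nat \<Rightarrow>\<^sub>0 'g::group_add \<Rightarrow>\<^sub>0 int"
  assumes u: "\<And>i \<epsilon>. \<epsilon> > 0 \<Longrightarrow> finite {g. \<bar>u i g\<bar> \<ge> \<epsilon>}" and int: "\<And>g. row_act a u g \<in> \<int>"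
  shows "finite {g. row_act a u g \<noteq> 0}"
proof -
  define \<epsilon> where "\<epsilon> = 1 / (row_norm a + 1)"
  have \<epsilon>: "\<epsilon> > 0" "row_norm a * \<epsilon> < 1" using row_norm_nonneg[of a] by (auto simp: \<epsilon>_def field_simps)
  have "{g. row_act a u g \<noteq> 0} \<subseteq> (\<Union>p\<in>row_supp a. (+) (snd p) ` {g. \<bar>u (fst p) g\<bar> \<ge> \<epsilon>})"
  proof (rule subsetI, rule ccontr)
    fix g assume g: "g \<in> {g. row_act a u g \<noteq> 0}"
      and notin: "g \<notin> (\<Union>p\<in>row_supp a. (+) (snd p) ` {g. \<bar>u (fst p) g\<bar> \<ge> \<epsilon>})"
    have small: "\<bar>u (fst p) (- snd p + g)\<bar> \<le> \<epsilon>" if p: "p \<in> row_supp a" for p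
    proof (rule ccontr)
      assume "\<not> ?thesis"
      then have "snd p + (- snd p + g) \<in> (+) (snd p) ` {g. \<bar>u (fst p) g\<bar> \<ge> \<epsilon>}" by (intro imageI) simp
      then show False using notin p by (simp add: add.assoc[symmetric])
    qed
    have "\<bar>row_act a u g\<bar> \<le> (\<Sum>p\<in>row_supp a. \<bar>of_int (coef a p) * u (fst p) (- snd p + g)\<bar>)"
      unfolding row_act_def by (rule sum_abs)
    also have "\<dots> \<le> (\<Sum>p\<in>row_supp a. \<bar>of_int (coef a p)\<bar> * \<epsilon>)"
      unfolding abs_mult by (intro sum_mono mult_left_mono small) auto
    also have "\<dots> = row_norm a * \<epsilon>" by (simp add: row_norm_def sum_distrib_right)
    finally have "\<bar>row_act a u g\<bar> < 1" using \<epsilon>(2) by linarith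
    then show False using Ints_nonzero_abs_less1[OF int] g by auto
  qed
  moreover have "finite (\<Union>p\<in>row_supp a. (+) (snd p) ` {g. \<bar>u (fst p) g\<bar> \<ge> \<epsilon>})" using u[OF \<epsilon>(1)] by auto
  ultimately show ?thesis by (rule finite_subset)
qed

text \<open>Every finite set contains a \<open>K\<close>-sparse subset of a fixed proportion, so
  independence of sparse sets suffices.\<close>

lemma independence_density_positive:
  fixes act :: "'g::group_add \<Rightarrow> 'x \<Rightarrow> 'x" and K :: "'g set"
  assumes K: "finite K"
    and ind: "\<And>P. (\<And>p q. p \<in> P \<Longrightarrow> q \<in> P \<Longrightarrow> p \<noteq> q \<Longrightarrow> p - q \<notin> K) \<Longrightarrow> independence_set act A P"
  shows "independence_density act A > 0"
proof -
  let ?C = "card (insert 0 (K \<union> uminus ` K))"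
  have C: "?C > 0" using K by (simp add: card_gt_0_iff)
  have "independence_density_bound act A (1 / real ?C)"
    unfolding independence_density_bound_def
  proof (intro conjI allI impI)
    fix F :: "'g set" assume "finite F"
    from sparse_subset[OF this K] obtain P where P: "P \<subseteq> F" "card F \<le> ?C * card P"
      "\<forall>p\<in>P. \<forall>q\<in>P. p \<noteq> q \<longrightarrow> p - q \<notin> K" by blast
    have "independence_set act A P" using P(3) by (intro ind) blast
    moreover have "1 / real ?C * real (card F) \<le> real (card P)"
    proof -
      have "real (card F) \<le> real ?C * real (card P)" using P(2) by (simp only: of_nat_mult[symmetric] of_nat_le_iff)
      then show ?thesis using C by (simp add: pos_divide_le_eq mult.commute)
    qed
    ultimately show "\<exists>J\<subseteq>F. 1 / real ?C * real (card F) \<le> real (card J) \<and> independence_set act A J"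
      using P(1) by blast
  qed simp
  then have "1 / real ?C \<le> independence_density act A" by (rule independence_density_greatest)
  moreover have "0 < 1 / real ?C" using C by simp
  ultimately show ?thesis by linarith
qed

context coordinate_action
begin

lemma mem_act_image: "act s y \<in> B \<Longrightarrow> y \<in> act (- s) ` B"
  by (rule image_eqI[of _ _ "act s y"]) (simp_all add: act_act act_zero)

text \<open>The point \<open>y\<close> that realises a pattern is the sum of translates of
  \<open>x\<close> over the places labelled \<open>0\<close>. A termwise bound on its lift
  \<open>v\<close> grows with the pattern. However, \<open>\<alpha>v\<close> is a sum of translates
  with disjoint supports, hence uniformly bounded; inverting \<open>\<alpha>\<close> bounds
  \<open>v\<close> independently of the pattern, and then the local estimate applies.\<close>

theorem homoclinic_independence_density:
  assumes near: "near_identity n \<alpha> N" and rel: "\<And>j. j < n \<Longrightarrow> \<alpha> j \<in> relations act n \<theta>"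
    and x: "x \<in> homoclinic_group act" and U: "open U" "x \<in> U" and V: "open V" "0 \<in> V"
  shows "independence_density act [U, V] > 0"
proof -
  define t where "t = phase x"
  have lt: "lifts t x" and tb: "\<And>i g. \<bar>t i g\<bar> \<le> 1 / 2" unfolding t_def by (rule lifts_phase, rule phase_bound)
  define z where "z j g = (if j < n then row_act (\<alpha> j) t g else 0)" for j g
  define Z where "Z = (\<Union>j<n. {g. row_act (\<alpha> j) t g \<noteq> 0})"
  have finZ: "finite Z" unfolding Z_def t_def
    by (intro finite_UN_I integer_row_act_finite phase_homoclinic[OF x] lifts_integer[OF lifts_phase] rel) auto
  have zZ: "g \<in> Z" if "z j g \<noteq> 0" for j g using that by (auto simp: z_def Z_def split: if_splits)
  define M where "M = (\<Sum>j<n. row_norm (\<alpha> j))"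
  have M: "0 \<le> M" unfolding M_def by (intro sum_nonneg row_norm_nonneg)
  have zM: "\<bar>z j g\<bar> \<le> M" for j g
  proof (cases "j < n")
    case True
    have "\<bar>row_act (\<alpha> j) t g\<bar> \<le> row_norm (\<alpha> j) * (1 / 2)" by (rule row_act_bound[OF tb])
    moreover have "row_norm (\<alpha> j) \<le> M" unfolding M_def
      by (rule member_le_sum) (use True in \<open>auto intro: row_norm_nonneg\<close>)
    ultimately show ?thesis using True row_norm_nonneg[of "\<alpha> j"] by (simp add: z_def)
  qed (simp add: z_def M)
  have N: "N > 0" using near by (simp add: near_identity_def)
  define W where "W = ((\<lambda>v. x + v) -` U) \<inter> V"
  have "open W" "0 \<in> W" unfolding W_def using U V by (auto intro!: open_Int open_vimage continuous_intros)
  then obtain S \<epsilon> where S: "finite S" "\<epsilon> > 0" "\<And>t x. lifts t x \<Longrightarrow> \<forall>g\<in>S. \<forall>i<n. \<bar>t i g\<bar> < \<epsilon> \<Longrightarrow> x \<in> W"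
    using lifts_neighbourhood[of W] by blast
  have MN: "0 \<le> 2 * M / N + 1 / 2" using M N by simp
  from near_identity_local[OF near S(2) MN] obtain T where T: "finite T"
    "\<And>u g. \<forall>i g. \<bar>u i g\<bar> \<le> 2 * M / N + 1 / 2 \<Longrightarrow> \<forall>k\<in>T. \<forall>j<n. row_act (\<alpha> j) u (k + g) = 0 \<Longrightarrow> \<forall>j<n. \<bar>u j g\<bar> < \<epsilon>"
    by blast
  \<comment> \<open>The first set keeps the window \<open>T + S\<close> seen from one place away
    from the translates of \<open>Z\<close> belonging to other places; the second makes the
    translates of \<open>Z\<close> disjoint.\<close>
  define K where "K = (\<lambda>(k, g, z). - (k + g) + z) ` (T \<times> S \<times> Z) \<union> (\<lambda>(z, z'). - z + z') ` (Z \<times> Z)"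
  have finK: "finite K" using T(1) S(1) finZ by (simp add: K_def)
  show ?thesis
  proof (rule independence_density_positive[OF finK])
    fix P assume sparse: "\<And>p q. p \<in> P \<Longrightarrow> q \<in> P \<Longrightarrow> p \<noteq> q \<Longrightarrow> p - q \<notin> K"
    show "independence_set act [U, V] P"
      unfolding independence_set_def
    proof (intro allI impI)
      fix I \<phi> assume a: "I \<subseteq> P \<and> finite I \<and> I \<noteq> {} \<and> (\<forall>s\<in>I. \<phi> s < length [U, V])"
      then have I: "I \<subseteq> P" "finite I" by auto
      define H where "H = {s\<in>I. \<phi> s = 0}"
      have H: "H \<subseteq> P" "finite H" using I by (auto simp: H_def)
      define y where "y = (\<Sum>s\<in>H. act (- s) x)"
      define v where "v i g = (\<Sum>s\<in>H. t i (g - s))" for i g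
      have "lifts (\<lambda>i g. t i (g - s)) (act (- s) x)" for s using lifts_shift[OF lt, of "- s"] by simp
      then have lv: "lifts v y" unfolding v_def y_def by (intro lifts_sum)
      define zz where "zz j g = (\<Sum>s\<in>H. z j (g - s))" for j g
      have act_v: "row_act (\<alpha> j) v g = zz j g" if "j < n" for j g
        using row_act_shift[of "\<alpha> j" t "- _" g] that
        by (simp add: v_def[abs_def] zz_def row_act_sum_right z_def)
      have zzM: "\<bar>zz j g\<bar> \<le> M" for j g
        unfolding zz_def
      proof (rule abs_sum_at_most_one[OF H(2) _ M zM])
        fix s s' assume s: "s \<in> H" "s' \<in> H" "z j (g - s) \<noteq> 0" "z j (g - s') \<noteq> 0"
        have "s - s' = - (g - s) + (g - s')" by (simp add: algebra_simps)
        also have "\<dots> \<in> K" unfolding K_def using zZ[OF s(3)] zZ[OF s(4)]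
          by (intro UnI2 image_eqI[of _ _ "(g - s, g - s')"]) auto
        finally show "s = s'" using sparse[of s s'] s H(1) by blast
      qed
      have "finite (\<Union>s\<in>H. (\<lambda>z. z + s) ` Z)" using H(2) finZ by auto
      moreover have "zz j g = 0" if "g \<notin> (\<Union>s\<in>H. (\<lambda>z. z + s) ` Z) \<or> j \<ge> n" for j g
        unfolding zz_def
      proof (rule sum.neutral, rule ballI, rule ccontr)
        fix s assume "s \<in> H" "z j (g - s) \<noteq> 0"
        moreover from this have "g \<in> (\<lambda>z. z + s) ` Z" using zZ[of j "g - s"] by (intro image_eqI[of _ _ "g - s"]) auto
        ultimately show False using that by (auto simp: z_def)
      qed
      ultimately obtain L where L: "L \<ge> 0" "\<And>j E. finite E \<Longrightarrow> (\<Sum>g\<in>E. \<bar>zz j g\<bar>) \<le> L"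
        using finite_support_l1[of "\<Union>s\<in>H. (\<lambda>z. z + s) ` Z" n zz] by blast
      \<comment> \<open>The solution with a bound free of \<open>card H\<close>. It will be
        identified with \<open>v\<close> by injectivity of \<open>\<alpha>\<close> on bounded
        configurations, for which a bound on \<open>v\<close> depending on \<open>H\<close> is
        enough.\<close>
      obtain u where u0: "(\<forall>j<n. \<forall>g. row_act (\<alpha> j) u g = zz j g) \<and> (\<forall>i g. \<bar>u i g\<bar> \<le> 2 * M / N) \<and>
          (\<forall>i E. finite E \<longrightarrow> (\<Sum>g\<in>E. \<bar>u i g\<bar>) \<le> 2 * L / N)"
        by (rule exE[OF near_identity_solve[OF near M zzM L]])
      then have u: "\<And>j g. j < n \<Longrightarrow> row_act (\<alpha> j) u g = zz j g" "\<And>i g. \<bar>u i g\<bar> \<le> 2 * M / N" by simp_all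
      have vM: "\<bar>v j g\<bar> \<le> 2 * M / N" for j g
      proof (cases "j < n")
        case True
        have "u j g - v j g = 0"
        proof (rule near_identity_injective[OF near _ _ True])
          show "\<bar>u i g - v i g\<bar> \<le> 2 * M / N + real (card H) * (1 / 2)" for i g
          proof -
            have "\<bar>v i g\<bar> \<le> (\<Sum>s\<in>H. \<bar>t i (g - s)\<bar>)" unfolding v_def by (rule sum_abs)
            also have "\<dots> \<le> real (card H) * (1 / 2)" by (rule sum_bounded_above) (rule tb)
            finally show ?thesis using u(2)[of i g] by linarith
          qed
          show "row_act (\<alpha> j) (\<lambda>i g. u i g - v i g) g = 0" if "j < n" for j g
            using that by (simp add: row_act_diff u(1) act_v)
        qed
        then show ?thesis using u(2)[of j g] by simp
      next
        case False
        then show ?thesis using M N by (simp add: v_def t_def phase_def)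
      qed
      have "y \<in> act (- h) ` ([U, V] ! \<phi> h)" if h: "h \<in> I" for h
      proof (rule mem_act_image)
        \<comment> \<open>A lift of the deviation of \<open>act h y\<close> from its target, which
          is \<open>x\<close> or \<open>0\<close> according to the label of
          \<open>h\<close>.\<close>
        define d where "d i g = v i (g + h) - (if h \<in> H then t i g else 0)" for i g
        have ld: "lifts d (act h y - (if h \<in> H then x else 0))"
          unfolding d_def using lifts_diff[OF lifts_shift[OF lv, of h] lt] lifts_diff[OF lifts_shift[OF lv, of h] lifts_zero]
          by (cases "h \<in> H") auto
        have db: "\<forall>i g. \<bar>d i g\<bar> \<le> 2 * M / N + 1 / 2"
        proof (intro allI)
          fix i g
          show "\<bar>d i g\<bar> \<le> 2 * M / N + 1 / 2"
            using vM[of i "g + h"] tb[of i g] by (cases "h \<in> H") (simp_all add: d_def)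
        qed
        have "row_act (\<alpha> j) d (k + g) = 0" if k: "k \<in> T" and g: "g \<in> S" and j: "j < n" for k g j
        proof -
          have d1: "row_act (\<alpha> j) d (k + g) = zz j (k + g + h) - (if h \<in> H then z j (k + g) else 0)"
            unfolding d_def[abs_def] using j
            by (cases "h \<in> H") (simp_all add: row_act_diff row_act_shift act_v z_def)
          have "zz j (k + g + h) = (\<Sum>s\<in>H. if s = h then z j (k + g) else 0)"
            unfolding zz_def
          proof (rule sum.cong)
            fix s assume s: "s \<in> H"
            have "z j (k + g + h - s) = 0" if "s \<noteq> h"
            proof (rule ccontr)
              assume "z j (k + g + h - s) \<noteq> 0"
              then have "k + g + h - s \<in> Z" by (rule zZ)
              then have "- (k + g) + (k + g + h - s) \<in> K" unfolding K_def using k g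
                by (intro UnI1 image_eqI[of _ _ "(k, g, k + g + h - s)"]) auto
              moreover have "- (k + g) + (k + g + h - s) = h - s" by (simp only: add_diff_eq[symmetric] minus_add_cancel)
              ultimately show False using sparse[of h s] that s h H(1) I(1) by auto
            qed
            then show "z j (k + g + h - s) = (if s = h then z j (k + g) else 0)" by (cases "s = h") simp_all
          qed simp
          then show ?thesis using d1 H(2) by simp
        qed
        then have "\<forall>j<n. \<bar>d j g\<bar> < \<epsilon>" if "g \<in> S" for g using T(2)[OF db, of g] that by blast
        then have "act h y - (if h \<in> H then x else 0) \<in> W" using S(3)[OF ld] by blast
        moreover have "\<phi> h = 0 \<or> \<phi> h = 1" using a h by (auto simp: less_2_cases_iff numeral_2_eq_2 less_Suc_eq)
        ultimately show "act h y \<in> [U, V] ! \<phi> h" using h by (auto simp: W_def H_def)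
      qed
      then show "(\<Inter>s\<in>I. act (- s) ` ([U, V] ! \<phi> s)) \<noteq> {}" by blast
    qed
  qed
qed

end

section \<open>Homoclinic points near independent points\<close>

lemma row_act_l1:
  fixes u :: "nat \<Rightarrow> 'g::group_add \<Rightarrow> real"
  assumes u: "\<And>i E. finite E \<Longrightarrow> (\<Sum>g\<in>E. \<bar>u i g\<bar>) \<le> M" and E: "finite E"
  shows "(\<Sum>g\<in>E. \<bar>row_act a u g\<bar>) \<le> row_norm a * M"
proof -
  have "(\<Sum>g\<in>E. \<bar>row_act a u g\<bar>) \<le> (\<Sum>g\<in>E. \<Sum>p\<in>row_supp a. \<bar>of_int (coef a p)\<bar> * \<bar>u (fst p) (- snd p + g)\<bar>)"
    unfolding row_act_def abs_mult[symmetric] by (intro sum_mono sum_abs)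
  also have "\<dots> = (\<Sum>p\<in>row_supp a. \<bar>of_int (coef a p)\<bar> * (\<Sum>g\<in>E. \<bar>u (fst p) (- snd p + g)\<bar>))"
    unfolding sum_distrib_left by (rule sum.swap)
  also have "\<dots> \<le> (\<Sum>p\<in>row_supp a. \<bar>of_int (coef a p)\<bar> * M)"
  proof (intro sum_mono mult_left_mono)
    fix p
    have "(\<Sum>g\<in>E. \<bar>u (fst p) (- snd p + g)\<bar>) = (\<Sum>g\<in>(+) (- snd p) ` E. \<bar>u (fst p) g\<bar>)"
      by (subst sum.reindex) (auto simp: inj_on_def)
    also have "\<dots> \<le> M" using E by (intro u) auto
    finally show "(\<Sum>g\<in>E. \<bar>u (fst p) (- snd p + g)\<bar>) \<le> M" .
  qed auto
  also have "\<dots> = row_norm a * M" by (simp add: row_norm_def sum_distrib_right)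
  finally show ?thesis .
qed

lemma row_act_integer:
  assumes "\<And>p. p \<in> row_supp a \<Longrightarrow> u (fst p) (- snd p + g) \<in> \<int>"
  shows "row_act a u g \<in> \<int>"
  unfolding row_act_def by (intro Ints_sum Ints_mult assms) auto

lemma (in algebraic_action) homoclinic_act:
  assumes "x \<in> homoclinic_group act"
  shows "act h x \<in> homoclinic_group act"
proof -
  have "inj (\<lambda>s. s + h)" by (simp add: inj_on_def)
  then have "filterlim (\<lambda>s. s + h) cofinite cofinite"
    unfolding filterlim_iff eventually_cofinite using finite_vimageI[of "{s. \<not> _ s}" "\<lambda>s. s + h"] by (simp add: vimage_def)
  from filterlim_compose[OF _ this, of "\<lambda>s. act s x" "nhds 0"] assms show ?thesis
    by (simp add: homoclinic_group_def act_act)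
qed

context coordinate_action
begin

context
  fixes \<alpha> b :: "nat \<Rightarrow> nat \<Rightarrow>\<^sub>0 'g \<Rightarrow>\<^sub>0 int" and N :: real and m :: nat and D :: "(nat \<Rightarrow>\<^sub>0 'g \<Rightarrow>\<^sub>0 int) set"
    and c :: "nat \<Rightarrow> nat \<Rightarrow>\<^sub>0 'g \<Rightarrow>\<^sub>0 int"
  assumes am: "amenable TYPE('g)" and near: "near_identity n \<alpha> N"
    and b: "\<And>j. j < m \<Longrightarrow> b j \<in> relations act n \<theta>"
    and gen: "\<And>a. a \<in> relations act n \<theta> \<Longrightarrow> \<exists>d\<in>free_module m. a = compose_row m b d"
    and c: "\<And>i. i < n \<Longrightarrow> c i \<in> free_module m" and comp: "\<And>i. i < n \<Longrightarrow> \<alpha> i = compose_row m b (c i)"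
    and D: "finite D" "\<And>d. d \<in> D \<Longrightarrow> d \<in> free_module m" "\<And>d. d \<in> D \<Longrightarrow> compose_row m b d = 0"
    and det: "\<And>u M d g. \<forall>j E. finite E \<longrightarrow> (\<Sum>g\<in>E. \<bar>u j g\<bar>) \<le> M \<Longrightarrow> \<forall>d\<in>D. \<forall>g. row_act d u g = 0 \<Longrightarrow>
      d \<in> free_module m \<Longrightarrow> compose_row m b d = 0 \<Longrightarrow> row_act d u g = 0"
begin

text \<open>The candidate \<open>\<xi>\<close> is obtained by solving \<open>\<alpha>\<xi> = Cw\<close>; the error \<open>w - B\<xi>\<close> is summable and killed
  by all relations between the generators, so it vanishes and \<open>\<xi>\<close> has integral rows.\<close>

lemma homoclinic_from_rows:
  assumes A: "finite A" "\<And>j g. g \<notin> A \<or> j \<ge> m \<Longrightarrow> w j g = 0" and int: "\<And>j g. w j g \<in> \<int>"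
    and Dw: "\<And>d g. d \<in> D \<Longrightarrow> row_act d w g = 0"
    and M: "0 \<le> M" "\<And>i g. i < n \<Longrightarrow> \<bar>row_act (c i) w g\<bar> \<le> M"
  shows "\<exists>\<xi> p. lifts \<xi> p \<and> p \<in> homoclinic_group act \<and> (\<forall>i g. \<bar>\<xi> i g\<bar> \<le> 2 * M / N) \<and>
    (\<forall>j<m. \<forall>g. row_act (b j) \<xi> g = w j g)"
proof -
  have N: "N > 0" using near by (simp add: near_identity_def)
  have bf: "b j \<in> free_module n" if "j < m" for j using b[OF that] by (simp add: relations_def)
  define z where "z i g = (if i < n then row_act (c i) w g else 0)" for i g
  have zM: "\<bar>z i g\<bar> \<le> M" for i g using M by (simp add: z_def)
  define Z where "Z = (\<Union>i<n. \<Union>p\<in>row_supp (c i). (+) (snd p) ` A)"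
  have finZ: "finite Z" using A(1) by (auto simp: Z_def)
  have "z i g = 0" if g: "g \<notin> Z \<or> i \<ge> n" for i g
  proof (cases "i < n")
    case True
    have "w (fst p) (- snd p + g) = 0" if p: "p \<in> row_supp (c i)" for p
    proof (rule ccontr)
      assume "w (fst p) (- snd p + g) \<noteq> 0"
      then have "- snd p + g \<in> A" using A(2) by blast
      then have "snd p + (- snd p + g) \<in> Z" unfolding Z_def using True p by blast
      then show False using g True by (simp add: add.assoc[symmetric])
    qed
    then show ?thesis by (simp add: z_def row_act_def)
  qed (simp add: z_def)
  from finite_support_l1[OF finZ this] obtain L where L0: "L \<ge> 0 \<and> (\<forall>j E. finite E \<longrightarrow> (\<Sum>g\<in>E. \<bar>z j g\<bar>) \<le> L)"
    by (rule exE)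
  then have L: "L \<ge> 0" "\<And>j E. finite E \<Longrightarrow> (\<Sum>g\<in>E. \<bar>z j g\<bar>) \<le> L" by simp_all
  obtain \<xi> where \<xi>0: "(\<forall>j<n. \<forall>g. row_act (\<alpha> j) \<xi> g = z j g) \<and> (\<forall>i g. \<bar>\<xi> i g\<bar> \<le> 2 * M / N) \<and>
      (\<forall>i E. finite E \<longrightarrow> (\<Sum>g\<in>E. \<bar>\<xi> i g\<bar>) \<le> 2 * L / N)"
    by (rule exE[OF near_identity_solve[OF near M(1) zM L]])
  then have \<xi>: "\<And>j g. j < n \<Longrightarrow> row_act (\<alpha> j) \<xi> g = row_act (c j) w g" "\<forall>i g. \<bar>\<xi> i g\<bar> \<le> 2 * M / N"
    "\<And>i E. finite E \<Longrightarrow> (\<Sum>g\<in>E. \<bar>\<xi> i g\<bar>) \<le> 2 * L / N" by (simp_all add: z_def)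
  obtain L' where L'0: "L' \<ge> 0 \<and> (\<forall>j E. finite E \<longrightarrow> (\<Sum>g\<in>E. \<bar>w j g\<bar>) \<le> L')"
    by (rule exE[OF finite_support_l1[OF A]])
  define u where "u j g = (if j < m then w j g - row_act (b j) \<xi> g else 0)" for j g
  have act_u: "row_act d u g = row_act d w g - row_act (compose_row m b d) \<xi> g" if d: "d \<in> free_module m" for d g
  proof -
    have "row_act d u g = row_act d (\<lambda>j g. w j g - row_act (b j) \<xi> g) g"
      by (rule row_act_cong) (simp add: u_def fst_row_supp[OF d])
    then show ?thesis by (simp add: row_act_diff row_act_compose_row[OF d])
  qed
  let ?M = "L' + (\<Sum>j<m. row_norm (b j)) * (2 * L / N)"
  have nn: "0 \<le> (\<Sum>j<m. row_norm (b j))" by (intro sum_nonneg row_norm_nonneg)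
  have LN: "0 \<le> 2 * L / N" using L(1) N by simp
  have ul1: "(\<Sum>g\<in>E. \<bar>u j g\<bar>) \<le> ?M" if E: "finite E" for j E
  proof (cases "j < m")
    case True
    have "(\<Sum>g\<in>E. \<bar>u j g\<bar>) \<le> (\<Sum>g\<in>E. \<bar>w j g\<bar> + \<bar>row_act (b j) \<xi> g\<bar>)"
      using True by (intro sum_mono) (simp add: u_def abs_triangle_ineq4)
    also have "\<dots> \<le> L' + row_norm (b j) * (2 * L / N)"
      unfolding sum.distrib using L'0 row_act_l1[OF \<xi>(3) E] E by (intro add_mono) auto
    also have "\<dots> \<le> ?M"
      by (intro add_left_mono mult_right_mono LN member_le_sum) (use True in \<open>auto intro: row_norm_nonneg\<close>)
    finally show ?thesis .
  next
    case False
    have "0 \<le> ?M" using L'0 nn LN by (intro add_nonneg_nonneg mult_nonneg_nonneg) auto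
    then show ?thesis using False by (simp add: u_def)
  qed
  \<comment> \<open>The relations in \<open>D\<close> kill \<open>w\<close> by assumption and the
    rows of \<open>B\<xi>\<close> identically; \<open>det\<close> extends this to all relations
    between the generators.\<close>
  have Lu: "row_act d u g = 0" if "d \<in> free_module m" "compose_row m b d = 0" for d g
    by (rule det[OF _ _ that, of _ ?M]) (use ul1 act_u[OF D(2)] D(3) Dw in auto)
  \<comment> \<open>The error \<open>u\<close> is killed by \<open>c\<close> as well, since
    \<open>\<xi>\<close> solves \<open>\<alpha>\<xi> = Cw\<close> and
    \<open>\<alpha> = CB\<close>.\<close>
  have rows: "row_act (b j) \<xi> g = w j g" if j: "j < m" for j g
  proof -
    have "u j g = 0"
      by (rule kernel_vanishes[OF am near bf c comp ul1 _ Lu j]) (use act_u[OF c] \<xi>(1) comp in auto)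
    then show ?thesis using j by (simp add: u_def)
  qed
  have "row_act a \<xi> g \<in> \<int>" if a: "a \<in> relations act n \<theta>" for a g
  proof -
    obtain d where d: "d \<in> free_module m" "a = compose_row m b d" using gen[OF a] by blast
    have "row_act a \<xi> g = row_act d (\<lambda>j. row_act (b j) \<xi>) g" by (simp add: d row_act_compose_row)
    also have "\<dots> \<in> \<int>" by (rule row_act_integer) (simp add: rows fst_row_supp[OF d(1)] int)
    finally show ?thesis .
  qed
  from exists_lifts[OF this] obtain p where p: "lifts \<xi> p" by (rule exE)
  have "p \<in> homoclinic_group act"
  proof (rule lifts_homoclinic[OF p])
    fix \<epsilon> :: real and i assume e: "\<epsilon> > 0"
    obtain K where K: "finite K" "\<forall>E. finite E \<longrightarrow> E \<inter> K = {} \<longrightarrow> (\<Sum>g\<in>E. \<bar>\<xi> i g\<bar>) < \<epsilon>"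
      using finite_sums_tail[of "\<xi> i", OF \<xi>(3) e] by blast
    have "\<bar>\<xi> i g\<bar> < \<epsilon>" if "g \<notin> K" for g using K(2)[THEN spec[of _ "{g}"]] that by simp
    then have "{g. \<bar>\<xi> i g\<bar> \<ge> \<epsilon>} \<subseteq> K" by (force simp: not_less[symmetric])
    then show "finite {g. \<bar>\<xi> i g\<bar> \<ge> \<epsilon>}" using K(1) by (rule finite_subset)
  qed
  then show ?thesis using p \<xi>(2) rows by blast
qed

text \<open>There are \<open>2 ^ card J\<close> patterns but at most
  \<open>(2 * r + 1) ^ card E\<close> families of values. Two patterns with equal values differ
  somewhere, and exchanging them if necessary puts the difference on the required side.\<close>

lemma pigeonhole_patterns:
  fixes k :: "'a set \<Rightarrow> 'b \<Rightarrow> int"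
  assumes J: "finite J" and E: "finite E" and k: "\<And>A p. p \<in> E \<Longrightarrow> \<bar>k A p\<bar> \<le> r"
    and R: "2 * r + 1 \<le> 2 ^ R" and r: "0 \<le> r" and less: "R * card E < card J"
  shows "\<exists>A A' s. A \<subseteq> J \<and> A' \<subseteq> J \<and> s \<in> A \<and> s \<notin> A' \<and> (\<forall>p\<in>E. k A p = k A' p)"
proof -
  let ?f = "\<lambda>A. restrict (k A) E" and ?X = "PiE E (\<lambda>_. {- r..r})"
  have "- r \<le> k A p \<and> k A p \<le> r" if "p \<in> E" for A p using k[OF that, of A] by linarith
  then have sub: "?f ` Pow J \<subseteq> ?X" by auto
  have "card (?f ` Pow J) \<le> card ?X" by (rule card_mono[OF _ sub]) (simp add: finite_PiE E)
  also have "\<dots> = nat (2 * r + 1) ^ card E" by (simp add: card_PiE E)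
  also have "\<dots> \<le> (2 ^ R) ^ card E"
  proof (rule power_mono)
    show "nat (2 * r + 1) \<le> 2 ^ R" using R by (simp add: nat_le_iff)
  qed simp
  also have "\<dots> = 2 ^ (R * card E)" by (simp add: power_mult)
  also have "\<dots> < 2 ^ card J" using less by simp
  also have "\<dots> = card (Pow J)" using J by (simp add: card_Pow)
  finally have "\<not> inj_on ?f (Pow J)" by (rule pigeonhole)
  then obtain A A' where A: "A \<subseteq> J" "A' \<subseteq> J" "A \<noteq> A'" "?f A = ?f A'" by (auto simp: inj_on_def)
  have eq: "k A p = k A' p" if "p \<in> E" for p using fun_cong[OF A(4), of p] that by simp
  consider s where "s \<in> A" "s \<notin> A'" | s where "s \<in> A'" "s \<notin> A" using A(3) by blast
  then show ?thesis
  proof cases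
    case 1
    then show ?thesis using A eq by blast
  next
    case 2
    then show ?thesis using A eq by (metis (no_types))
  qed
qed

lemma split_neighbourhood:
  assumes "open Y" "(x :: 'x) \<in> Y"
  shows "\<exists>U V W. open U \<and> x \<in> U \<and> open V \<and> 0 \<in> V \<and> open W \<and> 0 \<in> W \<and> (\<forall>u\<in>U. \<forall>v\<in>V. \<forall>w\<in>W. u - v + w \<in> Y)"
proof -
  have "open ((\<lambda>p :: 'x \<times> 'x \<times> 'x. fst p - fst (snd p) + snd (snd p)) -` Y)"
    by (intro open_vimage assms(1) continuous_intros)
  moreover have "(x, 0, 0) \<in> (\<lambda>p :: 'x \<times> 'x \<times> 'x. fst p - fst (snd p) + snd (snd p)) -` Y" using assms(2) by simp
  ultimately obtain U U' where U: "open U" "open U'" "(x, 0, 0) \<in> U \<times> U'"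
    "U \<times> U' \<subseteq> (\<lambda>p :: 'x \<times> 'x \<times> 'x. fst p - fst (snd p) + snd (snd p)) -` Y" by (rule open_prod_elim)
  then have "(0, 0) \<in> U'" by simp
  from open_prod_elim[OF U(2) this] obtain V W where V: "open V" "open W" "(0, 0) \<in> V \<times> W" "V \<times> W \<subseteq> U'" by blast
  have "u - v + w \<in> Y" if "u \<in> U" "v \<in> V" "w \<in> W" for u v w
    using subsetD[OF U(4), of "(u, v, w)"] subsetD[OF V(4), of "(v, w)"] that by simp
  then show ?thesis using U V by blast
qed

text \<open>Two points that follow patterns with a difference at \<open>s\<close> are moved by
  \<open>s\<close> close to \<open>x\<close> and to \<open>0\<close>, so their difference is moved
  close to \<open>x\<close>. The homoclinic point built from the truncated rows of this difference
  agrees with it up to a small error near \<open>s\<close>, as \<open>s\<close> lies deep inside the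
  Foelner set.\<close>

theorem independent_point_near_homoclinic:
  assumes x: "x \<in> IE_group act" and Y: "open Y" "x \<in> Y"
  shows "\<exists>p\<in>homoclinic_group act. p \<in> Y"
proof -
  have N: "N > 0" using near by (simp add: near_identity_def)
  obtain U V W where U: "open U" "x \<in> U" and V: "open V" "0 \<in> V" and W: "open W" "0 \<in> W"
    and UVW: "\<And>u v w. u \<in> U \<Longrightarrow> v \<in> V \<Longrightarrow> w \<in> W \<Longrightarrow> u - v + w \<in> Y"
    using split_neighbourhood[OF Y] by blast
  define q where "q = independence_density act [U, V]"
  have q: "q > 0"
  proof -
    have "\<forall>i<2. open ([U, V] ! i) \<and> [x, 0] ! i \<in> [U, V] ! i" using U V by (auto simp: less_Suc_eq numeral_2_eq_2)
    then show ?thesis using x unfolding q_def IE_group_def IE_tuples_def by auto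
  qed
  obtain S \<epsilon> where S: "finite S" "\<epsilon> > 0" "\<And>t y. lifts t y \<Longrightarrow> \<forall>g\<in>S. \<forall>i<n. \<bar>t i g\<bar> < \<epsilon> \<Longrightarrow> y \<in> W"
    using lifts_neighbourhood[OF W] by blast
  define M0 where "M0 = (\<Sum>j<m. row_norm (b j))"
  \<comment> \<open>Rows of the phases are bounded by \<open>M0\<close>, rows of a difference by
    \<open>2 * M0\<close>; \<open>M1\<close> bounds the image under \<open>c\<close> of the
    truncated difference.\<close>
  define M1 where "M1 = (\<Sum>i<n. row_norm (c i)) * (2 * M0)"
  have M0: "0 \<le> M0" unfolding M0_def by (intro sum_nonneg row_norm_nonneg)
  have M1: "0 \<le> M1" unfolding M1_def using M0 by (intro mult_nonneg_nonneg sum_nonneg row_norm_nonneg) auto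
  have MN: "0 \<le> 2 * M1 / N + 1" using M1 N by simp
  from near_identity_local[OF near S(2) MN] obtain T1 where T1: "finite T1"
    "\<And>u g. \<forall>i g. \<bar>u i g\<bar> \<le> 2 * M1 / N + 1 \<Longrightarrow> \<forall>k\<in>T1. \<forall>j<n. row_act (\<alpha> j) u (k + g) = 0 \<Longrightarrow> \<forall>j<n. \<bar>u j g\<bar> < \<epsilon>"
    by blast
  \<comment> \<open>\<open>TD\<close> ensures that a relation in \<open>D\<close> that reads one
    interior place of \<open>F\<close> reads only places of \<open>F\<close>. \<open>TC\<close>
    ensures the same for all places that influence the window around an interior place through
    \<open>c\<close>.\<close>
  define TD where "TD = (\<Union>d\<in>D. (\<lambda>(p, p'). - snd p' + snd p) ` (row_supp d \<times> row_supp d))"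
  define TC where "TC = (\<Union>i<n. (\<lambda>(p, k, g). - snd p + (k + g)) ` (row_supp (c i) \<times> T1 \<times> S))"
  define T where "T = TD \<union> TC"
  have T: "finite T" using D(1) T1(1) S(1) by (auto simp: T_def TD_def TC_def)
  define r where "r = \<lceil>M0\<rceil>"
  have r: "0 \<le> r" "M0 \<le> of_int r" using M0 by (auto simp: r_def)
  \<comment> \<open>\<open>R\<close> bits suffice for one integral value of modulus at most
    \<open>r\<close>.\<close>
  obtain R where R: "2 * r + 1 \<le> 2 ^ R"
  proof (rule that)
    have "int (nat (2 * r + 1)) < int (2 ^ nat (2 * r + 1))" by (simp only: of_nat_less_iff less_exp)
    moreover have "int (nat (2 * r + 1)) = 2 * r + 1" using r(1) by simp
    ultimately show "2 * r + 1 \<le> 2 ^ nat (2 * r + 1)" by (simp only: of_nat_power of_nat_numeral less_imp_le)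
  qed
  \<comment> \<open>The density \<open>q\<close> has to pay for \<open>R * m\<close> bits per
    boundary point and for removing the boundary points from \<open>J\<close>; the second unit in
    \<open>2\<close> makes the final inequality strict.\<close>
  define \<eta> where "\<eta> = q / (real (R * m) + 2)"
  have \<eta>: "\<eta> > 0" unfolding \<eta>_def by (intro divide_pos_pos q add_nonneg_pos) auto
  from folner_set[OF am T \<eta>] obtain F where F: "finite F" "F \<noteq> {}"
    "real (card {g\<in>F. \<exists>t\<in>T. t + g \<notin> F}) \<le> \<eta> * real (card F)" by blast
  define F' where "F' = {g\<in>F. \<exists>t\<in>T. t + g \<notin> F}"
  have F': "F' \<subseteq> F" "finite F'" "real (card F') \<le> \<eta> * real (card F)" using F by (auto simp: F'_def)
  obtain J where J: "J \<subseteq> F" "q * real (card F) \<le> real (card J)" "independence_set act [U, V] J"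
    using independence_density_bound[of act "[U, V]"] F(1) unfolding independence_density_bound_def q_def[symmetric] by blast
  define J' where "J' = J - F'"
  have J': "finite J'" "J' \<subseteq> J" using J(1) F(1) by (auto simp: J'_def intro: finite_subset)
  have cardJ: "R * card ({..<m} \<times> F') < card J'"
  proof -
    have "card J \<le> card J' + card F'" unfolding J'_def
      using card_Un_le[of "J - F'" F'] card_mono[of "(J - F') \<union> F'" J] J'(1) F'(2) by (auto simp: J'_def)
    then have c1: "real (card J) \<le> real (card J') + real (card F')" by linarith
    have "real (R * m) + 2 \<noteq> 0" using of_nat_0_le_iff[of "R * m", where 'a = real] by linarith
    then have "q = \<eta> * (real (R * m) + 2)" unfolding \<eta>_def by (rule nonzero_divide_eq_eq[THEN iffD1, OF _ refl])
    then have "q * real (card F) = real (R * m) * (\<eta> * real (card F)) + 2 * (\<eta> * real (card F))"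
      by (simp add: algebra_simps)
    moreover have "real (R * m) * real (card F') \<le> real (R * m) * (\<eta> * real (card F))"
      by (intro mult_left_mono F'(3)) simp
    moreover have "0 < \<eta> * real (card F)" using \<eta> F(1,2) by (simp add: card_gt_0_iff)
    ultimately have "real (R * m) * real (card F') < real (card J')" using c1 J(2) F'(3) by linarith
    then have "R * m * card F' < card J'" by (simp only: of_nat_mult[symmetric] of_nat_less_iff)
    then show ?thesis by (simp add: mult.assoc card_cartesian_product)
  qed
  then have J'ne: "J' \<noteq> {}" by auto
  have "\<exists>y. \<forall>s\<in>J'. act s y \<in> (if s \<in> A then U else V)" for A
  proof -
    have "(\<Inter>s\<in>J'. act (- s) ` ([U, V] ! (if s \<in> A then 0 else 1))) \<noteq> {}"
      using J(3)[unfolded independence_set_def, THEN spec[of _ J'], THEN spec[of _ "\<lambda>s. if s \<in> A then 0 else 1"]] J' J'ne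
      by simp
    then obtain y where y: "\<And>s. s \<in> J' \<Longrightarrow> y \<in> act (- s) ` ([U, V] ! (if s \<in> A then 0 else 1))" by blast
    have "act s y \<in> (if s \<in> A then U else V)" if s: "s \<in> J'" for s
    proof -
      obtain v where "v \<in> [U, V] ! (if s \<in> A then 0 else 1)" "y = act (- s) v" using y[OF s] by blast
      then show ?thesis by (cases "s \<in> A") (simp_all add: act_act act_zero)
    qed
    then show ?thesis by blast
  qed
  then obtain y where y: "\<And>A s. s \<in> J' \<Longrightarrow> act s (y A) \<in> (if s \<in> A then U else V)" by metis
  define v where "v A j g = row_act (b j) (phase (y A)) g" for A j g
  have vint: "v A j g \<in> \<int>" if "j < m" for A j g
    unfolding v_def by (rule lifts_integer[OF lifts_phase b[OF that]])
  have vM: "\<bar>v A j g\<bar> \<le> M0" if "j < m" for A j g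
  proof -
    have "\<bar>v A j g\<bar> \<le> row_norm (b j) * (1 / 2)" unfolding v_def by (rule row_act_bound[OF phase_bound])
    moreover have "row_norm (b j) \<le> M0" unfolding M0_def
      by (rule member_le_sum) (use that in \<open>auto intro: row_norm_nonneg\<close>)
    ultimately show ?thesis using row_norm_nonneg[of "b j"] by linarith
  qed
  have floor_v: "of_int \<lfloor>v A j g\<rfloor> = v A j g" if "j < m" for A j g using vint[OF that] by (auto elim: Ints_cases)
  have kr: "\<bar>\<lfloor>v A (fst p) (snd p)\<rfloor>\<bar> \<le> r" if "p \<in> {..<m} \<times> F'" for A p
  proof -
    have j: "fst p < m" using that by auto
    have "real_of_int \<bar>\<lfloor>v A (fst p) (snd p)\<rfloor>\<bar> \<le> of_int r"
      using vM[OF j, of A "snd p"] r(2) by (simp add: floor_v[OF j])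
    then show ?thesis by (simp only: of_int_le_iff)
  qed
  have "finite ({..<m} \<times> F')" using F'(2) by simp
  from pigeonhole_patterns[of J' "{..<m} \<times> F'" "\<lambda>A p. \<lfloor>v A (fst p) (snd p)\<rfloor>", OF J'(1) this kr R r(1) cardJ]
  obtain A A' s where AA: "s \<in> A" "s \<notin> A'" "A \<subseteq> J'" "\<forall>p\<in>{..<m} \<times> F'. \<lfloor>v A (fst p) (snd p)\<rfloor> = \<lfloor>v A' (fst p) (snd p)\<rfloor>"
    by blast
  have s: "s \<in> J'" using AA by blast
  then have sF: "s \<in> F" "s \<notin> F'" using J(1) by (auto simp: J'_def)
  define v' where "v' j g = v A j g - v A' j g" for j g
  \<comment> \<open>Truncation at the edge of \<open>F\<close> creates no jump, because the
    difference \<open>v'\<close> already vanishes on the boundary layer \<open>F'\<close>.\<close>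
  define w where "w j g = (if j < m \<and> g \<in> F then v' j g else 0)" for j g
  have v'F: "v' j g = 0" if "j < m" "g \<in> F'" for j g
  proof -
    have "\<lfloor>v A j g\<rfloor> = \<lfloor>v A' j g\<rfloor>" using AA(4)[THEN bspec[of _ _ "(j, g)"]] that by simp
    then have "real_of_int \<lfloor>v A j g\<rfloor> = of_int \<lfloor>v A' j g\<rfloor>" by (rule arg_cong)
    then have "v A j g = v A' j g" by (simp only: floor_v[OF that(1)])
    then show ?thesis by (simp only: v'_def diff_self)
  qed
  define \<delta> where "\<delta> i g = phase (y A) i g - phase (y A') i g" for i g
  have act_v': "row_act d v' g = row_act (compose_row m b d) \<delta> g" if "d \<in> free_module m" for d g
  proof -
    have "v' = (\<lambda>j. row_act (b j) \<delta>)"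
      by (intro ext) (simp only: v'_def v_def \<delta>_def[abs_def] row_act_diff)
    then show ?thesis by (simp only: row_act_compose_row[OF that])
  qed
  have interior: "t + g \<in> F" if "g \<in> F" "g \<notin> F'" "t \<in> T" for t g using that by (auto simp: F'_def)
  \<comment> \<open>Either the relation reads an interior place and then sees only
    \<open>v'\<close>, which satisfies it, or it reads only places where \<open>w\<close> is
    \<open>0\<close>.\<close>
  have Dw: "row_act d w g = 0" if d: "d \<in> D" for d g
  proof (cases "\<exists>p\<in>row_supp d. - snd p + g \<in> F - F'")
    case True
    then obtain p where p: "p \<in> row_supp d" "- snd p + g \<in> F" "- snd p + g \<notin> F'" by blast
    have "row_act d w g = row_act d v' g"
    proof (rule row_act_cong)
      fix p' assume p': "p' \<in> row_supp d"
      have "- snd p' + snd p \<in> T" unfolding T_def TD_def using d p(1) p' by (intro UnI1 UN_I[OF d] image_eqI[of _ _ "(p, p')"]) auto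
      from interior[OF p(2,3) this] have "- snd p' + g \<in> F" by (simp add: add.assoc)
      then show "w (fst p') (- snd p' + g) = v' (fst p') (- snd p' + g)"
        using fst_row_supp[OF D(2)[OF d] p'] by (simp add: w_def)
    qed
    also have "\<dots> = 0" using act_v'[OF D(2)[OF d]] D(3)[OF d] by simp
    finally show ?thesis .
  next
    case False
    have "w (fst p) (- snd p + g) = 0" if "p \<in> row_supp d" for p
      using False that v'F[of "fst p" "- snd p + g"] by (auto simp: w_def)
    then show ?thesis by (simp add: row_act_def)
  qed
  have wM: "\<bar>w j g\<bar> \<le> 2 * M0" for j g
    using vM[of j A g] vM[of j A' g] M0 by (auto simp: w_def v'_def abs_le_iff)
  have wint: "w j g \<in> \<int>" for j g using vint by (simp add: w_def v'_def)
  have "\<bar>row_act (c i) w g\<bar> \<le> M1" if "i < n" for i g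
  proof -
    have "\<bar>row_act (c i) w g\<bar> \<le> row_norm (c i) * (2 * M0)" by (rule row_act_bound[OF wM])
    also have "\<dots> \<le> M1" unfolding M1_def
      by (intro mult_right_mono member_le_sum) (use that M0 in \<open>auto intro: row_norm_nonneg\<close>)
    finally show ?thesis .
  qed
  note rows = homoclinic_from_rows[of F w M1, OF F(1) _ wint Dw M1 this]
  obtain \<xi> p where \<xi>p: "lifts \<xi> p \<and> p \<in> homoclinic_group act \<and> (\<forall>i g. \<bar>\<xi> i g\<bar> \<le> 2 * M1 / N) \<and>
      (\<forall>j<m. \<forall>g. row_act (b j) \<xi> g = w j g)"
  proof -
    have "\<exists>\<xi> p. lifts \<xi> p \<and> p \<in> homoclinic_group act \<and> (\<forall>i g. \<bar>\<xi> i g\<bar> \<le> 2 * M1 / N) \<and>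
      (\<forall>j<m. \<forall>g. row_act (b j) \<xi> g = w j g)" by (rule rows) (auto simp: w_def)
    then show ?thesis using that by (elim exE)
  qed
  then have \<xi>: "lifts \<xi> p" "p \<in> homoclinic_group act" "\<And>i g. \<bar>\<xi> i g\<bar> \<le> 2 * M1 / N"
    "\<And>j g. j < m \<Longrightarrow> row_act (b j) \<xi> g = w j g" by simp_all
  \<comment> \<open>A lift of the discrepancy between the homoclinic point and the difference of the
    two patterns, seen from \<open>s\<close>. Its image under \<open>\<alpha>\<close> vanishes on
    the window, so it is small there.\<close>
  define d where "d i g = \<xi> i (g + s) - \<delta> i (g + s)" for i g
  have ld: "lifts d (act s p - act s (y A - y A'))"
    unfolding d_def \<delta>_def by (intro lifts_diff lifts_shift[OF \<xi>(1)] lifts_shift[of "\<lambda>i g. phase (y A) i g - phase (y A') i g"] lifts_phase)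
  have db: "\<forall>i g. \<bar>d i g\<bar> \<le> 2 * M1 / N + 1"
  proof (intro allI)
    fix i g
    show "\<bar>d i g\<bar> \<le> 2 * M1 / N + 1"
      using \<xi>(3)[of i "g + s"] phase_bound[of "y A" i "g + s"] phase_bound[of "y A'" i "g + s"]
      unfolding d_def \<delta>_def by linarith
  qed
  have "row_act (\<alpha> i) d (k + g) = 0" if k: "k \<in> T1" and g: "g \<in> S" and i: "i < n" for k g i
  proof -
    have "row_act (\<alpha> i) d (k + g) = row_act (\<alpha> i) \<xi> (k + g + s) - row_act (\<alpha> i) \<delta> (k + g + s)"
      unfolding d_def[abs_def] by (simp only: row_act_diff row_act_shift)
    also have "row_act (\<alpha> i) \<delta> (k + g + s) = row_act (c i) v' (k + g + s)"
      using act_v'[OF c[OF i]] comp[OF i] by simp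
    also have "row_act (\<alpha> i) \<xi> (k + g + s) = row_act (c i) (\<lambda>j. row_act (b j) \<xi>) (k + g + s)"
      using row_act_compose_row[OF c[OF i]] comp[OF i] by simp
    also have "\<dots> = row_act (c i) v' (k + g + s)"
    proof (rule row_act_cong)
      fix p' assume p': "p' \<in> row_supp (c i)"
      have "- snd p' + (k + g) \<in> T" unfolding T_def TC_def using k g i p'
        by (intro UnI2 UN_I[of i] image_eqI[of _ _ "(p', k, g)"]) auto
      from interior[OF sF this] have "- snd p' + (k + g + s) \<in> F" by (simp add: add.assoc)
      then show "row_act (b (fst p')) \<xi> (- snd p' + (k + g + s)) = v' (fst p') (- snd p' + (k + g + s))"
        using fst_row_supp[OF c[OF i] p'] by (simp add: \<xi>(4) w_def)
    qed
    finally show ?thesis by simp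
  qed
  then have "\<forall>j<n. \<bar>d j g\<bar> < \<epsilon>" if "g \<in> S" for g using T1(2)[OF db, of g] that by blast
  then have "act s p - act s (y A - y A') \<in> W" using S(3)[OF ld] by blast
  moreover have "act s (y A) \<in> U" "act s (y A') \<in> V" using y[OF s, of A] y[OF s, of A'] AA(1,2) by auto
  ultimately have "act s (y A) - act s (y A') + (act s p - act s (y A - y A')) \<in> Y" by (intro UVW)
  then have "act s p \<in> Y" by (simp add: act_diff)
  moreover have "act s p \<in> homoclinic_group act" by (rule homoclinic_act[OF \<xi>(2)])
  ultimately show ?thesis by blast
qed

end

end

section \<open>The closure of the homoclinic group\<close>

text \<open>Only summable configurations are compared: the error term to which this is applied is
  summable, and such configurations lie in the square-summable kernels.\<close>

definition determines_kernel :: "(nat \<Rightarrow>\<^sub>0 'g::group_add \<Rightarrow>\<^sub>0 int) set \<Rightarrow> (nat \<Rightarrow>\<^sub>0 'g \<Rightarrow>\<^sub>0 int) set \<Rightarrow> bool" where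
  "determines_kernel D L \<longleftrightarrow> (\<forall>u M. (\<forall>j E. finite E \<longrightarrow> (\<Sum>g\<in>E. \<bar>u j g\<bar>) \<le> M) \<longrightarrow>
    (\<forall>d\<in>D. \<forall>g. row_act d u g = 0) \<longrightarrow> (\<forall>d\<in>L. \<forall>g. row_act d u g = 0))"

lemma determines_kernelD:
  assumes D: "determines_kernel D L" and u: "\<forall>j E. finite E \<longrightarrow> (\<Sum>g\<in>E. \<bar>u j g\<bar>) \<le> M"
    and "\<forall>d\<in>D. \<forall>g. row_act d u g = 0" "d \<in> L"
  shows "row_act d u g = 0"
  using D[unfolded determines_kernel_def, THEN spec[of _ u], THEN spec[of _ M], THEN mp, OF u] assms(3,4) by simp

lemma hull_determines_kernel:
  fixes D :: "(nat \<Rightarrow>\<^sub>0 'g::group_add \<Rightarrow>\<^sub>0 int) set"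
  assumes "finite D"
  shows "determines_kernel D (submodule free_scale hull D)"
  unfolding determines_kernel_def
proof (intro allI impI ballI)
  fix u :: "nat \<Rightarrow> 'g \<Rightarrow> real" and d g
  assume z: "\<forall>d\<in>D. \<forall>g. row_act d u g = 0" and "d \<in> submodule free_scale hull D"
  then obtain c where "d = (\<Sum>b\<in>D. free_scale (c b) b)" using free.hull_finite_combination[OF assms] by blast
  then show "row_act d u g = 0" using z by (simp add: row_act_sum row_act_free_scale ring_act_def)
qed

lemma finitely_generated_rows:
  assumes "finitely_generated free_scale N"
  shows "\<exists>m b. (\<forall>j<m. b j \<in> N) \<and> (\<forall>a\<in>N. \<exists>d\<in>free_module m. a = compose_row m b d)"
proof -
  obtain S where S: "finite S" "N = submodule free_scale hull S"
    using assms unfolding finitely_generated_def by blast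
  obtain bs where bs: "set bs = S" "distinct bs" using finite_distinct_list[OF S(1)] by blast
  have "bs ! j \<in> N" if "j < length bs" for j using that bs(1) hull_inc[of "bs ! j" S] S(2) by auto
  moreover have "\<exists>d\<in>free_module (length bs). a = compose_row (length bs) ((!) bs) d" if a: "a \<in> N" for a
  proof -
    obtain c where c: "a = (\<Sum>b\<in>S. free_scale (c b) b)"
      using free.hull_finite_combination[OF S(1)] a S(2) by blast
    define d where "d = (\<Sum>j<length bs. Poly_Mapping.single j (c (bs ! j)))"
    have "d \<in> free_module (length bs)" unfolding d_def
      by (rule free.submodule_sum[OF submodule_free_module]) (auto simp: free_module_def)
    moreover have "lookup d j = c (bs ! j)" if "j < length bs" for j
      using that by (simp add: d_def lookup_sum lookup_single when_def)
    then have "compose_row (length bs) ((!) bs) d = (\<Sum>j<length bs. free_scale (c (bs ! j)) (bs ! j))"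
      by (simp add: compose_row_def)
    then have "compose_row (length bs) ((!) bs) d = a"
      using sum.reindex_bij_betw[OF bij_betw_nth[OF bs(2) refl bs(1)[symmetric]], of "\<lambda>b. free_scale (c b) b"] c by simp
    ultimately show ?thesis by blast
  qed
  ultimately show ?thesis by blast
qed

context coordinate_action
begin

lemma closure_homoclinic_subset_IE:
  assumes "expansive act"
  shows "closure (homoclinic_group act) \<subseteq> IE_group act"
proof
  fix x assume x: "x \<in> closure (homoclinic_group act)"
  obtain \<alpha> N where near: "near_identity n \<alpha> N" "\<forall>j<n. \<alpha> j \<in> relations act n \<theta>"
    using expansive_near_identity[OF assms] by blast
  have "independence_density act A > 0"
    if A: "length A = 2" "\<forall>i<2. open (A ! i) \<and> [x, 0] ! i \<in> A ! i" for A
  proof -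
    have "\<exists>U V. A = [U, V]" using A(1) by (auto simp: numeral_2_eq_2 length_Suc_conv)
    then obtain U V where AUV: "A = [U, V]" by blast
    have U: "open U" "x \<in> U" and V: "open V" "0 \<in> V"
      using A(2)[THEN spec[of _ 0]] A(2)[THEN spec[of _ 1]] by (simp_all add: AUV)
    obtain y where y: "y \<in> homoclinic_group act" "y \<in> U"
      using x U closure_iff_nhds_not_empty[of x "homoclinic_group act"] by blast
    show ?thesis unfolding AUV
      by (rule homoclinic_independence_density[OF near(1) _ y(1) U(1) y(2) V]) (use near(2) in blast)
  qed
  then show "x \<in> IE_group act" by (simp add: IE_group_def IE_tuples_def)
qed

text \<open>The hypothesis \<open>det\<close> ranges over all \<open>m\<close> and \<open>L\<close>
  because the generators of the relations, and with them the module of relations between generators,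
  are chosen only inside the proof.\<close>

theorem closure_homoclinic_eq_IE:
  assumes am: "amenable TYPE('g)" and exp: "expansive act"
    and fg: "finitely_generated free_scale (relations act n \<theta>)"
    and det: "\<And>m (L :: (nat \<Rightarrow>\<^sub>0 'g \<Rightarrow>\<^sub>0 int) set). submodule free_scale L \<Longrightarrow> L \<subseteq> free_module m \<Longrightarrow>
      \<exists>D. finite D \<and> D \<subseteq> L \<and> determines_kernel D L"
  shows "closure (homoclinic_group act) = IE_group act"
proof (rule antisym)
  show "closure (homoclinic_group act) \<subseteq> IE_group act" by (rule closure_homoclinic_subset_IE[OF exp])
  obtain \<alpha> N where near: "near_identity n \<alpha> N" "\<forall>j<n. \<alpha> j \<in> relations act n \<theta>"
    using expansive_near_identity[OF exp] by blast
  obtain m b where b: "\<forall>j<m. b j \<in> relations act n \<theta>"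
      "\<forall>a\<in>relations act n \<theta>. \<exists>d\<in>free_module m. a = compose_row m b d"
    using finitely_generated_rows[OF fg] by blast
  have "\<forall>i. \<exists>d. i < n \<longrightarrow> d \<in> free_module m \<and> \<alpha> i = compose_row m b d" using near(2) b(2) by blast
  from choice[OF this] obtain c where c0: "\<forall>i. i < n \<longrightarrow> c i \<in> free_module m \<and> \<alpha> i = compose_row m b (c i)"
    by (rule exE)
  then have c: "c i \<in> free_module m" "\<alpha> i = compose_row m b (c i)" if "i < n" for i using that by simp_all
  define L where "L = {d \<in> free_module m. compose_row m b d = 0}"
  have "submodule free_scale (free_module m :: (nat \<Rightarrow>\<^sub>0 'g \<Rightarrow>\<^sub>0 int) set)" by (rule submodule_free_module)
  then have "submodule free_scale L"
    unfolding submodule_def L_def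
    by (simp add: compose_row_add compose_row_scale free.smul_zero_right) (simp add: compose_row_def free.smul_zero_left)
  moreover have "L \<subseteq> free_module m" by (auto simp: L_def)
  ultimately have "\<exists>D. finite D \<and> D \<subseteq> L \<and> determines_kernel D L" by (rule det)
  then obtain D where D: "finite D" "D \<subseteq> L" "determines_kernel D L" by (elim exE conjE)
  have Df: "d \<in> free_module m" "compose_row m b d = 0" if "d \<in> D" for d
    using subsetD[OF D(2) that] by (simp_all add: L_def)
  have DL: "row_act d u g = 0"
    if "\<forall>j E. finite E \<longrightarrow> (\<Sum>g\<in>E. \<bar>u j g\<bar>) \<le> M" "\<forall>d\<in>D. \<forall>g. row_act d u g = 0"
      "d \<in> free_module m" "compose_row m b d = 0" for u M d g
    by (rule determines_kernelD[OF D(3) that(1,2)]) (simp add: L_def that(3,4))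
  show "IE_group act \<subseteq> closure (homoclinic_group act)"
  proof
    fix x assume x: "x \<in> IE_group act"
    have "\<exists>p\<in>homoclinic_group act. p \<in> Y" if Y: "open Y" "x \<in> Y" for Y
      by (rule independent_point_near_homoclinic[OF am near(1) b(1)[rule_format] b(2)[rule_format]
            c D(1) Df DL x Y])
    then show "x \<in> closure (homoclinic_group act)" unfolding closure_iff_nhds_not_empty by blast
  qed
qed

end

text \<open>Finitely many characters detect every point outside a ball of the expansivity radius
  around \<open>0\<close>, by compactness. The orbit of a nonzero point leaves this ball, so their
  translates separate points.\<close>

lemma exists_finite_coordinates:
  fixes act :: "'g::group_add \<Rightarrow> 'x::{metric_space, topological_ab_group_add} \<Rightarrow> 'x"
  assumes cpt: "compact (UNIV :: 'x set)" and "algebraic_action act" and exp: "expansive act"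
  shows "\<exists>n \<theta>. coordinate_action act n \<theta>"
proof -
  interpret algebraic_action act by fact
  obtain c where c: "c > 0" "\<And>x y. x \<noteq> y \<Longrightarrow> \<exists>g. dist (act g x) (act g y) > c"
    using exp unfolding expansive_def by blast
  define C where "C = - ball (0 :: 'x) c"
  have comp: "compact C" using compact_Int_closed[OF cpt, of C] by (simp add: C_def closed_Compl)
  have op: "open {x. char_fun \<gamma> x \<noteq> 1}" for \<gamma> :: "'x pontryagin_dual"
    by (intro open_Collect_neq char_fun_continuous continuous_intros)
  have sub: "C \<subseteq> (\<Union>\<gamma>\<in>UNIV. {x. char_fun (\<gamma> :: 'x pontryagin_dual) x \<noteq> 1})"
  proof
    fix x assume "x \<in> C"
    then have "x \<noteq> 0" using c(1) by (auto simp: C_def)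
    then show "x \<in> (\<Union>\<gamma>\<in>UNIV. {x. char_fun \<gamma> x \<noteq> 1})" using characters_separate_points[OF cpt, of x] by simp
  qed
  obtain \<Gamma> :: "'x pontryagin_dual set" where "\<Gamma> \<subseteq> UNIV"
    and \<Gamma>: "finite \<Gamma>" "C \<subseteq> (\<Union>\<gamma>\<in>\<Gamma>. {x. char_fun \<gamma> x \<noteq> 1})"
    by (rule compactE_image[OF comp op sub])
  obtain \<gamma>s where \<gamma>s: "set \<gamma>s = \<Gamma>" using finite_list[OF \<Gamma>(1)] by blast
  have "coordinate_action act (length \<gamma>s) ((!) \<gamma>s)"
  proof unfold_locales
    fix x assume one: "\<And>i g. i < length \<gamma>s \<Longrightarrow> char_fun (\<gamma>s ! i) (act g x) = 1"
    have "act g x \<notin> C" for g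
    proof
      assume "act g x \<in> C"
      from subsetD[OF \<Gamma>(2) this] obtain \<gamma> where "\<gamma> \<in> set \<gamma>s" "char_fun \<gamma> (act g x) \<noteq> 1"
        unfolding \<gamma>s by (rule UN_E) simp
      then show False using one by (metis in_set_conv_nth)
    qed
    then have "dist (act g x) (act g 0) < c" for g by (simp add: C_def dist_commute not_le)
    then have "\<not> (\<exists>g. dist (act g x) (act g 0) > c)" by (auto dest: less_asym)
    then show "x = 0" using c(2)[of x 0] by blast
  qed (rule cpt)
  then show ?thesis by blast
qed

text \<open>The coordinates are the images of the standard basis under the given presentation. Its
  kernel is then exactly the module of relations, which transfers finite generation to it.\<close>

lemma finitely_presented_coordinates:
  fixes act :: "'g::group_add \<Rightarrow> 'x::{metric_space, topological_ab_group_add} \<Rightarrow> 'x"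
  assumes cpt: "compact (UNIV :: 'x set)" and "algebraic_action act" and fp: "finitely_presented (dual_scale act)"
  shows "\<exists>n \<theta>. coordinate_action act n \<theta> \<and> finitely_generated free_scale (relations act n \<theta>)"
proof -
  interpret algebraic_action act by fact
  obtain n and f :: "(nat \<Rightarrow>\<^sub>0 'g \<Rightarrow>\<^sub>0 int) \<Rightarrow> 'x pontryagin_dual" where
    f: "(\<forall>a\<in>free_module n. \<forall>b\<in>free_module n. f (a + b) = f a + f b) \<and>
        (\<forall>r. \<forall>a\<in>free_module n. f (free_scale r a) = dual_scale act r (f a)) \<and>
        f ` free_module n = UNIV \<and>
        finitely_generated free_scale {a \<in> free_module n. f a = 0}"
  proof -
    note fp[unfolded finitely_presented_def]
    then show ?thesis by (elim exE) (rule that)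
  qed
  then have add: "f (a + a') = f a + f a'" if "a \<in> free_module n" "a' \<in> free_module n" for a a'
    using that by simp
  have scale: "f (free_scale r a) = dual_scale act r (f a)" if "a \<in> free_module n" for r a
    using f that by simp
  have surj: "f ` free_module n = UNIV" and fg: "finitely_generated free_scale {a \<in> free_module n. f a = 0}"
    using f by simp_all
  define e :: "nat \<Rightarrow> nat \<Rightarrow>\<^sub>0 'g \<Rightarrow>\<^sub>0 int" where "e i = Poly_Mapping.single i 1" for i
  define \<theta> where "\<theta> i = f (e i)" for i
  have fm: "submodule free_scale (free_module n :: (nat \<Rightarrow>\<^sub>0 'g \<Rightarrow>\<^sub>0 int) set)" by (rule submodule_free_module)
  have f0: "f 0 = 0" using add[of 0 0] fm by (simp add: submodule_def)
  have fsum: "f (\<Sum>i\<in>I. h i) = (\<Sum>i\<in>I. f (h i))" if "\<And>i. i \<in> I \<Longrightarrow> h i \<in> free_module n" for I :: "nat set" and h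
    using that
  proof (induction I rule: infinite_finite_induct)
    case (insert i I)
    then show ?case using free.submodule_sum[OF fm, of I h] by (simp add: add)
  qed (simp_all add: f0)
  have e: "e i \<in> free_module n" if "i < n" for i using that by (simp add: e_def free_module_def)
  have fa: "f a = (\<Sum>i<n. dual_scale act (lookup a i) (\<theta> i))" if a: "a \<in> free_module n" for a
  proof -
    have "a = (\<Sum>i<n. free_scale (lookup a i) (e i))"
    proof (rule poly_mapping_eqI)
      fix k
      show "lookup a k = lookup (\<Sum>i<n. free_scale (lookup a i) (e i)) k"
        using a by (auto simp: lookup_sum lookup_free_scale e_def lookup_single when_def free_module_def if_distrib in_keys_iff cong: if_cong)
    qed
    then have "f a = f (\<Sum>i<n. free_scale (lookup a i) (e i))" by (rule arg_cong)
    also have "\<dots> = (\<Sum>i<n. f (free_scale (lookup a i) (e i)))"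
      by (rule fsum) (use fm e in \<open>auto simp: submodule_def\<close>)
    finally show ?thesis by (simp add: scale e \<theta>_def)
  qed
  have "coordinate_action act n \<theta>"
  proof unfold_locales
    fix x assume one: "\<And>i g. i < n \<Longrightarrow> char_fun (\<theta> i) (act g x) = 1"
    have "char_fun \<gamma> x = 1" for \<gamma>
    proof -
      obtain a where a: "a \<in> free_module n" "\<gamma> = f a" using surj by blast
      show ?thesis unfolding a(2) fa[OF a(1)] using one by (simp add: char_fun_sum char_fun_dual_scale)
    qed
    then show "x = 0" using characters_separate_points[OF cpt, of x] by blast
  qed (rule cpt)
  moreover have "relations act n \<theta> = {a \<in> free_module n. f a = 0}" using fa by (auto simp: relations_def)
  ultimately show ?thesis using fg by metis
qed

theorem corollary7p5:
  fixes act :: "'g::group_add \<Rightarrow> 'x::{metric_space, topological_ab_group_add} \<Rightarrow> 'x"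
  assumes "countable (UNIV :: 'g set)" and "infinite (UNIV :: 'g set)"
    and "amenable TYPE('g)"
    and "compact (UNIV :: 'x set)"
    and "algebraic_action act"
    and "expansive act"
    and "left_noetherian TYPE('g \<Rightarrow>\<^sub>0 int) \<or>
         (strong_atiyah TYPE('g) \<and> bounded_finite_subgroups TYPE('g) \<and>
          finitely_presented (dual_scale act))"
  shows "closure (homoclinic_group act) = IE_group act"
proof -
  interpret algebraic_action act by fact
  from assms(7) show ?thesis
  proof
    assume noeth: "left_noetherian TYPE('g \<Rightarrow>\<^sub>0 int)"
    obtain n \<theta> where "coordinate_action act n \<theta>" using exists_finite_coordinates[OF assms(4-6)] by blast
    then interpret coordinate_action act n \<theta> .
    have fg: "finitely_generated free_scale L" if "submodule free_scale L" "L \<subseteq> free_module m"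
      for m and L :: "(nat \<Rightarrow>\<^sub>0 'g \<Rightarrow>\<^sub>0 int) set"
      using noetherian_submodule_finitely_generated[OF noeth that] .
    show ?thesis
    proof (rule closure_homoclinic_eq_IE[OF assms(3,6)])
      show "finitely_generated free_scale (relations act n \<theta>)"
        by (rule fg[OF submodule_relations]) (auto simp: relations_def)
      fix m and L :: "(nat \<Rightarrow>\<^sub>0 'g \<Rightarrow>\<^sub>0 int) set"
      assume "submodule free_scale L" "L \<subseteq> free_module m"
      then obtain D where D: "finite D" "L = submodule free_scale hull D"
        using fg unfolding finitely_generated_def by blast
      then have "D \<subseteq> L" by (simp add: hull_subset)
      then show "\<exists>D. finite D \<and> D \<subseteq> L \<and> determines_kernel D L"
        using D hull_determines_kernel[OF D(1)] by auto
    qed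
  next
    assume at: "strong_atiyah TYPE('g) \<and> bounded_finite_subgroups TYPE('g) \<and> finitely_presented (dual_scale act)"
    then obtain n \<theta> where "coordinate_action act n \<theta>" and fg: "finitely_generated free_scale (relations act n \<theta>)"
      using finitely_presented_coordinates[OF assms(4,5)] by blast
    then interpret coordinate_action act n \<theta> by simp
    show ?thesis
    proof (rule closure_homoclinic_eq_IE[OF assms(3,6) fg])
      fix m and L :: "(nat \<Rightarrow>\<^sub>0 'g \<Rightarrow>\<^sub>0 int) set"
      assume "L \<subseteq> free_module m"
      then show "\<exists>D. finite D \<and> D \<subseteq> L \<and> determines_kernel D L"
        unfolding determines_kernel_def using at by (intro finite_kernel_determination) auto
    qed
  qed
qed

end
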